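(* Let $N\ge1$, $r>0$, $0<t_1<t_2<1$, and let $h\in H^1([0,1])$ satisfy $h(t)\le r$ for all $t\in[0,1]$ and $h(t)=r$ for $t\in[0,1]\setminus(t_1,t_2)$. Then $$\mathbb P\big(B_N(t)<h(t)\text{ for all }t\in[0,1]\big)=\det\big(\mathbb 1-K_N^h\big)_{\ell^2(\{0,1,\dots,N-1\})},$$ where $$K_N^h(n,m)=\delta_{n,m}-\int_{\mathbb R}\mathrm du\int_{\mathbb R}\mathrm dv\,\Phi_{\tau_1}^n(u)\,T^h_{\tau_1,\tau_2}(u,v)\,\Psi_{\tau_2}^m(v),\qquad n,m\in\{0,\dots,N-1\}.$$
   Context: $B_1(t)\le\dots\le B_N(t)$, $t\in[0,1]$, denote $N$ standard Brownian bridges (diffusion coefficient $1$) starting at $0$ at time $0$ and ending at $0$ at time $1$, conditioned in Doob's sense not to intersect for $t\in(0,1)$; $B_N$ is the top path. $H^1([0,1])$ is the space of square integrable functions with square integrable derivative. Set $\tau_i=\frac14\frac{t_i}{1-t_i}$ ($i=1,2$) and $\widetilde h(\tau)=\frac{1+4\tau}{\sqrt2}\big[h\big(\frac{4\tau}{1+4\tau}\big)-r\big]$. With $\widetilde b$ a Brownian motion with diffusion coefficient $2$ (variance $2s$ at time $s$), define for $u,v\in\mathbb R$ $$T^h_{\tau_1,\tau_2}(u,v)=\frac{\mathrm d}{\mathrm dv}\mathbb P_{\widetilde b(\tau_1)=u}\Big(\widetilde b(\tau)\le0\ \forall\tau\in[\tau_1,\tau_2],\ \widetilde b(\tau)\le\widetilde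 h(\tau)\ \forall\tau\in(\tau_1,\tau_2),\ \widetilde b(\tau_2)\le v\Big).$$ With $f_W(u)=e^{(\sqrt2r-2W)u}$, $g_Z(u)=e^{-(\sqrt2r-2Z)u}$, define for $\tau>0$, integers $n,m\ge0$, $u\in\mathbb R$: $\Phi_\tau^n(u)=\frac1{\pi \mathrm i}\int_{\mathrm i\mathbb R}\mathrm dW\,W^n e^{\tau(\sqrt2r-2W)^2-\sqrt2rW}(f_W(u)-f_W(-u))$ and $\Psi_\tau^m(u)=\frac1{2\pi \mathrm i}\oint_{\Gamma_0}\mathrm dZ\,Z^{-(m+1)}e^{-\tau(\sqrt2r-2Z)^2+\sqrt2rZ}(g_Z(u)-g_Z(-u))$, where $\mathrm i\mathbb R$ is oriented upwards and $\Gamma_0$ is a small counterclockwise circle around $0$. *)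

theory Defs
  imports "HOL-Probability.Probability" "Jordan_Normal_Form.Determinant"
begin

definition std_BM :: "'b measure \<Rightarrow> (real \<Rightarrow> 'b \<Rightarrow> real) \<Rightarrow> bool" where
  "std_BM M W \<longleftrightarrow>
     prob_space M \<and>
     (\<forall>t. W t \<in> borel_measurable M) \<and>
     (\<forall>\<omega>\<in>space M. W 0 \<omega> = 0 \<and> continuous_on {0..} (\<lambda>t. W t \<omega>)) \<and>
     (\<forall>s t. 0 \<le> s \<and> s < t \<longrightarrow>
        distributed M lborel (\<lambda>\<omega>. W t \<omega> - W s \<omega>) (\<lambda>x. ennreal (normal_density 0 (sqrt (t - s)) x))) \<and>
     (\<forall>(ts :: nat \<Rightarrow> real) k. (\<forall>j<k. 0 \<le> ts j \<and> ts j < ts (Suc j)) \<longrightarrow>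
        prob_space.indep_vars M (\<lambda>_. borel) (\<lambda>j \<omega>. W (ts (Suc j)) \<omega> - W (ts j) \<omega>) {..<k})"

definition heat_kernel :: "real \<Rightarrow> real \<Rightarrow> real \<Rightarrow> real" where
  "heat_kernel t x y = exp (- (x - y)\<^sup>2 / (2 * t)) / sqrt (2 * pi * t)"

definition vandermonde :: "nat \<Rightarrow> (nat \<Rightarrow> real) \<Rightarrow> real" where
  "vandermonde N x = (\<Prod>j<N. \<Prod>i<j. x j - x i)"

text \<open>Karlin--McGregor determinant of N independent Brownian motions killed at collision.\<close>
definition km_det :: "nat \<Rightarrow> real \<Rightarrow> (nat \<Rightarrow> real) \<Rightarrow> (nat \<Rightarrow> real) \<Rightarrow> real" where
  "km_det N t a b = Determinant.det (Matrix.mat N N (\<lambda>(i, l). heat_kernel t (a i) (b l)))"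

definition weyl_chamber :: "nat \<Rightarrow> (nat \<Rightarrow> real) \<Rightarrow> bool" where
  "weyl_chamber N x \<longleftrightarrow> (\<forall>i. Suc i < N \<longrightarrow> x i < x (Suc i))"

text \<open>Unnormalised joint density of (B_i(s_j)), j<k, i<N, at points x(j,i), for
  0 < s_0 < ... < s_{k-1} < 1: entrance law from 0 at time 0, Karlin--McGregor transitions,
  and the h-transform for returning to 0 at time 1.\<close>
definition nibb_fdd_unnorm :: "nat \<Rightarrow> nat \<Rightarrow> (nat \<Rightarrow> real) \<Rightarrow> (nat \<times> nat \<Rightarrow> real) \<Rightarrow> real" where
  "nibb_fdd_unnorm N k s x =
     (let row = (\<lambda>j i. x (j, i)) in
      if (\<forall>j<k. weyl_chamber N (row j)) then
        vandermonde N (row 0) * exp (- (\<Sum>i<N. (x (0, i))\<^sup>2) / (2 * s 0)) *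
        (\<Prod>j<k - 1. km_det N (s (Suc j) - s j) (row j) (row (Suc j))) *
        vandermonde N (row (k - 1)) * exp (- (\<Sum>i<N. (x (k - 1, i))\<^sup>2) / (2 * (1 - s (k - 1))))
      else 0)"

definition nibb_fdd :: "nat \<Rightarrow> nat \<Rightarrow> (nat \<Rightarrow> real) \<Rightarrow> (nat \<times> nat \<Rightarrow> real) \<Rightarrow> real" where
  "nibb_fdd N k s x = nibb_fdd_unnorm N k s x /
     integral\<^sup>L (PiM ({..<k} \<times> {..<N}) (\<lambda>_. lborel)) (nibb_fdd_unnorm N k s)"

text \<open>B i t, i = 0..N-1 (ordered increasingly, B (N-1) the top path), t in [0,1].\<close>
definition nonint_bridges :: "'a measure \<Rightarrow> nat \<Rightarrow> (nat \<Rightarrow> real \<Rightarrow> 'a \<Rightarrow> real) \<Rightarrow> bool" where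
  "nonint_bridges M N B \<longleftrightarrow>
     prob_space M \<and>
     (\<forall>i<N. \<forall>t. B i t \<in> borel_measurable M) \<and>
     (\<forall>\<omega>\<in>space M. \<forall>i<N. continuous_on {0..1} (\<lambda>t. B i t \<omega>) \<and> B i 0 \<omega> = 0 \<and> B i 1 \<omega> = 0) \<and>
     (\<forall>(k::nat) (s::nat \<Rightarrow> real). k \<ge> 1 \<and> 0 < s 0 \<and> s (k - 1) < 1 \<and> (\<forall>j. Suc j < k \<longrightarrow> s j < s (Suc j)) \<longrightarrow>
        distributed M (PiM ({..<k} \<times> {..<N}) (\<lambda>_. lborel))
          (\<lambda>\<omega>. restrict (\<lambda>(j, i). B i (s j) \<omega>) ({..<k} \<times> {..<N}))
          (\<lambda>x. ennreal (nibb_fdd N k s x)))"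

definition test_fun01 :: "(real \<Rightarrow> real) \<Rightarrow> bool" where
  "test_fun01 \<phi> \<longleftrightarrow> (\<forall>n. ((deriv ^^ n) \<phi>) differentiable_on UNIV) \<and>
      (\<exists>a b. 0 < a \<and> b < 1 \<and> (\<forall>t. t \<notin> {a..b} \<longrightarrow> \<phi> t = 0))"

definition H1_01 :: "(real \<Rightarrow> real) \<Rightarrow> bool" where
  "H1_01 h \<longleftrightarrow> set_borel_measurable lborel {0..1} h \<and>
     set_integrable lborel {0..1} (\<lambda>t. (h t)\<^sup>2) \<and>
     (\<exists>g. set_borel_measurable lborel {0..1} g \<and> set_integrable lborel {0..1} (\<lambda>t. (g t)\<^sup>2) \<and>
        (\<forall>\<phi>. test_fun01 \<phi> \<longrightarrow>
           (LINT t:{0..1}|lborel. h t * deriv \<phi> t) = - (LINT t:{0..1}|lborel. g t * \<phi> t)))"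

definition tau_of :: "real \<Rightarrow> real" where
  "tau_of t = (1/4) * (t / (1 - t))"

definition h_tilde :: "(real \<Rightarrow> real) \<Rightarrow> real \<Rightarrow> real \<Rightarrow> real" where
  "h_tilde h r \<tau> = (1 + 4 * \<tau>) / sqrt 2 * (h (4 * \<tau> / (1 + 4 * \<tau>)) - r)"

text \<open>b~(tau) = u + sqrt 2 * W(tau - tau1): Brownian motion with diffusion coefficient 2
  started at u at time tau1.\<close>
definition T_prob :: "'b measure \<Rightarrow> (real \<Rightarrow> 'b \<Rightarrow> real) \<Rightarrow> (real \<Rightarrow> real) \<Rightarrow> real \<Rightarrow> real \<Rightarrow> real
                        \<Rightarrow> real \<Rightarrow> real \<Rightarrow> real" where
  "T_prob M W h r \<tau>1 \<tau>2 u v =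
     (let b = (\<lambda>\<tau> \<omega>. u + sqrt 2 * W (\<tau> - \<tau>1) \<omega>) in
      measure M {\<omega> \<in> space M. (\<forall>\<tau>\<in>{\<tau>1..\<tau>2}. b \<tau> \<omega> \<le> 0) \<and>
                              (\<forall>\<tau>\<in>{\<tau>1<..<\<tau>2}. b \<tau> \<omega> \<le> h_tilde h r \<tau>) \<and> b \<tau>2 \<omega> \<le> v})"

definition T_kernel :: "'b measure \<Rightarrow> (real \<Rightarrow> 'b \<Rightarrow> real) \<Rightarrow> (real \<Rightarrow> real) \<Rightarrow> real \<Rightarrow> real \<Rightarrow> real
                        \<Rightarrow> real \<Rightarrow> real \<Rightarrow> real" where
  "T_kernel M W h r \<tau>1 \<tau>2 u v = deriv (\<lambda>v'. T_prob M W h r \<tau>1 \<tau>2 u v') v"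

definition f_W :: "real \<Rightarrow> complex \<Rightarrow> real \<Rightarrow> complex" where
  "f_W r w u = exp ((of_real (sqrt 2 * r) - 2 * w) * of_real u)"

definition g_Z :: "real \<Rightarrow> complex \<Rightarrow> real \<Rightarrow> complex" where
  "g_Z r z u = exp (- (of_real (sqrt 2 * r) - 2 * z) * of_real u)"

text \<open>Integral over i R (upwards), parametrised by W = i y, dW = i dy.\<close>
definition Phi :: "real \<Rightarrow> real \<Rightarrow> nat \<Rightarrow> real \<Rightarrow> complex" where
  "Phi r \<tau> n u = 1 / (of_real pi * \<i>) *
     (LINT y|lborel. (let w = \<i> * of_real y in
        \<i> * (w ^ n * exp (of_real \<tau> * (of_real (sqrt 2 * r) - 2 * w)\<^sup>2 - of_real (sqrt 2 * r) * w) *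
             (f_W r w u - f_W r w (- u)))))"

text \<open>Counterclockwise circle around 0 (radius 1; the integrand is analytic away from 0,
  so the value is independent of the radius), Z = e^{i theta}, dZ = i e^{i theta} d theta.\<close>
definition Psi :: "real \<Rightarrow> real \<Rightarrow> nat \<Rightarrow> real \<Rightarrow> complex" where
  "Psi r \<tau> m u = 1 / (2 * of_real pi * \<i>) *
     (LINT \<theta>:{0..2*pi}|lborel. (let z = exp (\<i> * of_real \<theta>) in
        \<i> * z * (inverse z ^ (m + 1) * exp (- of_real \<tau> * (of_real (sqrt 2 * r) - 2 * z)\<^sup>2 + of_real (sqrt 2 * r) * z) *
             (g_Z r z u - g_Z r z (- u)))))"

definition K_kernel :: "'b measure \<Rightarrow> (real \<Rightarrow> 'b \<Rightarrow> real) \<Rightarrow> (real \<Rightarrow> real) \<Rightarrow> real \<Rightarrow> real \<Rightarrow> real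
                        \<Rightarrow> nat \<Rightarrow> nat \<Rightarrow> complex" where
  "K_kernel M W h r t1 t2 n m =
     (if n = m then 1 else 0) -
     (LINT u|lborel. LINT v|lborel.
        Phi r (tau_of t1) n u * of_real (T_kernel M W h r (tau_of t1) (tau_of t2) u v) * Psi r (tau_of t2) m v)"

end

theory Submission
  imports Defs "HOL-Complex_Analysis.Complex_Analysis"
begin


text \<open>The bridges are first sampled at finitely many times. The Karlin-McGregor density of such a
  sample is a product of determinants, and Andreief's identity turns the probability that the top path is
  below prescribed levels into an N x N determinant of one-particle quantities. The space-time change
  that maps a bridge to a Brownian motion makes each entry an iterated heat flow, killed above the
  transformed barrier at the sampling times, between a Gaussian times a Hermite polynomial near time 0
  and a Hermite polynomial at a late time.

  Outside the interval from t1 to t2 the transformed barrier is 0. As the grid becomes dense, the heat flow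
  killed at 0 converges there by the reflection principle to the odd parts of the unkilled solutions: these are
  Phi and Psi, evaluated from their integrals as Gaussian moments and as Hermite coefficients. Between
  the two times the discretised flow converges to the barrier kernel T, which yields the probability that
  the top path stays weakly below h. Replacing h and r by h - e and r - e leaves T unchanged, and
  letting e tend to 0 gives the strict inequality.\<close>

section \<open>Functions of exponential growth and the heat kernel\<close>

text \<open>Odd parts arise because the reflected halves of the end data are negligible. On u <= 0
  the Gaussian in the reflected \<open>PhiF\<close> is evaluated at distance at least r / 2 from its
  centre, so it is of order t0 as the starting time t0 tends to 0; the reflected part of
  \<open>PsiF\<close> is of order exp (- r^2 t) at a late time t. Up to these errors the end data
  are odd, and odd data stay odd under the free flow and vanish at 0. The obstacle is growth:
  \<open>PsiF\<close> grows like exp ((2 r + 1) |v|), so errors on the Phi side must be small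
  relative to a weight exp (l u) with l > 2 r + 1. \<open>expbd c\<close> records such rates; c may
  be negative, rates add under products, and the heat flow keeps c. The kernel T is a derivative in
  v that need not exist everywhere. Its density is found as a limit of discretised kernels and
  identified with the derivative off a countable set. The normalisation of the bridge density needs
  no evaluation of its own: without barriers the same determinant has Kronecker delta entries, by
  biorthogonality of \<open>PhiF\<close> and \<open>PsiF\<close>.\<close>

definition expbd :: "real \<Rightarrow> (real \<Rightarrow> real) \<Rightarrow> bool" where
  "expbd c f \<longleftrightarrow> f \<in> borel_measurable borel \<and> (\<exists>C. \<forall>x. \<bar>f x\<bar> \<le> C * exp (c * \<bar>x\<bar>))"

lemma expbdI: "f \<in> borel_measurable borel \<Longrightarrow> (\<And>x. \<bar>f x\<bar> \<le> C * exp (c * \<bar>x\<bar>)) \<Longrightarrow> expbd c f"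
  unfolding expbd_def by blast

lemma expbdD [dest]: "expbd c f \<Longrightarrow> f \<in> borel_measurable borel"
  unfolding expbd_def by blast

lemma expbdE:
  assumes "expbd c f"
  obtains C where "C \<ge> 0" "\<And>x. \<bar>f x\<bar> \<le> C * exp (c * \<bar>x\<bar>)"
proof -
  obtain C where C: "\<And>x. \<bar>f x\<bar> \<le> C * exp (c * \<bar>x\<bar>)"
    using assms unfolding expbd_def by blast
  have "C \<ge> 0" using C[of 0] by simp
  with C show ?thesis using that by blast
qed

lemma expbd_mono:
  assumes "expbd c f" "c \<le> c'"
  shows "expbd c' f"
proof -
  obtain C where C: "C \<ge> 0" "\<And>x. \<bar>f x\<bar> \<le> C * exp (c * \<bar>x\<bar>)" using assms(1) by (rule expbdE) blast
  have "\<bar>f x\<bar> \<le> C * exp (c' * \<bar>x\<bar>)" for x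
  proof -
    have "exp (c * \<bar>x\<bar>) \<le> exp (c' * \<bar>x\<bar>)" using assms(2) by (simp add: mult_right_mono)
    with C show ?thesis by (meson mult_left_mono order_trans)
  qed
  with assms(1) show ?thesis by (auto intro: expbdI)
qed

lemma expbd_mult:
  assumes "expbd a f" "expbd b g"
  shows "expbd (a + b) (\<lambda>x. f x * g x)"
proof -
  obtain C where C: "C \<ge> 0" "\<And>x. \<bar>f x\<bar> \<le> C * exp (a * \<bar>x\<bar>)" using assms(1) by (rule expbdE) blast
  obtain D where D: "D \<ge> 0" "\<And>x. \<bar>g x\<bar> \<le> D * exp (b * \<bar>x\<bar>)" using assms(2) by (rule expbdE) blast
  have "\<bar>f x * g x\<bar> \<le> (C * D) * exp ((a + b) * \<bar>x\<bar>)" for x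
  proof -
    have "\<bar>f x * g x\<bar> \<le> (C * exp (a * \<bar>x\<bar>)) * (D * exp (b * \<bar>x\<bar>))"
      unfolding abs_mult using C D by (intro mult_mono) auto
    also have "\<dots> = (C * D) * exp ((a + b) * \<bar>x\<bar>)" by (simp add: exp_add algebra_simps)
    finally show ?thesis .
  qed
  moreover have "f \<in> borel_measurable borel" "g \<in> borel_measurable borel" using assms by auto
  ultimately show ?thesis by (intro expbdI) auto
qed

lemma expbd_add:
  assumes "expbd c f" "expbd c g"
  shows "expbd c (\<lambda>x. f x + g x)"
proof -
  obtain C where C: "\<And>x. \<bar>f x\<bar> \<le> C * exp (c * \<bar>x\<bar>)" using assms(1) by (rule expbdE) blast
  obtain D where D: "\<And>x. \<bar>g x\<bar> \<le> D * exp (c * \<bar>x\<bar>)" using assms(2) by (rule expbdE) blast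
  have "\<bar>f x + g x\<bar> \<le> (C + D) * exp (c * \<bar>x\<bar>)" for x
    using C[of x] D[of x] by (simp add: algebra_simps)
  moreover have "f \<in> borel_measurable borel" "g \<in> borel_measurable borel" using assms by auto
  ultimately show ?thesis by (intro expbdI) auto
qed

lemma expbd_cmult: "expbd c f \<Longrightarrow> expbd c (\<lambda>x. k * f x)"
proof -
  assume f: "expbd c f"
  obtain C where C: "\<And>x. \<bar>f x\<bar> \<le> C * exp (c * \<bar>x\<bar>)" using f by (rule expbdE) blast
  have "\<bar>k * f x\<bar> \<le> (\<bar>k\<bar> * C) * exp (c * \<bar>x\<bar>)" for x
    using mult_left_mono[OF C[of x], of "\<bar>k\<bar>"] by (simp add: abs_mult algebra_simps)
  moreover have "f \<in> borel_measurable borel" using f by auto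
  ultimately show ?thesis by (intro expbdI) auto
qed

lemma expbd_diff: "expbd c f \<Longrightarrow> expbd c g \<Longrightarrow> expbd c (\<lambda>x. f x - g x)"
  using expbd_add[of c f "\<lambda>x. - 1 * g x"] expbd_cmult[of c g "-1"] by simp

lemma expbd_indicator:
  assumes "expbd c f" "A \<in> sets borel"
  shows "expbd c (\<lambda>x. indicator A x * f x)"
proof -
  have "expbd 0 (indicator A :: real \<Rightarrow> real)"
    using assms(2) by (intro expbdI[where C=1]) (auto simp: indicator_def)
  from expbd_mult[OF this assms(1)] show ?thesis by simp
qed

lemma expbd_reflect: "expbd c f \<Longrightarrow> expbd c (\<lambda>x. f (- x))"
proof -
  assume f: "expbd c f"
  obtain C where C: "\<And>x. \<bar>f x\<bar> \<le> C * exp (c * \<bar>x\<bar>)" using f by (rule expbdE) blast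
  have [measurable]: "f \<in> borel_measurable borel" using f by auto
  have "\<bar>f (-x)\<bar> \<le> C * exp (c * \<bar>x\<bar>)" for x using C[of "-x"] by simp
  then show ?thesis by (intro expbdI) auto
qed

text \<open>A single term of the exponential series. Polynomial factors are traded for exponential
  weights in this way throughout.\<close>

lemma power_le_fact_exp:
  fixes x :: real
  assumes "x \<ge> 0"
  shows "x ^ n \<le> fact n * exp x"
proof -
  have "x ^ n / fact n \<le> exp x"
  proof -
    have s: "(\<lambda>k. x ^ k / fact k) sums exp x" using exp_converges[of x] by (simp add: field_simps scaleR_conv_of_real)
    have "sum (\<lambda>k. x ^ k / fact k) {n} \<le> suminf (\<lambda>k. x ^ k / fact k)"
      using s assms by (intro sum_le_suminf) (auto simp: sums_iff)
    with s show ?thesis by (simp add: sums_iff)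
  qed
  then show ?thesis by (simp add: field_simps)
qed

text \<open>Dominated by an exponential density plus its mirror image.\<close>

lemma integrable_exp_neg_abs:
  fixes k :: real
  assumes "k > 0"
  shows "integrable lborel (\<lambda>x. exp (- k * \<bar>x\<bar>))"
proof -
  interpret P: prob_space "density lborel (exponential_density k)" using assms by (rule prob_space_exponential_density)
  have nn: "(\<integral>\<^sup>+x. ennreal (exponential_density k x) \<partial>lborel) = 1"
    using P.emeasure_space_1 by (simp add: emeasure_density)
  have int: "integrable lborel (exponential_density k)"
    by (rule integrableI_nonneg) (use nn exponential_density_nonneg[OF assms] in \<open>auto simp: exponential_density_def intro!: AE_I2\<close>)
  have int2: "integrable lborel (\<lambda>x. exponential_density k (- x))"
    using lborel_integrable_real_affine[OF int, of "-1" 0] by simp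
  have "integrable lborel (\<lambda>x. (exponential_density k x + exponential_density k (- x)) / k)"
    using int int2 by simp
  then show ?thesis
  proof (rule Bochner_Integration.integrable_bound)
    show "AE x in lborel. norm (exp (- k * \<bar>x\<bar>)) \<le> norm ((exponential_density k x + exponential_density k (- x)) / k)"
      using assms by (intro AE_I2) (auto simp: exponential_density_def abs_if field_simps)
  qed auto
qed

lemma expbd_integrable:
  assumes "expbd c f" "c < 0"
  shows "integrable lborel f"
proof -
  obtain C where C: "C \<ge> 0" "\<And>x. \<bar>f x\<bar> \<le> C * exp (c * \<bar>x\<bar>)" using assms(1) by (rule expbdE) blast
  have [measurable]: "f \<in> borel_measurable borel" using assms by auto
  have "integrable lborel (\<lambda>x. C * exp (- (- c) * \<bar>x\<bar>))"
    using integrable_exp_neg_abs[of "-c"] assms(2) by simp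
  then show ?thesis
    by (rule Bochner_Integration.integrable_bound) (use C in \<open>auto intro!: AE_I2 simp: abs_mult\<close>)
qed

text \<open>Integration by parts without boundary terms. It yields both Stein's identity for the
  heat kernel and the recursion of the Gaussian moments behind \<open>Phi\<close>.\<close>

lemma integral_deriv_zero:
  fixes F f :: "real \<Rightarrow> 'a::euclidean_space"
  assumes der: "\<And>x. (F has_vector_derivative f x) (at x)"
    and cont: "continuous_on UNIV f"
    and int: "integrable lborel f"
    and dec: "\<And>x. norm (F x) \<le> C * exp (- \<bar>x\<bar>)"
  shows "(\<integral>x. f x \<partial>lborel) = 0"
proof -
  have t1: "((\<lambda>x. C * exp (- \<bar>x\<bar>)) \<longlongrightarrow> 0) at_top" by real_asymp
  have t2: "((\<lambda>x. C * exp (- \<bar>x\<bar>)) \<longlongrightarrow> 0) at_bot" by real_asymp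
  have l1: "(F \<longlongrightarrow> 0) at_top" by (rule Lim_null_comparison[OF _ t1]) (simp add: dec)
  have l2: "(F \<longlongrightarrow> 0) at_bot" by (rule Lim_null_comparison[OF _ t2]) (simp add: dec)
  have "(LBINT x=-\<infinity>..\<infinity>. f x) = 0 - 0"
  proof (rule interval_integral_FTC_integrable[where F=F])
    show "isCont f x" for x using cont by (simp add: continuous_on_eq_continuous_at)
    show "set_integrable lborel (einterval (- \<infinity>) \<infinity>) f"
      using int by (simp add: set_integrable_def)
    show "((F \<circ> real_of_ereal) \<longlongrightarrow> 0) (at_right (- \<infinity>))" using l2 by (simp add: ereal_tendsto_simps)
    show "((F \<circ> real_of_ereal) \<longlongrightarrow> 0) (at_left \<infinity>)" using l1 by (simp add: ereal_tendsto_simps)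
  qed (use der in auto)
  then show ?thesis
    by (simp add: interval_lebesgue_integral_def set_lebesgue_integral_def)
qed

section \<open>Exponential moments of the heat kernel, Chapman-Kolmogorov, Stein's identity\<close>

lemma heat_kernel_normal_density: "t > 0 \<Longrightarrow> heat_kernel t x y = normal_density x (sqrt t) y"
  unfolding heat_kernel_def normal_density_def by (simp add: power2_commute)

lemma heat_kernel_pos: "t > 0 \<Longrightarrow> heat_kernel t x y > 0"
  unfolding heat_kernel_def by simp

lemma heat_kernel_nonneg [simp]: "t \<ge> 0 \<Longrightarrow> heat_kernel t x y \<ge> 0"
  unfolding heat_kernel_def by simp

lemma heat_kernel_sym: "heat_kernel t x y = heat_kernel t y x"
  unfolding heat_kernel_def by (simp add: power2_commute)

lemma heat_kernel_shift: "heat_kernel t (x + a) (y + a) = heat_kernel t x y"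
  unfolding heat_kernel_def by simp

lemma heat_kernel_neg: "heat_kernel t (- x) (- y) = heat_kernel t x y"
  unfolding heat_kernel_def by (simp add: power2_commute)

lemma heat_kernel_measurable [measurable]: "(\<lambda>(x, y). heat_kernel t x y) \<in> borel_measurable (borel \<Otimes>\<^sub>M borel)"
  unfolding heat_kernel_def by measurable

lemma heat_kernel_measurable' [measurable (raw)]:
  assumes [measurable]: "f \<in> borel_measurable M" "g \<in> borel_measurable M"
  shows "(\<lambda>x. heat_kernel t (f x) (g x)) \<in> borel_measurable M"
  unfolding heat_kernel_def by measurable

lemma heat_kernel_le: "t > 0 \<Longrightarrow> heat_kernel t x y \<le> 1 / sqrt (2 * pi * t)"
  unfolding heat_kernel_def by (auto intro!: divide_right_mono)

lemma has_bochner_integral_heat_kernel: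
  assumes "t > 0" shows "has_bochner_integral lborel (heat_kernel t x) 1"
proof -
  have "heat_kernel t x = normal_density x (sqrt t)" using assms by (auto simp: heat_kernel_normal_density)
  with assms show ?thesis by (simp add: has_bochner_integral_iff)
qed

lemma integral_heat_kernel [simp]: "t > 0 \<Longrightarrow> (\<integral>y. heat_kernel t x y \<partial>lborel) = 1"
  and integrable_heat_kernel: "t > 0 \<Longrightarrow> integrable lborel (heat_kernel t x)"
  using has_bochner_integral_heat_kernel by (auto simp: has_bochner_integral_iff)

text \<open>Completing the square: an exponential tilt moves the centre by c t. With c = sqrt 2 r or
  its negative, this is how the drift hidden in \<open>xi_of\<close> is handled.\<close>

lemma heat_kernel_mult_exp:
  assumes "t > 0"
  shows "heat_kernel t x y * exp (c * y) = exp (c * x + c\<^sup>2 * t / 2) * heat_kernel t (x + c * t) y"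
proof -
  have "- (x - y)\<^sup>2 / (2 * t) + c * y = (c * x + c\<^sup>2 * t / 2) + - (x + c * t - y)\<^sup>2 / (2 * t)"
    using assms by (simp add: field_simps power2_eq_square)
  then show ?thesis unfolding heat_kernel_def by (simp add: exp_add[symmetric])
qed

lemma has_bochner_integral_heat_kernel_exp:
  assumes "t > 0"
  shows "has_bochner_integral lborel (\<lambda>y. heat_kernel t x y * exp (c * y)) (exp (c * x + c\<^sup>2 * t / 2))"
  unfolding heat_kernel_mult_exp[OF assms]
  using has_bochner_integral_mult_right[OF has_bochner_integral_heat_kernel[OF assms], of "exp (c * x + c\<^sup>2 * t / 2)" "x + c * t"]
  by simp

text \<open>The modulus is replaced by two plain exponentials, whose Gaussian integrals are
  explicit. Either sign of c is allowed since | |y| - |x| | <= |y - x|.\<close>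

lemma exp_abs_le:
  fixes c x y :: real
  shows "exp (c * \<bar>y\<bar>) \<le> exp (c * \<bar>x\<bar>) * (exp (c * (y - x)) + exp (- c * (y - x)))"
proof -
  have "c * \<bar>y\<bar> - c * \<bar>x\<bar> = c * (\<bar>y\<bar> - \<bar>x\<bar>)" by (simp add: algebra_simps)
  also have "\<dots> \<le> \<bar>c\<bar> * \<bar>\<bar>y\<bar> - \<bar>x\<bar>\<bar>" by (metis abs_ge_self abs_mult)
  also have "\<dots> \<le> \<bar>c\<bar> * \<bar>y - x\<bar>" by (intro mult_left_mono) auto
  finally have "c * \<bar>y\<bar> \<le> c * \<bar>x\<bar> + \<bar>c * (y - x)\<bar>" by (simp add: abs_mult)
  then have "exp (c * \<bar>y\<bar>) \<le> exp (c * \<bar>x\<bar>) * exp (\<bar>c * (y - x)\<bar>)" by (simp add: exp_add[symmetric])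
  also have "exp (\<bar>c * (y - x)\<bar>) \<le> exp (c * (y - x)) + exp (- c * (y - x))"
    by (cases "c * (y - x) \<ge> 0") auto
  finally show ?thesis by (simp add: mult_left_mono)
qed

text \<open>The rate c is the same on both sides, for either sign of c, so the heat operator keeps
  every class \<open>expbd c\<close> and only the constant changes.\<close>

lemma heat_kernel_exp_abs:
  assumes "t > 0"
  shows "integrable lborel (\<lambda>y. heat_kernel t x y * exp (c * \<bar>y\<bar>))"
    and "(\<integral>y. heat_kernel t x y * exp (c * \<bar>y\<bar>) \<partial>lborel) \<le> 2 * exp (c\<^sup>2 * t / 2) * exp (c * \<bar>x\<bar>)"
proof -
  let ?g = "\<lambda>y. exp (c * \<bar>x\<bar>) * (exp (- c * x) * (heat_kernel t x y * exp (c * y)) + exp (c * x) * (heat_kernel t x y * exp (- c * y)))"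
  have le: "heat_kernel t x y * exp (c * \<bar>y\<bar>) \<le> ?g y" for y
  proof -
    have "heat_kernel t x y * exp (c * \<bar>y\<bar>) \<le> heat_kernel t x y * (exp (c * \<bar>x\<bar>) * (exp (c * (y - x)) + exp (- c * (y - x))))"
      using assms by (intro mult_left_mono exp_abs_le) auto
    also have "\<dots> = ?g y" by (simp add: algebra_simps exp_diff exp_minus field_simps)
    finally show ?thesis .
  qed
  have hb: "has_bochner_integral lborel ?g
     (exp (c * \<bar>x\<bar>) * (exp (- c * x) * exp (c * x + c\<^sup>2 * t / 2) + exp (c * x) * exp ((- c) * x + (- c)\<^sup>2 * t / 2)))"
    by (intro has_bochner_integral_mult_right has_bochner_integral_add has_bochner_integral_heat_kernel_exp assms)
  have eq: "exp (c * \<bar>x\<bar>) * (exp (- c * x) * exp (c * x + c\<^sup>2 * t / 2) + exp (c * x) * exp ((- c) * x + (- c)\<^sup>2 * t / 2))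
     = 2 * exp (c\<^sup>2 * t / 2) * exp (c * \<bar>x\<bar>)"
    by (simp add: exp_add[symmetric])
  have gi: "integrable lborel ?g" using hb by (simp add: has_bochner_integral_iff)
  show i: "integrable lborel (\<lambda>y. heat_kernel t x y * exp (c * \<bar>y\<bar>))"
  proof (rule Bochner_Integration.integrable_bound[OF gi])
    have "norm (heat_kernel t x y * exp (c * \<bar>y\<bar>)) \<le> norm (?g y)" for y
    proof -
      have "norm (heat_kernel t x y * exp (c * \<bar>y\<bar>)) = heat_kernel t x y * exp (c * \<bar>y\<bar>)" using assms by simp
      then show ?thesis using le[of y] unfolding real_norm_def by linarith
    qed
    then show "AE y in lborel. norm (heat_kernel t x y * exp (c * \<bar>y\<bar>)) \<le> norm (?g y)" by blast
  qed measurable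
  have "(\<integral>y. heat_kernel t x y * exp (c * \<bar>y\<bar>) \<partial>lborel) \<le> integral\<^sup>L lborel ?g"
    by (rule integral_mono[OF i gi le])
  also have "\<dots> = 2 * exp (c\<^sup>2 * t / 2) * exp (c * \<bar>x\<bar>)"
    using has_bochner_integral_integral_eq[OF hb] eq by simp
  finally show "(\<integral>y. heat_kernel t x y * exp (c * \<bar>y\<bar>) \<partial>lborel) \<le> 2 * exp (c\<^sup>2 * t / 2) * exp (c * \<bar>x\<bar>)" .
qed

text \<open>Gaussian tails beat every exponential, so c may be as negative as desired: each tilted
  kernel is a shifted kernel, bounded by its maximum.\<close>

lemma expbd_heat_kernel:
  assumes t: "t > 0"
  shows "expbd c (heat_kernel t x)"
proof (rule expbdI[where C="exp (- c * \<bar>x\<bar>) * (2 * exp (c\<^sup>2 * t / 2) / sqrt (2 * pi * t))"])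
  fix y
  let ?D = "exp (- c * \<bar>x\<bar>) * (2 * exp (c\<^sup>2 * t / 2) / sqrt (2 * pi * t))"
  have one: "heat_kernel t x y * exp (a * (y - x)) \<le> exp (a\<^sup>2 * t / 2) / sqrt (2 * pi * t)" for a
  proof -
    have "heat_kernel t x y * exp (a * (y - x)) = exp (- a * x) * (heat_kernel t x y * exp (a * y))"
      by (simp add: exp_add[symmetric] algebra_simps)
    also have "\<dots> = exp (a\<^sup>2 * t / 2) * heat_kernel t (x + a * t) y"
      unfolding heat_kernel_mult_exp[OF t] by (simp add: exp_add[symmetric])
    also have "\<dots> \<le> exp (a\<^sup>2 * t / 2) * (1 / sqrt (2 * pi * t))"
      using heat_kernel_le[OF t] by (intro mult_left_mono) auto
    finally show ?thesis by simp
  qed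
  have "heat_kernel t x y * exp (- c * \<bar>y\<bar>) \<le> heat_kernel t x y * (exp (- c * \<bar>x\<bar>) * (exp (- c * (y - x)) + exp (- (- c) * (y - x))))"
    using t by (intro mult_left_mono exp_abs_le) auto
  also have "\<dots> = exp (- c * \<bar>x\<bar>) * (heat_kernel t x y * exp ((- c) * (y - x)) + heat_kernel t x y * exp (c * (y - x)))"
    by (simp add: algebra_simps)
  also have "\<dots> \<le> exp (- c * \<bar>x\<bar>) * (exp ((- c)\<^sup>2 * t / 2) / sqrt (2 * pi * t) + exp (c\<^sup>2 * t / 2) / sqrt (2 * pi * t))"
    by (intro mult_left_mono add_mono one) auto
  also have "\<dots> = ?D" by simp
  finally have "heat_kernel t x y * exp (- c * \<bar>y\<bar>) * exp (c * \<bar>y\<bar>) \<le> ?D * exp (c * \<bar>y\<bar>)"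
    by (rule mult_right_mono) simp
  then have "heat_kernel t x y \<le> ?D * exp (c * \<bar>y\<bar>)" by (simp add: mult.assoc exp_add[symmetric])
  then show "\<bar>heat_kernel t x y\<bar> \<le> ?D * exp (c * \<bar>y\<bar>)" using t by simp
qed simp

lemma expbd_heat_integrable:
  assumes "expbd c f" "t > 0"
  shows "integrable lborel (\<lambda>y. heat_kernel t x y * f y)"
proof -
  obtain C where C: "C \<ge> 0" "\<And>x. \<bar>f x\<bar> \<le> C * exp (c * \<bar>x\<bar>)" using assms(1) by (rule expbdE) blast
  have [measurable]: "f \<in> borel_measurable borel" using assms by auto
  have "integrable lborel (\<lambda>y. C * (heat_kernel t x y * exp (c * \<bar>y\<bar>)))"
    using heat_kernel_exp_abs[OF assms(2)] by simp
  then show ?thesis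
  proof (rule Bochner_Integration.integrable_bound)
    show "AE y in lborel. norm (heat_kernel t x y * f y) \<le> norm (C * (heat_kernel t x y * exp (c * \<bar>y\<bar>)))"
    proof (rule AE_I2)
      fix y
      have "heat_kernel t x y * \<bar>f y\<bar> \<le> heat_kernel t x y * (C * exp (c * \<bar>y\<bar>))" using assms(2) by (intro mult_left_mono C) auto
      then show "norm (heat_kernel t x y * f y) \<le> norm (C * (heat_kernel t x y * exp (c * \<bar>y\<bar>)))"
        using C(1) assms(2) by (simp add: abs_mult mult.left_commute)
    qed
  qed measurable
qed

text \<open>The constant is explicit, so it can serve as a dominating function for a whole family
  with common C and c.\<close>

lemma expbd_heat_bound:
  assumes [measurable]: "f \<in> borel_measurable borel" and C: "\<And>x. \<bar>f x\<bar> \<le> C * exp (c * \<bar>x\<bar>)" "C \<ge> 0" and t: "t > 0"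
  shows "(\<integral>y. heat_kernel t x y * \<bar>f y\<bar> \<partial>lborel) \<le> C * (2 * exp (c\<^sup>2 * t / 2)) * exp (c * \<bar>x\<bar>)"
    and "\<bar>\<integral>y. heat_kernel t x y * f y \<partial>lborel\<bar> \<le> C * (2 * exp (c\<^sup>2 * t / 2)) * exp (c * \<bar>x\<bar>)"
proof -
  have f: "expbd c f" using C by (intro expbdI) auto
  have af: "expbd c (\<lambda>x. \<bar>f x\<bar>)" using C by (intro expbdI) auto
  have "(\<integral>y. heat_kernel t x y * \<bar>f y\<bar> \<partial>lborel) \<le> (\<integral>y. C * (heat_kernel t x y * exp (c * \<bar>y\<bar>)) \<partial>lborel)"
  proof (rule integral_mono[OF expbd_heat_integrable[OF af t]])
    show "integrable lborel (\<lambda>y. C * (heat_kernel t x y * exp (c * \<bar>y\<bar>)))" using heat_kernel_exp_abs[OF t] by simp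
    show "heat_kernel t x y * \<bar>f y\<bar> \<le> C * (heat_kernel t x y * exp (c * \<bar>y\<bar>))" for y
      using mult_left_mono[OF C(1)[of y], of "heat_kernel t x y"] t by (simp add: mult.left_commute)
  qed
  also have "\<dots> \<le> C * (2 * exp (c\<^sup>2 * t / 2) * exp (c * \<bar>x\<bar>))"
    using mult_left_mono[OF heat_kernel_exp_abs(2)[OF t] C(2)] by simp
  finally show *: "(\<integral>y. heat_kernel t x y * \<bar>f y\<bar> \<partial>lborel) \<le> C * (2 * exp (c\<^sup>2 * t / 2)) * exp (c * \<bar>x\<bar>)"
    by (simp add: mult.assoc)
  have "\<bar>\<integral>y. heat_kernel t x y * f y \<partial>lborel\<bar> \<le> (\<integral>y. \<bar>heat_kernel t x y * f y\<bar> \<partial>lborel)"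
    using integral_norm_bound[of lborel "\<lambda>y. heat_kernel t x y * f y"] by simp
  with * show "\<bar>\<integral>y. heat_kernel t x y * f y \<partial>lborel\<bar> \<le> C * (2 * exp (c\<^sup>2 * t / 2)) * exp (c * \<bar>x\<bar>)"
    using t by (simp add: abs_mult)
qed

lemma expbd_heat_op:
  assumes f: "expbd c f" and t: "t > 0"
  shows "expbd c (\<lambda>x. \<integral>y. heat_kernel t x y * f y \<partial>lborel)"
proof -
  obtain C where C: "C \<ge> 0" "\<And>x. \<bar>f x\<bar> \<le> C * exp (c * \<bar>x\<bar>)" using f by (rule expbdE) blast
  have [measurable]: "f \<in> borel_measurable borel" using f by auto
  show ?thesis
    by (rule expbdI[where C="C * (2 * exp (c\<^sup>2 * t / 2))"]) (use expbd_heat_bound(2)[OF _ C(2) C(1) t] in auto)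
qed

text \<open>The second factor on the right is the density, at the intermediate time, of the Brownian
  bridge from x to z: centred at the linear interpolation, with variance s t / (s + t).\<close>

lemma Chapman_Kolmogorov_point:
  assumes s: "s > 0" and t: "t > 0"
  shows "heat_kernel s x y * heat_kernel t y z = heat_kernel (s + t) x z * heat_kernel (s * t / (s + t)) ((t * x + s * z) / (s + t)) y"
proof -
  have e: "- (x - y)\<^sup>2 / (2 * s) + - (y - z)\<^sup>2 / (2 * t) = - (x - z)\<^sup>2 / (2 * (s + t)) + - ((t * x + s * z) / (s + t) - y)\<^sup>2 / (2 * (s * t / (s + t)))"
    using s t by (simp add: field_simps add_nonneg_eq_0_iff power2_eq_square)
  have r: "sqrt (2 * pi * s) * sqrt (2 * pi * t) = sqrt (2 * pi * (s + t)) * sqrt (2 * pi * (s * t / (s + t)))"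
    using s t by (simp add: real_sqrt_mult[symmetric] field_simps)
  show ?thesis unfolding heat_kernel_def times_divide_times_eq r exp_add[symmetric] e ..
qed

lemma heat_kernel_deriv:
  "t > 0 \<Longrightarrow> ((\<lambda>y. heat_kernel t x y) has_real_derivative ((x - y) / t * heat_kernel t x y)) (at y)"
proof -
  assume t: "t > 0"
  define K where "K = sqrt (2 * pi * t)"
  have K: "K > 0" using t by (simp add: K_def)
  show ?thesis unfolding heat_kernel_def K_def[symmetric]
    using t K by (auto intro!: derivative_eq_intros simp: field_simps)
qed

lemma abs_diff_exp_bound: "\<bar>y - x\<bar> \<le> (1 + \<bar>x\<bar>) * exp \<bar>y :: real\<bar>"
proof -
  have "\<bar>y\<bar> \<le> exp \<bar>y\<bar>" using exp_ge_add_one_self[of "\<bar>y\<bar>"] by linarith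
  moreover have "\<bar>x\<bar> * 1 \<le> \<bar>x\<bar> * exp \<bar>y\<bar>" by (intro mult_left_mono) auto
  ultimately show ?thesis by (simp add: algebra_simps)
qed

text \<open>Gaussian integration by parts: (y - x) times the kernel is - t times its derivative in
  y. It drives both the heat equation and the orthogonality of the heat polynomials.\<close>

lemma heat_kernel_stein:
  assumes t: "t > 0" and f: "expbd c f" and f': "expbd c f'" and cont: "continuous_on UNIV f'"
    and der: "\<And>y. (f has_real_derivative f' y) (at y)"
  shows "(\<integral>y. heat_kernel t x y * ((y - x) * f y) \<partial>lborel) = t * (\<integral>y. heat_kernel t x y * f' y \<partial>lborel)"
proof -
  let ?g = "\<lambda>y. heat_kernel t x y * f' y - heat_kernel t x y * ((y - x) * f y) / t"
  have mf: "f \<in> borel_measurable borel" using f by auto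
  have id: "expbd 1 (\<lambda>y. y - x)"
    by (rule expbdI[where C="1 + \<bar>x\<bar>"]) (use exp_ge_add_one_self in \<open>auto intro!: abs_diff_exp_bound\<close>)
  have i1: "integrable lborel (\<lambda>y. heat_kernel t x y * f' y)" by (rule expbd_heat_integrable[OF f' t])
  have i2: "integrable lborel (\<lambda>y. heat_kernel t x y * ((y - x) * f y))"
    by (rule expbd_heat_integrable[OF expbd_mult[OF id f] t])
  have cf: "continuous_on UNIV f" using der by (meson DERIV_continuous continuous_at_imp_continuous_on)
  have ch: "continuous_on UNIV (heat_kernel t x)"
    using heat_kernel_deriv[OF t] by (meson DERIV_continuous continuous_at_imp_continuous_on)
  \<comment> \<open>The kernel is given the rate - 1 - c, so that its product with f decays at rate
    - 1 as \<open>integral_deriv_zero\<close> demands.\<close>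
  obtain C where C: "C \<ge> 0" "\<And>y. \<bar>heat_kernel t x y * f y\<bar> \<le> C * exp ((- 1 - c + c) * \<bar>y\<bar>)"
    using expbd_mult[OF expbd_heat_kernel[OF t, of "- 1 - c" x] f] by (rule expbdE) blast
  have "(\<integral>y. ?g y \<partial>lborel) = 0"
  proof (rule integral_deriv_zero[where F="\<lambda>y. heat_kernel t x y * f y" and C=C])
    show "((\<lambda>y. heat_kernel t x y * f y) has_vector_derivative ?g y) (at y)" for y
      unfolding has_real_derivative_iff_has_vector_derivative[symmetric]
      using DERIV_mult[OF heat_kernel_deriv[OF t, of x y] der[of y]] t by (simp add: field_simps)
    show "continuous_on UNIV ?g" by (intro continuous_intros ch cont cf) (use t in auto)
    show "integrable lborel ?g" using i1 i2 by simp
    show "norm (heat_kernel t x y * f y) \<le> C * exp (- \<bar>y\<bar>)" for y using C(2)[of y] by simp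
  qed
  also have "(\<integral>y. ?g y \<partial>lborel) = (\<integral>y. heat_kernel t x y * f' y \<partial>lborel) - (\<integral>y. heat_kernel t x y * ((y - x) * f y) \<partial>lborel) / t"
    using i1 i2 by simp
  finally show ?thesis using t by (simp add: field_simps)
qed

section \<open>Heat polynomials and the functions Phi and Psi\<close>

text \<open>The coefficients of the generating function exp (x z - s z^2 / 2) = (SUM n. heat_poly n s x z^n).\<close>

fun heat_poly :: "nat \<Rightarrow> real \<Rightarrow> real \<Rightarrow> real" where
  "heat_poly 0 s x = 1"
| "heat_poly (Suc 0) s x = x"
| "heat_poly (Suc (Suc n)) s x = (x * heat_poly (Suc n) s x - s * heat_poly n s x) / real (Suc (Suc n))"

lemma heat_poly_Suc: "real (Suc n) * heat_poly (Suc n) s x = x * heat_poly n s x - s * (if n = 0 then 0 else heat_poly (n - 1) s x)"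
  by (cases n) auto

text \<open>An Appell property: with 1 / n! built into the normalisation, differentiation just
  lowers the index. Differentiating the recursion gives the recursion one index lower plus one more
  copy of the lower polynomial.\<close>

lemma heat_poly_deriv: "(heat_poly n s has_real_derivative (if n = 0 then 0 else heat_poly (n - 1) s x)) (at x)"
proof (induction n s x rule: heat_poly.induct)
  case (3 n s x)
  have "(heat_poly (Suc (Suc n)) s has_real_derivative
      ((1 * heat_poly (Suc n) s x + heat_poly n s x * x) - s * (if n = 0 then 0 else heat_poly (n - 1) s x)) / real (Suc (Suc n))) (at x)"
    unfolding heat_poly.simps(3)[abs_def]
    by (rule DERIV_cdivide, rule DERIV_diff, rule DERIV_mult[OF DERIV_ident]) (use 3 in \<open>auto intro!: DERIV_cmult\<close>)
  also have "((1 * heat_poly (Suc n) s x + heat_poly n s x * x) - s * (if n = 0 then 0 else heat_poly (n - 1) s x)) / real (Suc (Suc n)) = heat_poly (Suc n) s x"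
    using heat_poly_Suc[of n s x] by (simp add: field_simps)
  finally show ?case by simp
qed (auto intro!: derivative_eq_intros)

lemma heat_poly_bound: "\<bar>heat_poly n s x\<bar> \<le> (\<bar>x\<bar> + \<bar>s\<bar> + 1) ^ n"
proof (induction n s x rule: heat_poly.induct)
  case (3 n s x)
  let ?A = "\<bar>x\<bar> + \<bar>s\<bar> + 1"
  have "\<bar>heat_poly (Suc (Suc n)) s x\<bar> \<le> \<bar>x * heat_poly (Suc n) s x - s * heat_poly n s x\<bar>"
    unfolding heat_poly.simps(3) abs_divide
    using mult_left_mono[of 1 "real (Suc (Suc n))" "\<bar>x * heat_poly (Suc n) s x - s * heat_poly n s x\<bar>"] by (simp add: divide_le_eq)
  also have "\<dots> \<le> \<bar>x\<bar> * \<bar>heat_poly (Suc n) s x\<bar> + \<bar>s\<bar> * \<bar>heat_poly n s x\<bar>" by (simp add: abs_mult[symmetric])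
  also have "\<dots> \<le> \<bar>x\<bar> * ?A ^ Suc n + \<bar>s\<bar> * ?A ^ Suc n"
  proof (intro add_mono mult_left_mono)
    show "\<bar>heat_poly n s x\<bar> \<le> ?A ^ Suc n"
      using 3(2) by (rule order_trans) (simp add: mult_left_mono[of 1, simplified])
  qed (use 3 in auto)
  also have "\<dots> \<le> ?A ^ Suc (Suc n)" by (simp add: algebra_simps)
  finally show ?case .
qed auto

lemma heat_poly_continuous [continuous_intros]:
  assumes "continuous_on S f" "continuous_on S g"
  shows "continuous_on S (\<lambda>x. heat_poly n (f x) (g x))"
proof -
  have "continuous_on UNIV (\<lambda>(s, x). heat_poly n s x)"
  proof (induction n rule: induct_nat_012)
    case (ge2 n)
    then show ?case by (auto simp: case_prod_unfold intro!: continuous_intros)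
  qed (auto simp: case_prod_unfold intro!: continuous_intros)
  from continuous_on_compose2[OF this continuous_on_Pair[OF assms]] show ?thesis by simp
qed

lemma heat_poly_measurable [measurable (raw)]:
  assumes "f \<in> borel_measurable M" "g \<in> borel_measurable M"
  shows "(\<lambda>x. heat_poly n (f x) (g x)) \<in> borel_measurable M"
proof -
  have "(\<lambda>z. heat_poly n (fst z) (snd z)) \<in> borel_measurable borel"
    by (intro borel_measurable_continuous_onI continuous_intros)
  from measurable_compose[OF borel_measurable_Pair[OF assms] this] show ?thesis by simp
qed

text \<open>Parabolic scaling. It evaluates the polynomial at the contracted centre of a bridge in
  \<open>gauss_heat_poly_heat\<close>.\<close>

lemma heat_poly_scale: "heat_poly n (l\<^sup>2 * s) (l * x) = l ^ n * heat_poly n s x"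
proof (induction n s x rule: heat_poly.induct)
  case (3 n s x)
  then show ?case by (simp add: field_simps power2_eq_square)
qed auto

lemma expbd_heat_poly: "k > 0 \<Longrightarrow> expbd k (heat_poly n s)"
proof (rule expbdI[where C="fact n / k ^ n * exp (k * (\<bar>s\<bar> + 1))"])
  fix x :: real assume k: "k > 0"
  have "k ^ n * \<bar>heat_poly n s x\<bar> \<le> k ^ n * (\<bar>x\<bar> + \<bar>s\<bar> + 1) ^ n" using heat_poly_bound k by (intro mult_left_mono) auto
  also have "\<dots> = (k * (\<bar>x\<bar> + \<bar>s\<bar> + 1)) ^ n" by (simp add: power_mult_distrib)
  also have "\<dots> \<le> fact n * exp (k * (\<bar>x\<bar> + \<bar>s\<bar> + 1))" using k by (intro power_le_fact_exp) auto
  also have "\<dots> = fact n * exp (k * (\<bar>s\<bar> + 1)) * exp (k * \<bar>x\<bar>)" by (simp add: exp_add[symmetric] algebra_simps)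
  finally show "\<bar>heat_poly n s x\<bar> \<le> fact n / k ^ n * exp (k * (\<bar>s\<bar> + 1)) * exp (k * \<bar>x\<bar>)"
    using k by (simp add: field_simps)
qed measurable

text \<open>Backward heat equation with the variance parameter as time. With y = (y - x) + x in the
  recursion, Stein's identity turns the first part into t times the polynomial two indices lower,
  which cancels the t in s + t.\<close>

lemma heat_poly_heat:
  assumes t: "t > 0"
  shows "(\<integral>y. heat_kernel t x y * heat_poly n (s + t) y \<partial>lborel) = heat_poly n s x"
proof (induction n rule: induct_nat_012)
  case 0 then show ?case using t by simp
next
  case 1
  have "(\<integral>y. heat_kernel t x y * ((y - x) * 1) \<partial>lborel) = t * (\<integral>y. heat_kernel t x y * 0 \<partial>lborel)"
  proof (rule heat_kernel_stein[OF t])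
    show "expbd 0 (\<lambda>_. 1)" "expbd 0 (\<lambda>_. 0)" by (auto intro!: expbdI[where C=1])
  qed (auto intro!: derivative_eq_intros)
  moreover have "integrable lborel (\<lambda>y. heat_kernel t x y * (y - x))"
    using expbd_heat_integrable[of 1 "\<lambda>y. y - x" t x] expbdI[of "\<lambda>y. y - x" "1 + \<bar>x\<bar>" 1] abs_diff_exp_bound t by simp
  then have "(\<integral>y. heat_kernel t x y * (y - x) + x * heat_kernel t x y \<partial>lborel) = (\<integral>y. heat_kernel t x y * (y - x) \<partial>lborel) + x"
    using integrable_heat_kernel[OF t] t by simp
  ultimately show ?case by (simp add: algebra_simps)
next
  case (ge2 n)
  let ?I = "\<lambda>f. \<integral>y. heat_kernel t x y * f y \<partial>lborel"
  let ?h = "\<lambda>n. heat_poly n (s + t)"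
  have st: "?I (\<lambda>y. (y - x) * ?h (Suc n) y) = t * ?I (?h n)"
  proof (rule heat_kernel_stein[OF t])
    show "expbd 1 (?h (Suc n))" "expbd 1 (?h n)" by (auto intro: expbd_heat_poly)
    show "continuous_on UNIV (?h n)" by (intro continuous_intros)
    show "(?h (Suc n) has_real_derivative ?h n y) (at y)" for y using heat_poly_deriv[of "Suc n" "s + t" y] by simp
  qed
  have i: "integrable lborel (\<lambda>y. heat_kernel t x y * ?h k y)" for k
    by (rule expbd_heat_integrable[OF expbd_heat_poly[of 1] t]) simp
  have id: "expbd 1 (\<lambda>y. y - x)" using abs_diff_exp_bound by (intro expbdI[of _ "1 + \<bar>x\<bar>"]) auto
  have ix: "integrable lborel (\<lambda>y. heat_kernel t x y * ((y - x) * ?h k y))" for k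
    by (rule expbd_heat_integrable[OF expbd_mult[OF id expbd_heat_poly[of 1]] t]) simp
  have "real (Suc (Suc n)) * ?I (?h (Suc (Suc n))) = (\<integral>y. heat_kernel t x y * ((y - x) * ?h (Suc n) y) + (x * (heat_kernel t x y * ?h (Suc n) y) - (s + t) * (heat_kernel t x y * ?h n y)) \<partial>lborel)"
    unfolding integral_mult_right_zero[symmetric]
    by (rule Bochner_Integration.integral_cong) (auto simp: field_simps)
  also have "\<dots> = ?I (\<lambda>y. (y - x) * ?h (Suc n) y) + (x * ?I (?h (Suc n)) - (s + t) * ?I (?h n))"
    using i ix by simp
  also have "\<dots> = x * heat_poly (Suc n) s x - s * heat_poly n s x" unfolding st ge2.IH by (simp add: algebra_simps)
  finally have "?I (?h (Suc (Suc n))) * real (Suc (Suc n)) = x * heat_poly (Suc n) s x - s * heat_poly n s x" by (simp only: mult.commute)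
  then have "?I (?h (Suc (Suc n))) = (x * heat_poly (Suc n) s x - s * heat_poly n s x) / real (Suc (Suc n))"
    by (subst nonzero_eq_divide_eq) auto
  then show ?case unfolding heat_poly.simps(3)[of n s x] .
qed

lemma heat_poly_0_0: "n > 0 \<Longrightarrow> heat_poly n 0 0 = 0"
  by (induction n rule: induct_nat_012) auto

text \<open>Induction on n for all m. Stein's identity at 0 moves the factor y of the recursion onto
  derivatives: the derivative of the n-th polynomial cancels the second term of the recursion, that
  of the m-th remains, and both indices drop by one.\<close>

lemma heat_poly_orthogonal:
  assumes s: "s > 0"
  shows "(\<integral>y. heat_kernel s 0 y * (heat_poly n s y * heat_poly m s y) \<partial>lborel) = (if n = m then s ^ n / fact n else 0)"
proof (induction n arbitrary: m)
  case 0
  then show ?case using heat_poly_heat[OF s, of 0 m 0] heat_poly_0_0[of m] by (cases m) auto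
next
  case (Suc n)
  let ?I = "\<lambda>f. \<integral>y. heat_kernel s 0 y * f y \<partial>lborel"
  show ?case
  proof (cases m)
    case 0
    then show ?thesis using heat_poly_heat[OF s, of 0 "Suc n" 0] heat_poly_0_0[of "Suc n"] by simp
  next
    case (Suc m')
    let ?dn = "\<lambda>y. if n = 0 then 0 else heat_poly (n - 1) s y"
    have en: "expbd 1 (heat_poly k s)" for k by (simp add: expbd_heat_poly)
    have ed: "expbd 1 ?dn" using en by (cases "n = 0") (auto intro: expbdI[of _ 1])
    have e2: "expbd 2 (\<lambda>y. heat_poly k s y * heat_poly l s y)" for k l using expbd_mult[OF en en] by simp
    have e2d: "expbd 2 (\<lambda>y. ?dn y * heat_poly l s y)" for l using expbd_mult[OF ed en] by simp
    have st: "?I (\<lambda>y. (y - 0) * (heat_poly n s y * heat_poly m s y)) = s * ?I (\<lambda>y. ?dn y * heat_poly m s y + heat_poly m' s y * heat_poly n s y)"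
    proof (rule heat_kernel_stein[OF s])
      show "expbd 2 (\<lambda>y. heat_poly n s y * heat_poly m s y)" by (rule e2)
      show "expbd 2 (\<lambda>y. ?dn y * heat_poly m s y + heat_poly m' s y * heat_poly n s y)" by (rule expbd_add[OF e2d e2])
      show "continuous_on UNIV (\<lambda>y. ?dn y * heat_poly m s y + heat_poly m' s y * heat_poly n s y)"
        by (cases "n = 0") (auto intro!: continuous_intros)
      show "((\<lambda>y. heat_poly n s y * heat_poly m s y) has_real_derivative ?dn y * heat_poly m s y + heat_poly m' s y * heat_poly n s y) (at y)" for y
        using DERIV_mult[OF heat_poly_deriv[of n s y] heat_poly_deriv[of m s y]] Suc by simp
    qed
    have i: "integrable lborel (\<lambda>y. heat_kernel s 0 y * (heat_poly k s y * heat_poly l s y))" for k l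
      by (rule expbd_heat_integrable[OF e2 s])
    have id: "integrable lborel (\<lambda>y. heat_kernel s 0 y * (?dn y * heat_poly l s y))" for l
      by (rule expbd_heat_integrable[OF e2d s])
    have ey: "expbd 1 (\<lambda>y. y - 0)" using abs_diff_exp_bound[of _ 0] by (intro expbdI[of _ 1]) auto
    have iy: "integrable lborel (\<lambda>y. heat_kernel s 0 y * ((y - 0) * (heat_poly n s y * heat_poly m s y)))"
      by (rule expbd_heat_integrable[OF expbd_mult[OF ey e2] s])
    have "real (Suc n) * ?I (\<lambda>y. heat_poly (Suc n) s y * heat_poly m s y) = ?I (\<lambda>y. (real (Suc n) * heat_poly (Suc n) s y) * heat_poly m s y)"
      unfolding integral_mult_right_zero[symmetric] by (simp add: ac_simps)
    also have "\<dots> = (\<integral>y. heat_kernel s 0 y * ((y - 0) * (heat_poly n s y * heat_poly m s y)) - s * (heat_kernel s 0 y * (?dn y * heat_poly m s y)) \<partial>lborel)"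
      unfolding heat_poly_Suc by (rule Bochner_Integration.integral_cong) (auto simp: algebra_simps)
    also have "\<dots> = ?I (\<lambda>y. (y - 0) * (heat_poly n s y * heat_poly m s y)) - s * ?I (\<lambda>y. ?dn y * heat_poly m s y)"
      using iy id by simp
    also have "?I (\<lambda>y. (y - 0) * (heat_poly n s y * heat_poly m s y)) = s * ?I (\<lambda>y. ?dn y * heat_poly m s y) + s * ?I (\<lambda>y. heat_poly m' s y * heat_poly n s y)"
      unfolding st using id i by (simp add: distrib_left)
    finally have "real (Suc n) * ?I (\<lambda>y. heat_poly (Suc n) s y * heat_poly m s y) = s * ?I (\<lambda>y. heat_poly n s y * heat_poly m' s y)"
      by (simp add: mult.commute)
    also have "\<dots> = s * (if n = m' then s ^ n / fact n else 0)" unfolding Suc.IH ..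
    finally have "?I (\<lambda>y. heat_poly (Suc n) s y * heat_poly m s y) * real (Suc n) = s * (if n = m' then s ^ n / fact n else 0)"
      by (simp only: mult.commute)
    then have "?I (\<lambda>y. heat_poly (Suc n) s y * heat_poly m s y) = s * (if n = m' then s ^ n / fact n else 0) / real (Suc n)"
      by (subst nonzero_eq_divide_eq) auto
    also have "\<dots> = (if Suc n = m then s ^ Suc n / fact (Suc n) else 0)" using Suc by (auto simp: mult.commute simp del: of_nat_Suc)
    finally show ?thesis .
  qed
qed

text \<open>Phi and Psi are PhiF and PsiF minus their reflections (Phi_eq and Psi_eq). In their integrals the
  exponent is quadratic in the integration variable, and xi_of is half its linear coefficient.\<close>

definition xi_of :: "real \<Rightarrow> real \<Rightarrow> real \<Rightarrow> real" where
  "xi_of r \<tau> u = u + r / sqrt 2 * (1 + 4 * \<tau>)"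

definition PhiF :: "real \<Rightarrow> real \<Rightarrow> nat \<Rightarrow> real \<Rightarrow> real" where
  "PhiF r \<tau> n u = exp (sqrt 2 * r * u + 2 * r\<^sup>2 * \<tau>) * (fact n / (4 * \<tau>) ^ n *
     (heat_kernel (2 * \<tau>) 0 (xi_of r \<tau> u) * heat_poly n (2 * \<tau>) (xi_of r \<tau> u)))"

definition PsiF :: "real \<Rightarrow> real \<Rightarrow> nat \<Rightarrow> real \<Rightarrow> real" where
  "PsiF r \<tau> m v = exp (- (sqrt 2 * r * v + 2 * r\<^sup>2 * \<tau>)) * (2 ^ m * heat_poly m (2 * \<tau>) (xi_of r \<tau> v))"

text \<open>The integral over the imaginary axis in \<open>Phi\<close> with W = i y, once the
  constant exponential is pulled out; \<open>xi_of\<close> will be substituted for x.\<close>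

definition fourier_moment :: "real \<Rightarrow> nat \<Rightarrow> real \<Rightarrow> complex" where
  "fourier_moment \<tau> n x = (\<integral>y. (\<i> * of_real y) ^ n * exp (- of_real (4 * \<tau> * y\<^sup>2) - \<i> * of_real (2 * x * y)) \<partial>lborel)"

section \<open>Gaussian moments and contour integrals\<close>

lemma gauss_power_bound:
  assumes "\<tau> > 0"
  shows "\<exists>C. \<forall>y::real. \<bar>y\<bar> ^ n * exp (- (4 * \<tau> * y\<^sup>2)) \<le> C * exp (- \<bar>y\<bar>)"
proof (intro exI allI)
  fix y :: real
  \<comment> \<open>The arithmetic-geometric inequality leaves two copies of |y|: one absorbs the
    power through \<open>power_le_fact_exp\<close>, the other remains as decay.\<close>
  have "2 * \<bar>y\<bar> \<le> 4 * \<tau> * y\<^sup>2 + 1 / (4 * \<tau>)"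
  proof -
    have "0 \<le> (4 * \<tau> * \<bar>y\<bar> - 1)\<^sup>2 / (4 * \<tau>)" using assms by simp
    also have "\<dots> = 4 * \<tau> * y\<^sup>2 + 1 / (4 * \<tau>) - 2 * \<bar>y\<bar>" using assms by (simp add: field_simps power2_eq_square)
    finally show ?thesis by simp
  qed
  then have "exp \<bar>y\<bar> * exp (- (4 * \<tau> * y\<^sup>2)) \<le> exp (1 / (4 * \<tau>)) * exp (- \<bar>y\<bar>)"
    by (simp add: exp_add[symmetric])
  moreover have "\<bar>y\<bar> ^ n * exp (- (4 * \<tau> * y\<^sup>2)) \<le> fact n * exp \<bar>y\<bar> * exp (- (4 * \<tau> * y\<^sup>2))"
    by (intro mult_right_mono power_le_fact_exp) auto
  ultimately show "\<bar>y\<bar> ^ n * exp (- (4 * \<tau> * y\<^sup>2)) \<le> (fact n * exp (1 / (4 * \<tau>))) * exp (- \<bar>y\<bar>)"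
    by (smt (verit) fact_ge_zero mult.assoc mult_left_mono)
qed

lemma norm_fourier_integrand:
  "norm ((\<i> * of_real y) ^ n * exp (- of_real (4 * \<tau> * y\<^sup>2) - \<i> * of_real (2 * x * y)) :: complex) = \<bar>y\<bar> ^ n * exp (- (4 * \<tau> * y\<^sup>2))"
  by (simp add: norm_mult norm_power norm_exp_eq_Re)

lemma fourier_integrable:
  assumes "\<tau> > 0"
  shows "integrable lborel (\<lambda>y. (\<i> * of_real y) ^ n * exp (- of_real (4 * \<tau> * y\<^sup>2) - \<i> * of_real (2 * x * y)) :: complex)"
proof -
  obtain C where C: "\<And>y::real. \<bar>y\<bar> ^ n * exp (- (4 * \<tau> * y\<^sup>2)) \<le> C * exp (- \<bar>y\<bar>)"
    using gauss_power_bound[OF assms] by blast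
  have "integrable lborel (\<lambda>y::real. C * exp (- 1 * \<bar>y\<bar>))" using integrable_exp_neg_abs[of 1] by simp
  then show ?thesis
  proof (rule Bochner_Integration.integrable_bound)
    show "AE y in lborel. norm ((\<i> * of_real y) ^ n * exp (- of_real (4 * \<tau> * y\<^sup>2) - \<i> * of_real (2 * x * y)) :: complex) \<le> norm (C * exp (- 1 * \<bar>y\<bar>))"
      unfolding norm_fourier_integrand using C by (intro AE_I2) (auto intro: order_trans[OF _ abs_ge_self])
  qed measurable
qed

text \<open>The derivative of the integrand in y integrates to 0. At n = 0 the truncated index n - 1
  is harmless because its coefficient is 0.\<close>

lemma fourier_moment_rec:
  assumes t: "\<tau> > 0"
  shows "8 * of_real \<tau> * fourier_moment \<tau> (Suc n) x = of_real (2 * x) * fourier_moment \<tau> n x - of_nat n * fourier_moment \<tau> (n - 1) x"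
proof -
  let ?e = "\<lambda>y. exp (- of_real (4 * \<tau> * y\<^sup>2) - \<i> * of_real (2 * x * y)) :: complex"
  let ?g = "\<lambda>n y. (\<i> * of_real y) ^ n * ?e y"
  let ?d = "\<lambda>y. \<i> * (of_nat n * ?g (n - 1) y + 8 * of_real \<tau> * ?g (Suc n) y - of_real (2 * x) * ?g n y)"
  obtain C where C: "\<And>y::real. \<bar>y\<bar> ^ n * exp (- (4 * \<tau> * y\<^sup>2)) \<le> C * exp (- \<bar>y\<bar>)"
    using gauss_power_bound[OF t] by blast
  have "(\<integral>y. ?d y \<partial>lborel) = 0"
  proof (rule integral_deriv_zero[where F="?g n" and C=C])
    fix y
    have "((\<lambda>z. (\<i> * z) ^ n * exp (- 4 * of_real \<tau> * z\<^sup>2 - \<i> * (2 * of_real x * z))) has_field_derivative ?d y) (at (of_real y))"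
      apply (rule derivative_eq_intros refl)+
      apply (simp add: algebra_simps power2_eq_square)
      done
    note d = this
    have "(of_real has_vector_derivative (1 :: complex)) (at y)"
      using has_vector_derivative_of_real[of "\<lambda>x. x" 1 "at y"] by simp
    note field_vector_diff_chain_at[OF this, OF d]
    then show "(?g n has_vector_derivative ?d y) (at y)" by (simp add: o_def mult.assoc)
  next
    show "continuous_on UNIV ?d" by (intro continuous_intros)
    show "integrable lborel ?d" by (intro integrable_mult_right Bochner_Integration.integrable_add Bochner_Integration.integrable_diff fourier_integrable[OF t])
    show "norm (?g n y) \<le> C * exp (- \<bar>y\<bar>)" for y unfolding norm_fourier_integrand by (rule C)
  qed
  also have "(\<integral>y. ?d y \<partial>lborel) = \<i> * (of_nat n * fourier_moment \<tau> (n - 1) x + 8 * of_real \<tau> * fourier_moment \<tau> (Suc n) x - of_real (2 * x) * fourier_moment \<tau> n x)"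
    unfolding fourier_moment_def using fourier_integrable[OF t]
    by (simp only: integral_mult_right_zero Bochner_Integration.integral_add Bochner_Integration.integral_diff integrable_mult_right Bochner_Integration.integrable_add)
  finally have "of_nat n * fourier_moment \<tau> (n - 1) x + 8 * of_real \<tau> * fourier_moment \<tau> (Suc n) x - of_real (2 * x) * fourier_moment \<tau> n x = 0"
    by simp
  then show ?thesis by (simp add: algebra_simps)
qed

text \<open>The characteristic function of the standard normal law at - 2 x / k, after rescaling y
  by k with k^2 = 8 \<tau>.\<close>

lemma fourier_moment_0:
  assumes t: "\<tau> > 0"
  shows "fourier_moment \<tau> 0 x = of_real (pi * heat_kernel (2 * \<tau>) 0 x)"
proof -
  define k where "k = sqrt (8 * \<tau>)"
  have k: "k > 0" "k\<^sup>2 = 8 * \<tau>" using t by (auto simp: k_def)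
  have "of_real (exp (- (- 2 * x / k)\<^sup>2 / 2)) = char std_normal_distribution (- 2 * x / k)"
    by (simp add: char_std_normal_distribution)
  also have "\<dots> = (\<integral>y. std_normal_density y *\<^sub>R iexp (- 2 * x / k * y) \<partial>lborel)"
    unfolding char_def by (subst integral_density) (auto simp: normal_density_nonneg)
  also have "\<dots> = k *\<^sub>R (\<integral>y. std_normal_density (k * y) *\<^sub>R iexp (- 2 * x / k * (k * y)) \<partial>lborel)"
    using k lborel_integral_real_affine[of k "\<lambda>y. std_normal_density y *\<^sub>R iexp (- 2 * x / k * y)" 0] by simp
  also have "(\<lambda>y. std_normal_density (k * y) *\<^sub>R iexp (- 2 * x / k * (k * y))) =
     (\<lambda>y. of_real (1 / sqrt (2 * pi)) * ((\<i> * of_real y) ^ 0 * exp (- of_real (4 * \<tau> * y\<^sup>2) - \<i> * of_real (2 * x * y))))"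
  proof (rule ext)
    fix y
    have "std_normal_density (k * y) = 1 / sqrt (2 * pi) * exp (- (4 * \<tau> * y\<^sup>2))"
      using k by (simp add: std_normal_density_def power_mult_distrib)
    moreover have "iexp (- 2 * x / k * (k * y)) = exp (- (\<i> * of_real (2 * x * y)))" using k by (simp add: mult.assoc)
    ultimately show "std_normal_density (k * y) *\<^sub>R iexp (- 2 * x / k * (k * y)) =
      of_real (1 / sqrt (2 * pi)) * ((\<i> * of_real y) ^ 0 * exp (- of_real (4 * \<tau> * y\<^sup>2) - \<i> * of_real (2 * x * y)))"
      unfolding diff_conv_add_uminus exp_add by (simp add: scaleR_conv_of_real exp_of_real[symmetric] del: of_real_mult)
  qed
  finally have "of_real (exp (- (- 2 * x / k)\<^sup>2 / 2)) = of_real (k / sqrt (2 * pi)) * fourier_moment \<tau> 0 x"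
    unfolding fourier_moment_def integral_mult_right_zero by (simp add: scaleR_conv_of_real)
  then have "fourier_moment \<tau> 0 x = of_real (exp (- (- 2 * x / k)\<^sup>2 / 2) * (sqrt (2 * pi) / k))"
    using k by (simp add: field_simps)
  also have "exp (- (- 2 * x / k)\<^sup>2 / 2) * (sqrt (2 * pi) / k) = pi * heat_kernel (2 * \<tau>) 0 x"
  proof -
    have "sqrt (2 * pi) / k = pi / sqrt (2 * pi * (2 * \<tau>))"
    proof -
      have "sqrt (2 * pi) * sqrt (2 * pi * (2 * \<tau>)) = pi * k"
        unfolding k_def real_sqrt_mult[symmetric]
        using real_sqrt_mult[of "pi * pi" "8 * \<tau>"] by (simp add: algebra_simps)
      then show ?thesis using k t by (simp add: field_simps)
    qed
    moreover have "- (- 2 * x / k)\<^sup>2 / 2 = - (0 - x)\<^sup>2 / (2 * (2 * \<tau>))"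
      using k t by (simp add: power_divide power_mult_distrib)
    ultimately show ?thesis unfolding heat_kernel_def by simp
  qed
  finally show ?thesis .
qed

text \<open>Up to the factors n! / (4 \<tau>)^n, \<open>fourier_moment_rec\<close> is the three-term
  recursion of \<open>heat_poly\<close>.\<close>

lemma fourier_moment_eq:
  assumes t: "\<tau> > 0"
  shows "fourier_moment \<tau> n x = of_real (pi * (fact n / (4 * \<tau>) ^ n * (heat_kernel (2 * \<tau>) 0 x * heat_poly n (2 * \<tau>) x)))"
proof (induction n rule: induct_nat_012)
  case 0 then show ?case by (simp add: fourier_moment_0[OF t])
next
  case 1
  have "fourier_moment \<tau> 1 x = of_real (2 * x) * fourier_moment \<tau> 0 x / (8 * of_real \<tau>)"
    using fourier_moment_rec[OF t, of 0 x] t by (simp add: field_simps)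
  then show ?case using t by (simp add: fourier_moment_0[OF t] field_simps)
next
  case (ge2 n)
  let ?p = "heat_kernel (2 * \<tau>) 0 x"
  have "fourier_moment \<tau> (Suc (Suc n)) x = (of_real (2 * x) * fourier_moment \<tau> (Suc n) x - of_nat (Suc n) * fourier_moment \<tau> n x) / (8 * of_real \<tau>)"
    using fourier_moment_rec[OF t, of "Suc n" x] t by (simp add: field_simps)
  also have "\<dots> = of_real ((2 * x * (pi * (fact (Suc n) / (4 * \<tau>) ^ Suc n * (?p * heat_poly (Suc n) (2 * \<tau>) x))) - real (Suc n) * (pi * (fact n / (4 * \<tau>) ^ n * (?p * heat_poly n (2 * \<tau>) x)))) / (8 * \<tau>))"
    unfolding ge2.IH by simp
  also have "(2 * x * (pi * (fact (Suc n) / (4 * \<tau>) ^ Suc n * (?p * heat_poly (Suc n) (2 * \<tau>) x))) - real (Suc n) * (pi * (fact n / (4 * \<tau>) ^ n * (?p * heat_poly n (2 * \<tau>) x)))) / (8 * \<tau>)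
     = pi * (fact (Suc (Suc n)) / (4 * \<tau>) ^ Suc (Suc n) * (?p * heat_poly (Suc (Suc n)) (2 * \<tau>) x))"
  proof -
    define a b c D F where "a = heat_poly (Suc n) (2 * \<tau>) x" and "b = heat_poly n (2 * \<tau>) x" and "c = heat_poly (Suc (Suc n)) (2 * \<tau>) x"
      and "D = (4 * \<tau>) ^ n" and "F = (fact (Suc n) :: real)"
    have c: "real (Suc (Suc n)) * c = x * a - 2 * \<tau> * b" using heat_poly_Suc[of "Suc n" "2 * \<tau>" x] by (simp add: a_def b_def c_def)
    have F: "real (Suc n) * fact n = F" "fact (Suc (Suc n)) = real (Suc (Suc n)) * F" by (simp_all add: F_def)
    have D: "D > 0" "(4 * \<tau>) ^ Suc n = 4 * \<tau> * D" "(4 * \<tau>) ^ Suc (Suc n) = 16 * \<tau>\<^sup>2 * D"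
      using t by (simp_all add: D_def power2_eq_square)
    have "(2 * x * (pi * (F / (4 * \<tau> * D) * (?p * a))) - real (Suc n) * (pi * (fact n / D * (?p * b)))) / (8 * \<tau>)
      = (2 * x * (pi * (F / (4 * \<tau> * D) * (?p * a))) - (pi * ((real (Suc n) * fact n) / D * (?p * b)))) / (8 * \<tau>)" by simp
    also have "\<dots> = pi * (F / (16 * \<tau>\<^sup>2 * D) * (?p * (x * a - 2 * \<tau> * b)))"
      unfolding F using t D(1) by (simp add: field_simps power2_eq_square)
    also have "\<dots> = pi * (real (Suc (Suc n)) * F / (16 * \<tau>\<^sup>2 * D) * (?p * c))"
      unfolding c[symmetric] by (simp add: mult_ac)
    finally show ?thesis
      unfolding a_def[symmetric] b_def[symmetric] c_def[symmetric] D(2,3) F(2) F_def[symmetric] D_def[symmetric] .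
  qed
  finally show ?case .
qed

lemma Phi_eq:
  assumes t: "\<tau> > 0"
  shows "Phi r \<tau> n u = of_real (PhiF r \<tau> n u - PhiF r \<tau> n (- u))"
proof -
  let ?G = "\<lambda>u y. (\<i> * of_real y) ^ n * exp (- of_real (4 * \<tau> * y\<^sup>2) - \<i> * of_real (2 * xi_of r \<tau> u * y)) :: complex"
  let ?E = "\<lambda>u. of_real (exp (sqrt 2 * r * u + 2 * r\<^sup>2 * \<tau>)) :: complex"
  \<comment> \<open>The square is expanded with w = i y: the constant part is the exponent of
    \<open>PhiF\<close>, the quadratic part is 4 \<tau> w^2, and the linear parts collect to - 2 w
    times \<open>xi_of\<close>.\<close>
  have ex: "exp (of_real \<tau> * (of_real (sqrt 2 * r) - 2 * (\<i> * of_real y))\<^sup>2 - of_real (sqrt 2 * r) * (\<i> * of_real y)) * f_W r (\<i> * of_real y) u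
      = ?E u * exp (- of_real (4 * \<tau> * y\<^sup>2) - \<i> * of_real (2 * xi_of r \<tau> u * y))" for y u
  proof -
    have s: "complex_of_real (sqrt 2) * complex_of_real (sqrt 2) = 2" by (metis of_real_mult of_real_numeral real_sqrt_mult_self abs_numeral)
    have s2: "2 / complex_of_real (sqrt 2) = of_real (sqrt 2)" using s by (simp add: field_simps)
    show ?thesis
      unfolding f_W_def xi_of_def exp_of_real[symmetric] exp_add[symmetric]
      apply (rule arg_cong[where f=exp])
      using s2 s by (simp add: complex_eq_iff power2_eq_square) (simp add: field_simps power2_eq_square)
  qed
  have "Phi r \<tau> n u = 1 / (of_real pi * \<i>) * (\<integral>y. \<i> * (?E u * ?G u y - ?E (- u) * ?G (- u) y) \<partial>lborel)"
    unfolding Phi_def Let_def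
    apply (intro arg_cong2[where f="(*)"] refl Bochner_Integration.integral_cong)
    using ex[of _ u] ex[of _ "- u"] by (simp add: algebra_simps)
  also have "(\<integral>y. \<i> * (?E u * ?G u y - ?E (- u) * ?G (- u) y) \<partial>lborel) = \<i> * (?E u * fourier_moment \<tau> n (xi_of r \<tau> u) - ?E (- u) * fourier_moment \<tau> n (xi_of r \<tau> (- u)))"
    unfolding fourier_moment_def using fourier_integrable[OF t]
    by (simp only: integral_mult_right_zero Bochner_Integration.integral_diff integrable_mult_right)
  also have "1 / (of_real pi * \<i>) * \<dots> = of_real (PhiF r \<tau> n u - PhiF r \<tau> n (- u))"
    unfolding fourier_moment_eq[OF t] PhiF_def by (simp add: field_simps)
  finally show ?thesis .
qed


text \<open>The derivative of f z / z^(n+1) integrates to 0 over the circle, which is the recursion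
  of \<open>heat_poly\<close> for the contour integrals. The exponent is that of the generating
  function at 2 z, hence the factor 2^m.\<close>

lemma hermite_contour:
  fixes s x :: real
  defines "f \<equiv> \<lambda>z::complex. exp (of_real (2 * x) * z - of_real (2 * s) * z\<^sup>2)"
  shows "((\<lambda>z. f z / z ^ Suc m) has_contour_integral (2 * of_real pi * \<i> * of_real (2 ^ m * heat_poly m s x))) (circlepath 0 1)"
proof -
  have fd: "(f has_field_derivative (of_real (2 * x) - of_real (4 * s) * z) * f z) (at z)" for z
    unfolding f_def by (auto intro!: derivative_eq_intros simp: algebra_simps)
  have hol: "f holomorphic_on A" for A unfolding f_def by (intro holomorphic_intros)
  \<comment> \<open>Starting values: without a pole Cauchy's theorem gives 0, and a simple pole
    gives Cauchy's integral formula with f 0 = 1.\<close>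
  have J0: "((\<lambda>z. f z / z ^ 0) has_contour_integral 0) (circlepath 0 1)"
  proof -
    have "path_image (circlepath 0 1) \<subseteq> ball (0 :: complex) 2" by auto
    then show ?thesis using Cauchy_theorem_disc_simple[OF hol[of "ball 0 2"], of "circlepath 0 1"] by simp
  qed
  have J1: "((\<lambda>z. f z / z ^ 1) has_contour_integral (2 * of_real pi * \<i>)) (circlepath 0 1)"
    using Cauchy_integral_circlepath_simple[OF hol[of "cball 0 1"], of 0] by (simp add: f_def)
  have D: "((\<lambda>z. (of_real (2 * x) - of_real (4 * s) * z) * f z / z ^ Suc n - of_nat (Suc n) * (f z / z ^ Suc (Suc n))) has_contour_integral 0) (circlepath 0 1)" for n
  proof (rule Cauchy_theorem_primitive[where f="\<lambda>z. f z / z ^ Suc n" and S="- {0}"])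
    fix z :: complex assume z: "z \<in> - {0}"
    have "((\<lambda>z. f z / z ^ Suc n) has_field_derivative (of_real (2 * x) - of_real (4 * s) * z) * f z / z ^ Suc n - of_nat (Suc n) * (f z / z ^ Suc (Suc n))) (at z)"
    proof -
      have p: "((\<lambda>z. z ^ Suc n) has_field_derivative of_nat (Suc n) * z ^ n) (at z)"
        by (rule DERIV_cong, rule DERIV_power_Suc[OF DERIV_ident]) simp
      from DERIV_divide[OF fd p] z show ?thesis
        by (simp add: diff_divide_distrib mult.commute[of "f z"] del: of_nat_Suc)
    qed
    then show "((\<lambda>z. f z / z ^ Suc n) has_field_derivative (of_real (2 * x) - of_real (4 * s) * z) * f z / z ^ Suc n - of_nat (Suc n) * (f z / z ^ Suc (Suc n))) (at z within - {0})"
      by (rule has_field_derivative_at_within)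
  qed (auto simp: path_image_circlepath)
  have nz: "z \<noteq> 0" if "z \<in> path_image (circlepath 0 1)" for z :: complex using that by auto
  have rec: "((\<lambda>z. f z / z ^ Suc (Suc n)) has_contour_integral (of_real (2 * x) * a - of_real (4 * s) * b) / of_nat (Suc n)) (circlepath 0 1)"
    if a: "((\<lambda>z. f z / z ^ Suc n) has_contour_integral a) (circlepath 0 1)"
      and b: "((\<lambda>z. f z / z ^ n) has_contour_integral b) (circlepath 0 1)" for n a b
  proof -
    have "((\<lambda>z. (1 / of_nat (Suc n)) * ((of_real (2 * x) * (f z / z ^ Suc n) - of_real (4 * s) * (f z / z ^ n))
      - ((of_real (2 * x) - of_real (4 * s) * z) * f z / z ^ Suc n - of_nat (Suc n) * (f z / z ^ Suc (Suc n)))))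
      has_contour_integral (1 / of_nat (Suc n)) * ((of_real (2 * x) * a - of_real (4 * s) * b) - 0)) (circlepath 0 1)"
      by (intro has_contour_integral_lmul has_contour_integral_diff a b D)
    then show ?thesis
    proof (rule has_contour_integral_eq[THEN back_subst[of "\<lambda>i. ((\<lambda>z. f z / z ^ Suc (Suc n)) has_contour_integral i) (circlepath 0 1)"]])
      fix z :: complex assume "z \<in> path_image (circlepath 0 1)"
      then have z: "z \<noteq> 0" by (rule nz)
      have "(of_real (2 * x) - of_real (4 * s) * z) * f z / z ^ Suc n = of_real (2 * x) * (f z / z ^ Suc n) - of_real (4 * s) * (f z / z ^ n)"
        using z by (simp add: field_simps)
      then show "(1 / of_nat (Suc n)) * ((of_real (2 * x) * (f z / z ^ Suc n) - of_real (4 * s) * (f z / z ^ n))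
        - ((of_real (2 * x) - of_real (4 * s) * z) * f z / z ^ Suc n - of_nat (Suc n) * (f z / z ^ Suc (Suc n)))) = f z / z ^ Suc (Suc n)"
        by (simp del: of_nat_Suc)
    qed simp
  qed
  show ?thesis
  proof (induction m rule: induct_nat_012)
    case 0 then show ?case using J1 by simp
  next
    case 1
    show ?case using rec[OF J1[unfolded One_nat_def] J0] by (simp add: mult_ac)
  next
    case (ge2 n)
    have "(of_real (2 * x) * (2 * of_real pi * \<i> * of_real (2 ^ Suc n * heat_poly (Suc n) s x)) - of_real (4 * s) * (2 * of_real pi * \<i> * of_real (2 ^ n * heat_poly n s x))) / of_nat (Suc (Suc n))
      = 2 * of_real pi * \<i> * complex_of_real (2 ^ Suc (Suc n) * heat_poly (Suc (Suc n)) s x)"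
      unfolding heat_poly.simps(3)[of n s x] by (simp add: field_simps)
    with rec[OF ge2.IH(2) ge2.IH(1)] show ?case by (simp only:)
  qed
qed

lemma hermite_circle:
  fixes s x :: real
  defines "f \<equiv> \<lambda>z::complex. exp (of_real (2 * x) * z - of_real (2 * s) * z\<^sup>2)"
  shows "set_integrable lborel {0..2*pi} (\<lambda>\<theta>. \<i> * exp (\<i> * of_real \<theta>) * (inverse (exp (\<i> * of_real \<theta>)) ^ (m + 1) * f (exp (\<i> * of_real \<theta>))))" (is ?A)
    and "(LINT \<theta>:{0..2*pi}|lborel. \<i> * exp (\<i> * of_real \<theta>) * (inverse (exp (\<i> * of_real \<theta>)) ^ (m + 1) * f (exp (\<i> * of_real \<theta>))))
     = 2 * of_real pi * \<i> * of_real (2 ^ m * heat_poly m s x)" (is ?B)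
proof -
  show *: ?A unfolding f_def by (intro borel_integrable_atLeastAtMost' continuous_intros) auto
  have "((\<lambda>t. f (0 + of_real 1 * cis t) / (0 + of_real 1 * cis t) ^ Suc m * of_real 1 * \<i> * cis t) has_integral (2 * of_real pi * \<i> * of_real (2 ^ m * heat_poly m s x))) {0..2*pi}"
    using hermite_contour[of x s m] unfolding circlepath_def f_def by (subst (asm) has_contour_integral_part_circlepath_iff) auto
  also have "(\<lambda>t. f (0 + of_real 1 * cis t) / (0 + of_real 1 * cis t) ^ Suc m * of_real 1 * \<i> * cis t) =
     (\<lambda>\<theta>. \<i> * exp (\<i> * of_real \<theta>) * (inverse (exp (\<i> * of_real \<theta>)) ^ (m + 1) * f (exp (\<i> * of_real \<theta>))))"
    by (simp add: fun_eq_iff cis_conv_exp divide_inverse power_inverse mult_ac)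
  finally show ?B using set_borel_integral_eq_integral(2)[OF *] by (simp add: integral_unique)
qed

text \<open>The exponent is that of \<open>Phi\<close> with the opposite sign, so the prefactor is
  the reciprocal one; the exponentials cancel when \<open>PhiF\<close> and \<open>PsiF\<close> are
  paired.\<close>

lemma Psi_eq: "Psi r \<tau> m v = of_real (PsiF r \<tau> m v - PsiF r \<tau> m (- v))"
proof -
  let ?G = "\<lambda>v \<theta>. \<i> * exp (\<i> * of_real \<theta>) * (inverse (exp (\<i> * of_real \<theta>)) ^ (m + 1) *
     exp (of_real (2 * xi_of r \<tau> v) * exp (\<i> * of_real \<theta>) - of_real (2 * (2 * \<tau>)) * (exp (\<i> * of_real \<theta>))\<^sup>2)) :: complex"
  let ?E = "\<lambda>v. of_real (exp (- (sqrt 2 * r * v + 2 * r\<^sup>2 * \<tau>))) :: complex"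
  have ex: "exp (- of_real \<tau> * (of_real (sqrt 2 * r) - 2 * z)\<^sup>2 + of_real (sqrt 2 * r) * z) * g_Z r z v
      = ?E v * exp (of_real (2 * xi_of r \<tau> v) * z - of_real (2 * (2 * \<tau>)) * z\<^sup>2)" for z v
  proof -
    have s: "complex_of_real (sqrt 2) * complex_of_real (sqrt 2) = 2" by (metis of_real_mult of_real_numeral real_sqrt_mult_self abs_numeral)
    have s': "complex_of_real (sqrt 2) * (complex_of_real (sqrt 2) * a) = 2 * a" for a using s by (simp add: mult.assoc[symmetric])
    have s2: "r / sqrt 2 = sqrt 2 * r / 2" by (simp add: field_simps)
    show ?thesis
      unfolding g_Z_def xi_of_def exp_of_real[symmetric] exp_add[symmetric] s2
      by (rule arg_cong[where f=exp]) (simp add: field_simps power2_eq_square s s')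
  qed
  have i: "set_integrable lborel {0..2*pi} (?G v)" for v by (rule hermite_circle(1))
  have "Psi r \<tau> m v = 1 / (2 * of_real pi * \<i>) * (LINT \<theta>:{0..2*pi}|lborel. ?E v * ?G v \<theta> - ?E (- v) * ?G (- v) \<theta>)"
  proof -
    have "\<i> * z * (I * X * (g_Z r z v - g_Z r z (- v))) = \<i> * z * (I * (X * g_Z r z v)) - \<i> * z * (I * (X * g_Z r z (- v)))" for z I X
      by (simp only: right_diff_distrib mult.assoc)
    then show ?thesis
      unfolding Psi_def Let_def by (simp only: ex) (simp only: mult.assoc mult.left_commute)
  qed
  also have "(LINT \<theta>:{0..2*pi}|lborel. ?E v * ?G v \<theta> - ?E (- v) * ?G (- v) \<theta>) = ?E v * (LINT \<theta>:{0..2*pi}|lborel. ?G v \<theta>) - ?E (- v) * (LINT \<theta>:{0..2*pi}|lborel. ?G (- v) \<theta>)"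
    using i by (simp add: set_integral_diff)
  also have "1 / (2 * of_real pi * \<i>) * \<dots> = of_real (PsiF r \<tau> m v - PsiF r \<tau> m (- v))"
    unfolding hermite_circle(2) PsiF_def by (simp add: field_simps)
  finally show ?thesis .
qed

section \<open>Heat flow and biorthogonality of PhiF and PsiF\<close>

lemma xi_of_diff: "xi_of r (\<tau> + d) v - xi_of r \<tau> u = v - u + 2 * sqrt 2 * r * d"
proof -
  have "r / sqrt 2 = sqrt 2 * r / 2" by (simp add: field_simps)
  then show ?thesis unfolding xi_of_def by (simp only:) (simp add: algebra_simps)
qed

lemma integral_xi_of:
  fixes f :: "real \<Rightarrow> real"
  shows "(\<integral>v. f (xi_of r \<tau> v) \<partial>lborel) = (\<integral>y. f y \<partial>lborel)"
  using lborel_integral_real_affine[of 1 f "r / sqrt 2 * (1 + 4 * \<tau>)"] by (simp add: xi_of_def add.commute)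

text \<open>The tilt exp (- sqrt 2 r v) shifts the centre of the kernel by - 2 sqrt 2 r d, exactly
  matching the displacement of \<open>xi_of\<close> over a time d. In the coordinate
  \<open>xi_of\<close> only \<open>heat_poly_heat\<close> remains.\<close>

lemma PsiF_heat:
  assumes d: "d > 0"
  shows "(\<integral>v. heat_kernel (2 * d) u v * PsiF r (\<tau> + d) m v \<partial>lborel) = PsiF r \<tau> m u"
proof -
  let ?c = "- (sqrt 2 * r)"
  have "heat_kernel (2 * d) u v * PsiF r (\<tau> + d) m v =
     exp (- (sqrt 2 * r * u + 2 * r\<^sup>2 * \<tau>)) * 2 ^ m * (heat_kernel (2 * d) (xi_of r \<tau> u) (xi_of r (\<tau> + d) v) * heat_poly m (2 * \<tau> + 2 * d) (xi_of r (\<tau> + d) v))" for v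
  proof -
    have "heat_kernel (2 * d) u v * exp (?c * v) = exp (?c * u + 2 * r\<^sup>2 * d) * heat_kernel (2 * d) (u + ?c * (2 * d)) v"
      using heat_kernel_mult_exp[of "2 * d" u v ?c] d by (simp add: power_mult_distrib)
    also have "heat_kernel (2 * d) (u + ?c * (2 * d)) v = heat_kernel (2 * d) (xi_of r \<tau> u) (xi_of r (\<tau> + d) v)"
    proof -
      have "u + ?c * (2 * d) - v = xi_of r \<tau> u - xi_of r (\<tau> + d) v" using xi_of_diff[of r \<tau> d v u] by simp
      then show ?thesis by (simp only: heat_kernel_def)
    qed
    finally have 1: "heat_kernel (2 * d) u v * exp (?c * v) = exp (?c * u + 2 * r\<^sup>2 * d) * heat_kernel (2 * d) (xi_of r \<tau> u) (xi_of r (\<tau> + d) v)" .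
    have "heat_kernel (2 * d) u v * PsiF r (\<tau> + d) m v = exp (- (2 * r\<^sup>2 * (\<tau> + d))) * (heat_kernel (2 * d) u v * exp (?c * v)) * (2 ^ m * heat_poly m (2 * \<tau> + 2 * d) (xi_of r (\<tau> + d) v))"
    proof -
      have "exp (- (sqrt 2 * r * v + 2 * r\<^sup>2 * (\<tau> + d))) = exp (- (2 * r\<^sup>2 * (\<tau> + d))) * exp (?c * v)"
        by (simp add: exp_add[symmetric])
      note e1 = this
      have e2: "2 * (\<tau> + d) = 2 * \<tau> + 2 * d" by simp
      show ?thesis unfolding PsiF_def e1 e2 by (simp only: mult_ac)
    qed
    also have "\<dots> = (exp (- (2 * r\<^sup>2 * (\<tau> + d))) * exp (?c * u + 2 * r\<^sup>2 * d)) * 2 ^ m * (heat_kernel (2 * d) (xi_of r \<tau> u) (xi_of r (\<tau> + d) v) * heat_poly m (2 * \<tau> + 2 * d) (xi_of r (\<tau> + d) v))"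
      unfolding 1 by (simp add: mult_ac)
    also have "exp (- (2 * r\<^sup>2 * (\<tau> + d))) * exp (?c * u + 2 * r\<^sup>2 * d) = exp (- (sqrt 2 * r * u + 2 * r\<^sup>2 * \<tau>))"
      by (simp add: exp_add[symmetric] algebra_simps)
    finally show ?thesis .
  qed
  then have "(\<integral>v. heat_kernel (2 * d) u v * PsiF r (\<tau> + d) m v \<partial>lborel) =
     exp (- (sqrt 2 * r * u + 2 * r\<^sup>2 * \<tau>)) * 2 ^ m * (\<integral>v. heat_kernel (2 * d) (xi_of r \<tau> u) (xi_of r (\<tau> + d) v) * heat_poly m (2 * \<tau> + 2 * d) (xi_of r (\<tau> + d) v) \<partial>lborel)"
    by simp
  also have "(\<integral>v. heat_kernel (2 * d) (xi_of r \<tau> u) (xi_of r (\<tau> + d) v) * heat_poly m (2 * \<tau> + 2 * d) (xi_of r (\<tau> + d) v) \<partial>lborel) = heat_poly m (2 * \<tau>) (xi_of r \<tau> u)"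
    using integral_xi_of[of "\<lambda>y. heat_kernel (2 * d) (xi_of r \<tau> u) y * heat_poly m (2 * \<tau> + 2 * d) y"] heat_poly_heat[of "2 * d" "xi_of r \<tau> u" m "2 * \<tau>"] d by simp
  finally show ?thesis unfolding PsiF_def by (simp add: mult_ac)
qed

text \<open>By \<open>Chapman_Kolmogorov_point\<close> the Gaussian weight turns the kernel into
  that of a bridge to 0, centred at l x with l = t / (s + t). Since l^2 (s + t) plus the bridge
  variance equals t, \<open>heat_poly_heat\<close> applies, and scaling yields l^n.\<close>

lemma gauss_heat_poly_heat:
  assumes s: "s > 0" and t: "t > 0"
  shows "(\<integral>y. heat_kernel s x y * (fact n / (2 * t) ^ n * (heat_kernel t 0 y * heat_poly n t y)) \<partial>lborel)
     = fact n / (2 * (s + t)) ^ n * (heat_kernel (s + t) 0 x * heat_poly n (s + t) x)"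
proof -
  let ?l = "t / (s + t)" and ?t = "s * t / (s + t)"
  have l: "?t > 0" "?l\<^sup>2 * (s + t) + ?t = t" using s t
  proof -
    have "?l\<^sup>2 * (s + t) = t * t / (s + t)" using s t by (simp add: power2_eq_square)
    then have "?l\<^sup>2 * (s + t) + ?t = t * (s + t) / (s + t)" by (simp add: add_divide_distrib algebra_simps)
    then show "?l\<^sup>2 * (s + t) + ?t = t" using s t by simp
  qed (use s t in simp)
  have "(\<integral>y. heat_kernel s x y * (fact n / (2 * t) ^ n * (heat_kernel t 0 y * heat_poly n t y)) \<partial>lborel)
     = (\<integral>y. fact n / (2 * t) ^ n * heat_kernel (s + t) 0 x * (heat_kernel ?t (?l * x) y * heat_poly n (?l\<^sup>2 * (s + t) + ?t) y) \<partial>lborel)"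
  proof (rule Bochner_Integration.integral_cong[OF refl])
    fix y
    have "heat_kernel s x y * heat_kernel t y 0 = heat_kernel (s + t) x 0 * heat_kernel ?t (?l * x) y"
      using Chapman_Kolmogorov_point[OF s t, of x y 0] by simp
    note ck = this
    have "heat_kernel s x y * (fact n / (2 * t) ^ n * (heat_kernel t 0 y * heat_poly n t y)) =
      fact n / (2 * t) ^ n * (heat_kernel s x y * heat_kernel t y 0) * heat_poly n t y"
      unfolding heat_kernel_sym[of t 0 y] by (simp only: mult_ac)
    then show "heat_kernel s x y * (fact n / (2 * t) ^ n * (heat_kernel t 0 y * heat_poly n t y)) =
      fact n / (2 * t) ^ n * heat_kernel (s + t) 0 x * (heat_kernel ?t (?l * x) y * heat_poly n (?l\<^sup>2 * (s + t) + ?t) y)"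
      unfolding l(2) ck heat_kernel_sym[of "s + t" 0 x] by (simp only: mult_ac)
  qed
  also have "\<dots> = fact n / (2 * t) ^ n * heat_kernel (s + t) 0 x * heat_poly n (?l\<^sup>2 * (s + t)) (?l * x)"
    by (simp only: integral_mult_right_zero heat_poly_heat[OF l(1)])
  also have "\<dots> = fact n / (2 * (s + t)) ^ n * (heat_kernel (s + t) 0 x * heat_poly n (s + t) x)"
    unfolding heat_poly_scale using s t by (simp add: power_divide power_mult_distrib del: distrib_left_numeral)
  finally show ?thesis .
qed

text \<open>The same kernel transports \<open>PhiF\<close> forward in \<tau> and \<open>PsiF\<close>
  backward; here the tilt has the opposite sign.\<close>

lemma PhiF_heat:
  assumes t: "\<tau> > 0" and d: "d > 0"
  shows "(\<integral>u. heat_kernel (2 * d) v u * PhiF r \<tau> n u \<partial>lborel) = PhiF r (\<tau> + d) n v"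
proof -
  let ?c = "sqrt 2 * r"
  let ?f = "\<lambda>y. fact n / (2 * (2 * \<tau>)) ^ n * (heat_kernel (2 * \<tau>) 0 y * heat_poly n (2 * \<tau>) y)"
  have "heat_kernel (2 * d) v u * PhiF r \<tau> n u =
     exp (sqrt 2 * r * v + 2 * r\<^sup>2 * (\<tau> + d)) * (heat_kernel (2 * d) (xi_of r (\<tau> + d) v) (xi_of r \<tau> u) * ?f (xi_of r \<tau> u))" for u
  proof -
    have "heat_kernel (2 * d) v u * exp (?c * u) = exp (?c * v + 2 * r\<^sup>2 * d) * heat_kernel (2 * d) (v + ?c * (2 * d)) u"
      using heat_kernel_mult_exp[of "2 * d" v u ?c] d by (simp add: power_mult_distrib)
    also have "heat_kernel (2 * d) (v + ?c * (2 * d)) u = heat_kernel (2 * d) (xi_of r (\<tau> + d) v) (xi_of r \<tau> u)"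
    proof -
      have "v + ?c * (2 * d) - u = xi_of r (\<tau> + d) v - xi_of r \<tau> u" using xi_of_diff[of r \<tau> d v u] by simp
      then show ?thesis by (simp only: heat_kernel_def)
    qed
    finally have 1: "heat_kernel (2 * d) v u * exp (?c * u) = exp (?c * v + 2 * r\<^sup>2 * d) * heat_kernel (2 * d) (xi_of r (\<tau> + d) v) (xi_of r \<tau> u)" .
    have "heat_kernel (2 * d) v u * PhiF r \<tau> n u = exp (2 * r\<^sup>2 * \<tau>) * (heat_kernel (2 * d) v u * exp (?c * u)) * ?f (xi_of r \<tau> u)"
      unfolding PhiF_def by (simp add: exp_add)
    also have "\<dots> = (exp (2 * r\<^sup>2 * \<tau>) * exp (?c * v + 2 * r\<^sup>2 * d)) * (heat_kernel (2 * d) (xi_of r (\<tau> + d) v) (xi_of r \<tau> u) * ?f (xi_of r \<tau> u))"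
      unfolding 1 by (simp add: mult_ac)
    also have "exp (2 * r\<^sup>2 * \<tau>) * exp (?c * v + 2 * r\<^sup>2 * d) = exp (sqrt 2 * r * v + 2 * r\<^sup>2 * (\<tau> + d))"
      by (simp add: exp_add[symmetric] algebra_simps)
    finally show ?thesis .
  qed
  then have "(\<integral>u. heat_kernel (2 * d) v u * PhiF r \<tau> n u \<partial>lborel) =
     exp (sqrt 2 * r * v + 2 * r\<^sup>2 * (\<tau> + d)) * (\<integral>u. heat_kernel (2 * d) (xi_of r (\<tau> + d) v) (xi_of r \<tau> u) * ?f (xi_of r \<tau> u) \<partial>lborel)"
    by simp
  also have "\<dots> = exp (sqrt 2 * r * v + 2 * r\<^sup>2 * (\<tau> + d)) * (\<integral>y. heat_kernel (2 * d) (xi_of r (\<tau> + d) v) y * ?f y \<partial>lborel)"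
    using integral_xi_of[of "\<lambda>y. heat_kernel (2 * d) (xi_of r (\<tau> + d) v) y * ?f y"] by simp
  also have "\<dots> = PhiF r (\<tau> + d) n v"
    unfolding PhiF_def using gauss_heat_poly_heat[of "2 * d" "2 * \<tau>" "xi_of r (\<tau> + d) v" n] t d by (simp add: algebra_simps)
  finally show ?thesis .
qed

text \<open>The exponential prefactors are reciprocal, so this is Hermite orthogonality in the
  coordinate \<open>xi_of\<close>. It makes the determinant without barriers equal to 1.\<close>

lemma PhiF_PsiF_orthogonal:
  assumes t: "\<tau> > 0"
  shows "(\<integral>u. PhiF r \<tau> n u * PsiF r \<tau> m u \<partial>lborel) = (if n = m then 1 else 0)"
proof -
  let ?h = "\<lambda>y. heat_kernel (2 * \<tau>) 0 y * (heat_poly n (2 * \<tau>) y * heat_poly m (2 * \<tau>) y)"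
  have "PhiF r \<tau> n u * PsiF r \<tau> m u = (fact n / (4 * \<tau>) ^ n * 2 ^ m) * ?h (xi_of r \<tau> u)" for u
    unfolding PhiF_def PsiF_def exp_minus by (simp add: field_simps)
  then have "(\<integral>u. PhiF r \<tau> n u * PsiF r \<tau> m u \<partial>lborel) = (fact n / (4 * \<tau>) ^ n * 2 ^ m) * (\<integral>u. ?h (xi_of r \<tau> u) \<partial>lborel)"
    by simp
  also have "\<dots> = (fact n / (4 * \<tau>) ^ n * 2 ^ m) * (if n = m then (2 * \<tau>) ^ n / fact n else 0)"
    unfolding integral_xi_of[of ?h] using heat_poly_orthogonal[of "2 * \<tau>" n m] t by simp
  also have "\<dots> = (if n = m then 1 else 0)"
  proof -
    have "(2 * (2 * \<tau>)) ^ n = 2 ^ n * (2 * \<tau>) ^ n" by (rule power_mult_distrib)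
    moreover have "2 * (2 * \<tau>) = 4 * \<tau>" by simp
    ultimately have "(4 * \<tau>) ^ n = 2 ^ n * (2 * \<tau>) ^ n" by (simp only:)
    then show ?thesis using t by simp
  qed
  finally show ?thesis .
qed

section \<open>Continuity, uniform bounds and tails of PhiF and PsiF\<close>

lemma continuous_on_PhiF [continuous_intros]:
  assumes [continuous_intros]: "continuous_on S f" "continuous_on S g" "continuous_on S h" and pos: "\<And>z. z \<in> S \<Longrightarrow> g z > 0"
  shows "continuous_on S (\<lambda>z. PhiF (f z) (g z) n (h z))"
  unfolding PhiF_def xi_of_def heat_kernel_def
  by (intro continuous_intros) (use pos in \<open>force+\<close>)

lemma continuous_on_PsiF [continuous_intros]:
  assumes [continuous_intros]: "continuous_on S f" "continuous_on S g" "continuous_on S h"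
  shows "continuous_on S (\<lambda>z. PsiF (f z) (g z) n (h z))"
  unfolding PsiF_def xi_of_def by (intro continuous_intros) auto

lemma measurable_PhiF [measurable]: "PhiF r \<tau> n \<in> borel_measurable borel"
  unfolding PhiF_def[abs_def] xi_of_def by measurable

lemma measurable_PsiF [measurable]: "PsiF r \<tau> n \<in> borel_measurable borel"
  unfolding PsiF_def[abs_def] xi_of_def by measurable

lemma sqrt2_le_2: "sqrt 2 \<le> 2"
  by (rule real_le_lsqrt) auto

lemma xi_of_abs:
  assumes "\<bar>r\<bar> \<le> R" "0 \<le> \<tau>" "\<tau> \<le> b"
  shows "\<bar>xi_of r \<tau> u - u\<bar> \<le> R * (1 + 4 * b)"
proof -
  have "\<bar>r / sqrt 2\<bar> \<le> \<bar>r\<bar>" by (simp add: divide_le_eq mult_le_cancel_left1)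
  then have "\<bar>r / sqrt 2\<bar> * (1 + 4 * \<tau>) \<le> R * (1 + 4 * b)" using assms by (intro mult_mono) auto
  moreover have "\<bar>xi_of r \<tau> u - u\<bar> = \<bar>r / sqrt 2\<bar> * (1 + 4 * \<tau>)" using assms unfolding xi_of_def by (simp add: abs_mult)
  ultimately show ?thesis by simp
qed

lemma sqrt2_mult_le: "\<bar>r\<bar> \<le> R \<Longrightarrow> sqrt 2 * \<bar>r * u\<bar> \<le> 2 * R * \<bar>u\<bar>"
proof -
  assume "\<bar>r\<bar> \<le> R"
  then have "\<bar>r * u\<bar> \<le> R * \<bar>u\<bar>" by (simp add: abs_mult mult_right_mono)
  then have "sqrt 2 * \<bar>r * u\<bar> \<le> 2 * (R * \<bar>u\<bar>)" using sqrt2_le_2 by (intro mult_mono) auto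
  then show ?thesis by simp
qed

text \<open>Uniform in r as well as in \<tau>, for the limit in which r is approached by lower
  levels. In the rate 2 R + 1, the part 2 R bounds sqrt 2 |r| and the 1 pays for the
  polynomial.\<close>

lemma PsiF_bound:
  assumes "R \<ge> 0"
  shows "\<exists>C\<ge>0. \<forall>r \<tau> v. \<bar>r\<bar> \<le> R \<longrightarrow> 0 \<le> \<tau> \<longrightarrow> \<tau> \<le> b \<longrightarrow> \<bar>PsiF r \<tau> m v\<bar> \<le> C * exp ((2 * R + 1) * \<bar>v\<bar>)"
proof (intro exI[of _ "2 ^ m * fact m * exp (R * (1 + 4 * b) + 2 * b + 1)"] conjI allI impI)
  fix r \<tau> v assume r: "\<bar>r\<bar> \<le> R" and t: "0 \<le> \<tau>" "\<tau> \<le> b"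
  let ?x = "xi_of r \<tau> v"
  have x: "\<bar>?x\<bar> \<le> \<bar>v\<bar> + R * (1 + 4 * b)" using xi_of_abs[OF r t, of v] by linarith
  have "\<bar>heat_poly m (2 * \<tau>) ?x\<bar> \<le> (\<bar>?x\<bar> + \<bar>2 * \<tau>\<bar> + 1) ^ m" by (rule heat_poly_bound)
  also have "\<dots> \<le> fact m * exp (\<bar>?x\<bar> + \<bar>2 * \<tau>\<bar> + 1)" by (rule power_le_fact_exp) simp
  also have "\<dots> \<le> fact m * exp (\<bar>v\<bar> + (R * (1 + 4 * b) + 2 * b + 1))" using x t by (intro mult_left_mono) auto
  finally have h: "\<bar>heat_poly m (2 * \<tau>) ?x\<bar> \<le> fact m * exp (\<bar>v\<bar> + (R * (1 + 4 * b) + 2 * b + 1))" .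
  have "- (sqrt 2 * r * v + 2 * r\<^sup>2 * \<tau>) \<le> 2 * R * \<bar>v\<bar>"
  proof -
    have "- (sqrt 2 * r * v) \<le> sqrt 2 * \<bar>r * v\<bar>" using abs_ge_minus_self[of "r * v"] by (simp add: mult.assoc) (metis abs_ge_minus_self minus_mult_right mult_left_mono real_sqrt_ge_zero zero_le_numeral)
    moreover have "2 * r\<^sup>2 * \<tau> \<ge> 0" using t by simp
    ultimately show ?thesis using sqrt2_mult_le[OF r, of v] by linarith
  qed
  then have e: "exp (- (sqrt 2 * r * v + 2 * r\<^sup>2 * \<tau>)) \<le> exp (2 * R * \<bar>v\<bar>)" by simp
  have "\<bar>PsiF r \<tau> m v\<bar> = exp (- (sqrt 2 * r * v + 2 * r\<^sup>2 * \<tau>)) * (2 ^ m * \<bar>heat_poly m (2 * \<tau>) ?x\<bar>)"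
    unfolding PsiF_def by (simp add: abs_mult)
  also have "\<dots> \<le> exp (2 * R * \<bar>v\<bar>) * (2 ^ m * (fact m * exp (\<bar>v\<bar> + (R * (1 + 4 * b) + 2 * b + 1))))"
    by (intro mult_mono e h mult_left_mono) auto
  also have "\<dots> = 2 ^ m * fact m * exp (R * (1 + 4 * b) + 2 * b + 1) * exp ((2 * R + 1) * \<bar>v\<bar>)"
    by (simp add: exp_add algebra_simps)
  finally show "\<bar>PsiF r \<tau> m v\<bar> \<le> 2 ^ m * fact m * exp (R * (1 + 4 * b) + 2 * b + 1) * exp ((2 * R + 1) * \<bar>v\<bar>)" .
qed simp

lemma linear_minus_square_le: "b > 0 \<Longrightarrow> A * x - x\<^sup>2 / (4 * b) \<le> A\<^sup>2 * (b :: real)"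
proof -
  assume b: "b > 0"
  have "0 \<le> (x - 2 * b * A)\<^sup>2 / (4 * b)" using b by simp
  also have "\<dots> = x\<^sup>2 / (4 * b) - A * x + A\<^sup>2 * b" using b by (simp add: field_simps power2_eq_square)
  finally show ?thesis by simp
qed

lemma PhiF_bound:
  assumes R: "R \<ge> 0" and a: "a > 0" and k: "k \<ge> 0"
  shows "\<exists>C\<ge>0. \<forall>r \<tau> u. \<bar>r\<bar> \<le> R \<longrightarrow> a \<le> \<tau> \<longrightarrow> \<tau> \<le> b \<longrightarrow> \<bar>PhiF r \<tau> n u\<bar> \<le> C * exp (- k * \<bar>u\<bar>)"
proof (intro exI conjI allI impI)
  fix r \<tau> u assume r: "\<bar>r\<bar> \<le> R" and t: "a \<le> \<tau>" "\<tau> \<le> b"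
  \<comment> \<open>\<open>?A\<close> collects the linear rates that the Gaussian has to beat: 2 R
    from the prefactor, k for the desired decay, 1 for the polynomial. \<open>?B\<close> bounds the
    distance between u and \<open>xi_of\<close>.\<close>
  let ?x = "xi_of r \<tau> u" and ?A = "2 * R + k + 1" and ?B = "R * (1 + 4 * b)"
  have b: "b > 0" "\<tau> > 0" using a t by auto
  have x: "\<bar>u\<bar> \<le> \<bar>?x\<bar> + ?B" using xi_of_abs[OF r _ t(2), of u] b by linarith
  have "\<bar>heat_poly n (2 * \<tau>) ?x\<bar> \<le> (\<bar>?x\<bar> + \<bar>2 * \<tau>\<bar> + 1) ^ n" by (rule heat_poly_bound)
  also have "\<dots> \<le> fact n * exp (\<bar>?x\<bar> + \<bar>2 * \<tau>\<bar> + 1)" by (rule power_le_fact_exp) simp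
  also have "\<dots> \<le> fact n * exp (\<bar>?x\<bar> + (2 * b + 1))" using t b by (intro mult_left_mono) auto
  finally have h: "\<bar>heat_poly n (2 * \<tau>) ?x\<bar> \<le> fact n * exp (\<bar>?x\<bar> + (2 * b + 1))" .
  have hk: "heat_kernel (2 * \<tau>) 0 ?x \<le> exp (- ?x\<^sup>2 / (4 * b)) / sqrt (2 * pi * (2 * a))"
  proof -
    have "?x\<^sup>2 / (4 * b) \<le> ?x\<^sup>2 / (4 * \<tau>)" using t b by (intro divide_left_mono) auto
    then show ?thesis unfolding heat_kernel_def using a t by (intro frac_le) auto
  qed
  have e: "exp (sqrt 2 * r * u + 2 * r\<^sup>2 * \<tau>) \<le> exp (2 * R * \<bar>u\<bar> + 2 * R\<^sup>2 * b)"
  proof -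
    have "sqrt 2 * r * u \<le> sqrt 2 * \<bar>r * u\<bar>" unfolding mult.assoc by (intro mult_left_mono) auto
    moreover have "r\<^sup>2 \<le> R\<^sup>2" using r by (simp add: abs_le_square_iff[symmetric])
    then have "2 * r\<^sup>2 * \<tau> \<le> 2 * R\<^sup>2 * b" using t b by (intro mult_mono) auto
    ultimately show ?thesis unfolding exp_le_cancel_iff using sqrt2_mult_le[OF r, of u] by linarith
  qed
  have p: "fact n / (4 * \<tau>) ^ n \<le> (fact n / (4 * a) ^ n :: real)" using a t by (intro divide_left_mono power_mono) auto
  have "\<bar>PhiF r \<tau> n u\<bar> = exp (sqrt 2 * r * u + 2 * r\<^sup>2 * \<tau>) * (fact n / (4 * \<tau>) ^ n * (heat_kernel (2 * \<tau>) 0 ?x * \<bar>heat_poly n (2 * \<tau>) ?x\<bar>))"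
    unfolding PhiF_def using b by (simp add: abs_mult)
  also have "\<dots> \<le> exp (2 * R * \<bar>u\<bar> + 2 * R\<^sup>2 * b) * (fact n / (4 * a) ^ n * (exp (- ?x\<^sup>2 / (4 * b)) / sqrt (2 * pi * (2 * a)) * (fact n * exp (\<bar>?x\<bar> + (2 * b + 1)))))"
    using b a by (intro mult_mono e h hk p mult_nonneg_nonneg divide_nonneg_nonneg) auto
  also have "\<dots> = (fact n / (4 * a) ^ n / sqrt (2 * pi * (2 * a)) * fact n) * exp (2 * R * \<bar>u\<bar> + 2 * R\<^sup>2 * b + - ?x\<^sup>2 / (4 * b) + (\<bar>?x\<bar> + (2 * b + 1)))"
    unfolding exp_add by simp
  also have "\<dots> \<le> (fact n / (4 * a) ^ n / sqrt (2 * pi * (2 * a)) * fact n) * exp ((?A * ?B + 2 * R\<^sup>2 * b + ?A\<^sup>2 * b + 2 * b + 1) + - k * \<bar>u\<bar>)"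
  proof (intro mult_left_mono)
    have "?A * \<bar>?x\<bar> - ?x\<^sup>2 / (4 * b) \<le> ?A\<^sup>2 * b"
      using linear_minus_square_le[OF b(1), of ?A "\<bar>?x\<bar>"] by simp
    moreover have "(2 * R + k) * \<bar>u\<bar> \<le> (2 * R + k) * (\<bar>?x\<bar> + ?B)" using x R k by (intro mult_left_mono) auto
    moreover have "(2 * R + k) * ?B \<le> ?A * ?B" using R b by (intro mult_right_mono) auto
    ultimately have "2 * R * \<bar>u\<bar> + 2 * R\<^sup>2 * b + - ?x\<^sup>2 / (4 * b) + (\<bar>?x\<bar> + (2 * b + 1)) \<le> (?A * ?B + 2 * R\<^sup>2 * b + ?A\<^sup>2 * b + 2 * b + 1) + - k * \<bar>u\<bar>"
      by (simp add: algebra_simps)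
    then show "exp (2 * R * \<bar>u\<bar> + 2 * R\<^sup>2 * b + - ?x\<^sup>2 / (4 * b) + (\<bar>?x\<bar> + (2 * b + 1))) \<le> exp ((?A * ?B + 2 * R\<^sup>2 * b + ?A\<^sup>2 * b + 2 * b + 1) + - k * \<bar>u\<bar>)" by simp
  qed (use a in auto)
  finally show "\<bar>PhiF r \<tau> n u\<bar> \<le> ((fact n / (4 * a) ^ n / sqrt (2 * pi * (2 * a)) * fact n) * exp (?A * ?B + 2 * R\<^sup>2 * b + ?A\<^sup>2 * b + 2 * b + 1)) * exp (- k * \<bar>u\<bar>)"
    unfolding exp_add by (simp add: mult.assoc)
qed (use a in auto)

lemma expbd_PhiF: "\<tau> > 0 \<Longrightarrow> expbd c (PhiF r \<tau> n)"
proof -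
  assume t: "\<tau> > 0"
  obtain C where C: "\<And>u. \<bar>PhiF r \<tau> n u\<bar> \<le> C * exp (- \<bar>c\<bar> * \<bar>u\<bar>)"
    using PhiF_bound[of "\<bar>r\<bar>" \<tau> "\<bar>c\<bar>" \<tau> n] t by (auto simp: )
  have "expbd (- \<bar>c\<bar>) (PhiF r \<tau> n)" by (rule expbdI[OF _ C]) measurable
  then show ?thesis by (rule expbd_mono) simp
qed

lemma expbd_PsiF: "\<tau> \<ge> 0 \<Longrightarrow> expbd (2 * \<bar>r\<bar> + 1) (PsiF r \<tau> m)"
proof -
  assume t: "\<tau> \<ge> 0"
  obtain C where C: "\<And>u. \<bar>PsiF r \<tau> m u\<bar> \<le> C * exp ((2 * \<bar>r\<bar> + 1) * \<bar>u\<bar>)"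
    using PsiF_bound[of "\<bar>r\<bar>" \<tau> m] t by auto
  show ?thesis by (rule expbdI[OF _ C]) measurable
qed


text \<open>At a reflected argument the prefactor exp (sqrt 2 r v - 2 r^2 \<tau>) decays both in
  \<tau> and as v tends to minus infinity; half of the decay in \<tau> pays for the
  polynomial.\<close>

lemma PsiF_tail:
  assumes r: "r > 0"
  shows "\<exists>C\<ge>0. \<forall>\<tau>\<ge>0. \<forall>v\<le>0. \<bar>PsiF r \<tau> m (- v)\<bar> \<le> C * exp (- (r\<^sup>2 * \<tau>))"
proof -
  \<comment> \<open>The polynomial is bounded by an exponential of rate k. The two constraints keep
    its cost in v below sqrt 2 r and its cost in \<tau> below r^2.\<close>
  define k where "k = min (r / 2) (r\<^sup>2 / (4 * r + 2))"
  have k: "k > 0" "k \<le> r / 2" "k * (4 * r + 2) \<le> r\<^sup>2"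
  proof -
    show "k > 0" using r by (auto simp: k_def)
    show "k \<le> r / 2" unfolding k_def by (rule min.cobounded1)
    have "k \<le> r\<^sup>2 / (4 * r + 2)" by (simp add: k_def)
    then show "k * (4 * r + 2) \<le> r\<^sup>2" using r by (subst (asm) pos_le_divide_eq) auto
  qed
  show ?thesis
  proof (intro exI[of _ "2 ^ m * fact m / k ^ m * exp (k * (r + 1))"] conjI allI impI)
    fix \<tau> v :: real assume t: "\<tau> \<ge> 0" and v: "v \<le> 0"
    let ?x = "xi_of r \<tau> (- v)"
    have "r / sqrt 2 \<le> r" using r by (simp add: divide_le_eq mult_le_cancel_left1)
    then have "r / sqrt 2 * (1 + 4 * \<tau>) \<le> r * (1 + 4 * \<tau>)" using t by (intro mult_right_mono) auto
    moreover have "0 \<le> r / sqrt 2 * (1 + 4 * \<tau>)" using r t by simp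
    ultimately have x: "\<bar>?x\<bar> \<le> - v + r * (1 + 4 * \<tau>)" using v unfolding xi_of_def by simp
    have "k ^ m * \<bar>heat_poly m (2 * \<tau>) ?x\<bar> \<le> k ^ m * (\<bar>?x\<bar> + \<bar>2 * \<tau>\<bar> + 1) ^ m" using k by (intro mult_left_mono heat_poly_bound) auto
    also have "\<dots> = (k * (\<bar>?x\<bar> + \<bar>2 * \<tau>\<bar> + 1)) ^ m" by (simp add: power_mult_distrib)
    also have "\<dots> \<le> fact m * exp (k * (\<bar>?x\<bar> + \<bar>2 * \<tau>\<bar> + 1))" using k by (intro power_le_fact_exp) auto
    also have "\<dots> \<le> fact m * exp (k * (- v + r * (1 + 4 * \<tau>) + 2 * \<tau> + 1))"
      using x t k by (intro mult_left_mono) auto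
    finally have h: "\<bar>heat_poly m (2 * \<tau>) ?x\<bar> \<le> fact m / k ^ m * exp (k * (- v + r * (1 + 4 * \<tau>) + 2 * \<tau> + 1))"
      using k by (simp add: field_simps)
    have "\<bar>PsiF r \<tau> m (- v)\<bar> = 2 ^ m * (exp (sqrt 2 * r * v - 2 * r\<^sup>2 * \<tau>) * \<bar>heat_poly m (2 * \<tau>) ?x\<bar>)"
      unfolding PsiF_def by (simp add: abs_mult)
    also have "\<dots> \<le> 2 ^ m * (exp (sqrt 2 * r * v - 2 * r\<^sup>2 * \<tau>) * (fact m / k ^ m * exp (k * (- v + r * (1 + 4 * \<tau>) + 2 * \<tau> + 1))))"
      by (intro mult_left_mono h) auto
    also have "\<dots> = 2 ^ m * fact m / k ^ m * (exp (sqrt 2 * r * v - 2 * r\<^sup>2 * \<tau> + k * (- v + r * (1 + 4 * \<tau>) + 2 * \<tau> + 1)))"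
      unfolding exp_add by simp
    also have "\<dots> \<le> 2 ^ m * fact m / k ^ m * exp (k * (r + 1) + - (r\<^sup>2 * \<tau>))"
    proof -
      have "1 * r \<le> sqrt 2 * r" using r by (intro mult_right_mono) auto
      moreover have "k \<le> 1 * r" using k r by simp
      ultimately have "k - sqrt 2 * r \<le> 0" using order_trans by fastforce
      then have "(k - sqrt 2 * r) * (- v) \<le> 0" using v by (intro mult_nonpos_nonneg) auto
      moreover have "k * (4 * r + 2) * \<tau> \<le> r\<^sup>2 * \<tau>" using k t by (intro mult_right_mono) auto
      ultimately have "sqrt 2 * r * v - 2 * r\<^sup>2 * \<tau> + k * (- v + r * (1 + 4 * \<tau>) + 2 * \<tau> + 1) \<le> k * (r + 1) + - (r\<^sup>2 * \<tau>)"
        by (simp add: algebra_simps)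
      then show ?thesis using k by (intro mult_left_mono) auto
    qed
    finally show "\<bar>PsiF r \<tau> m (- v)\<bar> \<le> 2 ^ m * fact m / k ^ m * exp (k * (r + 1)) * exp (- (r\<^sup>2 * \<tau>))"
      unfolding exp_add by (simp add: mult.assoc)
  qed (use k in auto)
qed

text \<open>For u <= 0 the reflected \<open>xi_of\<close> is at least r / 2, so the Gaussian
  contains a factor exp (- K / \<tau>) that beats every negative power of \<tau>; one power of
  \<tau> is kept as gain.\<close>

lemma PhiF_tail:
  assumes r: "r > 0" and l: "l \<ge> 0"
  shows "\<exists>C\<ge>0. \<forall>\<tau>. 0 < \<tau> \<longrightarrow> \<tau> \<le> 1 \<longrightarrow> (\<forall>u\<le>0. \<bar>PhiF r \<tau> n (- u)\<bar> \<le> C * \<tau> * exp (l * u))"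
proof -
  \<comment> \<open>\<open>A\<close> is the linear rate to be beaten: 2 r from the prefactor, l from
    the weight, 1 from the polynomial. With K = (r / 2)^2 / 8, half of the Gaussian exponent
    supplies exp (- K / \<tau>) and the other half beats \<open>A\<close>.\<close>
  define A where "A = 2 * r + l + 1"
  define K where "K = r\<^sup>2 / 32"
  have K: "K > 0" using r by (simp add: K_def)
  define C where "C = exp (2 * r\<^sup>2 + 3 + 2 * A\<^sup>2) * (fact n * fact n * fact (n + 2) / K ^ (n + 2))"
  show ?thesis
  proof (intro exI[of _ C] conjI allI impI)
    fix \<tau> u :: real assume t: "0 < \<tau>" "\<tau> \<le> 1" and u: "u \<le> 0"
    let ?x = "xi_of r \<tau> (- u)"
    have rs: "r / 2 \<le> r / sqrt 2" using r sqrt2_le_2 by (intro divide_left_mono) auto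
    have "r / 2 * 1 \<le> r / sqrt 2 * (1 + 4 * \<tau>)" using r t rs by (intro mult_mono) auto
    then have x: "- u + r / 2 \<le> ?x" unfolding xi_of_def by simp
    then have x0: "?x \<ge> r / 2" "?x \<ge> - u" "?x > 0" using u r by auto
    have "\<bar>heat_poly n (2 * \<tau>) ?x\<bar> \<le> (\<bar>?x\<bar> + \<bar>2 * \<tau>\<bar> + 1) ^ n" by (rule heat_poly_bound)
    also have "\<dots> \<le> fact n * exp (\<bar>?x\<bar> + \<bar>2 * \<tau>\<bar> + 1)" by (rule power_le_fact_exp) simp
    also have "\<dots> \<le> fact n * exp (?x + 3)" using t x0 by (intro mult_left_mono) auto
    finally have h: "\<bar>heat_poly n (2 * \<tau>) ?x\<bar> \<le> fact n * exp (?x + 3)" .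
    have e: "exp (sqrt 2 * r * (- u) + 2 * r\<^sup>2 * \<tau>) \<le> exp (2 * r * ?x + 2 * r\<^sup>2)"
    proof -
      have "sqrt 2 * r * (- u) \<le> 2 * r * ?x" using sqrt2_le_2 r u x0 by (intro mult_mono) auto
      moreover have "2 * r\<^sup>2 * \<tau> \<le> 2 * r\<^sup>2" using t by (simp add: mult_left_le)
      ultimately show ?thesis by simp
    qed
    have hk: "heat_kernel (2 * \<tau>) 0 ?x \<le> 1 / \<tau> * exp (- ?x\<^sup>2 / (4 * \<tau>))"
    proof -
      have "\<tau> * \<tau> \<le> 2 * pi * (2 * \<tau>)"
      proof -
        have "\<tau> * \<tau> \<le> 1 * \<tau>" using t by (intro mult_right_mono) auto
        also have "\<dots> \<le> (4 * pi) * \<tau>" using t pi_ge_two by (intro mult_right_mono) auto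
        finally show ?thesis by simp
      qed
      then have "\<tau> \<le> sqrt (2 * pi * (2 * \<tau>))" using t by (intro real_le_rsqrt) (simp add: power2_eq_square)
      then show ?thesis unfolding heat_kernel_def using t by (simp add: frac_le)
    qed
    have p: "fact n / (4 * \<tau>) ^ n \<le> (fact n / \<tau> ^ n :: real)" using t by (intro divide_left_mono power_mono) auto
    \<comment> \<open>Of the n + 2 powers, n come from the prefactor, one from the kernel, and one
      is the \<tau> kept in the bound.\<close>
    have q: "1 / \<tau> ^ (n + 2) * exp (- (K / \<tau>)) \<le> fact (n + 2) / K ^ (n + 2)"
    proof -
      have "(K / \<tau>) ^ (n + 2) \<le> fact (n + 2) * exp (K / \<tau>)" using K t by (intro power_le_fact_exp) auto
      then have "(K / \<tau>) ^ (n + 2) * exp (- (K / \<tau>)) \<le> fact (n + 2) * exp (K / \<tau>) * exp (- (K / \<tau>))" by (rule mult_right_mono) simp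
      then have "(K / \<tau>) ^ (n + 2) * exp (- (K / \<tau>)) \<le> fact (n + 2)" by (simp only: mult.assoc exp_minus_inverse mult_1_right)
      moreover have "(K / \<tau>) ^ (n + 2) = K ^ (n + 2) * (1 / \<tau> ^ (n + 2))" by (simp add: power_divide)
      ultimately have "K ^ (n + 2) * (1 / \<tau> ^ (n + 2) * exp (- (K / \<tau>))) \<le> fact (n + 2)" by (simp only: mult.assoc)
      then show ?thesis using K by (simp add: pos_le_divide_eq mult.commute del: power_Suc)
    qed
    have "\<bar>PhiF r \<tau> n (- u)\<bar> = exp (sqrt 2 * r * (- u) + 2 * r\<^sup>2 * \<tau>) * (fact n / (4 * \<tau>) ^ n * (heat_kernel (2 * \<tau>) 0 ?x * \<bar>heat_poly n (2 * \<tau>) ?x\<bar>))"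
      unfolding PhiF_def using t by (simp add: abs_mult)
    also have "\<dots> \<le> exp (2 * r * ?x + 2 * r\<^sup>2) * (fact n / \<tau> ^ n * (1 / \<tau> * exp (- ?x\<^sup>2 / (4 * \<tau>)) * (fact n * exp (?x + 3))))"
      using t by (intro mult_mono e h hk p mult_nonneg_nonneg divide_nonneg_nonneg) auto
    also have "\<dots> = \<tau> * (fact n * fact n) * (1 / \<tau> ^ (n + 2)) * exp (2 * r * ?x + 2 * r\<^sup>2 + - ?x\<^sup>2 / (4 * \<tau>) + (?x + 3))"
      unfolding exp_add using t by (simp add: field_simps)
    also have "\<dots> \<le> \<tau> * (fact n * fact n) * (1 / \<tau> ^ (n + 2)) * exp (l * u + (2 * r\<^sup>2 + 3 + 2 * A\<^sup>2) + - (K / \<tau>))"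
    proof (intro mult_left_mono)
      have 1: "A * ?x - ?x\<^sup>2 / 8 \<le> 2 * A\<^sup>2" using linear_minus_square_le[of 2 A ?x] by simp
      have 2: "l * (- u) \<le> l * ?x" using l x0 by (intro mult_left_mono) auto
      have 3: "?x\<^sup>2 / 8 + K / \<tau> \<le> ?x\<^sup>2 / (4 * \<tau>)"
      proof -
        have "(r / 2)\<^sup>2 \<le> ?x\<^sup>2" using x0 r by (intro power_mono) auto
        then have "K \<le> ?x\<^sup>2 / 8" by (simp add: K_def power_divide)
        moreover have "?x\<^sup>2 / 8 * \<tau> \<le> ?x\<^sup>2 / 8 * 1" using t by (intro mult_left_mono) auto
        ultimately have "?x\<^sup>2 / 8 * \<tau> + K \<le> ?x\<^sup>2 / 4" by linarith
        then have "(?x\<^sup>2 / 8 * \<tau> + K) / \<tau> \<le> (?x\<^sup>2 / 4) / \<tau>" using t by (intro divide_right_mono) auto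
        then show ?thesis using t by (simp add: add_divide_distrib)
      qed
      have "A * ?x = 2 * r * ?x + l * ?x + ?x" by (simp add: A_def algebra_simps)
      with 1 2 3 have "2 * r * ?x + 2 * r\<^sup>2 + - ?x\<^sup>2 / (4 * \<tau>) + (?x + 3) \<le> l * u + (2 * r\<^sup>2 + 3 + 2 * A\<^sup>2) + - (K / \<tau>)"
        by simp
      then show "exp (2 * r * ?x + 2 * r\<^sup>2 + - ?x\<^sup>2 / (4 * \<tau>) + (?x + 3)) \<le> exp (l * u + (2 * r\<^sup>2 + 3 + 2 * A\<^sup>2) + - (K / \<tau>))" by simp
    qed (use t in auto)
    also have "\<dots> = \<tau> * (fact n * fact n) * (exp (l * u) * exp (2 * r\<^sup>2 + 3 + 2 * A\<^sup>2)) * (1 / \<tau> ^ (n + 2) * exp (- (K / \<tau>)))"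
      unfolding exp_add by (simp only: mult_ac)
    also have "\<dots> \<le> \<tau> * (fact n * fact n) * (exp (l * u) * exp (2 * r\<^sup>2 + 3 + 2 * A\<^sup>2)) * (fact (n + 2) / K ^ (n + 2))"
      using t by (intro mult_left_mono q) auto
    also have "\<dots> = C * \<tau> * exp (l * u)" by (simp add: C_def)
    finally show "\<bar>PhiF r \<tau> n (- u)\<bar> \<le> C * \<tau> * exp (l * u)" .
  qed (use K in \<open>simp add: C_def\<close>)
qed

section \<open>Heat flow killed at grid times\<close>

text \<open>Only the arrival point is tested, so for u > 0 the value is that of a chain allowed to
  start above 0. Estimates of iterates therefore restrict to the negative half-line, and pairings
  carry an explicit indicator.\<close>

definition killed_heat :: "real \<Rightarrow> (real \<Rightarrow> real) \<Rightarrow> real \<Rightarrow> real" where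
  "killed_heat d g u = (\<integral>v. heat_kernel d u v * (indicator {..0} v * g v) \<partial>lborel)"

lemma expbd_killed_heat: "expbd c g \<Longrightarrow> d > 0 \<Longrightarrow> expbd c (killed_heat d g)"
  unfolding killed_heat_def[abs_def] by (intro expbd_heat_op expbd_indicator) auto

lemma expbd_killed_heat_pow: "expbd c g \<Longrightarrow> d > 0 \<Longrightarrow> expbd c ((killed_heat d ^^ n) g)"
  by (induction n) (auto intro: expbd_killed_heat)

lemma killed_heat_integrable: "expbd c g \<Longrightarrow> d > 0 \<Longrightarrow> integrable lborel (\<lambda>v. heat_kernel d u v * (indicator {..0} v * g v))"
  by (rule expbd_heat_integrable[OF expbd_indicator]) auto

lemma killed_heat_add:
  assumes "expbd c f" "expbd c g" "d > 0"
  shows "killed_heat d (\<lambda>x. f x + g x) = (\<lambda>u. killed_heat d f u + killed_heat d g u)"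
  unfolding killed_heat_def using killed_heat_integrable[OF assms(1,3)] killed_heat_integrable[OF assms(2,3)]
  by (auto simp: distrib_left)

lemma killed_heat_pow_add:
  assumes "expbd c f" "expbd c g" "d > 0"
  shows "(killed_heat d ^^ n) (\<lambda>x. f x + g x) = (\<lambda>u. (killed_heat d ^^ n) f u + (killed_heat d ^^ n) g u)"
proof (induction n)
  case (Suc n)
  then show ?case using killed_heat_add[OF expbd_killed_heat_pow[OF assms(1,3)] expbd_killed_heat_pow[OF assms(2,3)] assms(3)] by simp
qed simp

text \<open>The weight is exp (l y) rather than exp (l |y|) because its Gaussian integral is exact:
  a step costs exp (l^2 d / 2), hence steps of total length S cost exp (l^2 S / 2) however fine the
  grid. The bound for |y| would lose a factor 2 per step.\<close>

lemma killed_heat_bound: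
  assumes g: "expbd c g" and d: "d > 0" and b: "\<And>y. y \<le> 0 \<Longrightarrow> \<bar>g y\<bar> \<le> D * exp (l * y)" and D: "D \<ge> 0"
  shows "\<bar>killed_heat d g x\<bar> \<le> D * exp (l\<^sup>2 * d / 2) * exp (l * x)"
proof -
  have "\<bar>killed_heat d g x\<bar> \<le> (\<integral>v. \<bar>heat_kernel d x v * (indicator {..0} v * g v)\<bar> \<partial>lborel)"
    unfolding killed_heat_def using integral_norm_bound[of lborel "\<lambda>v. heat_kernel d x v * (indicator {..0} v * g v)"] by simp
  also have "\<dots> \<le> (\<integral>v. D * (heat_kernel d x v * exp (l * v)) \<partial>lborel)"
  proof (rule integral_mono)
    show "integrable lborel (\<lambda>v. \<bar>heat_kernel d x v * (indicator {..0} v * g v)\<bar>)" using killed_heat_integrable[OF g d] by auto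
    show "integrable lborel (\<lambda>v. D * (heat_kernel d x v * exp (l * v)))"
      using has_bochner_integral_heat_kernel_exp[OF d, of x l] by (simp add: has_bochner_integral_iff)
    show "\<bar>heat_kernel d x v * (indicator {..0} v * g v)\<bar> \<le> D * (heat_kernel d x v * exp (l * v))" for v
      using mult_left_mono[OF b[of v], of "heat_kernel d x v"] d D
      by (auto simp: indicator_def abs_mult algebra_simps)
  qed
  also have "\<dots> = D * exp (l\<^sup>2 * d / 2) * exp (l * x)"
    using has_bochner_integral_integral_eq[OF has_bochner_integral_heat_kernel_exp[OF d, of x l]] by (simp add: exp_add)
  finally show ?thesis .
qed

lemma killed_heat_pow_bound:
  assumes g: "expbd c g" and d: "d > 0" and b: "\<And>y. y \<le> 0 \<Longrightarrow> \<bar>g y\<bar> \<le> D * exp (l * y)" and D: "D \<ge> 0" and x: "x \<le> 0"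
  shows "\<bar>(killed_heat d ^^ n) g x\<bar> \<le> D * exp (l\<^sup>2 * (real n * d) / 2) * exp (l * x)"
  using x
proof (induction n arbitrary: x)
  case (Suc n)
  have "\<bar>killed_heat d ((killed_heat d ^^ n) g) x\<bar> \<le> D * exp (l\<^sup>2 * (real n * d) / 2) * exp (l\<^sup>2 * d / 2) * exp (l * x)"
    using Suc.IH D by (intro killed_heat_bound[OF expbd_killed_heat_pow[OF g d] d]) auto
  also have "\<dots> = D * exp (l\<^sup>2 * (real (Suc n) * d) / 2) * exp (l * x)"
    by (simp add: exp_add[symmetric] algebra_simps add_divide_distrib)
  finally show ?case by simp
qed (use b in auto)

lemma heat_kernel_scale: "d > 0 \<Longrightarrow> sqrt d * heat_kernel d x (x + sqrt d * w) = heat_kernel 1 0 w"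
  unfolding heat_kernel_def by (simp add: power_mult_distrib real_sqrt_mult field_simps)

text \<open>Brownian scaling y = x + sqrt d w produces d^2; the exponential weight is dominated by
  its value at d = S.\<close>

lemma overshoot_bound:
  assumes S: "S > 0" and c: "c \<ge> 0"
  shows "\<exists>M\<ge>0. \<forall>d x. 0 < d \<longrightarrow> d \<le> S \<longrightarrow>
     integrable lborel (\<lambda>y. heat_kernel d x y * ((y - x) ^ 4 * exp (c * \<bar>y - x\<bar>))) \<and>
     (\<integral>y. heat_kernel d x y * ((y - x) ^ 4 * exp (c * \<bar>y - x\<bar>)) \<partial>lborel) \<le> M * d\<^sup>2"
proof (intro exI conjI allI impI)
  let ?g = "\<lambda>w::real. w ^ 4 * exp (c * sqrt S * \<bar>w\<bar>)"
  let ?M = "\<integral>w. heat_kernel 1 0 w * ?g w \<partial>lborel"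
  show "0 \<le> ?M" by (intro integral_nonneg_AE AE_I2) auto
  have eg: "expbd (1 + c * sqrt S) ?g"
  proof (rule expbdI[where C="fact 4"])
    fix w :: real
    have "\<bar>w ^ 4\<bar> \<le> fact 4 * exp \<bar>w\<bar>" using power_le_fact_exp[of "\<bar>w\<bar>" 4] by (simp add: power_abs)
    then have "\<bar>w ^ 4\<bar> * exp (c * sqrt S * \<bar>w\<bar>) \<le> fact 4 * exp \<bar>w\<bar> * exp (c * sqrt S * \<bar>w\<bar>)" by (rule mult_right_mono) simp
    also have "\<dots> = fact 4 * exp ((1 + c * sqrt S) * \<bar>w\<bar>)" by (simp only: exp_add[symmetric] mult.assoc) (simp add: algebra_simps)
    finally show "\<bar>?g w\<bar> \<le> fact 4 * exp ((1 + c * sqrt S) * \<bar>w\<bar>)" by (simp only: abs_mult abs_exp_cancel)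
  qed measurable
  have i1: "integrable lborel (\<lambda>w. heat_kernel 1 0 w * ?g w)" by (rule expbd_heat_integrable[OF eg]) simp
  fix d x :: real assume d: "0 < d" "d \<le> S"
  let ?f = "\<lambda>y. heat_kernel d x y * ((y - x) ^ 4 * exp (c * \<bar>y - x\<bar>))"
  have sc: "sqrt d * ?f (x + sqrt d * w) = d\<^sup>2 * (heat_kernel 1 0 w * (w ^ 4 * exp (c * sqrt d * \<bar>w\<bar>)))" for w
  proof -
    have "sqrt d ^ 4 = d\<^sup>2" using d by (simp add: power4_eq_xxxx power2_eq_square)
    then show ?thesis unfolding heat_kernel_scale[OF d(1), symmetric, of w x] using d
      by (simp add: power_mult_distrib abs_mult mult_ac)
  qed
  have le: "heat_kernel 1 0 w * (w ^ 4 * exp (c * sqrt d * \<bar>w\<bar>)) \<le> heat_kernel 1 0 w * ?g w" for w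
    using d c by (intro mult_left_mono) (auto intro!: mult_right_mono mult_left_mono)
  have i2: "integrable lborel (\<lambda>w. heat_kernel 1 0 w * (w ^ 4 * exp (c * sqrt d * \<bar>w\<bar>)))"
    by (rule Bochner_Integration.integrable_bound[OF i1]) (use le in \<open>auto simp: abs_mult\<close>)
  have "integrable lborel (\<lambda>w. ?f (x + sqrt d * w))"
  proof -
    have "integrable lborel (\<lambda>w. (1 / sqrt d) * (d\<^sup>2 * (heat_kernel 1 0 w * (w ^ 4 * exp (c * sqrt d * \<bar>w\<bar>)))))"
      using i2 by simp
    then show ?thesis unfolding sc[symmetric] using d by simp
  qed
  then show "integrable lborel ?f" using d by (subst (asm) lborel_integrable_real_affine_iff) auto
  have "(\<integral>y. ?f y \<partial>lborel) = (\<integral>w. sqrt d * ?f (x + sqrt d * w) \<partial>lborel)"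
    using lborel_integral_real_affine[of "sqrt d" ?f x] d by simp
  also have "\<dots> = d\<^sup>2 * (\<integral>w. heat_kernel 1 0 w * (w ^ 4 * exp (c * sqrt d * \<bar>w\<bar>)) \<partial>lborel)"
    unfolding sc by simp
  also have "\<dots> \<le> d\<^sup>2 * ?M" by (intro mult_left_mono integral_mono[OF i2 i1] le) auto
  finally show "(\<integral>y. ?f y \<partial>lborel) \<le> ?M * d\<^sup>2" by (simp add: mult.commute)
qed

text \<open>The restriction of an odd solution to the negative axis solves the killed equation. Against the discrete
  flow, the error of one step is the mass of f above 0: close to 0 it is small because f vanishes at 0, and
  elsewhere it is controlled by the fourth moment of the overshoot, which is of order d^2 and hence
  negligible over S / d steps. To keep the first contribution from accumulating, it is absorbed in the
  inductive bound, extended to the whole line as a multiple of exp (l x).\<close>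

lemma killed_limit:
  fixes f :: "real \<Rightarrow> real \<Rightarrow> real"
  assumes S: "S > 0" and l: "l \<ge> 0" and c: "c \<ge> 0" and C: "C \<ge> 0" and eps: "eps > 0"
    and odd: "\<And>s x. 0 \<le> s \<Longrightarrow> s \<le> S \<Longrightarrow> f s (- x) = - f s x"
    and cont: "continuous_on ({0..S} \<times> UNIV) (\<lambda>(s, x). f s x)"
    and bd: "\<And>s x. 0 \<le> s \<Longrightarrow> s \<le> S \<Longrightarrow> \<bar>f s x\<bar> \<le> C * exp (c * \<bar>x\<bar>)"
    and heat: "\<And>s s' x. 0 \<le> s \<Longrightarrow> s < s' \<Longrightarrow> s' \<le> S \<Longrightarrow> f s x = (\<integral>y. heat_kernel (s' - s) x y * f s' y \<partial>lborel)"
  shows "\<forall>\<^sub>F n in sequentially. \<forall>x\<le>0. \<bar>(killed_heat (S / real n) ^^ n) (f S) x - f 0 x\<bar> \<le> eps * exp (l * x)"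
proof -
  \<comment> \<open>The factor 2 is for two error terms, and exp (l^2 S / 2) is the growth of the
    weight over all steps.\<close>
  define \<delta> where "\<delta> = eps / (2 * exp (l\<^sup>2 * S / 2))"
  have \<delta>: "\<delta> > 0" using eps by (simp add: \<delta>_def)
  have meas: "f s \<in> borel_measurable borel" if "0 \<le> s" "s \<le> S" for s
  proof (rule borel_measurable_continuous_onI)
    have "continuous_on UNIV (\<lambda>x. case (s, x) of (s, x) \<Rightarrow> f s x)"
      by (rule continuous_on_compose2[OF cont]) (use that in \<open>auto intro!: continuous_intros\<close>)
    then show "continuous_on UNIV (f s)" by simp
  qed
  have ef: "expbd c (f s)" if "0 \<le> s" "s \<le> S" for s using meas[OF that] bd[OF that] by (intro expbdI) auto
  have f0: "f s 0 = 0" if "0 \<le> s" "s \<le> S" for s using odd[OF that, of 0] by simp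
  \<comment> \<open>Since f vanishes at 0, uniform continuity on a compact strip makes it small near
    0 uniformly in time.\<close>
  obtain \<eta> where \<eta>: "\<eta> > 0" "\<And>s y. 0 \<le> s \<Longrightarrow> s \<le> S \<Longrightarrow> 0 < y \<Longrightarrow> y < \<eta> \<Longrightarrow> \<bar>f s y\<bar> \<le> \<delta>"
  proof -
    have "uniformly_continuous_on ({0..S} \<times> {0..1}) (\<lambda>(s, x). f s x)"
      by (intro compact_uniformly_continuous continuous_on_subset[OF cont] compact_Times) auto
    then obtain e where e: "e > 0" "\<And>p q. p \<in> {0..S} \<times> {0..1} \<Longrightarrow> q \<in> {0..S} \<times> {0..1} \<Longrightarrow> dist q p < e \<Longrightarrow>
        dist (case q of (s, x) \<Rightarrow> f s x) (case p of (s, x) \<Rightarrow> f s x) < \<delta>"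
      using \<delta> unfolding uniformly_continuous_on_def by meson
    show ?thesis
    proof (rule that[of "min e 1"])
      fix s y assume "0 \<le> s" "s \<le> S" "0 < y" "y < min e 1"
      then show "\<bar>f s y\<bar> \<le> \<delta>" using e(2)[of "(s, 0)" "(s, y)"] f0[of s] by (simp add: dist_Pair_Pair dist_real_def)
    qed (use e in auto)
  qed
  \<comment> \<open>As in Markov's inequality: beyond \<eta> the factor (y / \<eta>)^4 is at least
    1.\<close>
  define K where "K = C / \<eta> ^ 4"
  have K: "K \<ge> 0" using C \<eta> by (simp add: K_def)
  have pos: "\<bar>f s y\<bar> \<le> \<delta> * exp (l * y) + K * (y ^ 4 * exp (c * y))" if s: "0 \<le> s" "s \<le> S" and y: "y > 0" for s y
  proof (cases "y < \<eta>")
    case True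
    have "\<bar>f s y\<bar> \<le> \<delta> * 1" using \<eta>(2)[OF s y True] by simp
    also have "\<dots> \<le> \<delta> * exp (l * y)" using \<delta> l y by (intro mult_left_mono) auto
    finally show ?thesis using K y by (simp add: add_increasing2)
  next
    case False
    have "\<bar>f s y\<bar> \<le> C * exp (c * y)" using bd[OF s, of y] y by simp
    also have "\<dots> = K * (\<eta> ^ 4 * exp (c * y))" using \<eta> by (simp add: K_def)
    also have "\<dots> \<le> K * (y ^ 4 * exp (c * y))" using False K \<eta> by (intro mult_left_mono mult_right_mono power_mono) auto
    finally show ?thesis using \<delta> by (simp add: add_increasing)
  qed
  have cl: "0 \<le> c + l" using c l by simp
  let ?mom = "\<lambda>d x y. heat_kernel d x y * ((y - x) ^ 4 * exp ((c + l) * \<bar>y - x\<bar>))"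
  from overshoot_bound[OF S cl] obtain M where M0: "M \<ge> 0 \<and> (\<forall>d x. 0 < d \<longrightarrow> d \<le> S \<longrightarrow>
      integrable lborel (?mom d x) \<and> (\<integral>y. ?mom d x y \<partial>lborel) \<le> M * d\<^sup>2)" by (rule exE)
  have M: "M \<ge> 0" "\<And>d x. 0 < d \<Longrightarrow> d \<le> S \<Longrightarrow> integrable lborel (?mom d x)"
     "\<And>d x. 0 < d \<Longrightarrow> d \<le> S \<Longrightarrow> (\<integral>y. ?mom d x y \<partial>lborel) \<le> M * d\<^sup>2"
    using M0 by blast+
  have main: "\<bar>(killed_heat d ^^ j) (f S) x - f (S - real j * d) x\<bar> \<le> (\<delta> + real j * (K * M * d\<^sup>2)) * exp (l\<^sup>2 * (real j * d) / 2) * exp (l * x)"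
    if d: "0 < d" "d \<le> S" and j: "real j * d \<le> S" and x: "x \<le> 0" for d j x
    using j x
  proof (induction j arbitrary: x)
    case 0
    then show ?case using \<delta> by simp
  next
    case (Suc j)
    let ?g = "(killed_heat d ^^ j) (f S)" and ?s = "S - real j * d" and ?A = "(\<delta> + real j * (K * M * d\<^sup>2)) * exp (l\<^sup>2 * (real j * d) / 2)"
    have jd: "real j * d + d \<le> S" using Suc.prems(1) by (simp add: algebra_simps)
    have s: "0 \<le> ?s" "?s \<le> S" "0 \<le> ?s - d" using jd d by auto
    have \<delta>A: "\<delta> \<le> ?A"
    proof -
      have "\<delta> * 1 \<le> (\<delta> + real j * (K * M * d\<^sup>2)) * exp (l\<^sup>2 * (real j * d) / 2)"
        using \<delta> K M d by (intro mult_mono) auto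
      then show ?thesis by simp
    qed
    have eg: "expbd c ?g" using d S by (intro expbd_killed_heat_pow ef) auto
    let ?p = "heat_kernel d x"
    have hf: "f (?s - d) x = (\<integral>y. ?p y * f ?s y \<partial>lborel)" using heat[of "?s - d" ?s x] s d by simp
    have i1: "integrable lborel (\<lambda>y. ?p y * f ?s y)" by (rule expbd_heat_integrable[OF ef d(1)]) (use s in auto)
    have i2: "integrable lborel (\<lambda>y. ?p y * (indicator {..0} y * ?g y))" by (rule killed_heat_integrable[OF eg d(1)])
    have eq: "killed_heat d ?g x - f (?s - d) x = (\<integral>y. ?p y * (indicator {..0} y * ?g y) - ?p y * f ?s y \<partial>lborel)"
      unfolding killed_heat_def[of d ?g x] hf using i1 i2 by simp
    have ie: "integrable lborel (\<lambda>y. ?A * (?p y * exp (l * y)))"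
      using has_bochner_integral_heat_kernel_exp[OF d(1), of x l] by (simp add: has_bochner_integral_iff)
    have im: "integrable lborel (\<lambda>y. (K * exp (l * x)) * (?p y * ((y - x) ^ 4 * exp ((c + l) * \<bar>y - x\<bar>))))"
      using M(2)[OF d, of x] by simp
    have "\<bar>killed_heat d ?g x - f (?s - d) x\<bar> \<le> (\<integral>y. \<bar>?p y * (indicator {..0} y * ?g y) - ?p y * f ?s y\<bar> \<partial>lborel)"
      unfolding eq using integral_norm_bound[of lborel "\<lambda>y. ?p y * (indicator {..0} y * ?g y) - ?p y * f ?s y"] by simp
    also have "\<dots> \<le> (\<integral>y. ?A * (?p y * exp (l * y)) + (K * exp (l * x)) * (?p y * ((y - x) ^ 4 * exp ((c + l) * \<bar>y - x\<bar>))) \<partial>lborel)"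
    proof (rule integral_mono)
      show "integrable lborel (\<lambda>y. \<bar>?p y * (indicator {..0} y * ?g y) - ?p y * f ?s y\<bar>)" using i1 i2 by auto
      show "integrable lborel (\<lambda>y. ?A * (?p y * exp (l * y)) + (K * exp (l * x)) * (?p y * ((y - x) ^ 4 * exp ((c + l) * \<bar>y - x\<bar>))))"
        by (rule Bochner_Integration.integrable_add[OF ie im])
      fix y
      have p0: "0 \<le> ?p y" using d by simp
      show "\<bar>?p y * (indicator {..0} y * ?g y) - ?p y * f ?s y\<bar> \<le> ?A * (?p y * exp (l * y)) + (K * exp (l * x)) * (?p y * ((y - x) ^ 4 * exp ((c + l) * \<bar>y - x\<bar>)))"
      proof (cases "y \<le> 0")
        case True
        have "\<bar>?g y - f ?s y\<bar> \<le> ?A * exp (l * y)" using Suc.IH[of y] jd d True by simp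
        then have "?p y * \<bar>?g y - f ?s y\<bar> \<le> ?p y * (?A * exp (l * y))" using p0 by (rule mult_left_mono)
        moreover have "\<bar>?p y * (indicator {..0} y * ?g y) - ?p y * f ?s y\<bar> = ?p y * \<bar>?g y - f ?s y\<bar>"
        proof -
          have "?p y * (indicator {..0} y * ?g y) - ?p y * f ?s y = ?p y * (?g y - f ?s y)" using True by (simp add: right_diff_distrib)
          then show ?thesis using p0 by (simp only: abs_mult abs_of_nonneg)
        qed
        moreover have "0 \<le> (K * exp (l * x)) * (?p y * ((y - x) ^ 4 * exp ((c + l) * \<bar>y - x\<bar>)))" using K p0 by simp
        ultimately show ?thesis by (simp only: mult.left_commute[of "?p y"])
      next
        case False
        then have y: "y > 0" by simp
        \<comment> \<open>As x <= 0 < y, the overshoot y is at most the increment y - x. The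
          enlarged rate c + l frees a factor exp (l x), which keeps this error within the
          weight.\<close>
        have "y ^ 4 * exp (c * y) \<le> (y - x) ^ 4 * (exp ((c + l) * \<bar>y - x\<bar>) * exp (l * x))"
        proof (intro mult_mono power_mono)
          have "c * x \<le> 0" "0 \<le> l * y" using c l y Suc.prems(2) by (auto intro: mult_nonneg_nonpos)
          then have "c * y \<le> (c + l) * (y - x) + l * x" by (simp add: algebra_simps)
          then show "exp (c * y) \<le> exp ((c + l) * \<bar>y - x\<bar>) * exp (l * x)"
            using y Suc.prems(2) by (simp add: exp_add[symmetric])
        qed (use y Suc.prems(2) in auto)
        then have "K * (y ^ 4 * exp (c * y)) \<le> K * ((y - x) ^ 4 * (exp ((c + l) * \<bar>y - x\<bar>) * exp (l * x)))"
          using K by (rule mult_left_mono)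
        moreover have "\<delta> * exp (l * y) \<le> ?A * exp (l * y)" using \<delta>A by (intro mult_right_mono) auto
        ultimately have "\<bar>f ?s y\<bar> \<le> ?A * exp (l * y) + K * ((y - x) ^ 4 * (exp ((c + l) * \<bar>y - x\<bar>) * exp (l * x)))"
          using pos[OF s(1,2) y] by linarith
        then have "?p y * \<bar>f ?s y\<bar> \<le> ?p y * (?A * exp (l * y) + K * ((y - x) ^ 4 * (exp ((c + l) * \<bar>y - x\<bar>) * exp (l * x))))"
          using p0 by (rule mult_left_mono)
        also have "\<dots> = ?A * (?p y * exp (l * y)) + (K * exp (l * x)) * (?p y * ((y - x) ^ 4 * exp ((c + l) * \<bar>y - x\<bar>)))"
          by (simp only: distrib_left mult_ac)
        finally show ?thesis using False p0 by (simp add: abs_mult)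
      qed
    qed
    also have "\<dots> = ?A * exp (l * x + l\<^sup>2 * d / 2) + (K * exp (l * x)) * (\<integral>y. ?p y * ((y - x) ^ 4 * exp ((c + l) * \<bar>y - x\<bar>)) \<partial>lborel)"
      using has_bochner_integral_integral_eq[OF has_bochner_integral_heat_kernel_exp[OF d(1), of x l]]
      by (simp only: Bochner_Integration.integral_add[OF ie im] integral_mult_right_zero)
    also have "\<dots> \<le> ?A * exp (l * x + l\<^sup>2 * d / 2) + (K * exp (l * x)) * (M * d\<^sup>2)"
      using K by (intro add_left_mono mult_left_mono M(3) d) auto
    also have "\<dots> = (?A * exp (l\<^sup>2 * d / 2) + K * M * d\<^sup>2 * 1) * exp (l * x)"
      by (simp add: exp_add algebra_simps)
    also have "\<dots> \<le> (?A * exp (l\<^sup>2 * d / 2) + K * M * d\<^sup>2 * exp (l\<^sup>2 * (real (Suc j) * d) / 2)) * exp (l * x)"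
      using K M d by (intro mult_right_mono add_mono mult_left_mono) auto
    also have "?A * exp (l\<^sup>2 * d / 2) = (\<delta> + real j * (K * M * d\<^sup>2)) * exp (l\<^sup>2 * (real (Suc j) * d) / 2)"
      by (simp add: mult.assoc exp_add[symmetric] algebra_simps add_divide_distrib)
    also have "(\<delta> + real j * (K * M * d\<^sup>2)) * exp (l\<^sup>2 * (real (Suc j) * d) / 2) + K * M * d\<^sup>2 * exp (l\<^sup>2 * (real (Suc j) * d) / 2)
      = (\<delta> + real (Suc j) * (K * M * d\<^sup>2)) * exp (l\<^sup>2 * (real (Suc j) * d) / 2)"
      by (simp add: algebra_simps)
    finally show ?case using d by (simp add: algebra_simps)
  qed
  \<comment> \<open>Each of the n steps contributes K M (S / n)^2.\<close>
  have "(\<lambda>n. K * M * S\<^sup>2 / real n) \<longlonglongrightarrow> 0" by real_asymp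
  then have "\<forall>\<^sub>F n in sequentially. K * M * S\<^sup>2 / real n < \<delta>" using \<delta> by (rule order_tendstoD)
  then show ?thesis using eventually_gt_at_top[of 0]
  proof eventually_elim
    case (elim n)
    show ?case
    proof (intro allI impI)
      fix x :: real assume x: "x \<le> 0"
      have n: "real n \<ge> 1" using elim by simp
      have dd: "0 < S / real n" "S / real n \<le> S" "real n * (S / real n) \<le> S" "real n * (S / real n) = S"
        using S n by (auto simp: field_simps)
      have "\<bar>(killed_heat (S / real n) ^^ n) (f S) x - f (S - real n * (S / real n)) x\<bar> \<le> (\<delta> + real n * (K * M * (S / real n)\<^sup>2)) * exp (l\<^sup>2 * (real n * (S / real n)) / 2) * exp (l * x)"
        by (rule main[OF dd(1,2,3) x])
      also have "real n * (K * M * (S / real n)\<^sup>2) = K * M * S\<^sup>2 / real n" using n by (simp add: power2_eq_square field_simps)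
      also have "(\<delta> + K * M * S\<^sup>2 / real n) * exp (l\<^sup>2 * (real n * (S / real n)) / 2) * exp (l * x) \<le> (2 * \<delta>) * exp (l\<^sup>2 * S / 2) * exp (l * x)"
        unfolding dd(4) using elim by (intro mult_right_mono) auto
      also have "(2 * \<delta>) * exp (l\<^sup>2 * S / 2) = eps" by (simp add: \<delta>_def)
      finally show "\<bar>(killed_heat (S / real n) ^^ n) (f S) x - f 0 x\<bar> \<le> eps * exp (l * x)" unfolding dd(4) by simp
    qed
  qed
qed


section \<open>The end data under the flow killed at 0\<close>

lemma heat_kernel_integral_reflect:
  "(\<integral>y. heat_kernel t x y * g (- y) \<partial>lborel) = (\<integral>y. heat_kernel t (- x) y * (g y :: real) \<partial>lborel)"
  using lborel_integral_real_affine[of "-1" "\<lambda>y. heat_kernel t x y * g (- y)" 0] heat_kernel_neg[of t "- x"] by simp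

text \<open>\<open>PhiF\<close> at t0 is its odd part plus its reflection. The odd part is the case
  of \<open>killed_limit\<close>; the reflection is of order t0 in the weight exp (l u), and the
  killed flow enlarges it by at most exp (l^2 t1). Hence t0 is fixed before the number of
  steps.\<close>

lemma killed_Phi:
  assumes r: "r > 0" and t1: "t1 > 0" and l: "l \<ge> 0" and eps: "eps > 0"
  shows "\<forall>\<^sub>F t0 in at_right 0. \<forall>\<^sub>F k in sequentially. \<forall>u\<le>0.
    \<bar>(killed_heat (2 * (t1 - t0) / real k) ^^ k) (PhiF r t0 n) u - (PhiF r t1 n u - PhiF r t1 n (- u))\<bar> \<le> eps * exp (l * u)"
proof -
  obtain C where C: "C \<ge> 0" "\<And>\<tau> u. 0 < \<tau> \<Longrightarrow> \<tau> \<le> 1 \<Longrightarrow> u \<le> 0 \<Longrightarrow> \<bar>PhiF r \<tau> n (- u)\<bar> \<le> C * \<tau> * exp (l * u)"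
    using PhiF_tail[OF r l, of n] by blast
  have "((\<lambda>t0. C * t0 * exp (l\<^sup>2 * t1)) \<longlongrightarrow> C * 0 * exp (l\<^sup>2 * t1)) (at_right 0)" by (intro tendsto_intros)
  then have "\<forall>\<^sub>F t0 in at_right 0. C * t0 * exp (l\<^sup>2 * t1) < eps / 2" by (rule order_tendstoD) (use eps in simp)
  moreover have "\<forall>\<^sub>F t0 in at_right 0. t0 \<in> {0<..<min 1 t1}" by (rule eventually_at_right_real) (use t1 in auto)
  ultimately show ?thesis
  proof eventually_elim
    case (elim t0)
    then have t0: "0 < t0" "t0 < t1" "t0 \<le> 1" by auto
    define S where "S = 2 * (t1 - t0)"
    have S: "S > 0" using t0 by (simp add: S_def)
    \<comment> \<open>Time is reversed: s = 0 is \<tau> = t1 and s = S is \<tau> = t0, since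
      \<open>killed_limit\<close> carries data at S to time 0.\<close>
    let ?f = "\<lambda>s x. PhiF r (t1 - s / 2) n x - PhiF r (t1 - s / 2) n (- x)"
    obtain D where D: "D \<ge> 0" "\<And>\<tau> u. t0 \<le> \<tau> \<Longrightarrow> \<tau> \<le> t1 \<Longrightarrow> \<bar>PhiF r \<tau> n u\<bar> \<le> D"
      using PhiF_bound[of r t0 0 t1 n] r t0 by (auto simp: )
    have "\<forall>\<^sub>F k in sequentially. \<forall>u\<le>0. \<bar>(killed_heat (S / real k) ^^ k) (?f S) u - ?f 0 u\<bar> \<le> eps / 2 * exp (l * u)"
    proof (rule killed_limit[OF S l, of 0 "2 * D"])
      show "continuous_on ({0..S} \<times> UNIV) (\<lambda>(s, x). ?f s x)"
        unfolding case_prod_beta by (intro continuous_intros) (use t0 in \<open>auto simp: S_def\<close>)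
    next
      fix s x :: real assume s: "0 \<le> s" "s \<le> S"
      show "?f s (- x) = - ?f s x" by simp
      have "\<bar>PhiF r (t1 - s / 2) n x\<bar> \<le> D" "\<bar>PhiF r (t1 - s / 2) n (- x)\<bar> \<le> D"
        using s by (auto intro!: D(2) simp: S_def)
      then show "\<bar>?f s x\<bar> \<le> 2 * D * exp (0 * \<bar>x\<bar>)" by simp
    next
      fix s s' x :: real assume s: "0 \<le> s" "s < s'" "s' \<le> S"
      let ?t = "t1 - s' / 2" and ?d = "(s' - s) / 2"
      have t: "?t > 0" "?d > 0" "?t + ?d = t1 - s / 2" "2 * ?d = s' - s" using s t0 by (auto simp: S_def field_simps)
      have h: "(\<integral>y. heat_kernel (s' - s) x y * PhiF r ?t n y \<partial>lborel) = PhiF r (t1 - s / 2) n x" for x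
        using PhiF_heat[OF t(1,2), of x r n] unfolding t(3,4) .
      have i: "integrable lborel (\<lambda>y. heat_kernel (s' - s) x y * PhiF r ?t n y)"
        by (rule expbd_heat_integrable[OF expbd_PhiF[OF t(1), of 0]]) (use s in simp)
      have i': "integrable lborel (\<lambda>y. heat_kernel (s' - s) x y * PhiF r ?t n (- y))"
        by (rule expbd_heat_integrable[OF expbd_reflect[OF expbd_PhiF[OF t(1), of 0]]]) (use s in simp)
      show "?f s x = (\<integral>y. heat_kernel (s' - s) x y * ?f s' y \<partial>lborel)"
        unfolding right_diff_distrib using i i' heat_kernel_integral_reflect[of "s' - s" x "PhiF r ?t n"] h by simp
    qed (use D eps in auto)
    then show ?case unfolding S_def[symmetric] using eventually_gt_at_top[of 0]
    proof eventually_elim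
      case k: (elim k)
      have d: "S / real k > 0" "real k * (S / real k) = S" using S k by auto
      have eR: "expbd 0 (\<lambda>x. PhiF r t0 n (- x))" and eP: "expbd 0 (PhiF r t0 n)"
        using expbd_PhiF[OF t0(1), of 0 r n] by (auto intro: expbd_reflect)
      have S2: "t1 - S / 2 = t0" by (simp add: S_def field_simps)
      have eF: "expbd 0 (?f S)" unfolding S2 by (rule expbd_diff[OF eP eR])
      have split: "PhiF r t0 n = (\<lambda>x. ?f S x + PhiF r t0 n (- x))" unfolding S2 by simp
      show ?case
      proof (intro allI impI)
        fix u :: real assume u: "u \<le> 0"
        have "\<bar>(killed_heat (S / real k) ^^ k) (\<lambda>x. PhiF r t0 n (- x)) u\<bar> \<le> (C * t0) * exp (l\<^sup>2 * (real k * (S / real k)) / 2) * exp (l * u)"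
          using C t0 by (intro killed_heat_pow_bound[OF eR d(1) _ _ u]) auto
        also have "\<dots> \<le> (C * t0) * exp (l\<^sup>2 * t1) * exp (l * u)"
        proof -
          have "l\<^sup>2 * (t1 - t0) \<le> l\<^sup>2 * t1" using t0 by (intro mult_left_mono) auto
          moreover have "l\<^sup>2 * (real k * (S / real k)) / 2 = l\<^sup>2 * (t1 - t0)"
          proof -
            have "S / 2 = t1 - t0" by (simp add: S_def field_simps)
            then have "l\<^sup>2 * (S / 2) = l\<^sup>2 * (t1 - t0)" by (simp only:)
            then show ?thesis unfolding d(2) by simp
          qed
          ultimately have "l\<^sup>2 * (real k * (S / real k)) / 2 \<le> l\<^sup>2 * t1" by (simp only:)
          then have "exp (l\<^sup>2 * (real k * (S / real k)) / 2) \<le> exp (l\<^sup>2 * t1)" by (simp only: exp_le_cancel_iff)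
          moreover have "0 \<le> C * t0" using C t0 by simp
          ultimately have "C * t0 * exp (l\<^sup>2 * (real k * (S / real k)) / 2) \<le> C * t0 * exp (l\<^sup>2 * t1)" by (rule mult_left_mono)
          then show ?thesis by (rule mult_right_mono) simp
        qed
        also have "\<dots> \<le> eps / 2 * exp (l * u)" using elim by (intro mult_right_mono) auto
        finally have b: "\<bar>(killed_heat (S / real k) ^^ k) (\<lambda>x. PhiF r t0 n (- x)) u\<bar> \<le> eps / 2 * exp (l * u)" .
        have "(killed_heat (S / real k) ^^ k) (PhiF r t0 n) u = (killed_heat (S / real k) ^^ k) (?f S) u + (killed_heat (S / real k) ^^ k) (\<lambda>x. PhiF r t0 n (- x)) u"
          by (subst split, subst killed_heat_pow_add[OF eF eR d(1)]) simp
        moreover have "\<bar>(killed_heat (S / real k) ^^ k) (?f S) u - (PhiF r t1 n u - PhiF r t1 n (- u))\<bar> \<le> eps / 2 * exp (l * u)"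
          using k(1) u by simp
        ultimately show "\<bar>(killed_heat (S / real k) ^^ k) (PhiF r t0 n) u - (PhiF r t1 n u - PhiF r t1 n (- u))\<bar> \<le> eps * exp (l * u)"
          using b by linarith
      qed
    qed
  qed
qed

text \<open>The same splitting with the flat weight l = 0: on the negative half-line the killed flow
  does not increase suprema, and the reflected part is uniformly of order exp (- r^2 t3). A flat
  weight is enough because the Phi side supplies the decay in the pairing.\<close>

lemma killed_Psi:
  assumes r: "r > 0" and t2: "t2 > 0" and eps: "eps > 0"
  shows "\<forall>\<^sub>F t3 in at_top. \<forall>\<^sub>F k in sequentially. \<forall>v\<le>0.
    \<bar>(killed_heat (2 * (t3 - t2) / real k) ^^ k) (PsiF r t3 m) v - (PsiF r t2 m v - PsiF r t2 m (- v))\<bar> \<le> eps"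
proof -
  obtain C where C: "C \<ge> 0" "\<And>\<tau> v. 0 \<le> \<tau> \<Longrightarrow> v \<le> 0 \<Longrightarrow> \<bar>PsiF r \<tau> m (- v)\<bar> \<le> C * exp (- (r\<^sup>2 * \<tau>))"
    using PsiF_tail[OF r, of m] by blast
  have "((\<lambda>t3. C * exp (- (r\<^sup>2 * t3))) \<longlongrightarrow> 0) at_top" using r by real_asymp
  then have "\<forall>\<^sub>F t3 in at_top. C * exp (- (r\<^sup>2 * t3)) < eps / 2" by (rule order_tendstoD) (use eps in simp)
  then show ?thesis using eventually_gt_at_top[of t2]
  proof eventually_elim
    case (elim t3)
    define S where "S = 2 * (t3 - t2)"
    have S: "S > 0" using elim by (simp add: S_def)
    let ?f = "\<lambda>s x. PsiF r (t2 + s / 2) m x - PsiF r (t2 + s / 2) m (- x)"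
    let ?c = "2 * r + 1"
    obtain D where D: "D \<ge> 0" "\<And>\<tau> u. 0 \<le> \<tau> \<Longrightarrow> \<tau> \<le> t3 \<Longrightarrow> \<bar>PsiF r \<tau> m u\<bar> \<le> D * exp (?c * \<bar>u\<bar>)"
      using PsiF_bound[of r t3 m] r by auto
    have "\<forall>\<^sub>F k in sequentially. \<forall>u\<le>0. \<bar>(killed_heat (S / real k) ^^ k) (?f S) u - ?f 0 u\<bar> \<le> eps / 2 * exp (0 * u)"
    proof (rule killed_limit[OF S order_refl, of ?c "2 * D"])
      show "continuous_on ({0..S} \<times> UNIV) (\<lambda>(s, x). ?f s x)"
        unfolding case_prod_beta by (intro continuous_intros) auto
    next
      fix s x :: real assume s: "0 \<le> s" "s \<le> S"
      show "?f s (- x) = - ?f s x" by simp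
      have "\<bar>PsiF r (t2 + s / 2) m x\<bar> \<le> D * exp (?c * \<bar>x\<bar>)" "\<bar>PsiF r (t2 + s / 2) m (- x)\<bar> \<le> D * exp (?c * \<bar>- x\<bar>)"
      proof -
        have "0 \<le> t2 + s / 2" "t2 + s / 2 \<le> t3" using s t2 by (auto simp: S_def field_simps)
        then show "\<bar>PsiF r (t2 + s / 2) m x\<bar> \<le> D * exp (?c * \<bar>x\<bar>)" "\<bar>PsiF r (t2 + s / 2) m (- x)\<bar> \<le> D * exp (?c * \<bar>- x\<bar>)"
          using D(2)[of "t2 + s / 2" x] D(2)[of "t2 + s / 2" "- x"] by blast+
      qed
      then show "\<bar>?f s x\<bar> \<le> 2 * D * exp (?c * \<bar>x\<bar>)" unfolding abs_minus_cancel by linarith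
    next
      fix s s' x :: real assume s: "0 \<le> s" "s < s'" "s' \<le> S"
      let ?t = "t2 + s / 2" and ?d = "(s' - s) / 2"
      have t: "?t > 0" "?d > 0" "?t + ?d = t2 + s' / 2" "2 * ?d = s' - s" "t2 + s' / 2 \<ge> 0" using s t2 by (auto simp: S_def field_simps)
      have h: "(\<integral>y. heat_kernel (s' - s) x y * PsiF r (t2 + s' / 2) m y \<partial>lborel) = PsiF r ?t m x" for x
        using PsiF_heat[OF t(2), of x r ?t m] unfolding t(3,4) .
      have i: "integrable lborel (\<lambda>y. heat_kernel (s' - s) x y * PsiF r (t2 + s' / 2) m y)"
        by (rule expbd_heat_integrable[OF expbd_PsiF[OF t(5)]]) (use s in simp)
      have i': "integrable lborel (\<lambda>y. heat_kernel (s' - s) x y * PsiF r (t2 + s' / 2) m (- y))"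
        by (rule expbd_heat_integrable[OF expbd_reflect[OF expbd_PsiF[OF t(5)]]]) (use s in simp)
      show "?f s x = (\<integral>y. heat_kernel (s' - s) x y * ?f s' y \<partial>lborel)"
        unfolding right_diff_distrib using i i' heat_kernel_integral_reflect[of "s' - s" x "PsiF r (t2 + s' / 2) m"] h by simp
    qed (use D eps r in auto)
    then show ?case unfolding S_def[symmetric] using eventually_gt_at_top[of 0]
    proof eventually_elim
      case k: (elim k)
      have d: "S / real k > 0" "real k * (S / real k) = S" using S k by auto
      have t3: "t3 \<ge> 0" "t2 + S / 2 = t3" using elim t2 by (auto simp: S_def field_simps)
      have eR: "expbd (2 * \<bar>r\<bar> + 1) (\<lambda>x. PsiF r t3 m (- x))" and eP: "expbd (2 * \<bar>r\<bar> + 1) (PsiF r t3 m)"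
        using expbd_PsiF[OF t3(1), of r m] by (auto intro: expbd_reflect)
      have eF: "expbd (2 * \<bar>r\<bar> + 1) (?f S)" unfolding t3(2) using expbd_diff[OF eP eR] by simp
      have split: "PsiF r t3 m = (\<lambda>x. ?f S x + PsiF r t3 m (- x))" unfolding t3(2) by simp
      show ?case
      proof (intro allI impI)
        fix u :: real assume u: "u \<le> 0"
        have "\<bar>(killed_heat (S / real k) ^^ k) (\<lambda>x. PsiF r t3 m (- x)) u\<bar> \<le> (C * exp (- (r\<^sup>2 * t3))) * exp (0\<^sup>2 * (real k * (S / real k)) / 2) * exp (0 * u)"
          using C t3 by (intro killed_heat_pow_bound[OF eR d(1) _ _ u]) auto
        then have b: "\<bar>(killed_heat (S / real k) ^^ k) (\<lambda>x. PsiF r t3 m (- x)) u\<bar> \<le> eps / 2" using elim by simp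
        have "(killed_heat (S / real k) ^^ k) (PsiF r t3 m) u = (killed_heat (S / real k) ^^ k) (?f S) u + (killed_heat (S / real k) ^^ k) (\<lambda>x. PsiF r t3 m (- x)) u"
          by (subst split, subst killed_heat_pow_add[OF eF eR d(1)]) simp
        moreover have "\<bar>(killed_heat (S / real k) ^^ k) (?f S) u - (PsiF r t2 m u - PsiF r t2 m (- u))\<bar> \<le> eps / 2"
          using k(1) u by simp
        ultimately show "\<bar>(killed_heat (S / real k) ^^ k) (PsiF r t3 m) u - (PsiF r t2 m u - PsiF r t2 m (- u))\<bar> \<le> eps"
          using b by linarith
      qed
    qed
  qed
qed

section \<open>Determinants and the identity of Andreief\<close>

text \<open>Serves two purposes: a time slice of the index set of pairs is identified with {..<N},
  and permuting coordinates preserves the measure.\<close>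

lemma PiM_lborel_reindex:
  assumes fin: "finite I" "finite J" and g: "bij_betw g J I"
  shows "distr (PiM I (\<lambda>_. lborel :: real measure)) (PiM J (\<lambda>_. lborel)) (\<lambda>x. \<lambda>j\<in>J. x (g j)) = PiM J (\<lambda>_. lborel)"
proof -
  interpret product_sigma_finite "\<lambda>_. lborel :: real measure" by standard
  have gI: "g j \<in> I" if "j \<in> J" for j using g that by (auto simp: bij_betw_def)
  have m: "(\<lambda>x. \<lambda>j\<in>J. x (g j)) \<in> measurable (PiM I (\<lambda>_. lborel :: real measure)) (PiM J (\<lambda>_. lborel))"
    by (intro measurable_restrict measurable_component_singleton gI)
  show ?thesis
  proof (rule PiM_eqI)
    fix A :: "_ \<Rightarrow> real set" assume A: "\<And>i. i \<in> J \<Longrightarrow> A i \<in> sets lborel"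
    let ?h = "inv_into J g"
    have h: "bij_betw ?h I J" using g by (rule bij_betw_inv_into)
    have hg: "?h (g j) = j" if "j \<in> J" for j using g that by (simp add: bij_betw_inv_into_left)
    have gh: "g (?h i) = i" if "i \<in> I" for i using g that by (simp add: bij_betw_inv_into_right)
    have hJ: "?h i \<in> J" if "i \<in> I" for i using h that by (auto simp: bij_betw_def)
    have AJ: "Pi\<^sub>E J A \<in> sets (PiM J (\<lambda>_. lborel :: real measure))" using A fin by (intro sets_PiM_I_finite) auto
    have "emeasure (distr (PiM I (\<lambda>_. lborel :: real measure)) (PiM J (\<lambda>_. lborel)) (\<lambda>x. \<lambda>j\<in>J. x (g j))) (Pi\<^sub>E J A)
      = emeasure (PiM I (\<lambda>_. lborel)) ((\<lambda>x. \<lambda>j\<in>J. x (g j)) -` Pi\<^sub>E J A \<inter> space (PiM I (\<lambda>_. lborel :: real measure)))"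
      by (rule emeasure_distr[OF m AJ])
    also have "(\<lambda>x. \<lambda>j\<in>J. x (g j)) -` Pi\<^sub>E J A \<inter> space (PiM I (\<lambda>_. lborel :: real measure)) = Pi\<^sub>E I (\<lambda>i. A (?h i))"
      using hg gh hJ gI by (auto simp: space_PiM PiE_iff) metis+
    also have "emeasure (PiM I (\<lambda>_. lborel)) \<dots> = (\<Prod>i\<in>I. emeasure lborel (A (?h i)))"
      using A hJ fin by (intro emeasure_PiM) auto
    also have "\<dots> = (\<Prod>j\<in>J. emeasure lborel (A j))" by (rule prod.reindex_bij_betw[OF h])
    finally show "emeasure (distr (PiM I (\<lambda>_. lborel :: real measure)) (PiM J (\<lambda>_. lborel)) (\<lambda>x. \<lambda>j\<in>J. x (g j))) (Pi\<^sub>E J A) = (\<Prod>j\<in>J. emeasure lborel (A j))" .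
  qed (use fin in auto)
qed

lemma PiM_lborel_reindex_integral:
  fixes f :: "('i \<Rightarrow> real) \<Rightarrow> real"
  assumes fin: "finite I" "finite J" and g: "bij_betw g J I" and f: "f \<in> borel_measurable (PiM J (\<lambda>_. lborel))"
  shows "(\<integral>x. f (\<lambda>j\<in>J. x (g j)) \<partial>PiM I (\<lambda>_. lborel)) = integral\<^sup>L (PiM J (\<lambda>_. lborel)) f"
    and "integrable (PiM I (\<lambda>_. lborel)) (\<lambda>x. f (\<lambda>j\<in>J. x (g j))) \<longleftrightarrow> integrable (PiM J (\<lambda>_. lborel)) f"
proof -
  have gI: "g j \<in> I" if "j \<in> J" for j using g that by (auto simp: bij_betw_def)
  have m: "(\<lambda>x. \<lambda>j\<in>J. x (g j)) \<in> measurable (PiM I (\<lambda>_. lborel :: real measure)) (PiM J (\<lambda>_. lborel))"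
    by (intro measurable_restrict measurable_component_singleton gI)
  show "(\<integral>x. f (\<lambda>j\<in>J. x (g j)) \<partial>PiM I (\<lambda>_. lborel)) = integral\<^sup>L (PiM J (\<lambda>_. lborel)) f"
    using integral_distr[OF m f] PiM_lborel_reindex[OF fin g] by simp
  show "integrable (PiM I (\<lambda>_. lborel)) (\<lambda>x. f (\<lambda>j\<in>J. x (g j))) \<longleftrightarrow> integrable (PiM J (\<lambda>_. lborel)) f"
    using integrable_distr_eq[OF m f] PiM_lborel_reindex[OF fin g] by simp
qed

text \<open>Entries are a plain function of two indices, so that scaling, transposition and
  substitution need no matrix bounds. The ring is general because the determinants are real until
  the final passage to complex numbers.\<close>

definition fdet :: "nat \<Rightarrow> (nat \<Rightarrow> nat \<Rightarrow> 'a::comm_ring_1) \<Rightarrow> 'a" where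
  "fdet N a = Determinant.det (Matrix.mat N N (\<lambda>(i, l). a i l))"

section \<open>Determinants as sums over permutations\<close>

lemma fdet_row: "fdet N a = (\<Sum>p | p permutes {..<N}. of_int (sign p) * (\<Prod>i<N. a i (p i)))"
proof -
  have "p i < N" if "p permutes {0..<N}" "i < N" for p i using permutes_in_image[OF that(1), of i] that(2) by simp
  then show ?thesis unfolding fdet_def by (subst det_def'[of _ N]) (auto simp: lessThan_atLeast0 intro!: sum.cong prod.cong)
qed

lemma fdet_col: "fdet N a = (\<Sum>p | p permutes {..<N}. of_int (sign p) * (\<Prod>j<N. a (p j) j))"
proof -
  have "p i < N" if "p permutes {0..<N}" "i < N" for p i using permutes_in_image[OF that(1), of i] that(2) by simp
  then show ?thesis unfolding fdet_def by (subst det_col[of _ N]) (auto simp: lessThan_atLeast0 intro!: sum.cong prod.cong)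
qed

lemma fdet_transpose: "fdet N (\<lambda>i j. a j i) = fdet N a"
  by (subst fdet_row, subst fdet_col) simp

lemma fdet_cong: "(\<And>i j. i < N \<Longrightarrow> j < N \<Longrightarrow> a i j = b i j) \<Longrightarrow> fdet N a = fdet N b"
  unfolding fdet_def by (intro arg_cong[where f=Determinant.det] eq_matI) auto

lemma fdet_scale_cols: "fdet N (\<lambda>i j. a i j * c j) = (\<Prod>j<N. c j) * fdet N a"
  unfolding fdet_col by (simp add: prod.distrib sum_distrib_left mult_ac)

lemma fdet_scale_rows: "fdet N (\<lambda>i j. c i * a i j) = (\<Prod>j<N. c j) * fdet N a"
  unfolding fdet_row by (simp add: prod.distrib sum_distrib_left mult_ac)

lemma fdet_measurable [measurable (raw)]:
  assumes "\<And>i j. i < N \<Longrightarrow> j < N \<Longrightarrow> (\<lambda>x. f x i j :: real) \<in> borel_measurable M"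
  shows "(\<lambda>x. fdet N (f x)) \<in> borel_measurable M"
  unfolding fdet_row
proof (intro borel_measurable_sum borel_measurable_times borel_measurable_prod borel_measurable_const)
  fix p i assume p: "p \<in> {p. p permutes {..<N}}" "i \<in> {..<N}"
  then have "p i < N" using permutes_in_image[of p "{..<N}" i] by auto
  with p show "(\<lambda>x. f x i (p i)) \<in> borel_measurable M" using assms by auto
qed

lemma fdet_permute_cols:
  assumes q: "q permutes {..<N}"
  shows "fdet N (\<lambda>i j. a i (q j)) = of_int (sign q) * fdet N (a :: nat \<Rightarrow> nat \<Rightarrow> real)"
proof -
  have "fdet N (\<lambda>i j. a i (q j)) = (\<Sum>p | p permutes {..<N}. of_int (sign p) * (\<Prod>i<N. a i ((q \<circ> p) i)))"
    unfolding fdet_row by simp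
  also have "\<dots> = (\<Sum>p | p permutes {..<N}. of_int (sign q) * (of_int (sign (q \<circ> p)) * (\<Prod>i<N. a i ((q \<circ> p) i))))"
  proof (rule sum.cong[OF refl])
    fix p assume p: "p \<in> {p. p permutes {..<N}}"
    have "sign (q \<circ> p) = sign q * sign p"
      using q p by (intro sign_compose) (auto intro: permutation_permutes[THEN iffD2] simp: permutation_permutes)
    then have "of_int (sign q) * of_int (sign (q \<circ> p)) = (of_int (sign p) :: real)"
      by (simp add: sign_def)
    then show "of_int (sign p) * (\<Prod>i<N. a i ((q \<circ> p) i)) = of_int (sign q) * (of_int (sign (q \<circ> p)) * (\<Prod>i<N. a i ((q \<circ> p) i)))"
      by (simp only: mult.assoc[symmetric])
  qed
  also have "\<dots> = of_int (sign q) * (\<Sum>p | p permutes {..<N}. of_int (sign (q \<circ> p)) * (\<Prod>i<N. a i ((q \<circ> p) i)))"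
    by (simp add: sum_distrib_left)
  also have "(\<Sum>p | p permutes {..<N}. of_int (sign (q \<circ> p)) * (\<Prod>i<N. a i ((q \<circ> p) i))) = fdet N a"
    unfolding fdet_row by (rule setum_permutations_compose_left[OF q, symmetric])
  finally show ?thesis .
qed

lemma fdet_eq_cols:
  assumes "i < N" "j < N" "i \<noteq> j" "\<And>k. k < N \<Longrightarrow> a k i = a k j"
  shows "fdet N (a :: nat \<Rightarrow> nat \<Rightarrow> real) = 0"
proof -
  let ?q = "Transposition.transpose i j"
  have q: "?q permutes {..<N}" using assms by (intro permutes_swap_id) auto
  have "fdet N (\<lambda>k l. a k (?q l)) = fdet N a" using assms by (intro fdet_cong) (auto simp: Transposition.transpose_def)
  moreover have "sign ?q = -1" using assms by (simp add: sign_swap_id)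
  ultimately show ?thesis using fdet_permute_cols[OF q, of a] by simp
qed

section \<open>Weyl chambers and Andreief's identity\<close>

lemma weyl_chamber_iff_sorted: "weyl_chamber N x \<longleftrightarrow> sorted_wrt (<) (map x [0..<N])"
proof -
  have "sorted_wrt (<) (map x [0..<N]) \<longleftrightarrow> (\<forall>i. Suc i < length (map x [0..<N]) \<longrightarrow> map x [0..<N] ! i < map x [0..<N] ! Suc i)"
    by (rule sorted_wrt_iff_nth_Suc_transp) (auto simp: transp_def)
  also have "\<dots> \<longleftrightarrow> weyl_chamber N x" unfolding weyl_chamber_def by auto
  finally show ?thesis by simp
qed

lemma weyl_chamber_cong: "(\<And>i. i < N \<Longrightarrow> x i = y i) \<Longrightarrow> weyl_chamber N x = weyl_chamber N y"
  unfolding weyl_chamber_def by (metis Suc_lessD)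

text \<open>Existence by sorting; uniqueness because strictly sorted lists with the same elements
  agree. Off the diagonals, the space is thus cut into N! chambers.\<close>

lemma ex1_sorting_permutation:
  assumes inj: "inj_on x {..<N}"
  shows "\<exists>!p. p permutes {..<N} \<and> weyl_chamber N (\<lambda>i. x (p i) :: real)"
proof (rule ex_ex1I)
  let ?l = "sort_key x [0..<N]"
  let ?p = "\<lambda>i. if i < N then ?l ! i else i"
  have "bij_betw ((!) ?l) {..<N} {..<N}"
    by (rule bij_betw_nth) (auto simp: distinct_sort)
  then have "bij_betw ?p {..<N} {..<N}" by (subst bij_betw_cong[of _ _ "(!) ?l"]) auto
  then have p: "?p permutes {..<N}" by (rule bij_imp_permutes) auto
  have "sorted (map x ?l)" by simp
  moreover have "distinct (map x ?l)" using inj by (auto simp: distinct_map distinct_sort lessThan_atLeast0)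
  ultimately have s: "sorted_wrt (<) (map x ?l)" by (simp add: strict_sorted_iff)
  have "map (\<lambda>i. x (?p i)) [0..<N] = map x ?l" by (rule nth_equalityI) auto
  then have "weyl_chamber N (\<lambda>i. x (?p i))" unfolding weyl_chamber_iff_sorted using s by simp
  with p show "\<exists>p. p permutes {..<N} \<and> weyl_chamber N (\<lambda>i. x (p i))" by blast
next
  fix p q assume p: "p permutes {..<N} \<and> weyl_chamber N (\<lambda>i. x (p i))" and q: "q permutes {..<N} \<and> weyl_chamber N (\<lambda>i. x (q i))"
  have im: "(\<lambda>i. x (r i)) ` {..<N} = x ` {..<N}" if "r permutes {..<N}" for r
    using permutes_image[OF that] by (metis image_image)
  have "map (\<lambda>i. x (p i)) [0..<N] = map (\<lambda>i. x (q i)) [0..<N]"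
    using p q im unfolding weyl_chamber_iff_sorted by (intro strict_sorted_equal) (auto simp: lessThan_atLeast0)
  then have eq: "x (p i) = x (q i)" if "i < N" for i using that by auto
  show "p = q"
  proof
    fix i show "p i = q i"
    proof (cases "i < N")
      case True
      then have "p i \<in> {..<N}" "q i \<in> {..<N}" using p q by (auto simp: permutes_in_image[of p] permutes_in_image[of q] simp del: lessThan_iff)
      with inj eq[OF True] show ?thesis by (auto dest: inj_onD)
    next
      case False then show ?thesis using p q by (auto simp: permutes_def)
    qed
  qed
qed

lemma weyl_chamber_measurable [measurable]: "Measurable.pred (PiM {..<N} (\<lambda>_. lborel)) (weyl_chamber N)"
proof -
  have "weyl_chamber N = (\<lambda>x. \<forall>i\<in>{..<N - 1}. x i < x (Suc i))" unfolding weyl_chamber_def by (auto simp: fun_eq_iff)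
  moreover have "Measurable.pred (PiM {..<N} (\<lambda>_. lborel)) (\<lambda>x. \<forall>i\<in>{..<N - 1}. x i < (x (Suc i) :: real))"
  proof (intro pred_intros_finite)
    fix i assume i: "i \<in> {..<N - 1}"
    have c: "(\<lambda>x. x i) \<in> borel_measurable (PiM {..<N} (\<lambda>_. lborel :: real measure))"
      "(\<lambda>x. x (Suc i)) \<in> borel_measurable (PiM {..<N} (\<lambda>_. lborel :: real measure))"
      using measurable_component_singleton[of i "{..<N}" "\<lambda>_. lborel :: real measure"]
        measurable_component_singleton[of "Suc i" "{..<N}" "\<lambda>_. lborel :: real measure"] i by auto
    show "Measurable.pred (PiM {..<N} (\<lambda>_. lborel)) (\<lambda>x. x i < (x (Suc i) :: real))" by (rule borel_measurable_pred_less[OF c])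
  qed simp
  ultimately show ?thesis by simp
qed

text \<open>Over the full space, Fubini evaluates the integral of one determinant times only the
  diagonal product of the other. Relabelling each chamber to the standard one contributes the sign
  of a permutation, and the sum over chambers restores the missing determinant.\<close>

lemma andreief:
  fixes phi psi :: "nat \<Rightarrow> real \<Rightarrow> real"
  assumes [measurable]: "\<And>i. phi i \<in> borel_measurable borel" "\<And>i. psi i \<in> borel_measurable borel"
    and int: "\<And>i m. i < N \<Longrightarrow> m < N \<Longrightarrow> integrable lborel (\<lambda>x. phi i x * psi m x)"
  shows "(\<integral>x. (if weyl_chamber N x then fdet N (\<lambda>i l. phi i (x l)) * fdet N (\<lambda>m l. psi m (x l)) else 0) \<partial>PiM {..<N} (\<lambda>_. lborel))
     = fdet N (\<lambda>i m. \<integral>x. phi i x * psi m x \<partial>lborel)"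
proof -
  interpret product_sigma_finite "\<lambda>_. lborel :: real measure" by standard
  let ?P = "PiM {..<N} (\<lambda>_. lborel :: real measure)"
  let ?S = "{p. p permutes {..<N}}"
  let ?prod = "\<lambda>x. \<Prod>l<N. phi l (x l)" and ?D = "\<lambda>x. fdet N (\<lambda>m l. psi m (x l))"
  let ?act = "\<lambda>p x. (\<lambda>l\<in>{..<N}. x (p l :: nat) :: real)"
  have lt: "p i < N" if "p \<in> ?S" "i < N" for p i using permutes_in_image[of p "{..<N}" i] that by auto
  have exp: "?prod x * ?D x = (\<Sum>p\<in>?S. of_int (sign p) * (\<Prod>j<N. phi j (x j) * psi (p j) (x j)))" for x
    unfolding fdet_col sum_distrib_left by (simp add: prod.distrib mult_ac)
  have ip: "integrable ?P (\<lambda>x. \<Prod>j<N. phi j (x j) * psi (p j) (x j))" if "p \<in> ?S" for p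
    using product_integrable_prod[of "{..<N}" "\<lambda>j y. phi j y * psi (p j) y"] int lt[OF that] by auto
  have int1: "integrable ?P (\<lambda>x. ?prod x * ?D x)" unfolding exp by (intro Bochner_Integration.integrable_sum integrable_mult_right ip)
  have "(\<integral>x. ?prod x * ?D x \<partial>?P) = (\<Sum>p\<in>?S. of_int (sign p) * (\<integral>x. (\<Prod>j<N. phi j (x j) * psi (p j) (x j)) \<partial>?P))"
    unfolding exp using ip by (subst Bochner_Integration.integral_sum) auto
  also have "\<dots> = (\<Sum>p\<in>?S. of_int (sign p) * (\<Prod>j<N. \<integral>y. phi j y * psi (p j) y \<partial>lborel))"
    using int lt by (intro sum.cong refl arg_cong2[where f="(*)"] product_integral_prod) auto
  also have "\<dots> = fdet N (\<lambda>i m. \<integral>x. phi i x * psi m x \<partial>lborel)" unfolding fdet_row ..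
  finally have A: "(\<integral>x. ?prod x * ?D x \<partial>?P) = fdet N (\<lambda>i m. \<integral>x. phi i x * psi m x \<partial>lborel)" .
  let ?w = "\<lambda>p x. if weyl_chamber N (\<lambda>i. x (p i)) then 1 else (0 :: real)"
  \<comment> \<open>The chamber indicators sum to 1 if the coordinates are distinct; otherwise the
    determinant has two equal columns. So the diagonals need no null-set argument.\<close>
  have one: "(\<Sum>p\<in>?S. ?w p x) * ?D x = ?D x" for x
  proof (cases "inj_on x {..<N}")
    case True
    from ex1_sorting_permutation[OF True] obtain q where q0: "q permutes {..<N} \<and> weyl_chamber N (\<lambda>i. x (q i))"
      and un0: "\<forall>p. p permutes {..<N} \<and> weyl_chamber N (\<lambda>i. x (p i)) \<longrightarrow> p = q"
      by (elim ex1E) (rule that)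
    have q: "q \<in> ?S" "weyl_chamber N (\<lambda>i. x (q i))" using q0 by simp_all
    have un: "p = q" if "p \<in> ?S" "weyl_chamber N (\<lambda>i. x (p i))" for p using un0 that by simp
    have w: "?w p x = (if p = q then 1 else 0)" if "p \<in> ?S" for p
    proof (cases "p = q")
      case False
      then have "\<not> weyl_chamber N (\<lambda>i. x (p i))" using un[OF that] by blast
      then show ?thesis using False by simp
    qed (use q(2) in simp)
    have "(\<Sum>p\<in>?S. ?w p x) = (\<Sum>p\<in>?S. if p = q then 1 else 0)" by (intro sum.cong refl w)
    also have "\<dots> = 1" using q by (simp add: finite_permutations)
    finally show ?thesis by simp
  next
    case False
    then obtain i j where "i < N" "j < N" "i \<noteq> j" "x i = x j" by (auto simp: inj_on_def)
    then have "?D x = 0" by (intro fdet_eq_cols[of i N j]) auto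
    then show ?thesis by simp
  qed
  have wm: "(\<lambda>x. ?w p x) \<in> borel_measurable ?P" if p: "p \<in> ?S" for p
  proof -
    have m: "?act p \<in> measurable ?P ?P" using lt[OF p] by (intro measurable_restrict measurable_component_singleton) auto
    have "(\<lambda>x. if weyl_chamber N (?act p x) then 1 else (0::real)) \<in> borel_measurable ?P"
      by (intro measurable_If borel_measurable_const measurable_compose[OF m weyl_chamber_measurable, unfolded Measurable.pred_def]) 
    also have "(\<lambda>x. if weyl_chamber N (?act p x) then 1 else (0::real)) = ?w p"
      by (intro ext if_cong weyl_chamber_cong) auto
    finally show ?thesis .
  qed
  have int2: "integrable ?P (\<lambda>x. ?w p x * (?prod x * ?D x))" if p: "p \<in> ?S" for p
    by (rule Bochner_Integration.integrable_bound[OF int1]) (use wm[OF p] borel_measurable_integrable[OF int1] in auto)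
  have B: "(\<integral>x. ?prod x * ?D x \<partial>?P) = (\<Sum>p\<in>?S. \<integral>x. ?w p x * (?prod x * ?D x) \<partial>?P)"
  proof -
    have "?prod x * ?D x = (\<Sum>p\<in>?S. ?w p x * (?prod x * ?D x))" for x
      using one[of x] by (simp add: sum_distrib_right[symmetric])
    then have "(\<integral>x. ?prod x * ?D x \<partial>?P) = (\<integral>x. (\<Sum>p\<in>?S. ?w p x * (?prod x * ?D x)) \<partial>?P)"
      by (intro Bochner_Integration.integral_cong) auto
    also have "\<dots> = (\<Sum>p\<in>?S. \<integral>x. ?w p x * (?prod x * ?D x) \<partial>?P)"
      using int2 by (intro Bochner_Integration.integral_sum) auto
    finally show ?thesis .
  qed
  \<comment> \<open>Permuting the coordinates by the inverse of p carries the chamber of p to the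
    standard one, and the permuted determinant returns the sign.\<close>
  have C: "(\<integral>x. ?w p x * (?prod x * ?D x) \<partial>?P) = (\<integral>x. (if weyl_chamber N x then ?prod (\<lambda>l. x (inv_into UNIV p l)) * (of_int (sign p) * ?D x) else 0) \<partial>?P)"
    and C': "integrable ?P (\<lambda>x. if weyl_chamber N x then ?prod (\<lambda>l. x (inv_into UNIV p l)) * (of_int (sign p) * ?D x) else 0)"
    if p: "p \<in> ?S" for p
  proof -
    let ?q = "inv_into UNIV p"
    have q: "?q permutes {..<N}" using p by (auto intro: permutes_inv)
    have q': "?q \<in> ?S" using q by simp
    have pq: "?q (p i) = i" for i using p by (auto simp: permutes_inverses)
    let ?F = "\<lambda>x. ?w p x * (?prod x * ?D x)"
    have bij: "bij_betw ?q {..<N} {..<N}" using q by (rule permutes_imp_bij)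
    have Fm: "?F \<in> borel_measurable ?P" using int2[OF p] by auto
    have eq: "?F (?act ?q x) = (if weyl_chamber N x then ?prod (\<lambda>l. x (?q l)) * (of_int (sign p) * ?D x) else 0)" for x
    proof -
      have 1: "weyl_chamber N (\<lambda>i. ?act ?q x (p i)) = weyl_chamber N x"
        using lt[OF p] pq by (intro weyl_chamber_cong) auto
      have 2: "?prod (?act ?q x) = ?prod (\<lambda>l. x (?q l))" by (intro prod.cong) auto
      have "?D (?act ?q x) = fdet N (\<lambda>m l. psi m (x (?q l)))" by (intro fdet_cong) auto
      also have "\<dots> = of_int (sign ?q) * ?D x" by (rule fdet_permute_cols[OF q, of "\<lambda>m l. psi m (x l)"])
      also have "sign ?q = sign p" using p by (intro sign_inverse) (auto simp: permutation_permutes)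
      finally show ?thesis unfolding 1 2 by auto
    qed
    show "(\<integral>x. ?F x \<partial>?P) = (\<integral>x. (if weyl_chamber N x then ?prod (\<lambda>l. x (?q l)) * (of_int (sign p) * ?D x) else 0) \<partial>?P)"
      using PiM_lborel_reindex_integral(1)[OF _ _ bij Fm] unfolding eq by simp
    show "integrable ?P (\<lambda>x. if weyl_chamber N x then ?prod (\<lambda>l. x (?q l)) * (of_int (sign p) * ?D x) else 0)"
      using PiM_lborel_reindex_integral(2)[OF _ _ bij Fm] int2[OF p] unfolding eq by simp
  qed
  have "(\<Sum>p\<in>?S. \<integral>x. ?w p x * (?prod x * ?D x) \<partial>?P) = (\<integral>x. (\<Sum>p\<in>?S. if weyl_chamber N x then ?prod (\<lambda>l. x (inv_into UNIV p l)) * (of_int (sign p) * ?D x) else 0) \<partial>?P)"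
    using C C' by (subst Bochner_Integration.integral_sum) auto
  also have "\<dots> = (\<integral>x. (if weyl_chamber N x then fdet N (\<lambda>i l. phi i (x l)) * ?D x else 0) \<partial>?P)"
  proof (rule Bochner_Integration.integral_cong[OF refl])
    fix x :: "nat \<Rightarrow> real"
    have "(\<Sum>p\<in>?S. ?prod (\<lambda>l. x (inv_into UNIV p l)) * (of_int (sign p) * ?D x)) = (\<Sum>p\<in>?S. ?prod (\<lambda>l. x (p l)) * (of_int (sign (inv_into UNIV p)) * ?D x))"
      by (subst sum.reindex_bij_witness[of ?S "inv_into UNIV" "inv_into UNIV"]) (auto simp: permutes_inv permutes_inv_inv)
    also have "\<dots> = (\<Sum>p\<in>?S. of_int (sign p) * ?prod (\<lambda>l. x (p l))) * ?D x"
    proof -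
      have "sign (inv_into UNIV p) = sign p" if "p \<in> ?S" for p
        using that by (intro sign_inverse) (auto simp: permutation_permutes)
      then show ?thesis unfolding sum_distrib_right by (intro sum.cong refl) simp
    qed
    also have "(\<Sum>p\<in>?S. of_int (sign p) * ?prod (\<lambda>l. x (p l))) = fdet N (\<lambda>i l. phi i (x l))" unfolding fdet_row ..
    finally show "(\<Sum>p\<in>?S. if weyl_chamber N x then ?prod (\<lambda>l. x (inv_into UNIV p l)) * (of_int (sign p) * ?D x) else 0)
       = (if weyl_chamber N x then fdet N (\<lambda>i l. phi i (x l)) * ?D x else 0)" by simp
  qed
  finally show ?thesis using A B by simp
qed

text \<open>A step goes from level j to \<open>Suc j\<close> and tests the arrival set only, so the
  set at the starting level enters through the pairing instead. The clock s measures variance, and n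
  counts steps.\<close>

primrec heat_iter :: "(nat \<Rightarrow> real) \<Rightarrow> (nat \<Rightarrow> real set) \<Rightarrow> nat \<Rightarrow> nat \<Rightarrow> (real \<Rightarrow> real) \<Rightarrow> real \<Rightarrow> real" where
  "heat_iter s A 0 j g = g"
| "heat_iter s A (Suc n) j g = (\<lambda>u. \<integral>v. heat_kernel (s (Suc j) - s j) u v * (indicator (A (Suc j)) v * heat_iter s A n (Suc j) g v) \<partial>lborel)"

lemma heat_iter_add: "heat_iter s A (m + n) j g = heat_iter s A m j (heat_iter s A n (j + m) g)"
  by (induction m arbitrary: j) simp_all

lemma heat_iter_Suc_right:
  "heat_iter s A (Suc n) j g = heat_iter s A n j (\<lambda>u. \<integral>v. heat_kernel (s (Suc (j + n)) - s (j + n)) u v * (indicator (A (Suc (j + n))) v * g v) \<partial>lborel)"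
  using heat_iter_add[of s A n 1 j g] by simp

lemma expbd_heat_iter:
  assumes "expbd c g" "\<And>i. j \<le> i \<Longrightarrow> i < j + n \<Longrightarrow> s i < s (Suc i)" "\<And>i. A i \<in> sets borel"
  shows "expbd c (heat_iter s A n j g)"
  using assms(2)
proof (induction n arbitrary: j)
  case (Suc n)
  have "expbd c (heat_iter s A n (Suc j) g)" using Suc.prems by (intro Suc.IH) auto
  then show ?case using Suc.prems[of j] assms(3) by (auto intro!: expbd_heat_op expbd_indicator)
qed (use assms(1) in simp)

text \<open>The indicators stand inside the determinants, on the columns entering a level, so that
  each determinant is built from one-particle functions as Andreief's identity requires. Taken out
  of all columns, they form the product over particles.\<close>

definition chain_density :: "nat \<Rightarrow> (nat \<Rightarrow> real) \<Rightarrow> (nat \<Rightarrow> real set) \<Rightarrow> (nat \<Rightarrow> real \<Rightarrow> real) \<Rightarrow> nat \<Rightarrow> (nat \<Rightarrow> real \<Rightarrow> real) \<Rightarrow> (nat \<times> nat \<Rightarrow> real) \<Rightarrow> real" where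
  "chain_density N s A phi k psi x =
     (\<Prod>j<Suc k. if weyl_chamber N (\<lambda>i. x (j, i)) then 1 else 0) *
     (fdet N (\<lambda>n i. phi n (x (0, i)) * indicator (A 0) (x (0, i))) *
     (\<Prod>j<k. fdet N (\<lambda>i l. heat_kernel (s (Suc j) - s j) (x (j, i)) (x (Suc j, l)) * indicator (A (Suc j)) (x (Suc j, l)))) *
     fdet N (\<lambda>m l. psi m (x (k, l))))"

text \<open>The last level is integrated out: Andreief's identity merges the last two determinants
  into one of the same kind, with psi replaced by its image under one killed step. Hence the
  induction on k for all psi.\<close>

lemma chain_integral:
  fixes phi psi :: "nat \<Rightarrow> real \<Rightarrow> real"
  assumes phi: "\<And>n. expbd (-1) (phi n)" and psi: "\<And>m. expbd 0 (psi m)" and A: "\<And>j. A j \<in> sets borel"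
    and s: "\<And>j. j < k \<Longrightarrow> s j < s (Suc j)"
    and int: "integrable (PiM ({..<Suc k} \<times> {..<N}) (\<lambda>_. lborel)) (chain_density N s A phi k psi)"
  shows "(\<integral>x. chain_density N s A phi k psi x \<partial>PiM ({..<Suc k} \<times> {..<N}) (\<lambda>_. lborel))
     = fdet N (\<lambda>n m. \<integral>u. phi n u * (indicator (A 0) u * heat_iter s A k 0 (psi m) u) \<partial>lborel)"
  using psi s int
proof (induction k arbitrary: psi)
  case 0
  let ?I = "{..<Suc 0} \<times> {..<N}"
  let ?ph = "\<lambda>n u. phi n u * indicator (A 0) u"
  have [measurable]: "phi n \<in> borel_measurable borel" "psi n \<in> borel_measurable borel" "A n \<in> sets borel" for n
    using phi[of n] 0(1)[of n] A by auto
  let ?f = "\<lambda>y. if weyl_chamber N y then fdet N (\<lambda>n i. ?ph n (y i)) * fdet N (\<lambda>m l. psi m (y l)) else 0"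
  have c: "(\<lambda>y. y i) \<in> borel_measurable (PiM {..<N} (\<lambda>_. lborel :: real measure))" if "i < N" for i
    using measurable_component_singleton[of i "{..<N}" "\<lambda>_. lborel :: real measure"] that by auto
  have fm: "?f \<in> borel_measurable (PiM {..<N} (\<lambda>_. lborel))"
    by (intro measurable_If weyl_chamber_measurable[unfolded Measurable.pred_def] borel_measurable_times fdet_measurable borel_measurable_const)
       (auto intro!: measurable_compose[OF c] borel_measurable_times)
  have bij: "bij_betw (\<lambda>i. (0, i)) {..<N} ?I" by (auto simp: bij_betw_def inj_on_def)
  have "(\<integral>x. chain_density N s A phi 0 psi x \<partial>PiM ?I (\<lambda>_. lborel)) = (\<integral>x. ?f (\<lambda>i\<in>{..<N}. x (0, i)) \<partial>PiM ?I (\<lambda>_. lborel))"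
  proof (rule Bochner_Integration.integral_cong[OF refl])
    fix x :: "nat \<times> nat \<Rightarrow> real"
    have "weyl_chamber N (\<lambda>i\<in>{..<N}. x (0, i)) = weyl_chamber N (\<lambda>i. x (0, i))" by (rule weyl_chamber_cong) auto
    moreover have "fdet N (\<lambda>n i. ?ph n ((\<lambda>i\<in>{..<N}. x (0, i)) i)) = fdet N (\<lambda>n i. phi n (x (0, i)) * indicator (A 0) (x (0, i)))"
      by (rule fdet_cong) auto
    moreover have "fdet N (\<lambda>m l. psi m ((\<lambda>i\<in>{..<N}. x (0, i)) l)) = fdet N (\<lambda>m l. psi m (x (0, l)))" by (rule fdet_cong) auto
    ultimately show "chain_density N s A phi 0 psi x = ?f (\<lambda>i\<in>{..<N}. x (0, i))"
      unfolding chain_density_def by (simp only:) simp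
  qed
  also have "\<dots> = integral\<^sup>L (PiM {..<N} (\<lambda>_. lborel)) ?f"
    by (rule PiM_lborel_reindex_integral(1)[OF _ _ bij fm]) auto
  also have "\<dots> = fdet N (\<lambda>n m. \<integral>u. ?ph n u * psi m u \<partial>lborel)"
  proof (rule andreief)
    show "integrable lborel (\<lambda>x. ?ph i x * psi m x)" for i m
    proof -
      have "expbd (-1) (\<lambda>x. indicator (A 0) x * (phi i x * psi m x))" using expbd_indicator[OF expbd_mult[OF phi 0(1)] A] by simp
      from expbd_integrable[OF this] show ?thesis by (simp add: mult_ac)
    qed
  qed measurable
  finally show ?case by (simp add: mult_ac)
next
  case (Suc k)
  interpret product_sigma_finite "\<lambda>_. lborel :: real measure" by standard
  let ?I = "{..<Suc k} \<times> {..<N}" and ?J = "{Suc k} \<times> {..<N}"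
  let ?K = "{..<Suc (Suc k)} \<times> {..<N}"
  have IJ: "?I \<inter> ?J = {}" "finite ?I" "finite ?J" by auto
  have un: "?I \<union> ?J = ?K" by auto
  interpret I: finite_product_sigma_finite "\<lambda>_. lborel :: real measure" ?I by standard auto
  interpret J: finite_product_sigma_finite "\<lambda>_. lborel :: real measure" ?J by standard auto
  interpret P: pair_sigma_finite "PiM ?I (\<lambda>_. lborel :: real measure)" "PiM ?J (\<lambda>_. lborel :: real measure)" ..
  have [measurable]: "psi n \<in> borel_measurable borel" "A n \<in> sets borel" for n
    using Suc.prems(1)[of n] A by auto
  let ?F = "chain_density N s A phi (Suc k) psi"
  let ?d = "s (Suc k) - s k"
  have d: "?d > 0" using Suc.prems(2)[of k] by simp
  let ?q = "\<lambda>u v. heat_kernel ?d u v * indicator (A (Suc k)) v"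
  let ?psi = "\<lambda>m u. \<integral>v. heat_kernel ?d u v * (indicator (A (Suc k)) v * psi m v) \<partial>lborel"
  have intF: "integrable (PiM (?I \<union> ?J) (\<lambda>_. lborel)) ?F" unfolding un by (rule Suc.prems(3))
  have f_int: "integrable (PiM ?I (\<lambda>_. lborel) \<Otimes>\<^sub>M PiM ?J (\<lambda>_. lborel)) (\<lambda>x. ?F (merge ?I ?J x))"
    by (rule integrable_distr[OF measurable_merge]) (simp add: distr_merge[OF IJ] intF)
  have inner: "(\<integral>y. ?F (merge ?I ?J (x, y)) \<partial>PiM ?J (\<lambda>_. lborel)) = chain_density N s A phi k ?psi x" for x
  proof -
    let ?f = "\<lambda>y. if weyl_chamber N y then fdet N (\<lambda>i l. ?q (x (k, i)) (y l)) * fdet N (\<lambda>m l. psi m (y l)) else 0"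
    let ?R = "(\<Prod>j<Suc k. if weyl_chamber N (\<lambda>i. x (j, i)) then 1 else 0) * (fdet N (\<lambda>n i. phi n (x (0, i)) * indicator (A 0) (x (0, i))) *
       (\<Prod>j<k. fdet N (\<lambda>i l. heat_kernel (s (Suc j) - s j) (x (j, i)) (x (Suc j, l)) * indicator (A (Suc j)) (x (Suc j, l)))))"
    have c: "(\<lambda>y. y i) \<in> borel_measurable (PiM {..<N} (\<lambda>_. lborel :: real measure))" if "i < N" for i
      using measurable_component_singleton[of i "{..<N}" "\<lambda>_. lborel :: real measure"] that by auto
    have fm: "?f \<in> borel_measurable (PiM {..<N} (\<lambda>_. lborel))"
      by (intro measurable_If weyl_chamber_measurable[unfolded Measurable.pred_def] borel_measurable_times fdet_measurable borel_measurable_const)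
         (auto intro!: measurable_compose[OF c] borel_measurable_times)
    have bij: "bij_betw (\<lambda>i. (Suc k, i)) {..<N} ?J" by (auto simp: bij_betw_def inj_on_def)
    have mI: "merge ?I ?J (x, y) (j, i) = x (j, i)" if "j < Suc k" "i < N" for j i y using that by (simp add: merge_def)
    have mJ: "merge ?I ?J (x, y) (Suc k, i) = y (Suc k, i)" if "i < N" for i y using that by (simp add: merge_def)
    have "?F (merge ?I ?J (x, y)) = ?R * ?f (\<lambda>i\<in>{..<N}. y (Suc k, i))" for y
    proof -
      let ?z = "merge ?I ?J (x, y)"
      have w: "weyl_chamber N (\<lambda>i. ?z (j, i)) = weyl_chamber N (\<lambda>i. x (j, i))" if "j < Suc k" for j
        using that by (intro weyl_chamber_cong) (simp add: mI)
      have w': "weyl_chamber N (\<lambda>i. ?z (Suc k, i)) = weyl_chamber N (\<lambda>i\<in>{..<N}. y (Suc k, i))"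
        by (intro weyl_chamber_cong) (simp add: mJ)
      have p: "(\<Prod>j<Suc (Suc k). if weyl_chamber N (\<lambda>i. ?z (j, i)) then 1 else 0) =
         (\<Prod>j<Suc k. if weyl_chamber N (\<lambda>i. x (j, i)) then 1 else 0) * (if weyl_chamber N (\<lambda>i\<in>{..<N}. y (Suc k, i)) then 1 else (0 :: real))"
        unfolding prod.lessThan_Suc[of _ "Suc k"] w' using w by (intro arg_cong2[where f="(*)"] prod.cong refl) auto
      have 1: "fdet N (\<lambda>n i. phi n (?z (0, i)) * indicator (A 0) (?z (0, i))) = fdet N (\<lambda>n i. phi n (x (0, i)) * indicator (A 0) (x (0, i)))"
        by (intro fdet_cong) (simp add: mI)
      have 2: "(\<Prod>j<Suc k. fdet N (\<lambda>i l. heat_kernel (s (Suc j) - s j) (?z (j, i)) (?z (Suc j, l)) * indicator (A (Suc j)) (?z (Suc j, l)))) =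
         (\<Prod>j<k. fdet N (\<lambda>i l. heat_kernel (s (Suc j) - s j) (x (j, i)) (x (Suc j, l)) * indicator (A (Suc j)) (x (Suc j, l)))) *
         fdet N (\<lambda>i l. ?q (x (k, i)) ((\<lambda>i\<in>{..<N}. y (Suc k, i)) l))"
        unfolding prod.lessThan_Suc[of _ "k"] by (intro arg_cong2[where f="(*)"] prod.cong refl fdet_cong) (simp_all add: mI mJ)
      have 3: "fdet N (\<lambda>m l. psi m (?z (Suc k, l))) = fdet N (\<lambda>m l. psi m ((\<lambda>i\<in>{..<N}. y (Suc k, i)) l))"
        by (intro fdet_cong) (simp add: mJ)
      show ?thesis unfolding chain_density_def p 1 2 3 by simp
    qed
    then have "(\<integral>y. ?F (merge ?I ?J (x, y)) \<partial>PiM ?J (\<lambda>_. lborel)) = (\<integral>y. ?R * ?f (\<lambda>i\<in>{..<N}. y (Suc k, i)) \<partial>PiM ?J (\<lambda>_. lborel))"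
      by (intro Bochner_Integration.integral_cong refl)
    also have "\<dots> = ?R * (\<integral>y. ?f (\<lambda>i\<in>{..<N}. y (Suc k, i)) \<partial>PiM ?J (\<lambda>_. lborel))" by (rule integral_mult_right_zero)
    also have "(\<integral>y. ?f (\<lambda>i\<in>{..<N}. y (Suc k, i)) \<partial>PiM ?J (\<lambda>_. lborel)) = integral\<^sup>L (PiM {..<N} (\<lambda>_. lborel)) ?f"
      by (rule PiM_lborel_reindex_integral(1)[OF _ _ bij fm]) auto
    also have "\<dots> = fdet N (\<lambda>i m. \<integral>v. ?q (x (k, i)) v * psi m v \<partial>lborel)"
    proof (rule andreief)
      show "integrable lborel (\<lambda>v. ?q (x (k, i)) v * psi m v)" for i m
        using expbd_heat_integrable[OF expbd_indicator[OF Suc.prems(1)[of m] A] d] by (simp add: mult_ac)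
    qed measurable
    \<comment> \<open>Transposed so that the new functions index the rows, the form in which psi
      enters \<open>chain_density\<close>.\<close>
    also have "\<dots> = fdet N (\<lambda>m i. ?psi m (x (k, i)))"
      by (subst fdet_transpose[symmetric]) (simp add: mult_ac)
    finally show ?thesis unfolding chain_density_def by (simp add: mult_ac)
  qed
  have "(\<integral>x. ?F x \<partial>PiM ?K (\<lambda>_. lborel)) = (\<integral>x. chain_density N s A phi k ?psi x \<partial>PiM ?I (\<lambda>_. lborel))"
    using product_integral_fold[OF IJ intF] unfolding inner un .
  also have "\<dots> = fdet N (\<lambda>n m. \<integral>u. phi n u * (indicator (A 0) u * heat_iter s A k 0 (?psi m) u) \<partial>lborel)"
  proof (rule Suc.IH)
    show "expbd 0 (?psi m)" for m using Suc.prems(1) A d by (intro expbd_heat_op expbd_indicator) auto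
    show "s j < s (Suc j)" if "j < k" for j using Suc.prems(2)[of j] that by simp
    \<comment> \<open>Integrability of the shortened chain is inherited from Fubini rather than
      estimated.\<close>
    show "integrable (PiM ?I (\<lambda>_. lborel)) (chain_density N s A phi k ?psi)"
      using P.integrable_fst'[OF f_int] unfolding inner .
  qed
  finally show ?case using heat_iter_Suc_right[of s A k 0] by simp
qed

section \<open>Polynomial families and the Vandermonde determinant\<close>

lemma fdet_upper_triangular:
  assumes "\<And>i j. j < i \<Longrightarrow> i < N \<Longrightarrow> a i j = 0"
  shows "fdet N a = (\<Prod>i<N. a i i :: real)"
proof -
  have "Determinant.det (Matrix.mat N N (\<lambda>(i, l). a i l)) = prod_list (diag_mat (Matrix.mat N N (\<lambda>(i, l). a i l)))"
    by (rule det_upper_triangular[of _ N]) (use assms in \<open>auto simp: upper_triangular_def\<close>)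
  also have "diag_mat (Matrix.mat N N (\<lambda>(i, l). a i l)) = map (\<lambda>i. a i i) [0..<N]" by (auto simp: diag_mat_def)
  also have "prod_list \<dots> = (\<Prod>i<N. a i i)" by (induction N) (auto simp: mult.commute)
  finally show ?thesis unfolding fdet_def .
qed

lemma fdet_mult: "fdet N (\<lambda>i j. \<Sum>k<N. a i k * b k j) = fdet N a * (fdet N b :: real)"
proof -
  have "Matrix.mat N N (\<lambda>(i, l). \<Sum>k<N. a i k * b k l) = Matrix.mat N N (\<lambda>(i, l). a i l) * Matrix.mat N N (\<lambda>(i, l). b i l)"
    by (rule eq_matI) (auto simp: scalar_prod_def lessThan_atLeast0)
  then show ?thesis unfolding fdet_def by (simp add: det_mult[of _ N])
qed

text \<open>The coefficients in the monomial basis form a triangular matrix, so only leading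
  coefficients survive.\<close>

lemma fdet_poly:
  assumes deg: "\<And>n. n < N \<Longrightarrow> degree (p n) \<le> n"
  shows "fdet N (\<lambda>n i. poly (p n) (x i)) = (\<Prod>n<N. poly.coeff (p n) n) * fdet N (\<lambda>k i. x i ^ k :: real)"
proof -
  have "fdet N (\<lambda>n i. poly (p n) (x i)) = fdet N (\<lambda>n i. \<Sum>k<N. poly.coeff (p n) k * x i ^ k)"
  proof (rule fdet_cong)
    fix n i assume n: "n < N"
    have "poly (p n) (x i) = (\<Sum>k\<le>degree (p n). poly.coeff (p n) k * x i ^ k)" by (rule poly_altdef)
    also have "\<dots> = (\<Sum>k<N. poly.coeff (p n) k * x i ^ k)"
      using deg[OF n] n by (intro sum.mono_neutral_left) (auto intro: coeff_eq_0)
    finally show "poly (p n) (x i) = (\<Sum>k<N. poly.coeff (p n) k * x i ^ k)" .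
  qed
  also have "\<dots> = fdet N (\<lambda>n k. poly.coeff (p n) k) * fdet N (\<lambda>k i. x i ^ k)" by (rule fdet_mult)
  also have "fdet N (\<lambda>n k. poly.coeff (p n) k) = fdet N (\<lambda>k n. poly.coeff (p n) k)" by (rule fdet_transpose[symmetric])
  also have "\<dots> = (\<Prod>n<N. poly.coeff (p n) n)"
    by (rule fdet_upper_triangular, rule coeff_eq_0, rule le_less_trans[OF deg]) auto
  finally show ?thesis .
qed

text \<open>Newton's basis is monic, so it may replace the monomials; evaluated at the nodes it is
  triangular, as p n vanishes at x i for i < n.\<close>

lemma fdet_powers: "fdet N (\<lambda>k i. x i ^ k) = vandermonde N x"
proof -
  define p where "p n = (\<Prod>k<n. [:- x k, 1:])" for n
  have deg: "degree (p n) = n" for n unfolding p_def by (subst degree_prod_eq_sum_degree) auto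
  have lead: "poly.coeff (p n) n = 1" for n
  proof -
    have "lead_coeff (p n) = 1" unfolding p_def by (simp add: lead_coeff_prod)
    then show ?thesis by (simp add: deg)
  qed
  have ev: "poly (p n) (x i) = (\<Prod>k<n. x i - x k)" for n i unfolding p_def by (simp add: poly_prod)
  have "fdet N (\<lambda>n i. poly (p n) (x i)) = fdet N (\<lambda>k i. x i ^ k)" using fdet_poly[of N p x] deg lead by simp
  moreover have "fdet N (\<lambda>n i. poly (p n) (x i)) = (\<Prod>i<N. poly (p i) (x i))"
    by (rule fdet_upper_triangular) (auto simp: ev)
  ultimately show ?thesis unfolding vandermonde_def ev by simp
qed

lemma heat_poly_poly: "\<exists>p. degree p \<le> n \<and> poly.coeff p n = 1 / fact n \<and> (\<forall>x. poly p x = heat_poly n s x)"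
proof (induction n rule: induct_nat_012)
  case 0 then show ?case by (intro exI[of _ 1]) auto
next
  case 1 then show ?case by (intro exI[of _ "[:0, 1:]"]) auto
next
  case (ge2 n)
  then obtain p q where p: "degree p \<le> n" "\<And>x. poly p x = heat_poly n s x"
    and q: "degree q \<le> Suc n" "poly.coeff q (Suc n) = 1 / fact (Suc n)" "\<And>x. poly q x = heat_poly (Suc n) s x" by blast
  let ?r = "Polynomial.smult (1 / real (Suc (Suc n))) (pCons 0 q - Polynomial.smult s p)"
  have "degree (pCons 0 q) \<le> Suc (Suc n)" using q(1) by (meson Suc_le_mono degree_pCons_le order_trans)
  then have d: "degree ?r \<le> Suc (Suc n)" using p(1) by (intro order_trans[OF degree_smult_le] degree_diff_le) (auto intro: order_trans[OF degree_smult_le])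
  have c: "poly.coeff p (Suc (Suc n)) = 0" using p(1) by (intro coeff_eq_0) auto
  show ?case
  proof (intro exI[of _ ?r] conjI allI d)
    show "poly.coeff ?r (Suc (Suc n)) = 1 / fact (Suc (Suc n))" using q(2) c by (simp add: field_simps)
    show "poly ?r x = heat_poly (Suc (Suc n)) s x" for x using p(2) q(3) by simp
  qed
qed

lemma fdet_heat_poly: "fdet N (\<lambda>n i. heat_poly n s (k * x i)) = (\<Prod>n<N. k ^ n / fact n) * vandermonde N x"
proof -
  obtain p where p: "\<And>n. degree (p n) \<le> n \<and> poly.coeff (p n) n = 1 / fact n \<and> (\<forall>x. poly (p n) x = heat_poly n s x)"
    using heat_poly_poly[of _ s] by metis
  have "fdet N (\<lambda>n i. heat_poly n s (k * x i)) = fdet N (\<lambda>n i. poly (p n) (k * x i))" using p by (intro fdet_cong) auto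
  also have "\<dots> = (\<Prod>n<N. poly.coeff (p n) n) * fdet N (\<lambda>j i. (k * x i) ^ j)" by (rule fdet_poly) (use p in auto)
  also have "fdet N (\<lambda>j i. (k * x i) ^ j) = (\<Prod>j<N. k ^ j) * fdet N (\<lambda>j i. x i ^ j)"
    unfolding power_mult_distrib by (rule fdet_scale_rows)
  finally show ?thesis using p by (simp add: fdet_powers prod.distrib prod_dividef)
qed

definition nibb_top :: "nat \<Rightarrow> nat \<Rightarrow> (nat \<Rightarrow> real) \<Rightarrow> (nat \<times> nat \<Rightarrow> real) set" where
  "nibb_top N k c = {x \<in> space (PiM ({..<k} \<times> {..<N}) (\<lambda>_. lborel :: real measure)). \<forall>j<k. x (j, N - 1) \<le> c j}"

section \<open>Probability that the top path is below levels at finitely many times\<close>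

lemma chain_density_measurable:
  assumes [measurable]: "\<And>n. phi n \<in> borel_measurable borel" "\<And>n. psi n \<in> borel_measurable borel" "\<And>j. A j \<in> sets borel"
  shows "chain_density N s A phi k psi \<in> borel_measurable (PiM ({..<Suc k} \<times> {..<N}) (\<lambda>_. lborel))"
proof -
  let ?P = "PiM ({..<Suc k} \<times> {..<N}) (\<lambda>_. lborel :: real measure)"
  have c: "(\<lambda>x. x (j, i)) \<in> borel_measurable ?P" if "j < Suc k" "i < N" for j i
    using measurable_component_singleton[of "(j, i)" "{..<Suc k} \<times> {..<N}" "\<lambda>_. lborel :: real measure"] that by auto
  have w: "(\<lambda>x. if weyl_chamber N (\<lambda>i. x (j, i)) then 1 else (0::real)) \<in> borel_measurable ?P" if j: "j < Suc k" for j
  proof -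
    have m: "(\<lambda>x. \<lambda>i\<in>{..<N}. x (j, i)) \<in> measurable ?P (PiM {..<N} (\<lambda>_. lborel :: real measure))"
      using c[OF j] by (intro measurable_restrict) auto
    have "(\<lambda>x. if weyl_chamber N (\<lambda>i\<in>{..<N}. x (j, i)) then 1 else (0::real)) \<in> borel_measurable ?P"
      by (intro measurable_If borel_measurable_const measurable_compose[OF m weyl_chamber_measurable, unfolded Measurable.pred_def])
    also have "(\<lambda>x. if weyl_chamber N (\<lambda>i\<in>{..<N}. x (j, i)) then 1 else (0::real)) = (\<lambda>x. if weyl_chamber N (\<lambda>i. x (j, i)) then 1 else 0)"
      by (intro ext if_cong weyl_chamber_cong) auto
    finally show ?thesis .
  qed
  show ?thesis unfolding chain_density_def[abs_def]
    by (intro borel_measurable_times borel_measurable_prod fdet_measurable w heat_kernel_measurable' c measurable_compose[OF c assms(1)]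
        measurable_compose[OF c assms(2)] measurable_compose[OF c borel_measurable_indicator[OF assms(3)]]) auto
qed

text \<open>phi and psi may be any families whose determinants are multiples of the two
  Vandermonde-Gaussian end factors of the density. These multiples and the normalisation enter both
  sides alike, and the product form of the conclusion avoids a quotient.\<close>

lemma nibb_prob:
  fixes phi psi :: "nat \<Rightarrow> real \<Rightarrow> real"
  assumes B: "nonint_bridges M N B" and N: "N \<ge> 1"
    and s0: "0 < s 0" and sk: "s k < 1" and smono: "\<And>j. j < k \<Longrightarrow> s j < s (Suc j)"
    and phi: "\<And>n. expbd (-1) (phi n)" and psi: "\<And>m. expbd 0 (psi m)"
    and c1: "c1 \<noteq> 0" "\<And>y. fdet N (\<lambda>n i. phi n (y i)) = c1 * (vandermonde N y * exp (- (\<Sum>i<N. (y i)\<^sup>2) / (2 * s 0)))"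
    and c2: "c2 \<noteq> 0" "\<And>y. fdet N (\<lambda>m i. psi m (y i)) = c2 * (vandermonde N y * exp (- (\<Sum>i<N. (y i)\<^sup>2) / (2 * (1 - s k))))"
  defines "ent \<equiv> \<lambda>A. fdet N (\<lambda>n m. \<integral>u. phi n u * (indicator (A 0) u * heat_iter s A k 0 (psi m) u) \<partial>lborel)"
  shows "measure M {\<omega> \<in> space M. \<forall>j\<le>k. B (N - 1) (s j) \<omega> \<le> c j} * ent (\<lambda>_. UNIV) = ent (\<lambda>j. {..c j})"
proof -
  let ?I = "{..<Suc k} \<times> {..<N}"
  let ?P = "PiM ?I (\<lambda>_. lborel :: real measure)"
  let ?X = "\<lambda>\<omega>. restrict (\<lambda>(j, i). B i (s j) \<omega>) ?I"
  let ?U = "nibb_fdd_unnorm N (Suc k) s"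
  let ?Z = "integral\<^sup>L ?P ?U"
  let ?f = "nibb_fdd N (Suc k) s"
  interpret prob_space M using B by (simp add: nonint_bridges_def)
  have D: "distributed M ?P ?X (\<lambda>x. ennreal (?f x))"
  proof -
    have "Suc k \<ge> 1 \<and> 0 < s 0 \<and> s (Suc k - 1) < 1 \<and> (\<forall>j. Suc j < Suc k \<longrightarrow> s j < s (Suc j))"
      using s0 sk smono by auto
    then show ?thesis using B unfolding nonint_bridges_def by blast
  qed
  have pm: "phi n \<in> borel_measurable borel" "psi n \<in> borel_measurable borel" for n using phi[of n] psi[of n] by auto
  have U: "?U x * (\<Prod>j<Suc k. \<Prod>i<N. indicator (A j) (x (j, i))) = chain_density N s A phi k psi x / (c1 * c2)" for A x
  proof (cases "\<forall>j<Suc k. weyl_chamber N (\<lambda>i. x (j, i))")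
    case True
    have "chain_density N s A phi k psi x = (\<Prod>i<N. indicator (A 0) (x (0, i))) * fdet N (\<lambda>n i. phi n (x (0, i))) *
       (\<Prod>j<k. (\<Prod>i<N. indicator (A (Suc j)) (x (Suc j, i))) * km_det N (s (Suc j) - s j) (\<lambda>i. x (j, i)) (\<lambda>i. x (Suc j, i))) *
       fdet N (\<lambda>m i. psi m (x (k, i)))"
      unfolding chain_density_def fdet_scale_cols using True by (simp add: km_det_def fdet_def[symmetric])
    also have "\<dots> = c1 * c2 * ((vandermonde N (\<lambda>i. x (0, i)) * exp (- (\<Sum>i<N. (x (0, i))\<^sup>2) / (2 * s 0)) *
        (\<Prod>j<k. km_det N (s (Suc j) - s j) (\<lambda>i. x (j, i)) (\<lambda>i. x (Suc j, i))) *
        vandermonde N (\<lambda>i. x (k, i)) * exp (- (\<Sum>i<N. (x (k, i))\<^sup>2) / (2 * (1 - s k)))) *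
        (\<Prod>j<Suc k. \<Prod>i<N. indicator (A j) (x (j, i))))"
      unfolding c1(2) c2(2) prod.distrib prod.lessThan_Suc_shift[of _ k] by (simp only: mult_ac o_def)
    also have "\<dots> = c1 * c2 * (?U x * (\<Prod>j<Suc k. \<Prod>i<N. indicator (A j) (x (j, i))))"
      unfolding nibb_fdd_unnorm_def Let_def using True by simp
    finally show ?thesis using c1(1) c2(1) by simp
  next
    case False
    then have "?U x = 0" unfolding nibb_fdd_unnorm_def Let_def by (rule if_not_P)
    moreover have "(\<Prod>j<Suc k. if weyl_chamber N (\<lambda>i. x (j, i)) then 1 else (0::real)) = 0" using False by (intro prod_zero) auto
    ultimately show ?thesis unfolding chain_density_def by simp
  qed
  have U1: "?U x = chain_density N s (\<lambda>_. UNIV) phi k psi x / (c1 * c2)" for x using U[of x "\<lambda>_. UNIV"] by simp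
  have Um: "?U \<in> borel_measurable ?P"
    unfolding U1[abs_def] using chain_density_measurable[of phi psi "\<lambda>_. UNIV" N s k] pm by simp
  have one: "(\<integral>\<^sup>+x. ennreal (?f x) \<partial>?P) = 1"
  proof -
    have "(\<integral>\<^sup>+x. ennreal (?f x) * 1 \<partial>?P) = (\<integral>\<^sup>+\<omega>. 1 \<partial>M)" by (rule distributed_nn_integral[OF D]) simp
    then show ?thesis using emeasure_space_1 by simp
  qed
  have f_eq: "?f x = ?U x / ?Z" for x by (simp add: nibb_fdd_def)
  \<comment> \<open>With a zero normalisation, division by zero would make the density 0, against
    total mass 1.\<close>
  have Z: "?Z \<noteq> 0"
  proof
    assume "?Z = 0"
    then have "?f x = 0" for x by (simp add: f_eq)
    then show False using one by simp
  qed
  \<comment> \<open>A nonzero Bochner integral certifies integrability, since the default value is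
    0.\<close>
  have Ui: "integrable ?P ?U" using Z not_integrable_integral_eq by blast
  have fi: "integrable ?P ?f" unfolding f_eq[abs_def] using Ui by simp
  have f1: "integral\<^sup>L ?P ?f = 1" unfolding f_eq[abs_def] using Z by simp
  \<comment> \<open>Nonnegativity of the density is obtained without positivity of the
    Karlin-McGregor determinants: the positive part has the same integral 1, hence agrees with the
    density almost everywhere.\<close>
  have fmax: "integrable ?P (\<lambda>x. max (?f x) 0)" using fi by (intro integrable_max) auto
  have "integral\<^sup>L ?P (\<lambda>x. max (?f x) 0) = 1"
  proof -
    have "ennreal (integral\<^sup>L ?P (\<lambda>x. max (?f x) 0)) = (\<integral>\<^sup>+x. ennreal (max (?f x) 0) \<partial>?P)"
      by (rule nn_integral_eq_integral[symmetric, OF fmax]) auto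
    also have "\<dots> = (\<integral>\<^sup>+x. ennreal (?f x) \<partial>?P)" by (intro nn_integral_cong) (auto simp: max_def ennreal_neg)
    finally show ?thesis using one by (simp add: ennreal_eq_1)
  qed
  then have "(\<integral>x. max (?f x) 0 - ?f x \<partial>?P) = 0" using fmax fi f1 by simp
  then have "AE x in ?P. max (?f x) 0 - ?f x = 0"
    by (subst (asm) integral_nonneg_eq_0_iff_AE) (use fmax fi in auto)
  then have pos: "AE x in ?P. 0 \<le> ?f x" by eventually_elim auto
  let ?T = "nibb_top N (Suc k) c"
  have c: "(\<lambda>x. x (j, N - 1)) \<in> borel_measurable ?P" if "j < Suc k" for j
    using measurable_component_singleton[of "(j, N - 1)" ?I "\<lambda>_. lborel :: real measure"] that N by auto
  have Tm: "?T \<in> sets ?P"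
  proof -
    have "?T = {x \<in> space ?P. \<forall>j\<in>{..<Suc k}. x (j, N - 1) \<le> c j}" unfolding nibb_top_def by auto
    also have "\<dots> \<in> sets ?P" by (intro sets.sets_Collect_finite_All borel_measurable_le c) auto
    finally show ?thesis .
  qed
  \<comment> \<open>In the chamber a bound on the top particle bounds all of them; outside, both
    sides vanish.\<close>
  have ind: "indicator ?T x * ?f x = chain_density N s (\<lambda>j. {..c j}) phi k psi x / (c1 * c2) / ?Z" if x: "x \<in> space ?P" for x
  proof (cases "\<forall>j<Suc k. weyl_chamber N (\<lambda>i. x (j, i))")
    case True
    have "indicator ?T x = (\<Prod>j<Suc k. \<Prod>i<N. indicator {..c j} (x (j, i)) :: real)"
    proof (cases "x \<in> ?T")
      case T: True
      have "x (j, i) \<le> c j" if j: "j < Suc k" and i: "i < N" for j i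
      proof -
        have "x (j, i) \<le> x (j, N - 1)"
        proof (cases "i = N - 1")
          case False
          then have iN: "i < N - 1" using i by simp
          have "sorted_wrt (<) (map (\<lambda>i. x (j, i)) [0..<N])" using True j by (simp add: weyl_chamber_iff_sorted)
          from sorted_wrt_nth_less[OF this iN] show ?thesis using N iN by simp
        qed simp
        also have "\<dots> \<le> c j" using T j by (auto simp: nibb_top_def)
        finally show ?thesis .
      qed
      then have "(\<Prod>j<Suc k. \<Prod>i<N. indicator {..c j} (x (j, i)) :: real) = (\<Prod>j<Suc k. \<Prod>i<N. 1)" by (intro prod.cong) auto
      then show ?thesis using T by simp
    next
      case F: False
      then obtain j where j: "j < Suc k" "\<not> x (j, N - 1) \<le> c j" using x by (auto simp: nibb_top_def)
      have z: "(\<Prod>i<N. indicator {..c j} (x (j, i)) :: real) = 0" using j N by (intro prod_zero bexI[of _ "N - 1"]) auto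
      have "(\<Prod>j<Suc k. \<Prod>i<N. indicator {..c j} (x (j, i)) :: real) = 0"
      proof (rule prod_zero)
        show "\<exists>j\<in>{..<Suc k}. (\<Prod>i<N. indicator {..c j} (x (j, i)) :: real) = 0" using z j(1) by blast
      qed simp
      then show ?thesis using F by simp
    qed
    then show ?thesis unfolding f_eq U[symmetric] by simp
  next
    case False
    then have "?U x = 0" unfolding nibb_fdd_unnorm_def Let_def by (rule if_not_P)
    moreover have "(\<Prod>j<Suc k. if weyl_chamber N (\<lambda>i. x (j, i)) then 1 else (0::real)) = 0" using False by (intro prod_zero) auto
    ultimately show ?thesis unfolding chain_density_def f_eq by simp
  qed
  have iT: "integrable ?P (\<lambda>x. indicator ?T x * ?f x)"
    using integrable_mult_indicator[OF Tm fi] by simp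
  have chain_int: "integrable ?P (chain_density N s (\<lambda>j. {..c j}) phi k psi)"
  proof -
    have "integrable ?P (\<lambda>x. c1 * c2 * ?Z * (indicator ?T x * ?f x))" using iT by simp
    then show ?thesis
      by (rule Bochner_Integration.integrable_cong[THEN iffD1, OF refl, rotated]) (use ind Z c1(1) c2(1) in simp)
  qed
  have "{\<omega> \<in> space M. \<forall>j\<le>k. B (N - 1) (s j) \<omega> \<le> c j} = ?X -` ?T \<inter> space M"
    using N by (auto simp: nibb_top_def space_PiM less_Suc_eq_le)
  then have "emeasure M {\<omega> \<in> space M. \<forall>j\<le>k. B (N - 1) (s j) \<omega> \<le> c j} = (\<integral>\<^sup>+x. ennreal (?f x) * indicator ?T x \<partial>?P)"
    using distributed_emeasure[OF D Tm] by simp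
  also have "\<dots> = (\<integral>\<^sup>+x. ennreal (indicator ?T x * ?f x) \<partial>?P)"
    by (intro nn_integral_cong) (auto simp: indicator_def)
  also have "\<dots> = ennreal (\<integral>x. indicator ?T x * ?f x \<partial>?P)"
    by (rule nn_integral_eq_integral[OF iT]) (use pos in eventually_elim, auto)
  finally have "measure M {\<omega> \<in> space M. \<forall>j\<le>k. B (N - 1) (s j) \<omega> \<le> c j} = (\<integral>x. indicator ?T x * ?f x \<partial>?P)"
    unfolding measure_def using pos by (subst enn2real_ennreal[symmetric]) (auto intro!: integral_nonneg_AE elim: eventually_mono)
  also have "\<dots> = (\<integral>x. chain_density N s (\<lambda>j. {..c j}) phi k psi x / (c1 * c2) / ?Z \<partial>?P)"
    by (rule Bochner_Integration.integral_cong[OF refl ind])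
  also have "\<dots> = (\<integral>x. chain_density N s (\<lambda>j. {..c j}) phi k psi x \<partial>?P) / (c1 * c2) / ?Z" by simp
  also have "(\<integral>x. chain_density N s (\<lambda>j. {..c j}) phi k psi x \<partial>?P) = ent (\<lambda>j. {..c j})"
    unfolding ent_def by (rule chain_integral[OF phi psi _ smono chain_int]) auto
  finally have R: "measure M {\<omega> \<in> space M. \<forall>j\<le>k. B (N - 1) (s j) \<omega> \<le> c j} = ent (\<lambda>j. {..c j}) / (c1 * c2) / ?Z" .
  have "integrable ?P (\<lambda>x. c1 * c2 * ?U x)" using Ui by simp
  then have chain_int1: "integrable ?P (chain_density N s (\<lambda>_. UNIV) phi k psi)" unfolding U1 using c1(1) c2(1) by simp
  have "?Z = (\<integral>x. chain_density N s (\<lambda>_. UNIV) phi k psi x \<partial>?P) / (c1 * c2)" unfolding U1 by simp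
  also have "(\<integral>x. chain_density N s (\<lambda>_. UNIV) phi k psi x \<partial>?P) = ent (\<lambda>_. UNIV)"
    unfolding ent_def by (rule chain_integral[OF phi psi _ smono chain_int1]) auto
  finally have Zeq: "?Z = ent (\<lambda>_. UNIV) / (c1 * c2)" .
  then have "ent (\<lambda>_. UNIV) \<noteq> 0" using Z by auto
  then show ?thesis using R c1(1) c2(1) unfolding Zeq by simp
qed

section \<open>Finite-dimensional distributions of the top path\<close>

lemma tau_of_pos: "0 < t \<Longrightarrow> t < 1 \<Longrightarrow> tau_of t > 0"
  unfolding tau_of_def by simp

lemma tau_of_less:
  assumes "t < t'" "t' < 1"
  shows "tau_of t < tau_of t'"
proof -
  have "t / (1 - t) < t' / (1 - t')" using assms by (simp add: divide_simps) (simp add: algebra_simps)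
  then show ?thesis unfolding tau_of_def by (intro mult_strict_left_mono) auto
qed

lemma one_plus_tau_of: "t < 1 \<Longrightarrow> 1 + 4 * tau_of t = 1 / (1 - t)"
  unfolding tau_of_def by (simp add: field_simps)

text \<open>The bridge at time t and position bridge_pt r t u corresponds to a Brownian motion at time 2 tau and
  position u; bridge_wt is the weight of the accompanying h-transform.\<close>

definition bridge_pt :: "real \<Rightarrow> real \<Rightarrow> real \<Rightarrow> real" where
  "bridge_pt r t u = r + sqrt 2 * (1 - t) * u"

definition bridge_wt :: "real \<Rightarrow> real \<Rightarrow> real" where
  "bridge_wt t u = exp (- ((1 - t) * u\<^sup>2)) / sqrt (1 - t)"

lemma integral_bridge_pt:
  fixes f :: "real \<Rightarrow> real"
  assumes "t < 1"
  shows "(\<integral>x. f x \<partial>lborel) = (\<integral>u. sqrt 2 * (1 - t) * f (bridge_pt r t u) \<partial>lborel)"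
  using lborel_integral_real_affine[of "sqrt 2 * (1 - t)" f r] assms by (simp add: bridge_pt_def abs_mult)

text \<open>The factor sqrt 2 (1 - t') is the Jacobian of \<open>bridge_pt\<close>. Both sides are
  Gaussian in u and v, so the claim is the equality of two quadratic forms and of two
  constants.\<close>

lemma heat_kernel_bridge:
  assumes "t < t'" "t' < 1"
  shows "sqrt 2 * (1 - t') * (heat_kernel (t' - t) (bridge_pt r t u) (bridge_pt r t' v) * bridge_wt t' v)
     = bridge_wt t u * heat_kernel (2 * tau_of t' - 2 * tau_of t) u v"
proof -
  \<comment> \<open>In these variables the new time difference is (a - b) / (2 a b).\<close>
  define a b where "a = 1 - t" and "b = 1 - t'"
  have ab: "0 < b" "b < a" using assms by (auto simp: a_def b_def)
  have tt: "2 * tau_of t' - 2 * tau_of t = (a - b) / (2 * (a * b))" "t' - t = a - b"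
  proof -
    have t1: "tau_of t = (1 / a - 1) / 4" "tau_of t' = (1 / b - 1) / 4" using assms by (simp_all add: tau_of_def a_def b_def field_simps)
    then show "2 * tau_of t' - 2 * tau_of t = (a - b) / (2 * (a * b))" unfolding t1 using ab by (simp add: field_simps)
  qed (simp add: a_def b_def)
  have pt: "bridge_pt r t u - bridge_pt r t' v = sqrt 2 * (a * u - b * v)" by (simp add: bridge_pt_def a_def b_def algebra_simps)
  have sq: "(sqrt 2 * (a * u - b * v))\<^sup>2 / (2 * (a - b)) = (a * u - b * v)\<^sup>2 / (a - b)"
    by (simp add: power_mult_distrib del: right_diff_distrib_numeral)
  have e: "- ((a * u - b * v)\<^sup>2 / (a - b)) + - (b * v\<^sup>2) = - (a * u\<^sup>2) + - ((u - v)\<^sup>2 / (2 * ((a - b) / (2 * (a * b)))))"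
    using ab by (simp add: field_simps power2_eq_square)
  have n: "sqrt 2 * b / sqrt b / sqrt (2 * pi * (a - b)) = 1 / sqrt a / sqrt (2 * pi * ((a - b) / (2 * (a * b))))"
  proof -
    define Q where "Q = sqrt (2 * pi * (a - b))"
    have 1: "sqrt (2 * pi * ((a - b) / (2 * (a * b)))) = Q / (sqrt 2 * sqrt a * sqrt b)"
      unfolding Q_def real_sqrt_mult[symmetric] real_sqrt_divide[symmetric] by (simp add: mult_ac)
    have "sqrt b * sqrt b = b" using ab by simp
    then have 2: "sqrt 2 * b / sqrt b = sqrt 2 * sqrt b" using ab by (simp add: field_simps)
    show ?thesis unfolding 1 2 Q_def[symmetric] using ab by simp
  qed
  have "sqrt 2 * b * (heat_kernel (a - b) (bridge_pt r t u) (bridge_pt r t' v) * bridge_wt t' v)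
     = (sqrt 2 * b / sqrt b / sqrt (2 * pi * (a - b))) * exp (- ((a * u - b * v)\<^sup>2 / (a - b)) + - (b * v\<^sup>2))"
    unfolding heat_kernel_def bridge_wt_def pt b_def[symmetric] exp_add minus_divide_left[symmetric] sq by simp
  also have "\<dots> = bridge_wt t u * heat_kernel ((a - b) / (2 * (a * b))) u v"
    unfolding heat_kernel_def bridge_wt_def a_def[symmetric] n e exp_add minus_divide_left[symmetric] by simp
  finally show ?thesis unfolding tt b_def[symmetric] .
qed

text \<open>The weights telescope: \<open>heat_kernel_bridge\<close> exchanges the weight at an
  arrival point for the one at the departure point, which is the arrival weight of the step
  before.\<close>

lemma heat_iter_bridge:
  assumes s: "\<And>i. j \<le> i \<Longrightarrow> i < j + n \<Longrightarrow> s i < s (Suc i)" "s (j + n) < 1"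
    and g: "\<And>v. g (bridge_pt r (s (j + n)) v) = bridge_wt (s (j + n)) v * g' v"
  shows "heat_iter s A n j g (bridge_pt r (s j) u) = bridge_wt (s j) u * heat_iter (\<lambda>j. 2 * tau_of (s j)) (\<lambda>j. {v. bridge_pt r (s j) v \<in> A j}) n j g' u"
  using s g
proof (induction n arbitrary: j u)
  case (Suc n)
  let ?A = "\<lambda>j. {v. bridge_pt r (s j) v \<in> A j}"
  let ?G = "heat_iter (\<lambda>j. 2 * tau_of (s j)) ?A n (Suc j) g'"
  have lt: "s j < s (Suc j)" using Suc.prems(1)[of j] by simp
  \<comment> \<open>Monotonicity carries the bound by 1 from the last time back to the first arrival
    time.\<close>
  have le: "s (Suc j) \<le> s (Suc j + m)" if "m \<le> n" for m
    using that
  proof (induction m)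
    case (Suc m)
    then have "s (Suc j + m) < s (Suc (Suc j + m))" using Suc.prems by (intro \<open>\<And>i. j \<le> i \<Longrightarrow> i < j + Suc n \<Longrightarrow> s i < s (Suc i)\<close>) auto
    then show ?case using Suc by simp
  qed simp
  have lt1: "s (Suc j) < 1" using le[of n] Suc.prems(2) by simp
  have IH: "heat_iter s A n (Suc j) g (bridge_pt r (s (Suc j)) v) = bridge_wt (s (Suc j)) v * ?G v" for v
  proof (rule Suc.IH)
    show "s i < s (Suc i)" if "Suc j \<le> i" "i < Suc j + n" for i using Suc.prems(1)[of i] that by simp
    show "s (Suc j + n) < 1" using Suc.prems(2) by simp
    show "g (bridge_pt r (s (Suc j + n)) v) = bridge_wt (s (Suc j + n)) v * g' v" for v using Suc.prems(3)[of v] by simp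
  qed
  have "heat_iter s A (Suc n) j g (bridge_pt r (s j) u) = (\<integral>v. sqrt 2 * (1 - s (Suc j)) * (heat_kernel (s (Suc j) - s j) (bridge_pt r (s j) u) (bridge_pt r (s (Suc j)) v) *
      (indicator (A (Suc j)) (bridge_pt r (s (Suc j)) v) * (bridge_wt (s (Suc j)) v * ?G v))) \<partial>lborel)"
    by (simp only: heat_iter.simps IH[symmetric]) (rule integral_bridge_pt[OF lt1])
  also have "\<dots> = (\<integral>v. bridge_wt (s j) u * (heat_kernel (2 * tau_of (s (Suc j)) - 2 * tau_of (s j)) u v * (indicator (?A (Suc j)) v * ?G v)) \<partial>lborel)"
  proof (rule Bochner_Integration.integral_cong[OF refl])
    fix v
    have i: "indicator (A (Suc j)) (bridge_pt r (s (Suc j)) v) = (indicator (?A (Suc j)) v :: real)" by (simp add: indicator_def)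
    have "sqrt 2 * (1 - s (Suc j)) * (heat_kernel (s (Suc j) - s j) (bridge_pt r (s j) u) (bridge_pt r (s (Suc j)) v) *
      (indicator (A (Suc j)) (bridge_pt r (s (Suc j)) v) * (bridge_wt (s (Suc j)) v * ?G v)))
      = (sqrt 2 * (1 - s (Suc j)) * (heat_kernel (s (Suc j) - s j) (bridge_pt r (s j) u) (bridge_pt r (s (Suc j)) v) * bridge_wt (s (Suc j)) v)) * (indicator (?A (Suc j)) v * ?G v)"
      unfolding i by (simp only: mult_ac)
    then show "sqrt 2 * (1 - s (Suc j)) * (heat_kernel (s (Suc j) - s j) (bridge_pt r (s j) u) (bridge_pt r (s (Suc j)) v) *
      (indicator (A (Suc j)) (bridge_pt r (s (Suc j)) v) * (bridge_wt (s (Suc j)) v * ?G v)))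
      = bridge_wt (s j) u * (heat_kernel (2 * tau_of (s (Suc j)) - 2 * tau_of (s j)) u v * (indicator (?A (Suc j)) v * ?G v))"
      unfolding heat_kernel_bridge[OF lt lt1] by (simp only: mult.assoc)
  qed
  finally show ?case by simp
qed simp

section \<open>The end functions in bridge coordinates\<close>

definition bridge_inv :: "real \<Rightarrow> real \<Rightarrow> real \<Rightarrow> real" where
  "bridge_inv r t x = (x - r) / (sqrt 2 * (1 - t))"

lemma bridge_inv_pt: "t < 1 \<Longrightarrow> bridge_inv r t (bridge_pt r t u) = u"
  by (simp add: bridge_inv_def bridge_pt_def)

lemma xi_of_bridge_inv: "t < 1 \<Longrightarrow> xi_of r (tau_of t) (bridge_inv r t x) = 1 / (sqrt 2 * (1 - t)) * x"
  unfolding xi_of_def one_plus_tau_of bridge_inv_def by (simp add: diff_divide_distrib)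

text \<open>The dependence on r collapses to the constant r^2 / 2, leaving the Gaussian that
  accounts for the return to 0 at time 1.\<close>

lemma bridge_exponent:
  fixes r x :: real
  assumes "t < 1"
  defines "u \<equiv> bridge_inv r t x"
  shows "(1 - t) * u\<^sup>2 + (sqrt 2 * r * u + 2 * r\<^sup>2 * tau_of t) = x\<^sup>2 / (2 * (1 - t)) - r\<^sup>2 / 2"
proof -
  define a where "a = 1 - t"
  have a: "a > 0" using assms by (simp add: a_def)
  have x: "x = r + sqrt 2 * a * u" using a unfolding u_def bridge_inv_def a_def[symmetric] by simp
  have s: "sqrt 2 * sqrt 2 = 2" "sqrt 2 * (sqrt 2 * z) = 2 * z" for z by (simp_all add: mult.assoc[symmetric])
  have "2 * r\<^sup>2 * tau_of t = r\<^sup>2 / (2 * a) - r\<^sup>2 / 2" unfolding tau_of_def a_def using assms by (simp add: field_simps)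
  moreover have "x\<^sup>2 / (2 * a) = r\<^sup>2 / (2 * a) + sqrt 2 * r * u + a * u\<^sup>2"
    unfolding x using a by (simp add: power2_eq_square field_simps s)
  ultimately show ?thesis unfolding a_def[symmetric] by simp
qed

text \<open>The weight divides here and multiplies in \<open>psiB\<close>, and the Jacobian is
  placed here, so that pairings in bridge coordinates equal those of \<open>PhiF\<close> and
  \<open>PsiF\<close>.\<close>

definition phiB :: "real \<Rightarrow> real \<Rightarrow> nat \<Rightarrow> real \<Rightarrow> real" where
  "phiB r t n x = PhiF r (tau_of t) n (bridge_inv r t x) / (sqrt 2 * (1 - t) * bridge_wt t (bridge_inv r t x))"

definition psiB :: "real \<Rightarrow> real \<Rightarrow> nat \<Rightarrow> real \<Rightarrow> real" where
  "psiB r t m x = bridge_wt t (bridge_inv r t x) * PsiF r (tau_of t) m (bridge_inv r t x)"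

lemma psiB_eq:
  assumes "t < 1"
  shows "psiB r t m x = (2 ^ m * heat_poly m (2 * tau_of t) (1 / (sqrt 2 * (1 - t)) * x)) * (exp (r\<^sup>2 / 2) / sqrt (1 - t) * exp (- x\<^sup>2 / (2 * (1 - t))))"
proof -
  let ?u = "bridge_inv r t x"
  have e: "exp (- ((1 - t) * ?u\<^sup>2)) * exp (- (sqrt 2 * r * ?u + 2 * r\<^sup>2 * tau_of t)) = exp (r\<^sup>2 / 2) * exp (- x\<^sup>2 / (2 * (1 - t)))"
    unfolding exp_add[symmetric] using bridge_exponent[OF assms, of r x] by (intro arg_cong[where f=exp]) simp
  have gen: "A / q * (B * H) = H * ((A * B) / q)" for A B H q :: real by (simp add: divide_inverse mult_ac)
  show ?thesis unfolding psiB_def PsiF_def bridge_wt_def xi_of_bridge_inv[OF assms] gen e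
    by (simp only: times_divide_eq_left)
qed

lemma phiB_eq:
  assumes "0 < t" "t < 1"
  shows "phiB r t n x = (fact n / (4 * tau_of t) ^ n * heat_poly n (2 * tau_of t) (1 / (sqrt 2 * (1 - t)) * x)) *
     (exp (- r\<^sup>2 / 2) / (sqrt (2 * pi * (2 * tau_of t)) * (sqrt 2 * (1 - t) / sqrt (1 - t))) * exp (- x\<^sup>2 / (2 * t)))"
proof -
  let ?u = "bridge_inv r t x" and ?x = "1 / (sqrt 2 * (1 - t)) * x"
  have e: "exp (sqrt 2 * r * ?u + 2 * r\<^sup>2 * tau_of t) * exp (- (0 - ?x)\<^sup>2 / (2 * (2 * tau_of t))) * exp ((1 - t) * ?u\<^sup>2) = exp (- r\<^sup>2 / 2) * exp (- x\<^sup>2 / (2 * t))"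
  proof -
    \<comment> \<open>By 1 / (t (1 - t)) = 1 / t + 1 / (1 - t) the exponent of \<open>PhiF\<close>
      splits; the second part cancels by \<open>bridge_exponent\<close>, and the first is the
      entrance law from 0.\<close>
    have "(0 - ?x)\<^sup>2 / (2 * (2 * tau_of t)) = x\<^sup>2 / (2 * (1 - t)) + x\<^sup>2 / (2 * t)"
      using assms unfolding tau_of_def by (simp add: power_divide power_mult_distrib) (simp add: divide_simps power2_eq_square, simp add: algebra_simps)
    then show ?thesis unfolding exp_add[symmetric] using bridge_exponent[OF assms(2), of r x] by (intro arg_cong[where f=exp]) simp
  qed
  have gen: "(A * (F * (B / q1 * H))) / (D * (inverse E / q2)) = (F * H) / (q1 * (D / q2)) * (A * B * E)" for A B D E F H q1 q2 :: real
    by (simp add: divide_inverse mult_ac)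
  have gen': "X / Q * (a * b) = X * (a / Q * b)" for X Q a b :: real by (simp add: divide_inverse mult_ac)
  show ?thesis
    unfolding phiB_def PhiF_def bridge_wt_def xi_of_bridge_inv[OF assms(2)] heat_kernel_def exp_minus[of "(1 - t) * ?u\<^sup>2"] gen e
    by (rule gen')
qed

lemma fdet_gauss_heat_poly:
  "fdet N (\<lambda>n i. (a n * heat_poly n s (k * y i)) * (K * exp (- (y i)\<^sup>2 / (2 * b)))) =
   ((\<Prod>n<N. a n) * (\<Prod>n<N. k ^ n / fact n) * K ^ N) * (vandermonde N y * exp (- (\<Sum>i<N. (y i)\<^sup>2) / (2 * b)))"
proof -
  have "(\<Prod>i<N. K * exp (- (y i)\<^sup>2 / (2 * b))) = K ^ N * exp (- (\<Sum>i<N. (y i)\<^sup>2) / (2 * b))"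
    by (simp add: prod.distrib exp_sum[symmetric] sum_divide_distrib sum_negf)
  then show ?thesis unfolding fdet_scale_cols fdet_scale_rows fdet_heat_poly by simp
qed

lemma expbd_scale_arg:
  assumes "expbd c f" "c \<ge> 0"
  shows "expbd (c * \<bar>k\<bar>) (\<lambda>x. f (k * x))"
proof -
  obtain C where C: "C \<ge> 0" "\<And>x. \<bar>f x\<bar> \<le> C * exp (c * \<bar>x\<bar>)" using assms(1) by (rule expbdE) blast
  have [measurable]: "f \<in> borel_measurable borel" using assms(1) by auto
  show ?thesis by (rule expbdI[where C=C]) (use C(2)[of "k * _"] in \<open>auto simp: abs_mult mult.assoc\<close>)
qed

lemma expbd_heat_poly_gauss:
  assumes "b > 0"
  shows "expbd c (\<lambda>x. (a * heat_poly n s (k * x)) * (K * exp (- x\<^sup>2 / (2 * b))))"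
proof -
  have "expbd (1 * \<bar>k\<bar>) (\<lambda>x. heat_poly n s (k * x))" by (rule expbd_scale_arg[OF expbd_heat_poly]) auto
  from expbd_mult[OF this expbd_heat_kernel[OF assms, of "c - 1 * \<bar>k\<bar>" 0]]
  have "expbd c (\<lambda>x. (a * K * sqrt (2 * pi * b)) * (heat_poly n s (k * x) * heat_kernel b 0 x))" by (intro expbd_cmult) simp
  also have "(\<lambda>x. (a * K * sqrt (2 * pi * b)) * (heat_poly n s (k * x) * heat_kernel b 0 x)) = (\<lambda>x. (a * heat_poly n s (k * x)) * (K * exp (- x\<^sup>2 / (2 * b))))"
    using assms by (auto simp: heat_kernel_def fun_eq_iff)
  finally show ?thesis .
qed

lemma heat_iter_UNIV_PsiF:
  assumes "\<And>i. j \<le> i \<Longrightarrow> i < j + n \<Longrightarrow> \<tau> i < \<tau> (Suc i)"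
  shows "heat_iter (\<lambda>j. 2 * \<tau> j) (\<lambda>_. UNIV) n j (PsiF r (\<tau> (j + n)) m) = PsiF r (\<tau> j) m"
  using assms
proof (induction n arbitrary: j)
  case (Suc n)
  have "heat_iter (\<lambda>j. 2 * \<tau> j) (\<lambda>_. UNIV) n (Suc j) (PsiF r (\<tau> (Suc j + n)) m) = PsiF r (\<tau> (Suc j)) m"
    using Suc.prems by (intro Suc.IH) auto
  moreover have "(\<integral>v. heat_kernel (2 * \<tau> (Suc j) - 2 * \<tau> j) u v * PsiF r (\<tau> (Suc j)) m v \<partial>lborel) = PsiF r (\<tau> j) m u" for u
    using PsiF_heat[of "\<tau> (Suc j) - \<tau> j" u r "\<tau> j" m] Suc.prems[of j] by (simp add: right_diff_distrib)
  ultimately show ?case by (simp add: fun_eq_iff)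
qed simp

text \<open>Without levels the entries are the biorthogonality relations, so the normalising
  determinant is 1 and no quotient appears. Here r is a free parameter that only selects
  coordinates.\<close>

lemma fdd_det:
  assumes B: "nonint_bridges M N B" and N: "N \<ge> 1"
    and s0: "0 < s 0" and sk: "s k < 1" and smono: "\<And>j. j < k \<Longrightarrow> s j < s (Suc j)"
  shows "measure M {\<omega> \<in> space M. \<forall>j\<le>k. B (N - 1) (s j) \<omega> \<le> c j} =
    fdet N (\<lambda>n m. \<integral>u. PhiF r (tau_of (s 0)) n u * (indicator {..bridge_inv r (s 0) (c 0)} u *
      heat_iter (\<lambda>j. 2 * tau_of (s j)) (\<lambda>j. {v. bridge_pt r (s j) v \<le> c j}) k 0 (PsiF r (tau_of (s k)) m) u) \<partial>lborel)"
proof -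
  have mono: "s i \<le> s j" if "i \<le> j" "j \<le> k" for i j
    using that
  proof (induction j)
    case (Suc j)
    then show ?case using smono[of j] by (cases "i = Suc j") auto
  qed simp
  have s01: "0 < s 0" "s 0 < 1" "0 < s k" "s k < 1" using mono[of 0 k] s0 sk by auto
  have tp: "tau_of (s 0) > 0" "tau_of (s k) > 0" using s01 by (auto intro: tau_of_pos)
  let ?phi = "phiB r (s 0)" and ?psi = "psiB r (s k)"
  let ?ent = "\<lambda>A. fdet N (\<lambda>n m. \<integral>u. ?phi n u * (indicator (A 0) u * heat_iter s A k 0 (?psi m) u) \<partial>lborel)"
  let ?k0 = "1 / (sqrt 2 * (1 - s 0))" and ?k1 = "1 / (sqrt 2 * (1 - s k))"
  let ?K0 = "exp (- r\<^sup>2 / 2) / (sqrt (2 * pi * (2 * tau_of (s 0))) * (sqrt 2 * (1 - s 0) / sqrt (1 - s 0)))"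
  let ?K1 = "exp (r\<^sup>2 / 2) / sqrt (1 - s k)"
  let ?c1 = "(\<Prod>n<N. fact n / (4 * tau_of (s 0)) ^ n) * (\<Prod>n<N. ?k0 ^ n / fact n) * ?K0 ^ N"
  let ?c2 = "(\<Prod>n<N. 2 ^ n) * (\<Prod>n<N. ?k1 ^ n / fact n) * ?K1 ^ N"
  have P: "measure M {\<omega> \<in> space M. \<forall>j\<le>k. B (N - 1) (s j) \<omega> \<le> c j} * ?ent (\<lambda>_. UNIV) = ?ent (\<lambda>j. {..c j})"
  proof (rule nibb_prob[OF B N s0 sk smono, where ?c1.0="?c1" and ?c2.0="?c2"])
    show "expbd (- 1) (?phi n)" for n unfolding phiB_eq[OF s01(1,2), abs_def] by (rule expbd_heat_poly_gauss[OF s01(1)])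
    show "expbd 0 (?psi m)" for m unfolding psiB_eq[OF s01(4), abs_def] by (rule expbd_heat_poly_gauss) (use s01 in simp)
    show "?c1 \<noteq> 0" using s01 tp by simp
    show "?c2 \<noteq> 0" using s01 by simp
    show "fdet N (\<lambda>n i. ?phi n (y i)) = ?c1 * (vandermonde N y * exp (- (\<Sum>i<N. (y i)\<^sup>2) / (2 * s 0)))" for y
      unfolding phiB_eq[OF s01(1,2)] by (rule fdet_gauss_heat_poly)
    show "fdet N (\<lambda>m i. ?psi m (y i)) = ?c2 * (vandermonde N y * exp (- (\<Sum>i<N. (y i)\<^sup>2) / (2 * (1 - s k))))" for y
      unfolding psiB_eq[OF s01(4)] by (rule fdet_gauss_heat_poly)
  qed auto
  have ent: "(\<integral>u. ?phi n u * (indicator (A 0) u * heat_iter s A k 0 (?psi m) u) \<partial>lborel) =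
     (\<integral>u. PhiF r (tau_of (s 0)) n u * (indicator {v. bridge_pt r (s 0) v \<in> A 0} u *
        heat_iter (\<lambda>j. 2 * tau_of (s j)) (\<lambda>j. {v. bridge_pt r (s j) v \<in> A j}) k 0 (PsiF r (tau_of (s k)) m) u) \<partial>lborel)" for A n m
  proof -
    have kb: "heat_iter s A k 0 (?psi m) (bridge_pt r (s 0) u) = bridge_wt (s 0) u * heat_iter (\<lambda>j. 2 * tau_of (s j)) (\<lambda>j. {v. bridge_pt r (s j) v \<in> A j}) k 0 (PsiF r (tau_of (s k)) m) u" for u
      by (rule heat_iter_bridge) (use smono sk in \<open>auto simp: psiB_def bridge_inv_pt\<close>)
    have "bridge_wt (s 0) u > 0" for u using s01 by (simp add: bridge_wt_def)
    then have ph: "sqrt 2 * (1 - s 0) * ?phi n (bridge_pt r (s 0) u) * bridge_wt (s 0) u = PhiF r (tau_of (s 0)) n u" for u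
      using s01 by (simp add: phiB_def bridge_inv_pt less_imp_neq[symmetric])
    show ?thesis
      unfolding integral_bridge_pt[OF s01(2), of "\<lambda>u. ?phi n u * (indicator (A 0) u * heat_iter s A k 0 (?psi m) u)" r] kb ph[symmetric]
      by (rule Bochner_Integration.integral_cong) (auto simp: indicator_def)
  qed
  have "?ent (\<lambda>_. UNIV) = fdet N (\<lambda>n m. if n = m then 1 else 0)"
  proof (rule fdet_cong)
    fix n m
    have "heat_iter (\<lambda>j. 2 * tau_of (s j)) (\<lambda>j. UNIV) k 0 (PsiF r (tau_of (s k)) m) = PsiF r (tau_of (s 0)) m"
    proof (rule heat_iter_UNIV_PsiF[where \<tau>="\<lambda>j. tau_of (s j)" and j=0, simplified])
      show "tau_of (s i) < tau_of (s (Suc i))" if "i < k" for i using smono[OF that] mono[of "Suc i" k] sk that by (intro tau_of_less) auto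
    qed
    then show "(\<integral>u. ?phi n u * (indicator ((\<lambda>_. UNIV) 0) u * heat_iter s (\<lambda>_. UNIV) k 0 (?psi m) u) \<partial>lborel) = (if n = m then 1 else 0)"
      unfolding ent[of n "\<lambda>_. UNIV" m] using PhiF_PsiF_orthogonal[OF tp(1), of r n m] by simp
  qed
  also have "\<dots> = 1" by (subst fdet_upper_triangular) auto
  finally have one: "?ent (\<lambda>_. UNIV) = 1" .
  have i0: "{v. bridge_pt r (s 0) v \<in> {..c 0}} = {..bridge_inv r (s 0) (c 0)}"
    using s01 by (auto simp: bridge_pt_def bridge_inv_def field_simps)
  show ?thesis using P unfolding one ent[of _ "\<lambda>j. {..c j}" _] i0 by simp
qed

section \<open>Brownian motion below a barrier\<close>

text \<open>It suffices that F absorbs the growth of g, because the heat step preserves the rate of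
  that growth.\<close>

lemma heat_fubini:
  assumes [measurable]: "F \<in> borel_measurable borel" and g: "expbd c g" and t: "t > 0"
    and int: "integrable lborel (\<lambda>y. F y * exp (c * \<bar>y\<bar>))"
  shows "(\<integral>y. F y * (\<integral>v. heat_kernel t y v * g v \<partial>lborel) \<partial>lborel) = (\<integral>v. (\<integral>y. F y * heat_kernel t y v \<partial>lborel) * g v \<partial>lborel)"
proof -
  have [measurable]: "g \<in> borel_measurable borel" using g by auto
  obtain C where C: "C \<ge> 0" "\<And>x. \<bar>g x\<bar> \<le> C * exp (c * \<bar>x\<bar>)" using g by (rule expbdE) blast
  let ?f = "\<lambda>y v. F y * (heat_kernel t y v * g v)"
  have i: "integrable lborel (\<lambda>v. heat_kernel t y v * g v)" for y by (rule expbd_heat_integrable[OF g t])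
  have nrm: "(\<integral>v. norm (?f y v) \<partial>lborel) = \<bar>F y\<bar> * (\<integral>v. heat_kernel t y v * \<bar>g v\<bar> \<partial>lborel)" for y
    using t by (simp add: abs_mult)
  have "integrable (lborel \<Otimes>\<^sub>M lborel) (case_prod ?f)"
  proof (rule lborel_pair.Fubini_integrable)
    show "case_prod ?f \<in> borel_measurable (lborel \<Otimes>\<^sub>M lborel)" by measurable
    have "integrable lborel (\<lambda>y. (C * (2 * exp (c\<^sup>2 * t / 2))) * (F y * exp (c * \<bar>y\<bar>)))" using int by simp
    then show "integrable lborel (\<lambda>y. \<integral>v. norm (case (y, v) of (y, v) \<Rightarrow> ?f y v) \<partial>lborel)"
    proof (rule Bochner_Integration.integrable_bound)
      show "(\<lambda>y. \<integral>v. norm (case (y, v) of (y, v) \<Rightarrow> ?f y v) \<partial>lborel) \<in> borel_measurable lborel" by measurable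
      show "AE y in lborel. norm (\<integral>v. norm (case (y, v) of (y, v) \<Rightarrow> ?f y v) \<partial>lborel) \<le> norm ((C * (2 * exp (c\<^sup>2 * t / 2))) * (F y * exp (c * \<bar>y\<bar>)))"
      proof (rule AE_I2)
        fix y
        have nn: "0 \<le> (\<integral>v. heat_kernel t y v * \<bar>g v\<bar> \<partial>lborel)" using t by (intro integral_nonneg_AE AE_I2) auto
        have "\<bar>F y\<bar> * (\<integral>v. heat_kernel t y v * \<bar>g v\<bar> \<partial>lborel) \<le> \<bar>F y\<bar> * (C * (2 * exp (c\<^sup>2 * t / 2)) * exp (c * \<bar>y\<bar>))"
          by (intro mult_left_mono expbd_heat_bound(1) C t) auto
        then show "norm (\<integral>v. norm (case (y, v) of (y, v) \<Rightarrow> ?f y v) \<partial>lborel) \<le> norm ((C * (2 * exp (c\<^sup>2 * t / 2))) * (F y * exp (c * \<bar>y\<bar>)))"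
          unfolding prod.case nrm using C(1) nn by (simp add: abs_mult mult_ac)
      qed
    qed
    show "AE y in lborel. integrable lborel (\<lambda>v. case (y, v) of (y, v) \<Rightarrow> ?f y v)" using i by simp
  qed
  from lborel_pair.Fubini_integral[OF this]
  have "(\<integral>y. (\<integral>v. ?f y v \<partial>lborel) \<partial>lborel) = (\<integral>v. (\<integral>y. ?f y v \<partial>lborel) \<partial>lborel)" by (rule sym)
  moreover have "(\<integral>y. ?f y v \<partial>lborel) = (\<integral>y. F y * heat_kernel t y v \<partial>lborel) * g v" for v
    by (simp add: mult.assoc[symmetric])
  ultimately show ?thesis by simp
qed

lemma antimono_measurable:
  fixes G :: "real \<Rightarrow> real"
  assumes "antimono G" shows "G \<in> borel_measurable borel"
proof -
  have "mono (\<lambda>x. - G x)" using assms by (auto simp: mono_def antimono_def)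
  then have "(\<lambda>x. - G x) \<in> borel_measurable borel" by (rule borel_measurable_mono)
  then show ?thesis by (subst (asm) borel_measurable_uminus_eq)
qed

text \<open>G v is the probability that a discrete Brownian bridge ending at v stays below the levels; it is
  antitone in v because raising the end point raises the whole path.\<close>

lemma heat_iter_antitone:
  assumes "\<And>i. i \<le> n \<Longrightarrow> s i < s (Suc i)"
  shows "\<exists>G. antimono G \<and> (\<forall>v. 0 \<le> G v \<and> G v \<le> 1) \<and> (\<forall>k g. expbd k g \<longrightarrow>
    heat_iter s (\<lambda>j. {..c j :: real}) (Suc n) 0 g u = (\<integral>v. heat_kernel (s (Suc n) - s 0) u v * (G v * (indicator {..c (Suc n)} v * g v)) \<partial>lborel))"
  using assms
proof (induction n)
  case 0
  show ?case by (intro exI[of _ "\<lambda>_. 1"]) (auto simp: antimono_def)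
next
  case (Suc n)
  have "\<And>i. i \<le> n \<Longrightarrow> s i < s (Suc i)" using Suc.prems by simp
  from Suc.IH[OF this] obtain G where G0: "antimono G \<and> (\<forall>v. 0 \<le> G v \<and> G v \<le> 1) \<and> (\<forall>k g. expbd k g \<longrightarrow>
    heat_iter s (\<lambda>j. {..c j}) (Suc n) 0 g u = (\<integral>v. heat_kernel (s (Suc n) - s 0) u v * (G v * (indicator {..c (Suc n)} v * g v)) \<partial>lborel))"
    by (rule exE)
  have G: "antimono G" "\<And>v. 0 \<le> G v" "\<And>v. G v \<le> 1"
    and GI: "\<And>k g. expbd k g \<Longrightarrow> heat_iter s (\<lambda>j. {..c j}) (Suc n) 0 g u = (\<integral>v. heat_kernel (s (Suc n) - s 0) u v * (G v * (indicator {..c (Suc n)} v * g v)) \<partial>lborel)"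
    using G0 by blast+
  define S t where "S = s (Suc n) - s 0" and "t = s (Suc (Suc n)) - s (Suc n)"
  have t: "t > 0" using Suc.prems[of "Suc n"] by (simp add: t_def)
  have "s 0 < s (Suc m)" if "m \<le> n" for m
    using that
  proof (induction m)
    case (Suc m)
    then show ?case using \<open>\<And>i. i \<le> Suc n \<Longrightarrow> s i < s (Suc i)\<close>[of "Suc m"] by simp
  qed (use Suc.prems in simp)
  then have S: "S > 0" by (simp add: S_def)
  \<comment> \<open>Variance and mean, at the last time but one, of the Brownian bridge from u to v;
    the mean increases with v.\<close>
  let ?t = "S * t / (S + t)" and ?m = "\<lambda>v. (t * u + S * v) / (S + t)"
  have t': "?t > 0" using S t by simp
  have [measurable]: "G \<in> borel_measurable borel" by (rule antimono_measurable[OF G(1)])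
  let ?H = "\<lambda>y. indicator {..c (Suc n)} y * G y"
  \<comment> \<open>The noise z has a law that does not depend on v, so v enters through the mean
    only; this coupling gives monotonicity.\<close>
  define G' where "G' v = (\<integral>z. heat_kernel ?t 0 z * ?H (z + ?m v) \<partial>lborel)" for v
  have Hm: "?H x \<le> ?H y" if "y \<le> x" for x y using that G by (auto simp: indicator_def dest: antimonoD)
  have Hb: "0 \<le> ?H y" "?H y \<le> 1" for y using G by (auto simp: indicator_def)
  have eH: "expbd 0 (\<lambda>z. ?H (z + a))" for a
  proof (rule expbdI[where C=1])
    show "\<bar>?H (z + a)\<bar> \<le> 1 * exp (0 * \<bar>z\<bar>)" for z using Hb[of "z + a"] by simp
  qed measurable
  have iH: "integrable lborel (\<lambda>z. heat_kernel ?t 0 z * ?H (z + a))" for a by (rule expbd_heat_integrable[OF eH t'])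
  have G': "antimono G'" "\<And>v. 0 \<le> G' v" "\<And>v. G' v \<le> 1"
  proof -
    show "antimono G'"
    proof (rule antimonoI)
      fix v w :: real assume vw: "v \<le> w"
      have "?m v \<le> ?m w" using vw S t by (intro divide_right_mono add_left_mono mult_left_mono) auto
      then show "G' w \<le> G' v" unfolding G'_def using t'
        by (intro integral_mono iH mult_left_mono Hm) auto
    qed
    have hn: "0 \<le> heat_kernel ?t 0 z" for z using t' by simp
    show "0 \<le> G' v" for v unfolding G'_def by (rule integral_nonneg_AE, rule AE_I2, rule mult_nonneg_nonneg[OF hn Hb(1)])
    show "G' v \<le> 1" for v
    proof -
      have "G' v \<le> (\<integral>z. heat_kernel ?t 0 z \<partial>lborel)" unfolding G'_def
        by (rule integral_mono[OF iH integrable_heat_kernel[OF t'] mult_left_le[OF Hb(2) hn]])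
      then show ?thesis using t' by simp
    qed
  qed
  have inner: "(\<integral>y. (heat_kernel S u y * ?H y) * heat_kernel t y v \<partial>lborel) = heat_kernel (S + t) u v * G' v" for v
  proof -
    have "(\<integral>y. (heat_kernel S u y * ?H y) * heat_kernel t y v \<partial>lborel) = (\<integral>y. heat_kernel (S + t) u v * (heat_kernel ?t (?m v) y * ?H y) \<partial>lborel)"
    proof (rule Bochner_Integration.integral_cong[OF refl])
      fix y
      have "(heat_kernel S u y * ?H y) * heat_kernel t y v = (heat_kernel S u y * heat_kernel t y v) * ?H y" by (simp only: mult_ac)
      also have "\<dots> = heat_kernel (S + t) u v * (heat_kernel ?t (?m v) y * ?H y)"
        unfolding Chapman_Kolmogorov_point[OF S t] by (simp only: mult.assoc)
      finally show "(heat_kernel S u y * ?H y) * heat_kernel t y v = heat_kernel (S + t) u v * (heat_kernel ?t (?m v) y * ?H y)" .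
    qed
    also have "\<dots> = heat_kernel (S + t) u v * (\<integral>y. heat_kernel ?t (?m v) y * ?H y \<partial>lborel)" by (rule integral_mult_right_zero)
    also have "(\<integral>y. heat_kernel ?t (?m v) y * ?H y \<partial>lborel) = (\<integral>z. heat_kernel ?t (?m v) (?m v + z) * ?H (?m v + z) \<partial>lborel)"
      using lborel_integral_real_affine[of 1 "\<lambda>y. heat_kernel ?t (?m v) y * ?H y" "?m v"] by simp
    also have "\<dots> = G' v" unfolding G'_def using heat_kernel_shift[of ?t 0 "?m v"] by (simp add: add.commute)
    finally show ?thesis .
  qed
  show ?case
  proof (intro exI[of _ G'] conjI allI impI)
    fix k g assume g: "expbd k g"
    let ?g = "\<lambda>w. \<integral>v. heat_kernel t w v * (indicator {..c (Suc (Suc n))} v * g v) \<partial>lborel"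
    have eg: "expbd k (\<lambda>v. indicator {..c (Suc (Suc n))} v * g v)" by (rule expbd_indicator[OF g]) simp
    have "heat_iter s (\<lambda>j. {..c j}) (Suc (Suc n)) 0 g u = heat_iter s (\<lambda>j. {..c j}) (Suc n) 0 ?g u"
      unfolding heat_iter_Suc_right[of s _ "Suc n" 0 g] t_def by simp
    also have "\<dots> = (\<integral>y. heat_kernel S u y * (G y * (indicator {..c (Suc n)} y * ?g y)) \<partial>lborel)"
      unfolding S_def by (rule GI[OF expbd_heat_op[OF eg t]])
    also have "\<dots> = (\<integral>y. (heat_kernel S u y * ?H y) * ?g y \<partial>lborel)" by (simp only: mult_ac)
    also have "\<dots> = (\<integral>v. (\<integral>y. (heat_kernel S u y * ?H y) * heat_kernel t y v \<partial>lborel) * (indicator {..c (Suc (Suc n))} v * g v) \<partial>lborel)"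
    proof (rule heat_fubini[OF _ eg t])
      have "expbd k (\<lambda>y. ?H y * exp (k * \<bar>y\<bar>))"
        using expbd_mult[OF eH[of 0], of k "\<lambda>y. exp (k * \<bar>y\<bar>)"] expbdI[of "\<lambda>y. exp (k * \<bar>y\<bar>)" 1 k] by simp
      from expbd_heat_integrable[OF this S] show "integrable lborel (\<lambda>y. heat_kernel S u y * ?H y * exp (k * \<bar>y\<bar>))" by (simp add: mult.assoc)
    qed measurable
    finally show "heat_iter s (\<lambda>j. {..c j}) (Suc (Suc n)) 0 g u = (\<integral>v. heat_kernel (s (Suc (Suc n)) - s 0) u v * (G' v * (indicator {..c (Suc (Suc n))} v * g v)) \<partial>lborel)"
      unfolding inner by (simp add: S_def t_def mult.assoc)
  qed (use G' in auto)
qed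

text \<open>Integrating out the last increment amounts to one step of \<open>heat_iter\<close>
  applied to g. The factor sqrt 2 doubles the variance, whence the clock increments 2 d j.\<close>

lemma normal_increments_heat_iter:
  assumes d: "\<And>j. d j > 0" and s: "\<And>j. s (Suc j) - s j = 2 * d j" and A: "\<And>j. A j \<in> sets borel" and g: "expbd 0 g"
  shows "(\<integral>x. (\<Prod>j<k. indicator (A (Suc j)) (u + sqrt 2 * (\<Sum>i<Suc j. x i))) * g (u + sqrt 2 * (\<Sum>i<k. x i))
      \<partial>PiM {..<k} (\<lambda>j. density lborel (\<lambda>x. ennreal (normal_density 0 (sqrt (d j)) x)))) = heat_iter s A k 0 g u"
  using g
proof (induction k arbitrary: g)
  case 0
  interpret prob_space "PiM {} (\<lambda>j. density lborel (\<lambda>x. ennreal (normal_density 0 (sqrt (d j)) x)))"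
    by (rule prob_space_PiM) auto
  show ?case using prob_space by simp
next
  case (Suc k)
  let ?N = "\<lambda>j. density lborel (\<lambda>x. ennreal (normal_density 0 (sqrt (d j)) x))"
  have pN: "prob_space (?N j)" for j using d[of j] by (intro prob_space_normal_density) simp
  interpret product_sigma_finite ?N unfolding product_sigma_finite_def using pN prob_space_imp_sigma_finite by blast
  interpret PK: prob_space "PiM {..<Suc k} ?N" by (rule prob_space_PiM) (rule pN)
  have [measurable]: "g \<in> borel_measurable borel" "A j \<in> sets borel" for j using Suc.prems A by auto
  obtain C where C: "\<And>x. \<bar>g x\<bar> \<le> C * exp (0 * \<bar>x\<bar>)" "C \<ge> 0" using Suc.prems by (rule expbdE) blast
  let ?f = "\<lambda>x. (\<Prod>j<Suc k. indicator (A (Suc j)) (u + sqrt 2 * (\<Sum>i<Suc j. x i))) * g (u + sqrt 2 * (\<Sum>i<Suc k. x i))"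
  let ?g = "\<lambda>w. \<integral>v. heat_kernel (s (Suc k) - s k) w v * (indicator (A (Suc k)) v * g v) \<partial>lborel"
  have comp: "(\<lambda>x. x i) \<in> borel_measurable (PiM {..<Suc k} ?N)" if "i < Suc k" for i
    using measurable_component_singleton[of i "{..<Suc k}" ?N] that by simp
  have fm: "?f \<in> borel_measurable (PiM {..<Suc k} ?N)"
    by (intro borel_measurable_times borel_measurable_prod measurable_compose[OF _ borel_measurable_indicator[OF A]]
        measurable_compose[OF _ expbdD[OF Suc.prems]] borel_measurable_add borel_measurable_const borel_measurable_sum comp) auto
  have fi: "integrable (PiM {..<Suc k} ?N) ?f"
  proof (rule PK.integrable_const_bound[where B=C])
    have "\<bar>?f x\<bar> \<le> C" for x
    proof -
      have "\<bar>\<Prod>j<Suc k. indicator (A (Suc j)) (u + sqrt 2 * (\<Sum>i<Suc j. x i))\<bar> \<le> (1 :: real)"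
        unfolding abs_prod by (rule prod_le_1) (auto simp: indicator_def)
      then have "\<bar>?f x\<bar> \<le> 1 * C" unfolding abs_mult using C(1)[of "u + sqrt 2 * (\<Sum>i<Suc k. x i)"] by (intro mult_mono) auto
      then show ?thesis by simp
    qed
    then show "AE x in PiM {..<Suc k} ?N. norm (?f x) \<le> C" by simp
  qed (rule fm)
  have ins: "insert k {..<k} = {..<Suc k}" by auto
  have "integral\<^sup>L (PiM {..<Suc k} ?N) ?f = (\<integral>x. (\<integral>y. ?f (x(k := y)) \<partial>?N k) \<partial>PiM {..<k} ?N)"
    unfolding ins[symmetric] by (rule product_integral_insert) (use fi in \<open>auto simp: ins\<close>)
  also have "\<dots> = (\<integral>x. (\<Prod>j<k. indicator (A (Suc j)) (u + sqrt 2 * (\<Sum>i<Suc j. x i))) * ?g (u + sqrt 2 * (\<Sum>i<k. x i)) \<partial>PiM {..<k} ?N)"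
  proof (rule Bochner_Integration.integral_cong[OF refl])
    fix x :: "nat \<Rightarrow> real"
    let ?w = "u + sqrt 2 * (\<Sum>i<k. x i)"
    let ?P = "(\<Prod>j<k. indicator (A (Suc j)) (u + sqrt 2 * (\<Sum>i<Suc j. x i))) :: real"
    let ?q = "\<lambda>v. indicator (A (Suc k)) v * g v"
    have sm: "(\<Sum>i<j. (x(k := y)) i) = (\<Sum>i<j. x i)" if "j \<le> k" for j y using that by (intro sum.cong) auto
    have "?f (x(k := y)) = ?P * ?q (?w + sqrt 2 * y)" for y
    proof -
      have s1: "(\<Prod>j<k. indicator (A (Suc j)) (u + sqrt 2 * (\<Sum>i<Suc j. (x(k := y)) i))) = ?P"
        using sm[of "Suc _" y] by (intro prod.cong refl) (simp only: lessThan_iff Suc_le_eq)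
      have "(\<Sum>i<Suc k. (x(k := y)) i) = (\<Sum>i<k. (x(k := y)) i) + (x(k := y)) k" by (rule sum.lessThan_Suc)
      then have s2: "(\<Sum>i<Suc k. (x(k := y)) i) = (\<Sum>i<k. x i) + y" by (simp only: sm[of k y, OF order_refl] fun_upd_same)
      show ?thesis unfolding prod.lessThan_Suc[of _ k] s1 s2 by (simp only: distrib_left add.assoc mult.assoc)
    qed
    then have "(\<integral>y. ?f (x(k := y)) \<partial>?N k) = (\<integral>y. ?P * ?q (?w + sqrt 2 * y) \<partial>?N k)" by (simp only:)
    also have "\<dots> = ?P * (\<integral>y. ?q (?w + sqrt 2 * y) \<partial>?N k)" by (rule integral_mult_right_zero)
    also have "(\<integral>y. ?q (?w + sqrt 2 * y) \<partial>?N k) = (\<integral>y. normal_density 0 (sqrt (d k)) y * ?q (?w + sqrt 2 * y) \<partial>lborel)"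
      by (subst integral_density) auto
    also have "\<dots> = (\<integral>y. sqrt 2 * (heat_kernel (s (Suc k) - s k) ?w (?w + sqrt 2 * y) * ?q (?w + sqrt 2 * y)) \<partial>lborel)"
    proof (rule Bochner_Integration.integral_cong[OF refl])
      fix y
      have "sqrt 2 * heat_kernel (s (Suc k) - s k) ?w (?w + sqrt 2 * y) = normal_density 0 (sqrt (d k)) y"
        unfolding s heat_kernel_def normal_density_def using d[of k] by (simp add: power_mult_distrib real_sqrt_mult) (simp add: field_simps)
      then show "normal_density 0 (sqrt (d k)) y * ?q (?w + sqrt 2 * y) = sqrt 2 * (heat_kernel (s (Suc k) - s k) ?w (?w + sqrt 2 * y) * ?q (?w + sqrt 2 * y))"
        by (simp only: mult.assoc[symmetric])
    qed
    also have "\<dots> = ?g ?w"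
      using lborel_integral_real_affine[of "sqrt 2" "\<lambda>v. heat_kernel (s (Suc k) - s k) ?w v * ?q v" ?w] by simp
    finally show "(\<integral>y. ?f (x(k := y)) \<partial>?N k) = ?P * ?g ?w" .
  qed
  also have "\<dots> = heat_iter s A k 0 ?g u"
  proof (rule Suc.IH)
    show "expbd 0 ?g" using d[of k] by (intro expbd_heat_op expbd_indicator Suc.prems A) (simp add: s)
  qed
  finally show ?case using heat_iter_Suc_right[of s A k 0 g] by simp
qed

text \<open>Independence gives the increments a product law, to which
  \<open>normal_increments_heat_iter\<close> applies; path values are recovered by telescoping from
  W 0 = 0.\<close>

lemma BM_heat_iter:
  assumes W: "std_BM M W" and th0: "th 0 = 0" and th: "\<And>j. th j < th (Suc j)"
    and A: "\<And>j. A j \<in> sets borel" and g: "expbd 0 g"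
  shows "(\<integral>\<omega>. (\<Prod>j<k. indicator (A (Suc j)) (u + sqrt 2 * W (th (Suc j)) \<omega>)) * g (u + sqrt 2 * W (th k) \<omega>) \<partial>M) = heat_iter (\<lambda>j. 2 * th j) A k 0 g u"
proof -
  interpret prob_space M using W by (simp add: std_BM_def)
  have W0: "W 0 \<omega> = 0" if "\<omega> \<in> space M" for \<omega> using W that by (simp add: std_BM_def)
  have Wm: "W t \<in> borel_measurable M" for t using W by (simp add: std_BM_def)
  have th0': "0 \<le> th j" for j
  proof (induction j)
    case (Suc j) then show ?case using th[of j] by simp
  qed (simp add: th0)
  show ?thesis
  proof (cases "k = 0")
    case True
    have "(\<integral>\<omega>. g (u + sqrt 2 * W 0 \<omega>) \<partial>M) = (\<integral>\<omega>. g u \<partial>M)" using W0 by (intro Bochner_Integration.integral_cong) auto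
    then show ?thesis using True th0 prob_space by simp
  next
    case False
    let ?D = "\<lambda>j \<omega>. W (th (Suc j)) \<omega> - W (th j) \<omega>"
    let ?d = "\<lambda>j. th (Suc j) - th j"
    let ?N = "\<lambda>j. density lborel (\<lambda>x. ennreal (normal_density 0 (sqrt (?d j)) x))"
    have dist: "distributed M lborel (?D j) (\<lambda>x. ennreal (normal_density 0 (sqrt (?d j)) x))" for j
      using W th[of j] th0'[of j] by (simp add: std_BM_def)
    have "indep_vars (\<lambda>_. borel) ?D {..<k}" using W th th0' unfolding std_BM_def by blast
    moreover have Dm: "?D j \<in> borel_measurable M" for j using Wm by simp
    ultimately have "distr M (PiM {..<k} (\<lambda>_. borel)) (\<lambda>\<omega>. \<lambda>j\<in>{..<k}. ?D j \<omega>) = PiM {..<k} (\<lambda>j. distr M borel (?D j))"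
      using False by (subst (asm) indep_vars_iff_distr_eq_PiM) auto
    also have "\<dots> = PiM {..<k} ?N"
    proof (rule PiM_cong[OF refl])
      fix j
      have "distr M borel (?D j) = distr M lborel (?D j)" by (rule distr_cong) auto
      then show "distr M borel (?D j) = ?N j" using dist[of j] by (simp add: distributed_def)
    qed
    finally have D: "distr M (PiM {..<k} (\<lambda>_. borel)) (\<lambda>\<omega>. \<lambda>j\<in>{..<k}. ?D j \<omega>) = PiM {..<k} ?N" .
    let ?f = "\<lambda>x. (\<Prod>j<k. indicator (A (Suc j)) (u + sqrt 2 * (\<Sum>i<Suc j. x i))) * g (u + sqrt 2 * (\<Sum>i<k. x i))"
    have tel: "(\<Sum>i<j. (\<lambda>j\<in>{..<k}. ?D j \<omega>) i) = W (th j) \<omega>" if "j \<le> k" "\<omega> \<in> space M" for j \<omega>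
    proof -
      have "(\<Sum>i<j. (\<lambda>j\<in>{..<k}. ?D j \<omega>) i) = (\<Sum>i<j. ?D i \<omega>)" using that by (intro sum.cong) auto
      also have "\<dots> = W (th j) \<omega> - W (th 0) \<omega>" by (rule sum_lessThan_telescope)
      finally show ?thesis using W0[OF that(2)] th0 by simp
    qed
    have comp: "(\<lambda>x. x i) \<in> borel_measurable (PiM {..<k} (\<lambda>_. borel :: real measure))" if "i < k" for i
      using measurable_component_singleton[of i "{..<k}" "\<lambda>_. borel :: real measure"] that by simp
    have fm: "?f \<in> borel_measurable (PiM {..<k} (\<lambda>_. borel))"
      by (intro borel_measurable_times borel_measurable_prod measurable_compose[OF _ borel_measurable_indicator[OF A]]
          measurable_compose[OF _ expbdD[OF g]] borel_measurable_add borel_measurable_const borel_measurable_sum comp) auto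
    have "(\<integral>\<omega>. (\<Prod>j<k. indicator (A (Suc j)) (u + sqrt 2 * W (th (Suc j)) \<omega>)) * g (u + sqrt 2 * W (th k) \<omega>) \<partial>M) = (\<integral>\<omega>. ?f (\<lambda>j\<in>{..<k}. ?D j \<omega>) \<partial>M)"
    proof (rule Bochner_Integration.integral_cong[OF refl])
      fix \<omega> assume w: "\<omega> \<in> space M"
      show "(\<Prod>j<k. indicator (A (Suc j)) (u + sqrt 2 * W (th (Suc j)) \<omega>)) * g (u + sqrt 2 * W (th k) \<omega>) = ?f (\<lambda>j\<in>{..<k}. ?D j \<omega>)"
        unfolding tel[OF order_refl w] by (intro arg_cong2[where f="(*)"] prod.cong refl) (use tel[OF _ w] in \<open>simp add: Suc_le_eq\<close>)
    qed
    also have "\<dots> = integral\<^sup>L (PiM {..<k} ?N) ?f"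
      unfolding D[symmetric] by (rule integral_distr[symmetric, OF _ fm]) (intro measurable_restrict Dm)
    also have "\<dots> = heat_iter (\<lambda>j. 2 * th j) A k 0 g u"
      by (rule normal_increments_heat_iter) (use th A g in \<open>auto simp: algebra_simps\<close>)
    finally show ?thesis .
  qed
qed

text \<open>Rounding up rather than down gives p n >= 1 whenever t > a, which matters because the
  flow does not test the grid point 0.\<close>

lemma uniform_grid_dense:
  fixes a b t :: real
  assumes ab: "a < b" and t: "a \<le> t" "t \<le> b"
  obtains p where "\<And>n. p n \<le> Suc n" "(\<lambda>n. a + real (p n) * ((b - a) / real (Suc n))) \<longlonglongrightarrow> t" "\<And>n. a < t \<Longrightarrow> p n \<ge> 1"
proof -
  define x where "x = (t - a) / (b - a)"
  have x: "0 \<le> x" "x \<le> 1" "t = a + x * (b - a)" using ab t by (auto simp: x_def)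
  define p where "p n = nat \<lceil>x * real (Suc n)\<rceil>" for n
  have c: "x * real (Suc n) \<le> real (p n)" "real (p n) \<le> x * real (Suc n) + 1" for n
    unfolding p_def using x(1) by (auto simp: of_nat_nat)
  show ?thesis
  proof (rule that[of p])
    show "p n \<le> Suc n" for n
    proof -
      have "x * real (Suc n) \<le> real (Suc n)" using x by (intro mult_left_le_one_le) auto
      then have "\<lceil>x * real (Suc n)\<rceil> \<le> int (Suc n)" by (simp add: ceiling_le_iff)
      then show ?thesis unfolding p_def by linarith
    qed
    show "p n \<ge> 1" if "a < t" for n
    proof -
      have "0 < x" using that ab by (simp add: x_def)
      then have "0 < x * real (Suc n)" by simp
      then have "0 < real (p n)" using c(1)[of n] by linarith
      then show ?thesis by simp
    qed
    have lim: "(\<lambda>n. (b - a) / real (Suc n)) \<longlonglongrightarrow> 0" by real_asymp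
    have bd: "\<bar>a + real (p n) * ((b - a) / real (Suc n)) - t\<bar> \<le> (b - a) / real (Suc n)" for n
    proof -
      let ?d = "(b - a) / real (Suc n)"
      have d: "?d > 0" using ab by simp
      have e: "x * (b - a) = (x * real (Suc n)) * ?d" by simp
      have eq: "a + real (p n) * ?d - t = (real (p n) - x * real (Suc n)) * ?d" unfolding x(3) left_diff_distrib e by (simp only: add_diff_cancel_left)
      have r: "0 \<le> real (p n) - x * real (Suc n)" "real (p n) - x * real (Suc n) \<le> 1" using c[of n] by linarith+
      have "\<bar>(real (p n) - x * real (Suc n)) * ?d\<bar> = (real (p n) - x * real (Suc n)) * ?d"
        by (rule abs_of_nonneg, rule mult_nonneg_nonneg[OF r(1) less_imp_le[OF d]])
      also have "\<dots> \<le> ?d" by (rule mult_left_le_one_le[OF less_imp_le[OF d] r])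
      finally show ?thesis unfolding eq .
    qed
    have "(\<lambda>n. a + real (p n) * ((b - a) / real (Suc n)) - t) \<longlonglongrightarrow> 0"
      by (rule Lim_null_comparison[OF _ lim]) (use bd in simp)
    then show "(\<lambda>n. a + real (p n) * ((b - a) / real (Suc n))) \<longlonglongrightarrow> t" by (rule LIM_zero_cancel)
  qed
qed

text \<open>By continuity a path above the barrier at some t > 0 is eventually above it at grid
  points near t, so the discrete products converge pointwise. Time 0, which the products omit, is
  safe because u <= 0 = c 0.\<close>

lemma BM_barrier_limit:
  assumes W: "std_BM M W" and T: "T > 0" and c: "continuous_on {0..T} c" and c0: "c 0 = 0" and u: "u \<le> 0"
  shows "(\<lambda>n. heat_iter (\<lambda>j. 2 * (real j * (T / real (Suc n)))) (\<lambda>j. {..c (real j * (T / real (Suc n)))}) (Suc n) 0 (indicator {..v}) u)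
    \<longlonglongrightarrow> measure M {\<omega> \<in> space M. (\<forall>\<theta>\<in>{0..T}. u + sqrt 2 * W \<theta> \<omega> \<le> c \<theta>) \<and> u + sqrt 2 * W T \<omega> \<le> v}"
proof -
  interpret prob_space M using W by (simp add: std_BM_def)
  have W0: "W 0 \<omega> = 0" and Wc: "continuous_on {0..} (\<lambda>t. W t \<omega>)" if "\<omega> \<in> space M" for \<omega> using W that by (auto simp: std_BM_def)
  have Wm[measurable]: "W t \<in> borel_measurable M" for t using W by (simp add: std_BM_def)
  let ?E = "{\<omega> \<in> space M. (\<forall>\<theta>\<in>{0..T}. u + sqrt 2 * W \<theta> \<omega> \<le> c \<theta>) \<and> u + sqrt 2 * W T \<omega> \<le> v}"
  let ?th = "\<lambda>n j. real j * (T / real (Suc n))"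
  let ?X = "\<lambda>n \<omega>. (\<Prod>j<Suc n. indicator {..c (?th n (Suc j))} (u + sqrt 2 * W (?th n (Suc j)) \<omega>)) * (indicator {..v} (u + sqrt 2 * W (?th n (Suc n)) \<omega>) :: real)"
  have kX: "heat_iter (\<lambda>j. 2 * ?th n j) (\<lambda>j. {..c (?th n j)}) (Suc n) 0 (indicator {..v}) u = (\<integral>\<omega>. ?X n \<omega> \<partial>M)" for n
  proof (rule BM_heat_iter[OF W, symmetric])
    show "expbd 0 (indicator {..v})" by (rule expbdI[of _ 1]) (auto simp: indicator_def)
    show "?th n j < ?th n (Suc j)" for j using T by (intro mult_strict_right_mono) auto
  qed auto
  have Xm: "?X n \<in> borel_measurable M" for n by measurable
  have XE: "(\<lambda>n. ?X n \<omega>) \<longlonglongrightarrow> indicator ?E \<omega>" if w: "\<omega> \<in> space M" for \<omega>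
  proof (cases "\<forall>\<theta>\<in>{0..T}. u + sqrt 2 * W \<theta> \<omega> \<le> c \<theta>")
    case True
    have th: "?th n (Suc j) \<in> {0..T}" if "j < Suc n" for n j
    proof -
      have "real (Suc j) * (T / real (Suc n)) \<le> real (Suc n) * (T / real (Suc n))" using that T by (intro mult_right_mono) auto
      then show ?thesis using T by simp
    qed
    have "(\<Prod>j<Suc n. indicator {..c (?th n (Suc j))} (u + sqrt 2 * W (?th n (Suc j)) \<omega>)) = (1 :: real)" for n
      using True th by (intro prod.neutral) auto
    moreover have "?th n (Suc n) = T" for n by simp
    ultimately have "?X n \<omega> = indicator ?E \<omega>" for n using True w by (simp only:) (auto simp: indicator_def)
    then show ?thesis by simp
  next
    case False
    then obtain t where t: "0 \<le> t" "t \<le> T" "u + sqrt 2 * W t \<omega> > c t" by auto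
    have t0: "0 < t" using t c0 u W0[OF w] by (cases "t = 0") auto
    obtain p where p: "\<And>n. p n \<le> Suc n" "(\<lambda>n. 0 + real (p n) * ((T - 0) / real (Suc n))) \<longlonglongrightarrow> t" "\<And>n. 0 < t \<Longrightarrow> p n \<ge> 1"
      using uniform_grid_dense[OF T t(1,2)] by blast
    have p2: "(\<lambda>n. ?th n (p n)) \<longlonglongrightarrow> t" using p(2) by simp
    have thp: "?th n (p n) \<in> {0..T}" for n
    proof -
      have "real (p n) * (T / real (Suc n)) \<le> real (Suc n) * (T / real (Suc n))" using p(1)[of n] T by (intro mult_right_mono) auto
      then show ?thesis using T by simp
    qed
    have "continuous_on {0..T} (\<lambda>t. u + sqrt 2 * W t \<omega> - c t)"
      by (intro continuous_intros c continuous_on_subset[OF Wc[OF w]]) auto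
    then have "(\<lambda>n. u + sqrt 2 * W (?th n (p n)) \<omega> - c (?th n (p n))) \<longlonglongrightarrow> u + sqrt 2 * W t \<omega> - c t"
      by (rule continuous_on_tendsto_compose[OF _ p2]) (use t thp in \<open>auto intro!: always_eventually simp del: of_nat_Suc\<close>)
    then have "\<forall>\<^sub>F n in sequentially. 0 < u + sqrt 2 * W (?th n (p n)) \<omega> - c (?th n (p n))"
      by (rule order_tendstoD) (use t in simp)
    then have "\<forall>\<^sub>F n in sequentially. ?X n \<omega> = 0"
    proof eventually_elim
      case (elim n)
      have "p n - 1 < Suc n" "Suc (p n - 1) = p n" using p(1)[of n] p(3)[OF t0, of n] by auto
      then have "(\<Prod>j<Suc n. indicator {..c (?th n (Suc j))} (u + sqrt 2 * W (?th n (Suc j)) \<omega>)) = (0 :: real)"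
        using elim by (intro prod_zero bexI[of _ "p n - 1"]) auto
      then show ?case by (simp only: mult_zero_left)
    qed
    moreover have "indicator ?E \<omega> = (0 :: real)" using False by (simp add: indicator_def)
    ultimately show ?thesis by (simp add: tendsto_eventually)
  qed
  \<comment> \<open>The event involves uncountably many times; its measurability comes from the
    pointwise limit.\<close>
  have "(indicator ?E :: _ \<Rightarrow> real) \<in> borel_measurable M" by (rule borel_measurable_LIMSEQ_real[OF XE Xm])
  then have "?E \<inter> space M \<in> sets M" by (rule borel_measurable_indicator_iff[THEN iffD1])
  moreover have "?E \<inter> space M = ?E" by (rule Int_absorb2) (rule Collect_restrict)
  ultimately have Em: "?E \<in> sets M" by (simp only:)
  have "(\<lambda>n. \<integral>\<omega>. ?X n \<omega> \<partial>M) \<longlonglongrightarrow> (\<integral>\<omega>. indicator ?E \<omega> \<partial>M)"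
  proof (rule integral_dominated_convergence[where w="\<lambda>_. 1"])
    show "AE \<omega> in M. (\<lambda>n. ?X n \<omega>) \<longlonglongrightarrow> indicator ?E \<omega>" using XE by (rule AE_I2)
    show "AE \<omega> in M. norm (?X n \<omega>) \<le> 1" for n
    proof (rule AE_I2)
      fix \<omega>
      have "\<bar>\<Prod>j<Suc n. indicator {..c (?th n (Suc j))} (u + sqrt 2 * W (?th n (Suc j)) \<omega>)\<bar> \<le> (1 :: real)"
        unfolding abs_prod by (rule prod_le_1) (auto simp: indicator_def)
      then have "\<bar>?X n \<omega>\<bar> \<le> 1 * 1" unfolding abs_mult by (intro mult_mono) (auto simp: indicator_def)
      then show "norm (?X n \<omega>) \<le> 1" by simp
    qed
    show "?X n \<in> borel_measurable M" for n by (rule Xm)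
    show "indicator ?E \<in> borel_measurable M" using Em by simp
  qed simp
  then show ?thesis unfolding kX using Em by (simp add: sets.Int_space_eq2)
qed

text \<open>Helly-type selection without subsequences: weak convergence of the densities determines the limit of
  the antitone factors at every continuity point.\<close>

lemma antitone_liminf:
  fixes G :: "nat \<Rightarrow> real \<Rightarrow> real"
  assumes S: "S > 0" and G: "\<And>n. antimono (G n)" "\<And>n v. 0 \<le> G n v" "\<And>n v. G n v \<le> 1"
    and H: "\<And>v. (\<lambda>n. \<integral>x. heat_kernel S u x * (G n x * (indicator {..0} x * indicator {..v} x)) \<partial>lborel) \<longlonglongrightarrow> H v"
  obtains L C where "antimono L" "\<And>v. 0 \<le> L v" "\<And>v. L v \<le> 1" "countable C"
    "\<And>v. v < 0 \<Longrightarrow> v \<notin> C \<Longrightarrow> isCont L v" "\<And>v. v < 0 \<Longrightarrow> v \<notin> C \<Longrightarrow> (\<lambda>n. G n v) \<longlonglongrightarrow> L v"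
proof -
  define lo where "lo v = liminf (\<lambda>n. ereal (G n v))" for v
  define hi where "hi v = limsup (\<lambda>n. ereal (G n v))" for v
  define L where "L v = real_of_ereal (lo v)" for v
  have lohi: "0 \<le> lo v" "lo v \<le> hi v" "hi v \<le> 1" for v
  proof -
    show "0 \<le> lo v" unfolding lo_def by (rule Liminf_bounded) (use G in simp)
    show "lo v \<le> hi v" unfolding lo_def hi_def by (rule Liminf_le_Limsup) simp
    show "hi v \<le> 1" unfolding hi_def by (rule Limsup_bounded) (use G in simp)
  qed
  have L: "ereal (L v) = lo v" for v
  proof -
    have "\<bar>lo v\<bar> \<noteq> \<infinity>" using lohi[of v] by (cases "lo v") auto
    then show ?thesis unfolding L_def by (simp add: ereal_real)
  qed
  have Lanti: "antimono L"
  proof (rule antimonoI)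
    fix v w :: real assume "v \<le> w"
    then have "G n w \<le> G n v" for n by (rule antimonoD[OF G(1)])
    then have "lo w \<le> lo v" unfolding lo_def by (intro Liminf_mono always_eventually allI) simp
    then show "L w \<le> L v" using L by (metis ereal_less_eq(3))
  qed
  have Lb: "0 \<le> L v" "L v \<le> 1" for v
    using lohi[of v] L[of v] by (metis ereal_less_eq(3) zero_ereal_def, metis ereal_less_eq(3) one_ereal_def order_trans)
  have Gm: "G n \<in> borel_measurable borel" for n by (rule antimono_measurable[OF G(1)])
  \<comment> \<open>The average of G n over (v0, v1] against the kernel lies between the values at
    v1 and at v0 and converges by assumption; so the upper limit at v1 is at most the lower limit at
    v0.\<close>
  have key: "hi v1 \<le> lo v0" if v: "v0 < v1" "v1 \<le> 0" for v0 v1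
  proof -
    let ?i = "indicator {v0<..v1} :: real \<Rightarrow> real"
    let ?P = "\<integral>x. heat_kernel S u x * ?i x \<partial>lborel"
    let ?J = "\<lambda>n. \<integral>x. heat_kernel S u x * (G n x * ?i x) \<partial>lborel"
    have e: "expbd 0 (\<lambda>x. G n x * indicator A x)" if "A \<in> sets borel" for n A
    proof (rule expbdI[where C=1])
      show "\<bar>G n x * indicator A x\<bar> \<le> 1 * exp (0 * \<bar>x\<bar>)" for x using G(2,3)[of n x] by (auto simp: indicator_def)
      show "(\<lambda>x. G n x * indicator A x) \<in> borel_measurable borel" using Gm that by measurable
    qed
    have i1: "integrable lborel (\<lambda>x. heat_kernel S u x * (G n x * indicator A x))" if "A \<in> sets borel" for n A
      by (rule expbd_heat_integrable[OF e[OF that] S])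
    have i2: "integrable lborel (\<lambda>x. heat_kernel S u x * ?i x)"
      by (rule expbd_heat_integrable[OF expbdI[of _ 1 0] S]) (auto simp: indicator_def)
    have P: "?P > 0"
    proof -
      have nn: "0 \<le> heat_kernel S u x * ?i x" for x using S by simp
      have "?P \<noteq> 0"
      proof
        assume "?P = 0"
        then have "AE x in lborel. heat_kernel S u x * ?i x = 0"
          using integral_nonneg_eq_0_iff_AE[OF i2] nn by simp
        then have "AE x in lborel. x \<notin> {v0<..v1}"
          by eventually_elim (use heat_kernel_pos[OF S] in \<open>auto simp: indicator_def less_imp_neq[symmetric] split: if_splits\<close>)
        then have "emeasure lborel {v0<..v1} = 0" by (subst (asm) AE_iff_measurable[of "{v0<..v1}"]) auto
        then show False using v by simp
      qed
      moreover have "?P \<ge> 0" using nn by (intro integral_nonneg_AE AE_I2)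
      ultimately show ?thesis by simp
    qed
    have split: "?J n = (\<integral>x. heat_kernel S u x * (G n x * (indicator {..0} x * indicator {..v1} x)) \<partial>lborel) - (\<integral>x. heat_kernel S u x * (G n x * (indicator {..0} x * indicator {..v0} x)) \<partial>lborel)" for n
    proof -
      have m: "indicator {..0} x * indicator {..w} x = (indicator {..w} x :: real)" if "w \<le> 0" for w x :: real using that by (auto simp: indicator_def)
      have "?J n = (\<integral>x. heat_kernel S u x * (G n x * indicator {..v1} x) - heat_kernel S u x * (G n x * indicator {..v0} x) \<partial>lborel)"
        using v by (intro Bochner_Integration.integral_cong) (auto simp: indicator_def)
      also have "\<dots> = (\<integral>x. heat_kernel S u x * (G n x * indicator {..v1} x) \<partial>lborel) - (\<integral>x. heat_kernel S u x * (G n x * indicator {..v0} x) \<partial>lborel)"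
        by (rule Bochner_Integration.integral_diff) (auto intro: i1)
      finally show ?thesis using v by (simp add: m)
    qed
    have Jlim: "(\<lambda>n. ?J n / ?P) \<longlonglongrightarrow> (H v1 - H v0) / ?P" unfolding split by (intro tendsto_intros H) (use P in simp)
    have up: "G n v1 * ?P \<le> ?J n" and dn: "?J n \<le> G n v0 * ?P" for n
    proof -
      have "G n v1 * ?P = (\<integral>x. heat_kernel S u x * (G n v1 * ?i x) \<partial>lborel)"
        by (subst integral_mult_right_zero[symmetric]) (simp add: mult_ac)
      also have "\<dots> \<le> ?J n"
      proof (rule integral_mono)
        show "integrable lborel (\<lambda>x. heat_kernel S u x * (G n v1 * ?i x))" using integrable_mult_right[OF i2, of "G n v1"] by (simp add: mult_ac)
        show "heat_kernel S u x * (G n v1 * ?i x) \<le> heat_kernel S u x * (G n x * ?i x)" for x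
          using S antimonoD[OF G(1)[of n], of x v1] by (intro mult_left_mono) (auto simp: indicator_def)
      qed (rule i1, simp)
      finally show "G n v1 * ?P \<le> ?J n" .
      have "?J n \<le> (\<integral>x. heat_kernel S u x * (G n v0 * ?i x) \<partial>lborel)"
      proof (rule integral_mono)
        show "integrable lborel (\<lambda>x. heat_kernel S u x * (G n v0 * ?i x))" using integrable_mult_right[OF i2, of "G n v0"] by (simp add: mult_ac)
        show "heat_kernel S u x * (G n x * ?i x) \<le> heat_kernel S u x * (G n v0 * ?i x)" for x
          using S antimonoD[OF G(1)[of n], of v0 x] by (intro mult_left_mono) (auto simp: indicator_def)
      qed (rule i1, simp)
      also have "\<dots> = G n v0 * ?P" by (subst integral_mult_right_zero[symmetric]) (simp add: mult_ac)
      finally show "?J n \<le> G n v0 * ?P" .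
    qed
    have lim: "(\<lambda>n. ereal (?J n / ?P)) \<longlonglongrightarrow> ereal ((H v1 - H v0) / ?P)" using Jlim by simp
    have "hi v1 \<le> limsup (\<lambda>n. ereal (?J n / ?P))" unfolding hi_def
      by (rule Limsup_mono) (use up P in \<open>simp add: pos_le_divide_eq\<close>)
    also have "\<dots> = ereal ((H v1 - H v0) / ?P)" by (rule lim_imp_Limsup[OF _ lim]) simp
    also have "\<dots> = liminf (\<lambda>n. ereal (?J n / ?P))" by (rule lim_imp_Liminf[OF _ lim, symmetric]) simp
    also have "\<dots> \<le> lo v0" unfolding lo_def by (rule Liminf_mono) (use dn P in \<open>simp add: pos_divide_le_eq\<close>)
    finally show ?thesis .
  qed
  have "mono (\<lambda>x. - L x)" using Lanti by (auto simp: mono_def antimono_def)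
  then have "countable {a. \<not> isCont (\<lambda>x. - L x) a}" by (rule mono_ctble_discont)
  moreover have "{a. \<not> isCont L a} \<subseteq> {a. \<not> isCont (\<lambda>x. - L x) a}"
    using continuous_minus[of "at _" "\<lambda>x. - L x"] by auto
  ultimately have cnt: "countable {a. \<not> isCont L a}" by (rule countable_subset[rotated])
  show ?thesis
  proof (rule that[OF Lanti Lb cnt])
    fix v :: real assume v: "v < 0" "v \<notin> {a. \<not> isCont L a}"
    then show c: "isCont L v" by simp
    \<comment> \<open>\<open>key\<close> compares distinct points only; continuity of the lower
      limit L at v closes the gap as w increases to v.\<close>
    have "hi v \<le> ereal (L v)"
    proof (rule tendsto_lowerbound)
      show "((\<lambda>w. ereal (L w)) \<longlongrightarrow> ereal (L v)) (at_left v)"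
        using c by (auto simp: isCont_def intro: tendsto_mono[OF at_le])
      show "\<forall>\<^sub>F w in at_left v. hi v \<le> ereal (L w)"
        using eventually_at_left_real[of "v - 1" v] by (auto elim!: eventually_mono simp: L intro!: key less_imp_le[OF v(1)])
    qed simp
    then have "lo v = ereal (L v)" "hi v = ereal (L v)" using lohi(2)[of v] L[of v] by auto
    then have "(\<lambda>n. ereal (G n v)) \<longlonglongrightarrow> ereal (L v)"
      unfolding lo_def hi_def by (intro Liminf_eq_Limsup) auto
    then show "(\<lambda>n. G n v) \<longlonglongrightarrow> L v" by simp
  qed
qed


text \<open>The fundamental theorem of calculus applies where the density is continuous, and v < 0
  keeps the cut at 0 out of reach.\<close>

lemma density_has_derivative:
  assumes S: "S > 0" and L: "antimono L" "\<And>v. 0 \<le> L v" "\<And>v. L v \<le> 1"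
    and H: "\<And>v. H v = (\<integral>x. heat_kernel S u x * (L x * (indicator {..0} x * indicator {..v} x)) \<partial>lborel)"
    and v: "v < 0" "isCont L v"
  shows "(H has_real_derivative heat_kernel S u v * L v) (at v)"
proof -
  let ?psi = "\<lambda>x. heat_kernel S u x * L x"
  have [measurable]: "L \<in> borel_measurable borel" by (rule antimono_measurable[OF L(1)])
  have i: "integrable lborel (\<lambda>x. ?psi x * indicator A x)" if [measurable]: "A \<in> sets borel" for A
  proof -
    have "expbd 0 (\<lambda>x. L x * indicator A x)"
    proof (rule expbdI[where C=1])
      show "\<bar>L x * indicator A x\<bar> \<le> 1 * exp (0 * \<bar>x\<bar>)" for x using L(2,3)[of x] by (auto simp: indicator_def)
    qed measurable
    from expbd_heat_integrable[OF this S] show ?thesis by (simp add: mult.assoc)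
  qed
  have si: "set_integrable lborel {v-1..w} ?psi" for w unfolding set_integrable_def using i[of "{v-1..w}"] by (simp add: mult.commute)
  have Hw: "H w = H (v - 1) + integral {v-1..w} ?psi" if w: "v - 1 \<le> w" "w \<le> 0" for w
  proof -
    have H': "H z = (\<integral>x. ?psi x * indicator {..z} x \<partial>lborel)" if "z \<le> 0" for z
      unfolding H using that by (intro Bochner_Integration.integral_cong) (auto simp: indicator_def)
    have "H w - H (v - 1) = (\<integral>x. ?psi x * indicator {..w} x - ?psi x * indicator {..v-1} x \<partial>lborel)"
      using v w by (simp add: H' i)
    also have "\<dots> = (\<integral>x. indicator {v-1..w} x *\<^sub>R ?psi x \<partial>lborel)"
    proof (rule integral_cong_AE)
      show "AE x in lborel. ?psi x * indicator {..w} x - ?psi x * indicator {..v-1} x = indicator {v-1..w} x *\<^sub>R ?psi x"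
        using AE_lborel_singleton[of "v - 1"] by eventually_elim (use w in \<open>auto simp: indicator_def\<close>)
    qed measurable
    also have "\<dots> = integral {v-1..w} ?psi"
      using set_borel_integral_eq_integral(2)[OF si] unfolding set_lebesgue_integral_def .
    finally show ?thesis by simp
  qed
  have ch: "isCont (heat_kernel S u) v" using heat_kernel_deriv[OF S] by (rule DERIV_isCont)
  have "((\<lambda>w. integral {v-1..w} ?psi) has_vector_derivative ?psi v) (at v within {v-1..0})"
  proof (rule integral_has_vector_derivative_continuous_at[where S="{}", simplified])
    show "?psi integrable_on {v-1..0}" by (rule set_borel_integral_eq_integral(1)[OF si])
    show "continuous (at v within {v-1..0}) ?psi"
      by (rule continuous_at_imp_continuous_at_within, rule isCont_mult[OF ch v(2)])
  qed (use v in auto)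
  then have d: "((\<lambda>w. H (v - 1) + integral {v-1..w} ?psi) has_real_derivative ?psi v) (at v within {v-1..0})"
    unfolding has_real_derivative_iff_has_vector_derivative[symmetric] by (auto intro!: derivative_eq_intros)
  have at: "at v within {v-1..0} = at v" using v by (intro at_within_interior) auto
  have "\<forall>\<^sub>F w in nhds v. w \<in> {v-1<..<0}" using v by (intro eventually_nhds_in_open) auto
  then have ev: "\<forall>\<^sub>F w in nhds v. H (v - 1) + integral {v-1..w} ?psi = H w"
  proof eventually_elim
    case (elim w)
    show ?case by (rule Hw[symmetric]) (use elim in auto)
  qed
  have "((\<lambda>w. H (v - 1) + integral {v-1..w} ?psi) has_real_derivative ?psi v) (at v)"
    using d unfolding at .
  then show ?thesis by (rule DERIV_cong_ev[OF refl ev refl, THEN iffD1])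
qed

text \<open>The discretised kernels are the heat kernel times antitone factors, whose limit L gives
  the density of the barrier kernel. The derivative may fail to exist at 0 and at countably many
  other points, where \<open>deriv\<close> is arbitrary, so its bounds are stated almost
  everywhere.\<close>

lemma barrier_kernel_limit:
  assumes W: "std_BM M W" and T: "T > 0" and c: "continuous_on {0..T} c" and c0: "c 0 = 0" "c T = 0" and u: "u \<le> 0"
  defines "H \<equiv> \<lambda>v. measure M {\<omega> \<in> space M. (\<forall>\<theta>\<in>{0..T}. u + sqrt 2 * W \<theta> \<omega> \<le> c \<theta>) \<and> u + sqrt 2 * W T \<omega> \<le> v}"
  shows "deriv H \<in> borel_measurable borel"
    and "AE v in lborel. 0 \<le> deriv H v \<and> deriv H v \<le> heat_kernel (2 * T) u v \<and> (v > 0 \<longrightarrow> deriv H v = 0)"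
    and "expbd k g \<Longrightarrow> (\<lambda>n. heat_iter (\<lambda>j. 2 * (real j * (T / real (Suc n)))) (\<lambda>j. {..c (real j * (T / real (Suc n)))}) (Suc n) 0 g u)
      \<longlonglongrightarrow> (\<integral>v. deriv H v * g v \<partial>lborel)"
proof -
  let ?th = "\<lambda>n j. real j * (T / real (Suc n))"
  let ?K = "\<lambda>n g. heat_iter (\<lambda>j. 2 * ?th n j) (\<lambda>j. {..c (?th n j)}) (Suc n) 0 g u"
  let ?p = "heat_kernel (2 * T) u"
  have S: "2 * T > 0" using T by simp
  have thT: "?th n (Suc n) = T" for n by simp
  let ?Q = "\<lambda>n G. antimono G \<and> (\<forall>v. 0 \<le> G v \<and> G v \<le> 1) \<and> (\<forall>k g. expbd k g \<longrightarrow>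
    ?K n g = (\<integral>v. heat_kernel (2 * ?th n (Suc n) - 2 * ?th n 0) u v * (G v * (indicator {..c (?th n (Suc n))} v * g v)) \<partial>lborel))"
  have "\<exists>G. ?Q n G" for n
  proof (rule heat_iter_antitone)
    show "2 * ?th n i < 2 * ?th n (Suc i)" for i using T by (intro mult_strict_left_mono mult_strict_right_mono) auto
  qed
  then have "\<forall>n. \<exists>G. ?Q n G" by (rule allI)
  from choice[OF this] obtain G where G0: "\<forall>n. ?Q n (G n)" by (rule exE)
  have G: "\<And>n. antimono (G n)" "\<And>n v. 0 \<le> G n v" "\<And>n v. G n v \<le> 1"
    using G0 by blast+
  have th0: "2 * ?th n (Suc n) - 2 * ?th n 0 = 2 * T" for n by simp
  have KG: "?K n g = (\<integral>v. ?p v * (G n v * (indicator {..0} v * g v)) \<partial>lborel)" if "expbd k g" for n k g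
  proof -
    have "?K n g = (\<integral>v. heat_kernel (2 * ?th n (Suc n) - 2 * ?th n 0) u v * (G n v * (indicator {..c (?th n (Suc n))} v * g v)) \<partial>lborel)"
      using G0 that by blast
    then show ?thesis unfolding th0 unfolding thT c0 .
  qed
  have Gm[measurable]: "G n \<in> borel_measurable borel" for n by (rule antimono_measurable[OF G(1)])
  have eind: "expbd 0 (indicator {..v})" for v :: real by (rule expbdI[of _ 1]) (auto simp: indicator_def)
  have Hlim: "(\<lambda>n. \<integral>x. ?p x * (G n x * (indicator {..0} x * indicator {..v} x)) \<partial>lborel) \<longlonglongrightarrow> H v" for v
    using BM_barrier_limit[OF W T c c0(1) u, of v] unfolding KG[OF eind] H_def .
  obtain L C where L: "antimono L" "\<And>v. 0 \<le> L v" "\<And>v. L v \<le> 1" and C: "countable C"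
    and Lc: "\<And>v. v < 0 \<Longrightarrow> v \<notin> C \<Longrightarrow> isCont L v" and Ll: "\<And>v. v < 0 \<Longrightarrow> v \<notin> C \<Longrightarrow> (\<lambda>n. G n v) \<longlonglongrightarrow> L v"
    using antitone_liminf[OF S G Hlim] by blast
  have [measurable]: "L \<in> borel_measurable borel" by (rule antimono_measurable[OF L(1)])
  have C0: "AE v in lborel. v \<notin> insert 0 C"
    by (rule AE_not_in) (use C in \<open>simp add: null_setsI countable_imp_null_set_lborel\<close>)
  have conv: "(\<lambda>n. \<integral>x. ?p x * (G n x * (indicator {..0} x * g x)) \<partial>lborel) \<longlonglongrightarrow> (\<integral>x. ?p x * (L x * (indicator {..0} x * g x)) \<partial>lborel)"
    if g: "expbd k g" for g k
  proof (rule integral_dominated_convergence[where w="\<lambda>x. ?p x * \<bar>g x\<bar>"])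
    have [measurable]: "g \<in> borel_measurable borel" using g by auto
    obtain D where D: "\<And>x. \<bar>g x\<bar> \<le> D * exp (k * \<bar>x\<bar>)" using g by (rule expbdE) blast
    have "expbd k (\<lambda>x. \<bar>g x\<bar>)" by (rule expbdI[where C=D]) (use D in auto)
    then show "integrable lborel (\<lambda>x. ?p x * \<bar>g x\<bar>)" using S by (rule expbd_heat_integrable)
    show "(\<lambda>x. ?p x * (L x * (indicator {..0} x * g x))) \<in> borel_measurable lborel" by measurable
    show "(\<lambda>x. ?p x * (G n x * (indicator {..0} x * g x))) \<in> borel_measurable lborel" for n by measurable
    show "AE x in lborel. (\<lambda>n. ?p x * (G n x * (indicator {..0} x * g x))) \<longlonglongrightarrow> ?p x * (L x * (indicator {..0} x * g x))"
      using C0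
    proof eventually_elim
      case (elim x)
      show ?case
      proof (cases "x < 0")
        case True
        then show ?thesis using elim by (intro tendsto_intros Ll) auto
      next
        case False
        then have "x > 0" using elim by auto
        then show ?thesis by simp
      qed
    qed
    show "AE x in lborel. norm (?p x * (G n x * (indicator {..0} x * g x))) \<le> ?p x * \<bar>g x\<bar>" for n
    proof (rule AE_I2)
      fix x
      have "G n x * \<bar>indicator {..0} x * g x\<bar> \<le> 1 * \<bar>g x\<bar>" using G(2,3)[of n x] by (intro mult_mono) (auto simp: indicator_def)
      then have "?p x * (G n x * \<bar>indicator {..0} x * g x\<bar>) \<le> ?p x * \<bar>g x\<bar>" using T by (intro mult_left_mono) auto
      then show "norm (?p x * (G n x * (indicator {..0} x * g x))) \<le> ?p x * \<bar>g x\<bar>" using G(2)[of n x] T by (simp add: abs_mult)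
    qed
  qed
  have HL: "H v = (\<integral>x. ?p x * (L x * (indicator {..0} x * indicator {..v} x)) \<partial>lborel)" for v
    using LIMSEQ_unique[OF Hlim conv[OF eind]] .
  let ?q = "\<lambda>v. ?p v * (L v * indicator {..0} v)"
  have dH: "deriv H v = ?q v" if v: "v \<notin> insert 0 C" for v
  proof (cases "v < 0")
    case True
    have "(H has_real_derivative ?p v * L v) (at v)"
      by (rule density_has_derivative[OF S L HL True]) (use Lc True v in auto)
    then show ?thesis using True by (simp add: DERIV_imp_deriv)
  next
    case False
    then have v0: "v > 0" using v by auto
    \<comment> \<open>Paths in the event end below c T = 0, so there is no mass above 0.\<close>
    have H0: "H w = H 0" if "w > 0" for w
      unfolding HL using that by (intro Bochner_Integration.integral_cong) (auto simp: indicator_def)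
    have "\<forall>\<^sub>F w in nhds v. w \<in> {0<..}" using v0 by (intro eventually_nhds_in_open) auto
    then have "\<forall>\<^sub>F w in nhds v. H w = H 0" by eventually_elim (use H0 in auto)
    then have "(H has_real_derivative 0) (at v)" by (subst DERIV_cong_ev[OF refl _ refl]) auto
    then show ?thesis using v0 by (simp add: DERIV_imp_deriv)
  qed
  have qm: "?q \<in> borel_measurable borel" by measurable
  \<comment> \<open>A measurable function modified on a countable set.\<close>
  show dm: "deriv H \<in> borel_measurable borel"
    by (rule measurable_discrete_difference[OF qm, of "insert 0 C"]) (use C dH in auto)
  show "AE v in lborel. 0 \<le> deriv H v \<and> deriv H v \<le> ?p v \<and> (v > 0 \<longrightarrow> deriv H v = 0)"
    using C0
  proof eventually_elim
    case (elim v)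
    have "L v * indicator {..0} v \<le> 1" "0 \<le> L v * indicator {..0} v" using L(2,3)[of v] by (auto simp: indicator_def)
    moreover have "0 \<le> ?p v" using T by simp
    ultimately show ?case unfolding dH[OF elim] using mult_left_le[of "L v * indicator {..0} v" "?p v"] by (auto simp: indicator_def)
  qed
  show "(\<lambda>n. ?K n g) \<longlonglongrightarrow> (\<integral>v. deriv H v * g v \<partial>lborel)" if g: "expbd k g"
  proof -
    have [measurable]: "g \<in> borel_measurable borel" using g by auto
    note dm[measurable]
    have "(\<integral>v. deriv H v * g v \<partial>lborel) = (\<integral>x. ?p x * (L x * (indicator {..0} x * g x)) \<partial>lborel)"
    proof (rule integral_cong_AE)
      show "AE v in lborel. deriv H v * g v = ?p v * (L v * (indicator {..0} v * g v))"
        using C0 by eventually_elim (simp add: dH mult_ac)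
    qed measurable
    then show ?thesis using conv[OF g] unfolding KG[OF g] by simp
  qed
qed

section \<open>Refinement of the grid\<close>

lemma heat_iter_cong:
  assumes "\<And>i. i < n \<Longrightarrow> s (Suc (j + i)) - s (j + i) = s' (Suc (j' + i)) - s' (j' + i)"
    and "\<And>i. i < n \<Longrightarrow> A (Suc (j + i)) = A' (Suc (j' + i))"
  shows "heat_iter s A n j g = heat_iter s' A' n j' g"
  using assms
proof (induction n arbitrary: j j')
  case (Suc n)
  have "heat_iter s A n (Suc j) g = heat_iter s' A' n (Suc j') g"
  proof (rule Suc.IH)
    show "s (Suc (Suc j + i)) - s (Suc j + i) = s' (Suc (Suc j' + i)) - s' (Suc j' + i)" if "i < n" for i
      using Suc.prems(1)[of "Suc i"] that by simp
    show "A (Suc (Suc j + i)) = A' (Suc (Suc j' + i))" if "i < n" for i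
      using Suc.prems(2)[of "Suc i"] that by simp
  qed
  then show ?case using Suc.prems(1)[of 0] Suc.prems(2)[of 0] by simp
qed simp

lemma heat_iter_uniform:
  assumes "\<And>i. i < n \<Longrightarrow> s (Suc (j + i)) - s (j + i) = d" and "\<And>i. i < n \<Longrightarrow> A (Suc (j + i)) = {..0}"
  shows "heat_iter s A n j g = (killed_heat d ^^ n) g"
  using assms
proof (induction n arbitrary: j)
  case (Suc n)
  have "heat_iter s A n (Suc j) g = (killed_heat d ^^ n) g"
  proof (rule Suc.IH)
    show "s (Suc (Suc j + i)) - s (Suc j + i) = d" if "i < n" for i using Suc.prems(1)[of "Suc i"] that by simp
    show "A (Suc (Suc j + i)) = {..0}" if "i < n" for i using Suc.prems(2)[of "Suc i"] that by simp
  qed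
  then show ?case using Suc.prems(1)[of 0] Suc.prems(2)[of 0] by (simp add: killed_heat_def[abs_def])
qed simp

text \<open>The kernel is symmetric and both sides are cut at 0, so the killed step is self-adjoint
  on the negative half-line. This moves the steps before the barrier interval from the Psi side to
  the Phi side.\<close>

lemma killed_heat_dual:
  assumes f: "expbd a f" and g: "expbd c g" and ac: "a + c < 0" and d: "d > 0"
  shows "(\<integral>u. f u * (indicator {..0} u * killed_heat d g u) \<partial>lborel) = (\<integral>v. killed_heat d f v * (indicator {..0} v * g v) \<partial>lborel)"
proof -
  let ?F = "\<lambda>u. f u * indicator {..0} u"
  have [measurable]: "f \<in> borel_measurable borel" using f by auto
  have "(\<integral>u. ?F u * (\<integral>v. heat_kernel d u v * (indicator {..0} v * g v) \<partial>lborel) \<partial>lborel)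
     = (\<integral>v. (\<integral>y. ?F y * heat_kernel d y v \<partial>lborel) * (indicator {..0} v * g v) \<partial>lborel)"
  proof (rule heat_fubini[OF _ _ d])
    show "expbd c (\<lambda>v. indicator {..0} v * g v)" using g by (rule expbd_indicator) simp
    have "expbd c (\<lambda>y. exp (c * \<bar>y\<bar>))" by (rule expbdI[of _ 1]) auto
    from expbd_mult[OF expbd_indicator[OF f, of "{..0}"] this]
    have "expbd (a + c) (\<lambda>y. ?F y * exp (c * \<bar>y\<bar>))" by (simp add: mult_ac)
    then show "integrable lborel (\<lambda>y. ?F y * exp (c * \<bar>y\<bar>))" using ac by (rule expbd_integrable)
  qed measurable
  moreover have "(\<integral>y. ?F y * heat_kernel d y v \<partial>lborel) = killed_heat d f v" for v
    unfolding killed_heat_def using heat_kernel_sym[of d v] by (intro Bochner_Integration.integral_cong) (auto simp: mult_ac)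
  ultimately show ?thesis by (simp add: killed_heat_def mult_ac)
qed

lemma killed_heat_pow_dual:
  assumes f: "expbd a f" and g: "expbd c g" and ac: "a + c < 0" and d: "d > 0"
  shows "(\<integral>u. f u * (indicator {..0} u * (killed_heat d ^^ n) g u) \<partial>lborel) = (\<integral>v. (killed_heat d ^^ n) f v * (indicator {..0} v * g v) \<partial>lborel)"
  using f
proof (induction n arbitrary: f)
  case (Suc n)
  have "(\<integral>u. f u * (indicator {..0} u * (killed_heat d ^^ Suc n) g u) \<partial>lborel) = (\<integral>v. killed_heat d f v * (indicator {..0} v * (killed_heat d ^^ n) g v) \<partial>lborel)"
    using killed_heat_dual[OF Suc.prems expbd_killed_heat_pow[OF g d] ac d, of n] by simp
  also have "\<dots> = (\<integral>v. (killed_heat d ^^ n) (killed_heat d f) v * (indicator {..0} v * g v) \<partial>lborel)"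
    by (rule Suc.IH[OF expbd_killed_heat[OF Suc.prems d]])
  finally show ?case by (simp add: funpow_swap1)
qed simp

lemma grid_near:
  fixes \<sigma> :: "nat \<Rightarrow> real"
  assumes "\<sigma> 0 \<le> x" "x \<le> \<sigma> K" "\<And>j. j < K \<Longrightarrow> \<sigma> (Suc j) \<le> \<sigma> j + \<delta>" "\<delta> \<ge> 0"
  shows "\<exists>j\<le>K. \<sigma> j \<le> x \<and> x \<le> \<sigma> j + \<delta>"
  using assms
proof (induction K)
  case (Suc K)
  show ?case
  proof (cases "x \<le> \<sigma> K")
    case True
    then show ?thesis using Suc by (metis less_Suc_eq le_Suc_eq)
  next
    case False
    then show ?thesis using Suc.prems(2) Suc.prems(3)[of K] by (intro exI[of _ K]) auto
  qed
qed auto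

lemma fdet_tendsto:
  fixes b :: "nat \<Rightarrow> nat \<Rightarrow> real"
  assumes "\<And>n m. n < N \<Longrightarrow> m < N \<Longrightarrow> (\<lambda>i. a i n m) \<longlonglongrightarrow> b n m"
  shows "(\<lambda>i. fdet N (a i)) \<longlonglongrightarrow> fdet N b"
proof -
  have "p n < N" if "p permutes {..<N}" "n < N" for p n using permutes_in_image[OF that(1), of n] that(2) by simp
  then show ?thesis unfolding fdet_row by (intro tendsto_sum tendsto_mult tendsto_prod tendsto_const) (auto intro: assms)
qed

section \<open>The barrier in Brownian coordinates\<close>

lemma h_tilde_0: "h (4 * \<tau> / (1 + 4 * \<tau>)) = r \<Longrightarrow> h_tilde h r \<tau> = 0"
  by (simp add: h_tilde_def)

lemma bridge_pt_le_iff: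
  assumes "\<tau> > 0"
  shows "bridge_pt r (4 * \<tau> / (1 + 4 * \<tau>)) v \<le> h (4 * \<tau> / (1 + 4 * \<tau>)) \<longleftrightarrow> v \<le> h_tilde h r \<tau>"
proof -
  have e: "1 - 4 * \<tau> / (1 + 4 * \<tau>) = 1 / (1 + 4 * \<tau>)" using assms by (simp add: field_simps)
  have "h_tilde h r \<tau> = (h (4 * \<tau> / (1 + 4 * \<tau>)) - r) / (sqrt 2 / (1 + 4 * \<tau>))"
    by (simp add: h_tilde_def)
  moreover have "sqrt 2 / (1 + 4 * \<tau>) > 0" using assms by simp
  ultimately have "v \<le> h_tilde h r \<tau> \<longleftrightarrow> v * (sqrt 2 / (1 + 4 * \<tau>)) \<le> h (4 * \<tau> / (1 + 4 * \<tau>)) - r"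
    by (simp only: pos_le_divide_eq)
  then show ?thesis unfolding bridge_pt_def e by (auto simp: mult_ac)
qed

lemma tau_of_inverse: "\<tau> > 0 \<Longrightarrow> tau_of (4 * \<tau> / (1 + 4 * \<tau>)) = \<tau>"
  by (simp add: tau_of_def field_simps)

lemma inverse_tau_of:
  assumes "t < 1"
  shows "4 * tau_of t / (1 + 4 * tau_of t) = t"
proof -
  obtain a where a: "a > 0" "t = 1 - a" using assms by (metis diff_add_cancel diff_gt_0_iff_gt add_diff_cancel_left' add.commute)
  have "4 * tau_of t / (1 + 4 * tau_of t) = 4 * tau_of t * a" using one_plus_tau_of[OF assms] a by simp
  then show ?thesis using a(1) unfolding a(2) tau_of_def by (simp add: field_simps)
qed

text \<open>A path started above 0 violates the barrier at once. The integral over u in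
  \<open>K_kernel\<close> is thereby cut to u <= 0.\<close>

lemma T_kernel_pos:
  assumes "std_BM M W" and "\<tau>1 \<le> \<tau>2" and "u > 0"
  shows "T_kernel M W h r \<tau>1 \<tau>2 u v = 0"
proof -
  have "T_prob M W h r \<tau>1 \<tau>2 u v' = 0" for v'
  proof -
    have "{\<omega> \<in> space M. (\<forall>\<tau>\<in>{\<tau>1..\<tau>2}. u + sqrt 2 * W (\<tau> - \<tau>1) \<omega> \<le> 0) \<and>
       (\<forall>\<tau>\<in>{\<tau>1<..<\<tau>2}. u + sqrt 2 * W (\<tau> - \<tau>1) \<omega> \<le> h_tilde h r \<tau>) \<and> u + sqrt 2 * W (\<tau>2 - \<tau>1) \<omega> \<le> v'} = {}"
      (is "?E = {}")
    proof (rule ccontr)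
      assume "?E \<noteq> {}"
      then obtain \<omega> where \<omega>: "\<omega> \<in> space M" "\<forall>\<tau>\<in>{\<tau>1..\<tau>2}. u + sqrt 2 * W (\<tau> - \<tau>1) \<omega> \<le> 0" by blast
      have "u + sqrt 2 * W (\<tau>1 - \<tau>1) \<omega> \<le> 0" by (rule bspec[OF \<omega>(2)]) (use assms in simp)
      moreover have "W 0 \<omega> = 0" using assms(1) \<omega>(1) unfolding std_BM_def by blast
      ultimately show False using assms(3) by simp
    qed
    then show ?thesis unfolding T_prob_def Let_def by (simp only: measure_empty)
  qed
  then have "T_prob M W h r \<tau>1 \<tau>2 u = (\<lambda>_. 0)" by (intro ext)
  then show ?thesis unfolding T_kernel_def by simp
qed

text \<open>The two barrier conditions merge into one because \<open>h_tilde\<close> is at most 0 on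
  the interval and equal to 0 at its ends; time is then shifted to start at 0.\<close>

lemma T_kernel_barrier:
  assumes \<tau>: "\<tau>1 < \<tau>2" and c0: "\<And>\<tau>. \<tau> \<in> {\<tau>1..\<tau>2} \<Longrightarrow> h_tilde h r \<tau> \<le> 0"
    and c1: "h_tilde h r \<tau>1 = 0" "h_tilde h r \<tau>2 = 0"
  shows "T_kernel M W h r \<tau>1 \<tau>2 u = deriv (\<lambda>v. measure M {\<omega> \<in> space M.
      (\<forall>\<theta>\<in>{0..\<tau>2 - \<tau>1}. u + sqrt 2 * W \<theta> \<omega> \<le> h_tilde h r (\<tau>1 + \<theta>)) \<and> u + sqrt 2 * W (\<tau>2 - \<tau>1) \<omega> \<le> v})"
proof -
  have eq: "((\<forall>\<tau>\<in>{\<tau>1..\<tau>2}. x (\<tau> - \<tau>1) \<le> 0) \<and> (\<forall>\<tau>\<in>{\<tau>1<..<\<tau>2}. x (\<tau> - \<tau>1) \<le> h_tilde h r \<tau>)) \<longleftrightarrow>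
     (\<forall>\<theta>\<in>{0..\<tau>2 - \<tau>1}. x \<theta> \<le> h_tilde h r (\<tau>1 + \<theta>))" (is "?L \<longleftrightarrow> ?R") for x :: "real \<Rightarrow> real"
  proof
    assume L: ?L
    show ?R
    proof
      fix \<theta> assume \<theta>: "\<theta> \<in> {0..\<tau>2 - \<tau>1}"
      consider "\<theta> = 0" | "\<theta> = \<tau>2 - \<tau>1" | "\<tau>1 + \<theta> \<in> {\<tau>1<..<\<tau>2}" using \<theta> by force
      then show "x \<theta> \<le> h_tilde h r (\<tau>1 + \<theta>)"
      proof cases
        case 1 then show ?thesis using L c1 \<tau> by (auto dest: bspec[of _ _ \<tau>1])
      next
        case 2 then show ?thesis using L c1 \<tau> by (auto dest: bspec[of _ _ \<tau>2])
      next
        case 3 then show ?thesis using conjunct2[OF L] by (auto dest: bspec[of _ _ "\<tau>1 + \<theta>"])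
      qed
    qed
  next
    assume R: ?R
    have r: "x (\<tau> - \<tau>1) \<le> h_tilde h r \<tau>" if "\<tau> \<in> {\<tau>1..\<tau>2}" for \<tau>
      using bspec[OF R, of "\<tau> - \<tau>1"] that by auto
    show ?L using order_trans[OF r c0] r by auto
  qed
  have "T_prob M W h r \<tau>1 \<tau>2 u v = measure M {\<omega> \<in> space M.
      (\<forall>\<theta>\<in>{0..\<tau>2 - \<tau>1}. u + sqrt 2 * W \<theta> \<omega> \<le> h_tilde h r (\<tau>1 + \<theta>)) \<and> u + sqrt 2 * W (\<tau>2 - \<tau>1) \<omega> \<le> v}" for v
    unfolding T_prob_def Let_def
  proof (intro arg_cong[where f="measure M"] Collect_cong)
    fix \<omega>
    show "(\<omega> \<in> space M \<and> (\<forall>\<tau>\<in>{\<tau>1..\<tau>2}. u + sqrt 2 * W (\<tau> - \<tau>1) \<omega> \<le> 0) \<and>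
        (\<forall>\<tau>\<in>{\<tau>1<..<\<tau>2}. u + sqrt 2 * W (\<tau> - \<tau>1) \<omega> \<le> h_tilde h r \<tau>) \<and> u + sqrt 2 * W (\<tau>2 - \<tau>1) \<omega> \<le> v) \<longleftrightarrow>
      (\<omega> \<in> space M \<and> (\<forall>\<theta>\<in>{0..\<tau>2 - \<tau>1}. u + sqrt 2 * W \<theta> \<omega> \<le> h_tilde h r (\<tau>1 + \<theta>)) \<and> u + sqrt 2 * W (\<tau>2 - \<tau>1) \<omega> \<le> v)"
      unfolding eq[of "\<lambda>\<theta>. u + sqrt 2 * W \<theta> \<omega>", symmetric] by (simp only: conj_assoc)
  qed
  then have e: "(\<lambda>v. T_prob M W h r \<tau>1 \<tau>2 u v) = (\<lambda>v. measure M {\<omega> \<in> space M.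
      (\<forall>\<theta>\<in>{0..\<tau>2 - \<tau>1}. u + sqrt 2 * W \<theta> \<omega> \<le> h_tilde h r (\<tau>1 + \<theta>)) \<and> u + sqrt 2 * W (\<tau>2 - \<tau>1) \<omega> \<le> v})"
    by (intro ext)
  show ?thesis unfolding T_kernel_def[abs_def] e ..
qed

lemma h_tilde_shift: "h_tilde (\<lambda>t. h t - e) (r - e) = h_tilde h r"
  by (rule ext) (simp add: h_tilde_def)

lemma T_kernel_shift: "T_kernel M W (\<lambda>t. h t - e) (r - e) = T_kernel M W h r"
  unfolding T_kernel_def[abs_def] T_prob_def[abs_def] h_tilde_shift ..

text \<open>Measurability in u comes from the discretised flows as a pointwise limit, so that joint
  measurability of the derivative in u and v is not invoked.\<close>

lemma expbd_barrier_op: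
  assumes W: "std_BM M W" and T: "T > 0" and c: "continuous_on {0..T} c" and c0: "c 0 = 0" "c T = 0"
  defines "H \<equiv> \<lambda>u v. measure M {\<omega> \<in> space M. (\<forall>\<theta>\<in>{0..T}. u + sqrt 2 * W \<theta> \<omega> \<le> c \<theta>) \<and> u + sqrt 2 * W T \<omega> \<le> v}"
  assumes g: "expbd b g"
  shows "expbd b (\<lambda>u. indicator {..0} u * (\<integral>v. deriv (H u) v * g v \<partial>lborel))"
    and "\<And>u. u \<le> 0 \<Longrightarrow> integrable lborel (\<lambda>v. deriv (H u) v * g v)"
    and "\<And>u. u \<le> 0 \<Longrightarrow> \<bar>\<integral>v. deriv (H u) v * g v \<partial>lborel\<bar> \<le> (\<integral>v. heat_kernel (2 * T) u v * \<bar>g v\<bar> \<partial>lborel)"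
proof -
  have [measurable]: "g \<in> borel_measurable borel" using g by auto
  have S: "2 * T > 0" using T by simp
  let ?K = "\<lambda>n g. heat_iter (\<lambda>j. 2 * (real j * (T / real (Suc n)))) (\<lambda>j. {..c (real j * (T / real (Suc n)))}) (Suc n) 0 g"
  have ag: "expbd b (\<lambda>v. \<bar>g v\<bar>)" using g unfolding expbd_def by auto
  have Km[measurable]: "?K n g \<in> borel_measurable borel" for n
  proof (rule expbdD, rule expbd_heat_iter[OF g])
    show "2 * (real i * (T / real (Suc n))) < 2 * (real (Suc i) * (T / real (Suc n)))" for i
      using T by (intro mult_strict_left_mono mult_strict_right_mono) auto
  qed auto
  have Hu: "deriv (H u) \<in> borel_measurable borel" 
     "AE v in lborel. 0 \<le> deriv (H u) v \<and> deriv (H u) v \<le> heat_kernel (2 * T) u v \<and> (v > 0 \<longrightarrow> deriv (H u) v = 0)"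
     "(\<lambda>n. ?K n g u) \<longlonglongrightarrow> (\<integral>v. deriv (H u) v * g v \<partial>lborel)" if "u \<le> 0" for u
    using barrier_kernel_limit(1,2)[OF W T c c0 that] barrier_kernel_limit(3)[OF W T c c0 that g] unfolding H_def by blast+
  have dom: "AE v in lborel. norm (deriv (H u) v * g v) \<le> heat_kernel (2 * T) u v * \<bar>g v\<bar>" if "u \<le> 0" for u
    using Hu(2)[OF that]
  proof eventually_elim
    case (elim v)
    then show ?case by (simp add: abs_mult mult_right_mono)
  qed
  have hi: "integrable lborel (\<lambda>v. heat_kernel (2 * T) u v * \<bar>g v\<bar>)" for u using expbd_heat_integrable[OF ag S] .
  show int: "integrable lborel (\<lambda>v. deriv (H u) v * g v)" if "u \<le> 0" for u
  proof (rule Bochner_Integration.integrable_bound[OF hi[of u]])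
    note Hu(1)[OF that, measurable]
    show "(\<lambda>v. deriv (H u) v * g v) \<in> borel_measurable lborel" by measurable
    show "AE v in lborel. norm (deriv (H u) v * g v) \<le> norm (heat_kernel (2 * T) u v * \<bar>g v\<bar>)"
      using dom[OF that] by eventually_elim simp
  qed
  show bd: "\<bar>\<integral>v. deriv (H u) v * g v \<partial>lborel\<bar> \<le> (\<integral>v. heat_kernel (2 * T) u v * \<bar>g v\<bar> \<partial>lborel)" if "u \<le> 0" for u
    using order_trans[OF integral_norm_bound integral_mono_AE[OF _ hi[of u] dom[OF that]]] int[OF that] by auto
  obtain C where C: "C \<ge> 0" "\<And>x. \<bar>g x\<bar> \<le> C * exp (b * \<bar>x\<bar>)" using g by (rule expbdE) blast
  show "expbd b (\<lambda>u. indicator {..0} u * (\<integral>v. deriv (H u) v * g v \<partial>lborel))"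
  proof (rule expbdI)
    show "\<bar>indicator {..0} u * (\<integral>v. deriv (H u) v * g v \<partial>lborel)\<bar> \<le> C * (2 * exp (b\<^sup>2 * (2 * T) / 2)) * exp (b * \<bar>u\<bar>)" for u
    proof (cases "u \<le> 0")
      case True
      then show ?thesis using order_trans[OF bd[OF True] expbd_heat_bound(1)[OF _ C(2,1) S]] by simp
    qed (use C in simp)
    show "(\<lambda>u. indicator {..0} u * (\<integral>v. deriv (H u) v * g v \<partial>lborel)) \<in> borel_measurable borel"
    proof (rule borel_measurable_LIMSEQ_real)
      show "(\<lambda>n. indicator {..0} u * ?K n g u) \<longlonglongrightarrow> indicator {..0} u * (\<integral>v. deriv (H u) v * g v \<partial>lborel)" for u
        using Hu(3)[of u] by (cases "u \<le> 0") (auto simp: indicator_def)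
      show "(\<lambda>u. indicator {..0} u * ?K n g u) \<in> borel_measurable borel" for n by measurable
    qed
  qed
qed

text \<open>Three limits at once: the flow and both of its arguments. The flow does not enlarge the
  uniform error of \<beta>, its kernel having mass at most 1, and the weighted error of \<alpha> is
  integrable against the growth exp (b |u|) because b < l.\<close>

lemma barrier_pairing_limit:
  assumes W: "std_BM M W" and T: "T > 0" and c: "continuous_on {0..T} c" and c0: "c 0 = 0" "c T = 0"
  defines "H \<equiv> \<lambda>u v. measure M {\<omega> \<in> space M. (\<forall>\<theta>\<in>{0..T}. u + sqrt 2 * W \<theta> \<omega> \<le> c \<theta>) \<and> u + sqrt 2 * W T \<omega> \<le> v}"
  assumes b: "0 \<le> b" "b < l" and f: "expbd (- l) f" and g: "expbd b g"
    and \<alpha>: "\<And>i. expbd (- l) (\<alpha> i)" "\<And>i u. u \<le> 0 \<Longrightarrow> \<bar>\<alpha> i u - f u\<bar> \<le> exp (l * u) / real (Suc i)"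
    and \<beta>: "\<And>i. expbd b (\<beta> i)" "\<And>i v. v \<le> 0 \<Longrightarrow> \<bar>\<beta> i v - g v\<bar> \<le> 1 / real (Suc i)"
  shows "(\<lambda>i. \<integral>u. \<alpha> i u * (indicator {..0} u *
       heat_iter (\<lambda>j. 2 * (real j * (T / real (Suc i)))) (\<lambda>j. {..c (real j * (T / real (Suc i)))}) (Suc i) 0 (\<beta> i) u) \<partial>lborel)
     \<longlonglongrightarrow> (\<integral>u. f u * (indicator {..0} u * (\<integral>v. deriv (H u) v * g v \<partial>lborel)) \<partial>lborel)"
proof -
  let ?th = "\<lambda>n j. real j * (T / real (Suc n))"
  let ?K = "\<lambda>n g u. heat_iter (\<lambda>j. 2 * ?th n j) (\<lambda>j. {..c (?th n j)}) (Suc n) 0 g u"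
  have S: "2 * T > 0" using T by simp
  have stp: "2 * ?th n i < 2 * ?th n (Suc i)" for n i using T by (intro mult_strict_left_mono mult_strict_right_mono) auto
  have gm[measurable]: "f \<in> borel_measurable borel" "g \<in> borel_measurable borel" "\<alpha> i \<in> borel_measurable borel" "\<beta> i \<in> borel_measurable borel" for i
    using f g \<alpha>(1)[of i] \<beta>(1)[of i] by auto
  have Km[measurable]: "?K n (\<beta> n) \<in> borel_measurable borel" for n
  proof (rule expbdD, rule expbd_heat_iter[OF \<beta>(1)])
    show "2 * ?th n i < 2 * ?th n (Suc i)" for i by (rule stp)
  qed auto
  have KG: "\<exists>G. antimono G \<and> (\<forall>v. 0 \<le> G v \<and> G v \<le> 1) \<and> (\<forall>k g. expbd k g \<longrightarrow>
      ?K n g u = (\<integral>v. heat_kernel (2 * T) u v * (G v * (indicator {..0} v * g v)) \<partial>lborel))" for n u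
  proof -
    have "\<exists>G. antimono G \<and> (\<forall>v. 0 \<le> G v \<and> G v \<le> 1) \<and> (\<forall>k g. expbd k g \<longrightarrow>
      ?K n g u = (\<integral>v. heat_kernel (2 * ?th n (Suc n) - 2 * ?th n 0) u v * (G v * (indicator {..c (?th n (Suc n))} v * g v)) \<partial>lborel))"
    proof (rule heat_iter_antitone)
      show "2 * ?th n i < 2 * ?th n (Suc i)" for i by (rule stp)
    qed
    moreover have "2 * ?th n (Suc n) - 2 * ?th n 0 = 2 * T" "?th n (Suc n) = T" by simp_all
    ultimately show ?thesis by (simp only: c0)
  qed
  have diff: "\<bar>?K n (\<beta> n) u - ?K n g u\<bar> \<le> 1 / real (Suc n)" and Kg: "\<bar>?K n g u\<bar> \<le> (\<integral>v. heat_kernel (2 * T) u v * \<bar>g v\<bar> \<partial>lborel)" for n u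
  proof -
    obtain G where G0: "antimono G \<and> (\<forall>v. 0 \<le> G v \<and> G v \<le> 1) \<and> (\<forall>k g. expbd k g \<longrightarrow>
      ?K n g u = (\<integral>v. heat_kernel (2 * T) u v * (G v * (indicator {..0} v * g v)) \<partial>lborel))" using KG by (rule exE)
    have Ga: "antimono G" and G: "\<And>v. 0 \<le> G v" "\<And>v. G v \<le> 1" using G0 by blast+
    have KK: "?K n q u = (\<integral>v. heat_kernel (2 * T) u v * (G v * (indicator {..0} v * q v)) \<partial>lborel)" if "expbd b q" for q
      using G0 that by blast
    have [measurable]: "G \<in> borel_measurable borel" by (rule antimono_measurable[OF Ga])
    have eG: "expbd 0 G" using G by (intro expbdI[of _ 1]) auto
    have eq: "expbd b (\<lambda>v. G v * (indicator {..0} v * q v))" if "expbd b q" for q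
      using expbd_mult[OF eG expbd_indicator[OF that, of "{..0}"]] by simp
    have qi: "integrable lborel (\<lambda>v. heat_kernel (2 * T) u v * (G v * (indicator {..0} v * q v)))" if "expbd b q" for q
      by (rule expbd_heat_integrable[OF eq[OF that] S])
    have "\<bar>?K n (\<beta> n) u - ?K n g u\<bar> = \<bar>\<integral>v. heat_kernel (2 * T) u v * (G v * (indicator {..0} v * (\<beta> n v - g v))) \<partial>lborel\<bar>"
      unfolding KK[OF g] KK[OF \<beta>(1)] Bochner_Integration.integral_diff[OF qi[OF \<beta>(1)] qi[OF g], symmetric]
      by (simp add: algebra_simps)
    also have "\<dots> \<le> (\<integral>v. heat_kernel (2 * T) u v * (1 / real (Suc n)) \<partial>lborel)"
    proof (rule order_trans[OF integral_norm_bound[where 'a=real, unfolded real_norm_def]], rule integral_mono)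
      have "expbd b (\<lambda>v. \<beta> n v - g v)" by (rule expbd_diff[OF \<beta>(1) g])
      from qi[OF this] show "integrable lborel (\<lambda>v. \<bar>heat_kernel (2 * T) u v * (G v * (indicator {..0} v * (\<beta> n v - g v)))\<bar>)" by (rule integrable_abs)
      show "integrable lborel (\<lambda>v. heat_kernel (2 * T) u v * (1 / real (Suc n)))" using integrable_heat_kernel[OF S, of u] by simp
      fix v :: real
      have "\<bar>indicator {..0} v * (\<beta> n v - g v)\<bar> \<le> 1 / real (Suc n)" using \<beta>(2)[of v n] by (auto simp: indicator_def)
      then have "G v * \<bar>indicator {..0} v * (\<beta> n v - g v)\<bar> \<le> 1 * (1 / real (Suc n))" using G by (intro mult_mono) auto
      then have "heat_kernel (2 * T) u v * (G v * \<bar>indicator {..0} v * (\<beta> n v - g v)\<bar>) \<le> heat_kernel (2 * T) u v * (1 / real (Suc n))"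
        using T by (intro mult_left_mono) auto
      then show "\<bar>heat_kernel (2 * T) u v * (G v * (indicator {..0} v * (\<beta> n v - g v)))\<bar> \<le> heat_kernel (2 * T) u v * (1 / real (Suc n))"
        using G T by (simp add: abs_mult)
    qed
    also have "\<dots> = 1 / real (Suc n)" using integral_heat_kernel[OF S, of u] by simp
    finally show "\<bar>?K n (\<beta> n) u - ?K n g u\<bar> \<le> 1 / real (Suc n)" .
    show "\<bar>?K n g u\<bar> \<le> (\<integral>v. heat_kernel (2 * T) u v * \<bar>g v\<bar> \<partial>lborel)" unfolding KK[OF g]
    proof (rule order_trans[OF integral_norm_bound[where 'a=real, unfolded real_norm_def]], rule integral_mono)
      from qi[OF g] show "integrable lborel (\<lambda>v. \<bar>heat_kernel (2 * T) u v * (G v * (indicator {..0} v * g v))\<bar>)" by (rule integrable_abs)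
      have "expbd b (\<lambda>v. \<bar>g v\<bar>)" using g unfolding expbd_def by auto
      then show "integrable lborel (\<lambda>v. heat_kernel (2 * T) u v * \<bar>g v\<bar>)" using S by (rule expbd_heat_integrable)
      fix v :: real
      have "G v * \<bar>indicator {..0} v * g v\<bar> \<le> 1 * \<bar>g v\<bar>" using G by (intro mult_mono) (auto simp: indicator_def)
      then have "heat_kernel (2 * T) u v * (G v * \<bar>indicator {..0} v * g v\<bar>) \<le> heat_kernel (2 * T) u v * \<bar>g v\<bar>"
        using T by (intro mult_left_mono) auto
      then show "\<bar>heat_kernel (2 * T) u v * (G v * (indicator {..0} v * g v))\<bar> \<le> heat_kernel (2 * T) u v * \<bar>g v\<bar>"
        using G T by (simp add: abs_mult)
    qed
  qed
  obtain C where C: "C \<ge> 0" "\<And>x. \<bar>f x\<bar> \<le> C * exp (- l * \<bar>x\<bar>)" using f by (rule expbdE) blast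
  obtain D where D: "D \<ge> 0" "\<And>x. \<bar>g x\<bar> \<le> D * exp (b * \<bar>x\<bar>)" using g by (rule expbdE) blast
  let ?D = "D * (2 * exp (b\<^sup>2 * (2 * T) / 2))"
  have D0: "0 \<le> ?D" using D by simp
  have lim0: "(\<lambda>i. 1 / real (Suc i)) \<longlonglongrightarrow> 0" by real_asymp
  \<comment> \<open>The rates - l of \<alpha> and b of the flow add up to - (l - b). Each + 1
    absorbs an approximation error, which is at most 1 for every i.\<close>
  show ?thesis
  proof (rule integral_dominated_convergence[where w="\<lambda>u. (C + 1) * (?D + 1) * exp (- (l - b) * \<bar>u\<bar>)"])
    have "expbd (- (l - b)) (\<lambda>u. (C + 1) * (?D + 1) * exp (- (l - b) * \<bar>u\<bar>))"
      using C D0 by (intro expbdI[where C="(C + 1) * (?D + 1)"]) auto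
    then show "integrable lborel (\<lambda>u. (C + 1) * (?D + 1) * exp (- (l - b) * \<bar>u\<bar>))" using b by (rule_tac expbd_integrable) auto
    have "(\<lambda>u. indicator {..0} u * (\<integral>v. deriv (H u) v * g v \<partial>lborel)) \<in> borel_measurable borel"
      unfolding H_def by (rule expbdD[OF expbd_barrier_op(1)[OF W T c c0 g]])
    then show "(\<lambda>u. f u * (indicator {..0} u * (\<integral>v. deriv (H u) v * g v \<partial>lborel))) \<in> borel_measurable lborel" by measurable
    show "(\<lambda>u. \<alpha> i u * (indicator {..0} u * ?K i (\<beta> i) u)) \<in> borel_measurable lborel" for i by measurable
    show "AE u in lborel. (\<lambda>i. \<alpha> i u * (indicator {..0} u * ?K i (\<beta> i) u)) \<longlonglongrightarrow> f u * (indicator {..0} u * (\<integral>v. deriv (H u) v * g v \<partial>lborel))"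
    proof (rule AE_I2)
      fix u :: real
      show "(\<lambda>i. \<alpha> i u * (indicator {..0} u * ?K i (\<beta> i) u)) \<longlonglongrightarrow> f u * (indicator {..0} u * (\<integral>v. deriv (H u) v * g v \<partial>lborel))"
      proof (cases "u \<le> 0")
        case True
        have "(\<lambda>i. \<alpha> i u - f u) \<longlonglongrightarrow> 0"
        proof (rule Lim_null_comparison)
          show "\<forall>\<^sub>F i in sequentially. norm (\<alpha> i u - f u) \<le> exp (l * u) * (1 / real (Suc i))" using \<alpha>(2)[OF True] by simp
          show "(\<lambda>i. exp (l * u) * (1 / real (Suc i))) \<longlonglongrightarrow> 0" by (rule tendsto_mult_right_zero[OF lim0])
        qed
        then have a: "(\<lambda>i. \<alpha> i u) \<longlonglongrightarrow> f u" by (rule LIM_zero_cancel)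
        have "(\<lambda>i. ?K i (\<beta> i) u - ?K i g u) \<longlonglongrightarrow> 0"
          by (rule Lim_null_comparison[OF _ lim0]) (use diff in auto)
        from tendsto_add[OF this barrier_kernel_limit(3)[OF W T c c0 True g]]
        have "(\<lambda>i. ?K i (\<beta> i) u) \<longlonglongrightarrow> (\<integral>v. deriv (H u) v * g v \<partial>lborel)" unfolding H_def by simp
        then show ?thesis by (intro tendsto_mult a tendsto_const)
      qed simp
    qed
    show "AE u in lborel. norm (\<alpha> i u * (indicator {..0} u * ?K i (\<beta> i) u)) \<le> (C + 1) * (?D + 1) * exp (- (l - b) * \<bar>u\<bar>)" for i
    proof (rule AE_I2)
      fix u :: real
      show "norm (\<alpha> i u * (indicator {..0} u * ?K i (\<beta> i) u)) \<le> (C + 1) * (?D + 1) * exp (- (l - b) * \<bar>u\<bar>)"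
      proof (cases "u \<le> 0")
        case True
        have s: "1 / real (Suc i) \<le> 1" by simp
        have "exp (l * u) / real (Suc i) \<le> exp (- l * \<bar>u\<bar>)" using True mult_left_mono[OF s, of "exp (l * u)"] by simp
        then have a: "\<bar>\<alpha> i u\<bar> \<le> (C + 1) * exp (- l * \<bar>u\<bar>)" using \<alpha>(2)[OF True, of i] C(2)[of u] by (simp add: algebra_simps)
        have "(\<integral>v. heat_kernel (2 * T) u v * \<bar>g v\<bar> \<partial>lborel) \<le> ?D * exp (b * \<bar>u\<bar>)"
          by (rule expbd_heat_bound(1)[OF _ D(2,1) S]) simp
        moreover have "1 \<le> exp (b * \<bar>u\<bar>)" using b by simp
        ultimately have k: "\<bar>?K i (\<beta> i) u\<bar> \<le> (?D + 1) * exp (b * \<bar>u\<bar>)" using diff[of i u] Kg[of i u] s by (simp only: distrib_right)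
        have "norm (\<alpha> i u * (indicator {..0} u * ?K i (\<beta> i) u)) = \<bar>\<alpha> i u\<bar> * \<bar>?K i (\<beta> i) u\<bar>" using True by (simp add: abs_mult)
        also have "\<dots> \<le> ((C + 1) * exp (- l * \<bar>u\<bar>)) * ((?D + 1) * exp (b * \<bar>u\<bar>))"
          by (rule mult_mono[OF a k]) (use C in auto)
        also have "\<dots> = (C + 1) * (?D + 1) * (exp (- l * \<bar>u\<bar>) * exp (b * \<bar>u\<bar>))" by (simp only: mult_ac)
        also have "exp (- l * \<bar>u\<bar>) * exp (b * \<bar>u\<bar>) = exp (- (l - b) * \<bar>u\<bar>)" unfolding exp_add[symmetric] by (simp add: algebra_simps)
        finally show ?thesis .
      qed (use C D0 in simp)
    qed
  qed
qed

section \<open>Choice of the grids\<close>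

definition PhiO :: "real \<Rightarrow> real \<Rightarrow> nat \<Rightarrow> real \<Rightarrow> real" where
  "PhiO r \<tau> n u = PhiF r \<tau> n u - PhiF r \<tau> n (- u)"

definition PsiO :: "real \<Rightarrow> real \<Rightarrow> nat \<Rightarrow> real \<Rightarrow> real" where
  "PsiO r \<tau> m v = PsiF r \<tau> m v - PsiF r \<tau> m (- v)"

lemma expbd_PhiO: "\<tau> > 0 \<Longrightarrow> expbd c (PhiO r \<tau> n)"
  unfolding PhiO_def[abs_def] by (intro expbd_diff expbd_reflect expbd_PhiF)

lemma expbd_PsiO: "\<tau> \<ge> 0 \<Longrightarrow> expbd (2 * \<bar>r\<bar> + 1) (PsiO r \<tau> n)"
  unfolding PsiO_def[abs_def] by (intro expbd_diff expbd_reflect expbd_PsiF)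

text \<open>One t0 and one step count serve all n < N, as a finite conjunction of eventual
  statements. The condition on p controls the mesh.\<close>

lemma killed_Phi_grid:
  assumes r: "r > 0" and \<tau>: "\<tau> > 0" and l: "l \<ge> 0"
  shows "\<exists>t0 p. 0 < t0 \<and> t0 < \<tau> \<and> t0 \<le> 1 / real (Suc i) \<and> Suc i \<le> p \<and>
    (\<forall>n<N. \<forall>u\<le>0. \<bar>(killed_heat (2 * (\<tau> - t0) / real p) ^^ p) (PhiF r t0 n) u - PhiO r \<tau> n u\<bar> \<le> exp (l * u) / real (Suc i))"
proof -
  let ?P = "\<lambda>t0 n k. \<forall>u\<le>0. \<bar>(killed_heat (2 * (\<tau> - t0) / real k) ^^ k) (PhiF r t0 n) u - PhiO r \<tau> n u\<bar> \<le> exp (l * u) / real (Suc i)"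
  have "\<forall>\<^sub>F t0 in at_right 0. \<forall>n\<in>{..<N}. \<forall>\<^sub>F k in sequentially. ?P t0 n k"
    using killed_Phi[OF r \<tau> l, of "1 / real (Suc i)"] unfolding PhiO_def
    by (intro eventually_ball_finite) auto
  moreover have "\<forall>\<^sub>F t0 in at_right 0. t0 \<in> {0<..<min \<tau> (1 / real (Suc i))}" by (rule eventually_at_right_real) (use \<tau> in auto)
  ultimately have "\<forall>\<^sub>F t0 in at_right 0. (\<forall>n\<in>{..<N}. \<forall>\<^sub>F k in sequentially. ?P t0 n k) \<and> t0 \<in> {0<..<min \<tau> (1 / real (Suc i))}"
    by (rule eventually_conj)
  from eventually_happens'[OF trivial_limit_at_right_real this]
  obtain t0 where t0: "\<forall>n\<in>{..<N}. \<forall>\<^sub>F k in sequentially. ?P t0 n k" "t0 \<in> {0<..<min \<tau> (1 / real (Suc i))}" by blast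
  have "\<forall>\<^sub>F k in sequentially. (\<forall>n\<in>{..<N}. ?P t0 n k) \<and> Suc i \<le> k"
    by (intro eventually_conj eventually_ball_finite t0(1) eventually_ge_at_top) simp
  from eventually_happens'[OF sequentially_bot this] obtain p where "(\<forall>n\<in>{..<N}. ?P t0 n p)" "Suc i \<le> p" by blast
  then show ?thesis using t0(2) by (intro exI[of _ t0] exI[of _ p]) auto
qed

text \<open>Only lower bounds on t3 are known, so the number of steps is chosen after it, large
  enough for a mesh of at most 1 / (i + 1).\<close>

lemma killed_Psi_grid:
  assumes r: "r > 0" and \<tau>: "\<tau> > 0"
  shows "\<exists>t3 k. \<tau> < t3 \<and> real i \<le> t3 \<and> 0 < k \<and> (t3 - \<tau>) * real (Suc i) \<le> real k \<and>
    (\<forall>m<N. \<forall>v\<le>0. \<bar>(killed_heat (2 * (t3 - \<tau>) / real k) ^^ k) (PsiF r t3 m) v - PsiO r \<tau> m v\<bar> \<le> 1 / real (Suc i))"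
proof -
  let ?P = "\<lambda>t3 m k. \<forall>v\<le>0. \<bar>(killed_heat (2 * (t3 - \<tau>) / real k) ^^ k) (PsiF r t3 m) v - PsiO r \<tau> m v\<bar> \<le> 1 / real (Suc i)"
  have "\<forall>\<^sub>F t3 in at_top. \<forall>m\<in>{..<N}. \<forall>\<^sub>F k in sequentially. ?P t3 m k"
    using killed_Psi[OF r \<tau>, of "1 / real (Suc i)"] unfolding PsiO_def
    by (intro eventually_ball_finite) auto
  then have "\<forall>\<^sub>F t3 in at_top. (\<forall>m\<in>{..<N}. \<forall>\<^sub>F k in sequentially. ?P t3 m k) \<and> \<tau> < t3 \<and> real i \<le> t3"
    by (intro eventually_conj eventually_gt_at_top eventually_ge_at_top)
  from eventually_happens'[OF trivial_limit_at_top_linorder this]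
  obtain t3 where t3: "\<forall>m\<in>{..<N}. \<forall>\<^sub>F k in sequentially. ?P t3 m k" "\<tau> < t3" "real i \<le> t3" by blast
  have "\<forall>\<^sub>F k in sequentially. (\<forall>m\<in>{..<N}. ?P t3 m k) \<and> 0 < k \<and> nat \<lceil>(t3 - \<tau>) * real (Suc i)\<rceil> \<le> k"
    by (intro eventually_conj eventually_ball_finite t3(1) eventually_ge_at_top eventually_gt_at_top) simp
  from eventually_happens'[OF sequentially_bot this] obtain k where k: "\<forall>m\<in>{..<N}. ?P t3 m k" "0 < k" "nat \<lceil>(t3 - \<tau>) * real (Suc i)\<rceil> \<le> k" by blast
  have "(t3 - \<tau>) * real (Suc i) \<le> real k" using k(3) by linarith
  then show ?thesis using t3 k by (intro exI[of _ t3] exI[of _ k]) auto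
qed

text \<open>The i-th grid starts near 0, reaches beyond i, and has mesh of order 1 / i. In the last
  clause \<alpha> and \<beta> stand for the end data after the killed flow before \<tau>1 and after
  \<tau>2, and only the \<open>Suc i\<close> equal steps in between see the barrier.\<close>

definition killed_grid :: "real \<Rightarrow> real \<Rightarrow> real \<Rightarrow> real \<Rightarrow> (real \<Rightarrow> real) \<Rightarrow> nat \<Rightarrow> nat \<Rightarrow> nat \<Rightarrow> (nat \<Rightarrow> real)
    \<Rightarrow> (nat \<Rightarrow> real \<Rightarrow> real) \<Rightarrow> (nat \<Rightarrow> real \<Rightarrow> real) \<Rightarrow> bool" where
  "killed_grid r \<tau>1 \<tau>2 l b N i K \<sigma> \<alpha> \<beta> \<longleftrightarrow>
     (0 < \<sigma> 0 \<and> \<sigma> 0 < \<tau>1 \<and> \<sigma> 0 \<le> 1 / real (Suc i) \<and> real i \<le> \<sigma> K) \<and>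
     (\<forall>j<K. \<sigma> j < \<sigma> (Suc j) \<and> \<sigma> (Suc j) \<le> \<sigma> j + (1 + \<tau>2) / real (Suc i)) \<and>
     (\<forall>n. expbd (- l) (\<alpha> n)) \<and> (\<forall>m. expbd (2 * r + 1) (\<beta> m)) \<and>
     (\<forall>n<N. \<forall>u\<le>0. \<bar>\<alpha> n u - PhiO r \<tau>1 n u\<bar> \<le> exp (l * u) / real (Suc i)) \<and>
     (\<forall>m<N. \<forall>v\<le>0. \<bar>\<beta> m v - PsiO r \<tau>2 m v\<bar> \<le> 1 / real (Suc i)) \<and>
     (\<forall>n m. (\<integral>u. PhiF r (\<sigma> 0) n u * (indicator {..0} u *
          heat_iter (\<lambda>j. 2 * \<sigma> j) (\<lambda>j. {..b (\<sigma> j)}) K 0 (PsiF r (\<sigma> K) m) u) \<partial>lborel) =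
       (\<integral>u. \<alpha> n u * (indicator {..0} u *
          heat_iter (\<lambda>j. 2 * (real j * ((\<tau>2 - \<tau>1) / real (Suc i)))) (\<lambda>j. {..b (\<tau>1 + real j * ((\<tau>2 - \<tau>1) / real (Suc i)))}) (Suc i) 0 (\<beta> m) u) \<partial>lborel))"

lemma killed_grid_exists:
  assumes r: "r > 0" and \<tau>: "0 < \<tau>1" "\<tau>1 < \<tau>2" and l: "2 * r + 1 < l"
    and b: "\<And>\<tau>. 0 < \<tau> \<Longrightarrow> \<tau> \<le> \<tau>1 \<or> \<tau>2 \<le> \<tau> \<Longrightarrow> b \<tau> = 0"
  shows "\<exists>K \<sigma> \<alpha> \<beta>. killed_grid r \<tau>1 \<tau>2 l b N i K \<sigma> \<alpha> \<beta>"
proof -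
  have l0: "l \<ge> 0" using l r by simp
  have \<tau>2: "\<tau>2 > 0" using \<tau> by simp
  obtain t0 p where t0: "0 < t0" "t0 < \<tau>1" "t0 \<le> 1 / real (Suc i)" and p: "Suc i \<le> p"
    and a: "\<forall>n<N. \<forall>u\<le>0. \<bar>(killed_heat (2 * (\<tau>1 - t0) / real p) ^^ p) (PhiF r t0 n) u - PhiO r \<tau>1 n u\<bar> \<le> exp (l * u) / real (Suc i)"
    using killed_Phi_grid[OF r \<tau>(1) l0, of i N] by blast
  obtain t3 k where t3: "\<tau>2 < t3" "real i \<le> t3" and k: "0 < k" "(t3 - \<tau>2) * real (Suc i) \<le> real k"
    and c: "\<forall>m<N. \<forall>v\<le>0. \<bar>(killed_heat (2 * (t3 - \<tau>2) / real k) ^^ k) (PsiF r t3 m) v - PsiO r \<tau>2 m v\<bar> \<le> 1 / real (Suc i)"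
    using killed_Psi_grid[OF r \<tau>2, of i N] by blast
  define q where "q = Suc i"
  define dl dm dr where "dl = (\<tau>1 - t0) / real p" and "dm = (\<tau>2 - \<tau>1) / real q" and "dr = (t3 - \<tau>2) / real k"
  have pq: "p > 0" "q > 0" using p by (auto simp: q_def)
  have d: "dl > 0" "dm > 0" "dr > 0" using t0 t3 \<tau> pq k by (auto simp: dl_def dm_def dr_def)
  \<comment> \<open>Three uniform pieces, meeting in \<tau>1 at index p and in \<tau>2 at index p +
    q.\<close>
  define \<sigma> where "\<sigma> j = (if j \<le> p then t0 + real j * dl else if j \<le> p + q then \<tau>1 + real (j - p) * dm else \<tau>2 + real (j - (p + q)) * dr)" for j
  have s1: "\<sigma> j = t0 + real j * dl" if "j \<le> p" for j using that by (simp add: \<sigma>_def)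
  have pd: "real p * dl = \<tau>1 - t0" "real q * dm = \<tau>2 - \<tau>1" "real k * dr = t3 - \<tau>2" using pq k by (simp_all add: dl_def dm_def dr_def)
  have s2: "\<sigma> (p + j) = \<tau>1 + real j * dm" if "j \<le> q" for j using that pd(1) by (cases "j = 0") (auto simp: \<sigma>_def)
  have s3: "\<sigma> (p + q + j) = \<tau>2 + real j * dr" for j using pd(2) pq by (cases "j = 0") (auto simp: \<sigma>_def)
  have step1: "\<sigma> (Suc j) - \<sigma> j = dl" if "j < p" for j using that by (simp add: s1 algebra_simps)
  have step2: "\<sigma> (Suc (p + j)) - \<sigma> (p + j) = dm" if "j < q" for j
    using s2[of j] s2[of "Suc j"] that by (simp add: algebra_simps)
  have step3: "\<sigma> (Suc (p + q + j)) - \<sigma> (p + q + j) = dr" for j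
    using s3[of j] s3[of "Suc j"] by (simp add: algebra_simps)
  define K where "K = p + (q + k)"
  have sK: "\<sigma> K = t3" using s3[of k] pd(3) by (simp add: K_def add.assoc)
  have s0: "\<sigma> 0 = t0" by (simp add: \<sigma>_def)
  \<comment> \<open>The constant 1 + \<tau>2 covers all pieces: \<tau>2 bounds the lengths of the
    first two, and 1 comes from the choice of k for the third.\<close>
  have mesh: "dl \<le> (1 + \<tau>2) / real (Suc i)" "dm \<le> (1 + \<tau>2) / real (Suc i)" "dr \<le> (1 + \<tau>2) / real (Suc i)"
  proof -
    have "dl \<le> (\<tau>1 - t0) / real (Suc i)" unfolding dl_def using p t0 by (intro divide_left_mono) auto
    also have "\<dots> \<le> (1 + \<tau>2) / real (Suc i)" using t0 \<tau> by (intro divide_right_mono) auto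
    finally show "dl \<le> (1 + \<tau>2) / real (Suc i)" .
    show "dm \<le> (1 + \<tau>2) / real (Suc i)" unfolding dm_def q_def using \<tau> by (intro divide_right_mono) auto
    have "dr \<le> 1 / real (Suc i)" unfolding dr_def using k by (simp add: field_simps del: of_nat_Suc)
    also have "\<dots> \<le> (1 + \<tau>2) / real (Suc i)" using \<tau>2 by (intro divide_right_mono) auto
    finally show "dr \<le> (1 + \<tau>2) / real (Suc i)" .
  qed
  have step: "\<sigma> (Suc j) - \<sigma> j \<in> {dl, dm, dr}" for j
  proof -
    consider "j < p" | j' where "j = p + j'" "j' < q" | j' where "j = p + q + j'"
      by (metis add.assoc less_diff_conv2 le_add_diff_inverse not_less add.commute nat_le_linear)
    then show ?thesis using step1 step2 step3 by cases auto
  qed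
  have stp: "\<sigma> j < \<sigma> (Suc j)" "\<sigma> (Suc j) \<le> \<sigma> j + (1 + \<tau>2) / real (Suc i)" for j
    using step[of j] d mesh by (auto simp: algebra_simps)
  let ?ki = "heat_iter (\<lambda>j. 2 * \<sigma> j) (\<lambda>j. {..b (\<sigma> j)})"
  let ?km = "heat_iter (\<lambda>j. 2 * (real j * dm)) (\<lambda>j. {..b (\<tau>1 + real j * dm)}) q 0"
  have spos: "\<sigma> j > 0" for j using s0 t0(1) stp(1) by (induction j) (auto intro: less_trans)
  have left: "?ki p 0 g = (killed_heat (2 * dl) ^^ p) g" for g
  proof (rule heat_iter_uniform)
    fix j assume j: "j < p"
    show "2 * \<sigma> (Suc (0 + j)) - 2 * \<sigma> (0 + j) = 2 * dl" using step1[OF j] by simp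
    have "real (Suc j) * dl \<le> real p * dl" using j d by (intro mult_right_mono) auto
    then have "\<sigma> (Suc j) \<le> \<tau>1" using s1[of "Suc j"] j pd(1) by simp
    then show "{..b (\<sigma> (Suc (0 + j)))} = {..0}" using b[OF spos, of "Suc j"] by simp
  qed
  have mid: "?ki q p g = ?km g" for g
  proof (rule heat_iter_cong)
    fix j assume j: "j < q"
    show "2 * \<sigma> (Suc (p + j)) - 2 * \<sigma> (p + j) = 2 * (real (Suc (0 + j)) * dm) - 2 * (real (0 + j) * dm)"
      using step2[OF j] by (simp add: algebra_simps)
    show "{..b (\<sigma> (Suc (p + j)))} = {..b (\<tau>1 + real (Suc (0 + j)) * dm)}" using s2[of "Suc j"] j by simp
  qed
  have right: "?ki k (p + q) g = (killed_heat (2 * dr) ^^ k) g" for g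
  proof (rule heat_iter_uniform)
    fix j assume j: "j < k"
    show "2 * \<sigma> (Suc (p + q + j)) - 2 * \<sigma> (p + q + j) = 2 * dr" using step3[of j] by simp
    have "\<tau>2 \<le> \<sigma> (Suc (p + q + j))" using s3[of "Suc j"] d by simp
    then show "{..b (\<sigma> (Suc (p + q + j)))} = {..0}" using b[OF spos, of "Suc (p + q + j)"] by simp
  qed
  have split: "?ki K 0 g = (killed_heat (2 * dl) ^^ p) (?km ((killed_heat (2 * dr) ^^ k) g))" for g
    unfolding K_def heat_iter_add add_0 left mid right ..
  define \<alpha> \<beta> where "\<alpha> n = (killed_heat (2 * dl) ^^ p) (PhiF r t0 n)" and "\<beta> m = (killed_heat (2 * dr) ^^ k) (PsiF r t3 m)" for n m
  have e\<alpha>: "expbd (- l) (\<alpha> n)" for n unfolding \<alpha>_def using expbd_killed_heat_pow[OF expbd_PhiF[OF t0(1)]] d by simp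
  have e\<beta>: "expbd (2 * r + 1) (\<beta> m)" for m
    unfolding \<beta>_def using expbd_killed_heat_pow[OF expbd_PsiF[of t3 r m], of "2 * dr" k] d t3 \<tau>2 r by simp
  \<comment> \<open>Self-adjointness moves the p steps of the left piece onto \<open>PhiF\<close>;
    the barrier steps and the right piece stay on the other side.\<close>
  have pair: "(\<integral>u. PhiF r (\<sigma> 0) n u * (indicator {..0} u * ?ki K 0 (PsiF r (\<sigma> K) m) u) \<partial>lborel) =
    (\<integral>u. \<alpha> n u * (indicator {..0} u * ?km (\<beta> m) u) \<partial>lborel)" for n m
    unfolding split s0 sK \<beta>_def[symmetric] unfolding \<alpha>_def
  proof (rule killed_heat_pow_dual)
    show "expbd (- l) (PhiF r t0 n)" by (rule expbd_PhiF[OF t0(1)])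
    show "expbd (2 * r + 1) (?km (\<beta> m))" by (rule expbd_heat_iter[OF e\<beta>]) (use d in \<open>auto intro!: mult_strict_left_mono mult_strict_right_mono\<close>)
  qed (use l d in auto)
  have "killed_grid r \<tau>1 \<tau>2 l b N i K \<sigma> \<alpha> \<beta>"
    unfolding killed_grid_def
  proof (intro conjI)
    show "\<forall>n<N. \<forall>u\<le>0. \<bar>\<alpha> n u - PhiO r \<tau>1 n u\<bar> \<le> exp (l * u) / real (Suc i)" using a unfolding \<alpha>_def dl_def by simp
    show "\<forall>m<N. \<forall>v\<le>0. \<bar>\<beta> m v - PsiO r \<tau>2 m v\<bar> \<le> 1 / real (Suc i)" using c unfolding \<beta>_def dr_def by simp
    show "\<forall>n m. (\<integral>u. PhiF r (\<sigma> 0) n u * (indicator {..0} u *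
          heat_iter (\<lambda>j. 2 * \<sigma> j) (\<lambda>j. {..b (\<sigma> j)}) K 0 (PsiF r (\<sigma> K) m) u) \<partial>lborel) =
       (\<integral>u. \<alpha> n u * (indicator {..0} u *
          heat_iter (\<lambda>j. 2 * (real j * ((\<tau>2 - \<tau>1) / real (Suc i)))) (\<lambda>j. {..b (\<tau>1 + real j * ((\<tau>2 - \<tau>1) / real (Suc i)))}) (Suc i) 0 (\<beta> m) u) \<partial>lborel)"
      using pair unfolding dm_def q_def by blast
  qed (use s0 sK t0 t3 stp e\<alpha> e\<beta> in auto)
  then show ?thesis by blast
qed

text \<open>\<rho> enters the kernel and r the outer functions. They are separate because lowering h
  and r together fixes the kernel and changes the outer functions only.\<close>

definition barrier_entry :: "'b measure \<Rightarrow> (real \<Rightarrow> 'b \<Rightarrow> real) \<Rightarrow> (real \<Rightarrow> real) \<Rightarrow> real \<Rightarrow> real \<Rightarrow> real \<Rightarrow> real \<Rightarrow> nat \<Rightarrow> nat \<Rightarrow> real" where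
  "barrier_entry M W h \<rho> r \<tau>1 \<tau>2 n m =
     (\<integral>u. PhiO r \<tau>1 n u * (indicator {..0} u * (\<integral>v. T_kernel M W h \<rho> \<tau>1 \<tau>2 u v * PsiO r \<tau>2 m v \<partial>lborel)) \<partial>lborel)"

lemma choice4:
  assumes "\<And>i. \<exists>a b c d. P i a b c d"
  shows "\<exists>a b c d. \<forall>i. P i (a i) (b i) (c i) (d i)"
proof -
  from assms have "\<forall>i. \<exists>a b c d. P i a b c d" by (rule allI)
  from choice[OF this] obtain a where "\<forall>i. \<exists>b c d. P i (a i) b c d" by (rule exE)
  from choice[OF this] obtain b where "\<forall>i. \<exists>c d. P i (a i) (b i) c d" by (rule exE)
  from choice[OF this] obtain c where "\<forall>i. \<exists>d. P i (a i) (b i) (c i) d" by (rule exE)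
  from choice[OF this] show ?thesis by blast
qed

text \<open>An excess at t persists on a neighbourhood of the transformed time, eventually wider
  than the mesh; the grid eventually covers that time because its ends tend to 0 and to
  infinity.\<close>

lemma path_grid_exceeds:
  fixes F :: "real \<Rightarrow> real" and \<sigma> :: "nat \<Rightarrow> nat \<Rightarrow> real"
  assumes F: "continuous_on {0..1} F" and t: "0 < t" "t < 1" "F t > 0"
    and g: "\<And>i. \<sigma> i 0 \<le> 1 / real (Suc i)" "\<And>i. real i \<le> \<sigma> i (K i)"
      "\<And>i j. j < K i \<Longrightarrow> \<sigma> i (Suc j) \<le> \<sigma> i j + D / real (Suc i)" "\<And>i j. j \<le> K i \<Longrightarrow> 0 < \<sigma> i j" and D: "D \<ge> 0"
  shows "\<forall>\<^sub>F i in sequentially. \<exists>j\<le>K i. F (4 * \<sigma> i j / (1 + 4 * \<sigma> i j)) > 0"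
proof -
  define \<tau> where "\<tau> = tau_of t"
  have \<tau>: "\<tau> > 0" "4 * \<tau> / (1 + 4 * \<tau>) = t" using t by (auto simp: \<tau>_def tau_of_pos inverse_tau_of)
  have "continuous_on {0<..} (\<lambda>y. F (4 * y / (1 + 4 * y)))"
    by (rule continuous_on_compose2[OF F]) (auto intro!: continuous_intros)
  then have "isCont (\<lambda>y. F (4 * y / (1 + 4 * y))) \<tau>" using \<tau>(1) by (auto simp: continuous_on_eq_continuous_at)
  then have "\<forall>\<^sub>F y in at \<tau>. F (4 * y / (1 + 4 * y)) > 0"
    unfolding isCont_def by (rule order_tendstoD) (use t \<tau> in simp)
  then obtain d where d: "d > 0" "\<And>y. y \<noteq> \<tau> \<Longrightarrow> dist y \<tau> < d \<Longrightarrow> F (4 * y / (1 + 4 * y)) > 0"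
    unfolding eventually_at by auto
  have d': "F (4 * y / (1 + 4 * y)) > 0" if "\<bar>y - \<tau>\<bar> < d" for y
    using d(2)[of y] that t(3) \<tau>(2) by (cases "y = \<tau>") (auto simp: dist_real_def)
  have "(\<lambda>i. D / real (Suc i)) \<longlonglongrightarrow> 0" "(\<lambda>i. 1 / real (Suc i)) \<longlonglongrightarrow> 0" by real_asymp+
  then have "\<forall>\<^sub>F i in sequentially. D / real (Suc i) < d" "\<forall>\<^sub>F i in sequentially. 1 / real (Suc i) < \<tau>"
    using d(1) \<tau>(1) by (auto dest: order_tendstoD(2))
  moreover have "\<forall>\<^sub>F i in sequentially. \<tau> \<le> real i" using filterlim_real_sequentially by (simp add: filterlim_at_top)
  ultimately show ?thesis
  proof eventually_elim
    case (elim i)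
    have "\<exists>j\<le>K i. \<sigma> i j \<le> \<tau> \<and> \<tau> \<le> \<sigma> i j + D / real (Suc i)"
      by (rule grid_near) (use g(1,2)[of i] g(3)[of _ i] elim D in \<open>auto intro: order_trans simp del: of_nat_Suc\<close>)
    then obtain j where "j \<le> K i" "\<sigma> i j \<le> \<tau>" "\<tau> \<le> \<sigma> i j + D / real (Suc i)" by blast
    then show ?case using elim by (intro exI[of _ j] conjI d') auto
  qed
qed

lemma barrier_entry_op:
  assumes W: "std_BM M W" and \<tau>: "0 < \<tau>1" "\<tau>1 < \<tau>2" and c: "continuous_on {\<tau>1..\<tau>2} (h_tilde h \<rho>)"
    and c0: "\<And>\<tau>. \<tau> \<in> {\<tau>1..\<tau>2} \<Longrightarrow> h_tilde h \<rho> \<tau> \<le> 0" and c1: "h_tilde h \<rho> \<tau>1 = 0" "h_tilde h \<rho> \<tau>2 = 0"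
    and g: "expbd b g"
  shows "expbd b (\<lambda>u. indicator {..0} u * (\<integral>v. T_kernel M W h \<rho> \<tau>1 \<tau>2 u v * g v \<partial>lborel))"
    and "\<And>u. u \<le> 0 \<Longrightarrow> \<bar>\<integral>v. T_kernel M W h \<rho> \<tau>1 \<tau>2 u v * g v \<partial>lborel\<bar> \<le> (\<integral>v. heat_kernel (2 * (\<tau>2 - \<tau>1)) u v * \<bar>g v\<bar> \<partial>lborel)"
    and "\<And>u. u \<le> 0 \<Longrightarrow> T_kernel M W h \<rho> \<tau>1 \<tau>2 u \<in> borel_measurable borel"
    and "\<And>u. u \<le> 0 \<Longrightarrow> AE v in lborel. \<bar>T_kernel M W h \<rho> \<tau>1 \<tau>2 u v\<bar> \<le> heat_kernel (2 * (\<tau>2 - \<tau>1)) u v"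
    and "\<And>u. u \<le> 0 \<Longrightarrow> integrable lborel (\<lambda>v. T_kernel M W h \<rho> \<tau>1 \<tau>2 u v * g v)"
proof -
  have T: "\<tau>2 - \<tau>1 > 0" using \<tau> by simp
  have c': "continuous_on {0..\<tau>2 - \<tau>1} (\<lambda>\<theta>. h_tilde h \<rho> (\<tau>1 + \<theta>))"
    by (rule continuous_on_compose2[OF c]) (auto intro!: continuous_intros)
  have c0': "h_tilde h \<rho> (\<tau>1 + 0) = 0" "h_tilde h \<rho> (\<tau>1 + (\<tau>2 - \<tau>1)) = 0" using c1 by simp_all
  have Tk: "T_kernel M W h \<rho> \<tau>1 \<tau>2 u = deriv (\<lambda>v. measure M {\<omega> \<in> space M.
      (\<forall>\<theta>\<in>{0..\<tau>2 - \<tau>1}. u + sqrt 2 * W \<theta> \<omega> \<le> h_tilde h \<rho> (\<tau>1 + \<theta>)) \<and> u + sqrt 2 * W (\<tau>2 - \<tau>1) \<omega> \<le> v})" for u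
    by (rule T_kernel_barrier[OF \<tau>(2) _ c1]) (rule c0)
  note B = expbd_barrier_op[OF W T c' c0' g]
  note L = barrier_kernel_limit[OF W T c' c0']
  show "expbd b (\<lambda>u. indicator {..0} u * (\<integral>v. T_kernel M W h \<rho> \<tau>1 \<tau>2 u v * g v \<partial>lborel))" unfolding Tk by (rule B(1))
  fix u :: real assume u: "u \<le> 0"
  show "\<bar>\<integral>v. T_kernel M W h \<rho> \<tau>1 \<tau>2 u v * g v \<partial>lborel\<bar> \<le> (\<integral>v. heat_kernel (2 * (\<tau>2 - \<tau>1)) u v * \<bar>g v\<bar> \<partial>lborel)"
    unfolding Tk by (rule B(3)[OF u])
  show "T_kernel M W h \<rho> \<tau>1 \<tau>2 u \<in> borel_measurable borel" unfolding Tk by (rule L(1)[OF u])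
  show "AE v in lborel. \<bar>T_kernel M W h \<rho> \<tau>1 \<tau>2 u v\<bar> \<le> heat_kernel (2 * (\<tau>2 - \<tau>1)) u v"
    unfolding Tk using L(2)[OF u] by eventually_elim auto
  show "integrable lborel (\<lambda>v. T_kernel M W h \<rho> \<tau>1 \<tau>2 u v * g v)" unfolding Tk by (rule B(2)[OF u])
qed

text \<open>One sequence has two limits. As probabilities on grids filling (0, 1), it tends to the
  probability over [0, 1] by path continuity; as determinants of pairings, it tends to the
  determinant of \<open>barrier_entry\<close>.\<close>

lemma barrier_le_prob:
  assumes N: "N \<ge> 1" and r: "r > 0" and t: "0 < t1" "t1 < t2" "t2 < 1" and h: "continuous_on {0..1} h"
    and hr: "\<And>t. t \<in> {0..1} \<Longrightarrow> h t \<le> r" and h0: "\<And>t. t \<in> {0..1} - {t1<..<t2} \<Longrightarrow> h t = r"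
    and B: "nonint_bridges M N B" and W: "std_BM M2 W"
  shows "{\<omega> \<in> space M. \<forall>t\<in>{0..1}. B (N - 1) t \<omega> \<le> h t} \<in> sets M"
    and "measure M {\<omega> \<in> space M. \<forall>t\<in>{0..1}. B (N - 1) t \<omega> \<le> h t} = fdet N (barrier_entry M2 W h r r (tau_of t1) (tau_of t2))"
proof -
  interpret prob_space M using B by (simp add: nonint_bridges_def)
  have [measurable]: "B (N - 1) t \<in> borel_measurable M" for t using B N unfolding nonint_bridges_def by simp
  have path: "continuous_on {0..1} (\<lambda>t. B (N - 1) t \<omega>)" "B (N - 1) 0 \<omega> = 0" "B (N - 1) 1 \<omega> = 0" if "\<omega> \<in> space M" for \<omega>
    using B N that unfolding nonint_bridges_def by simp_all
  define \<tau>1 \<tau>2 where "\<tau>1 = tau_of t1" and "\<tau>2 = tau_of t2"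
  have \<tau>: "0 < \<tau>1" "\<tau>1 < \<tau>2" using t by (auto simp: \<tau>1_def \<tau>2_def intro: tau_of_pos tau_of_less)
  define b where "b = h_tilde h r"
  have unit: "4 * \<tau> / (1 + 4 * \<tau>) \<in> {0..1}" "4 * \<tau> / (1 + 4 * \<tau>) < 1" if "\<tau> > 0" for \<tau> :: real using that by (auto simp: field_simps)
  have mono4: "4 * x / (1 + 4 * x) \<le> 4 * y / (1 + 4 * y)" if "0 < x" "x \<le> y" for x y :: real
    using that by (simp add: divide_simps) (simp add: algebra_simps)
  have ti: "4 * \<tau>1 / (1 + 4 * \<tau>1) = t1" "4 * \<tau>2 / (1 + 4 * \<tau>2) = t2" using t by (auto simp: \<tau>1_def \<tau>2_def inverse_tau_of)
  have b0: "b \<tau> = 0" if "0 < \<tau>" "\<tau> \<le> \<tau>1 \<or> \<tau>2 \<le> \<tau>" for \<tau>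
  proof -
    have "4 * \<tau> / (1 + 4 * \<tau>) \<le> t1 \<or> t2 \<le> 4 * \<tau> / (1 + 4 * \<tau>)"
      using that(2) mono4[of \<tau> \<tau>1] mono4[of \<tau>2 \<tau>] that(1) \<tau> unfolding ti by auto
    then show ?thesis unfolding b_def by (intro h_tilde_0 h0) (use unit(1)[OF that(1)] in auto)
  qed
  have ble: "b \<tau> \<le> 0" if "\<tau> \<in> {\<tau>1..\<tau>2}" for \<tau>
  proof -
    have "\<tau> > 0" using that \<tau> by simp
    then show ?thesis unfolding b_def h_tilde_def using hr[OF unit(1)[of \<tau>]] by (intro mult_nonneg_nonpos) auto
  qed
  have bc: "continuous_on {\<tau>1..\<tau>2} b"
  proof -
    have "continuous_on {\<tau>1..\<tau>2} (\<lambda>\<tau>. h (4 * \<tau> / (1 + 4 * \<tau>)))"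
      by (rule continuous_on_compose2[OF h]) (use unit(1) \<tau> in \<open>auto intro!: continuous_intros\<close>)
    then show ?thesis unfolding b_def h_tilde_def[abs_def] by (intro continuous_intros) auto
  qed
  \<comment> \<open>The weight has to exceed the growth rate 2 r + 1 of \<open>PsiO\<close>.\<close>
  define l where "l = 2 * r + 2"
  have l: "2 * r + 1 < l" by (simp add: l_def)
  from choice4[of "killed_grid r \<tau>1 \<tau>2 l b N", OF killed_grid_exists[OF r \<tau> l b0]]
  obtain K \<sigma> \<alpha> \<beta> where G: "\<forall>i. killed_grid r \<tau>1 \<tau>2 l b N i (K i) (\<sigma> i) (\<alpha> i) (\<beta> i)" by blast
  have g1: "0 < \<sigma> i 0" "\<sigma> i 0 < \<tau>1" "\<sigma> i 0 \<le> 1 / real (Suc i)" "real i \<le> \<sigma> i (K i)" for i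
    using spec[OF G, of i] unfolding killed_grid_def by blast+
  have g2: "\<sigma> i j < \<sigma> i (Suc j)" "\<sigma> i (Suc j) \<le> \<sigma> i j + (1 + \<tau>2) / real (Suc i)" if "j < K i" for i j
    using spec[OF G, of i] that unfolding killed_grid_def by blast+
  have g3: "expbd (- l) (\<alpha> i n)" "expbd (2 * r + 1) (\<beta> i n)" for i n
    using spec[OF G, of i] unfolding killed_grid_def by blast+
  have g4: "\<bar>\<alpha> i n u - PhiO r \<tau>1 n u\<bar> \<le> exp (l * u) / real (Suc i)" "\<bar>\<beta> i n u - PsiO r \<tau>2 n u\<bar> \<le> 1 / real (Suc i)" if "n < N" "u \<le> 0" for i n u
    using spec[OF G, of i] that unfolding killed_grid_def by blast+
  have g5: "(\<integral>u. PhiF r (\<sigma> i 0) n u * (indicator {..0} u *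
          heat_iter (\<lambda>j. 2 * \<sigma> i j) (\<lambda>j. {..b (\<sigma> i j)}) (K i) 0 (PsiF r (\<sigma> i (K i)) m) u) \<partial>lborel) =
       (\<integral>u. \<alpha> i n u * (indicator {..0} u *
          heat_iter (\<lambda>j. 2 * (real j * ((\<tau>2 - \<tau>1) / real (Suc i)))) (\<lambda>j. {..b (\<tau>1 + real j * ((\<tau>2 - \<tau>1) / real (Suc i)))}) (Suc i) 0 (\<beta> i m) u) \<partial>lborel)" for i n m
    using spec[OF G, of i] unfolding killed_grid_def by blast
  have spos: "0 < \<sigma> i j" if "j \<le> K i" for i j
    using that
  proof (induction j)
    case (Suc j)
    then have "0 < \<sigma> i j" "\<sigma> i j < \<sigma> i (Suc j)" using g2(1)[of j i] by auto
    then show ?case by (rule less_trans)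
  qed (use g1 in simp)
  define s where "s i j = 4 * \<sigma> i j / (1 + 4 * \<sigma> i j)" for i j
  have s: "0 < s i j" "s i j < 1" "s i j \<in> {0..1}" "tau_of (s i j) = \<sigma> i j" if "j \<le> K i" for i j
    using spos[OF that] unit[OF spos[OF that]] tau_of_inverse[OF spos[OF that]] by (auto simp: s_def)
  have smono: "s i j < s i (Suc j)" if "j < K i" for i j
    using g2(1)[OF that] spos[of j i] spos[of "Suc j" i] that unfolding s_def by (simp add: divide_simps) (simp add: algebra_simps)
  let ?E = "{\<omega> \<in> space M. \<forall>t\<in>{0..1}. B (N - 1) t \<omega> \<le> h t}"
  let ?Ei = "\<lambda>i. {\<omega> \<in> space M. \<forall>j\<le>K i. B (N - 1) (s i j) \<omega> \<le> h (s i j)}"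
  have Eim[measurable]: "?Ei i \<in> sets M" for i by measurable
  have EE: "(\<lambda>i. indicator (?Ei i) \<omega>) \<longlonglongrightarrow> (indicator ?E \<omega> :: real)" if w: "\<omega> \<in> space M" for \<omega>
  proof (cases "\<omega> \<in> ?E")
    case True
    then have "\<omega> \<in> ?Ei i" for i using s(3) by blast
    then show ?thesis using True by simp
  next
    case False
    then obtain t where t: "t \<in> {0..1}" "B (N - 1) t \<omega> > h t" using w by force
    \<comment> \<open>The grids stay inside (0, 1). At the end points the path is 0 while h = r > 0,
      so no violation occurs there.\<close>
    have "t \<noteq> 0" "t \<noteq> 1" using t path[OF w] h0[of 0] h0[of 1] r \<open>0 < t1\<close> \<open>t2 < 1\<close> by auto
    then have t': "0 < t" "t < 1" using t(1) by auto
    have "continuous_on {0..1} (\<lambda>t. B (N - 1) t \<omega> - h t)" by (intro continuous_intros path(1)[OF w] h)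
    then have "\<forall>\<^sub>F i in sequentially. \<exists>j\<le>K i. B (N - 1) (4 * \<sigma> i j / (1 + 4 * \<sigma> i j)) \<omega> - h (4 * \<sigma> i j / (1 + 4 * \<sigma> i j)) > 0"
    proof (rule path_grid_exceeds[where D="1 + \<tau>2" and t=t])
      show "B (N - 1) t \<omega> - h t > 0" using t(2) by simp
      show "1 + \<tau>2 \<ge> 0" using \<tau> by simp
    qed (fact t' g1(3) g1(4) g2(2) spos)+
    then have "\<forall>\<^sub>F i in sequentially. indicator (?Ei i) \<omega> = (0 :: real)"
    proof eventually_elim
      case (elim i)
      then have "\<omega> \<notin> ?Ei i" by (force simp: s_def)
      then show ?case by simp
    qed
    then show ?thesis using False by (simp add: tendsto_eventually)
  qed
  have "(indicator ?E :: _ \<Rightarrow> real) \<in> borel_measurable M" by (rule borel_measurable_LIMSEQ_real[OF EE]) measurable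
  then have "?E \<inter> space M \<in> sets M" by (rule borel_measurable_indicator_iff[THEN iffD1])
  moreover have "?E \<inter> space M = ?E" by (rule Int_absorb2) (rule Collect_restrict)
  ultimately show Em: "?E \<in> sets M" by (simp only:)
  have "(\<lambda>i. \<integral>\<omega>. indicator (?Ei i) \<omega> \<partial>M) \<longlonglongrightarrow> (\<integral>\<omega>. (indicator ?E \<omega> :: real) \<partial>M)"
  proof (rule integral_dominated_convergence[where w="\<lambda>_. 1"])
    show "(\<lambda>\<omega>. indicator ?E \<omega> :: real) \<in> borel_measurable M" using Em by (rule borel_measurable_indicator)
    show "(\<lambda>\<omega>. indicator (?Ei i) \<omega> :: real) \<in> borel_measurable M" for i using Eim by (rule borel_measurable_indicator)
    show "AE \<omega> in M. (\<lambda>i. indicator (?Ei i) \<omega> :: real) \<longlonglongrightarrow> indicator ?E \<omega>" using EE by (rule AE_I2)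
    show "AE \<omega> in M. norm (indicator (?Ei i) \<omega> :: real) \<le> 1" for i by (rule AE_I2) (simp add: indicator_def)
  qed simp
  moreover have mi: "(\<integral>\<omega>. indicator A \<omega> \<partial>M) = measure M A" if "A \<in> sets M" for A using that by simp
  ultimately have P1: "(\<lambda>i. measure M (?Ei i)) \<longlonglongrightarrow> measure M ?E" unfolding mi[OF Eim] mi[OF Em] by blast
  have P2: "measure M (?Ei i) = fdet N (\<lambda>n m. \<integral>u. \<alpha> i n u * (indicator {..0} u *
          heat_iter (\<lambda>j. 2 * (real j * ((\<tau>2 - \<tau>1) / real (Suc i)))) (\<lambda>j. {..b (\<tau>1 + real j * ((\<tau>2 - \<tau>1) / real (Suc i)))}) (Suc i) 0 (\<beta> i m) u) \<partial>lborel)" for i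
  proof -
    have set: "{v. bridge_pt r (s i j) v \<le> h (s i j)} = {..b (\<sigma> i j)}" if "j \<le> K i" for j
      unfolding s_def b_def bridge_pt_le_iff[OF spos[OF that]] by auto
    have k: "heat_iter (\<lambda>j. 2 * tau_of (s i j)) (\<lambda>j. {v. bridge_pt r (s i j) v \<le> h (s i j)}) (K i) 0 g
      = heat_iter (\<lambda>j. 2 * \<sigma> i j) (\<lambda>j. {..b (\<sigma> i j)}) (K i) 0 g" for g
      by (rule heat_iter_cong) (use s(4) set in \<open>auto simp: Suc_le_eq less_imp_le\<close>)
    have i0: "bridge_inv r (s i 0) (h (s i 0)) = b (\<sigma> i 0)"
    proof -
      have "1 - s i 0 = 1 / (1 + 4 * \<sigma> i 0)" using spos[of 0 i] by (simp add: s_def field_simps)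
      then show ?thesis unfolding bridge_inv_def b_def h_tilde_def s_def by simp
    qed
    show ?thesis
    proof -
      have z: "b (\<sigma> i 0) = 0" using g1[of i] by (intro b0) auto
      have "measure M (?Ei i) = fdet N (\<lambda>n m. \<integral>u. PhiF r (tau_of (s i 0)) n u * (indicator {..bridge_inv r (s i 0) (h (s i 0))} u *
        heat_iter (\<lambda>j. 2 * tau_of (s i j)) (\<lambda>j. {v. bridge_pt r (s i j) v \<le> h (s i j)}) (K i) 0 (PsiF r (tau_of (s i (K i))) m) u) \<partial>lborel)"
        by (rule fdd_det[OF B N]) (use s smono in auto)
      then show ?thesis unfolding k i0 z s(4)[OF le0] s(4)[OF order_refl] g5 .
    qed
  qed
  have T: "\<tau>2 - \<tau>1 > 0" using \<tau> by simp
  have c': "continuous_on {0..\<tau>2 - \<tau>1} (\<lambda>\<theta>. b (\<tau>1 + \<theta>))"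
    by (rule continuous_on_compose2[OF bc]) (auto intro!: continuous_intros)
  have c0': "b (\<tau>1 + 0) = 0" "b (\<tau>1 + (\<tau>2 - \<tau>1)) = 0" using \<tau> by (auto intro!: b0)
  have "(\<lambda>i. fdet N (\<lambda>n m. \<integral>u. \<alpha> i n u * (indicator {..0} u *
          heat_iter (\<lambda>j. 2 * (real j * ((\<tau>2 - \<tau>1) / real (Suc i)))) (\<lambda>j. {..b (\<tau>1 + real j * ((\<tau>2 - \<tau>1) / real (Suc i)))}) (Suc i) 0 (\<beta> i m) u) \<partial>lborel))
     \<longlonglongrightarrow> fdet N (barrier_entry M2 W h r r \<tau>1 \<tau>2)"
  proof (rule fdet_tendsto)
    fix n m assume nm: "n < N" "m < N"
    have Tk: "T_kernel M2 W h r \<tau>1 \<tau>2 u = deriv (\<lambda>v. measure M2 {\<omega> \<in> space M2.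
      (\<forall>\<theta>\<in>{0..\<tau>2 - \<tau>1}. u + sqrt 2 * W \<theta> \<omega> \<le> b (\<tau>1 + \<theta>)) \<and> u + sqrt 2 * W (\<tau>2 - \<tau>1) \<omega> \<le> v})" for u
      using T_kernel_barrier[OF \<tau>(2), of h r M2 W u] ble b0[of \<tau>1] b0[of \<tau>2] \<tau> unfolding b_def by simp
    show "(\<lambda>i. \<integral>u. \<alpha> i n u * (indicator {..0} u *
          heat_iter (\<lambda>j. 2 * (real j * ((\<tau>2 - \<tau>1) / real (Suc i)))) (\<lambda>j. {..b (\<tau>1 + real j * ((\<tau>2 - \<tau>1) / real (Suc i)))}) (Suc i) 0 (\<beta> i m) u) \<partial>lborel)
      \<longlonglongrightarrow> barrier_entry M2 W h r r \<tau>1 \<tau>2 n m"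
      unfolding barrier_entry_def Tk
    proof (rule barrier_pairing_limit[OF W T c' c0', where b="2 * r + 1" and l=l])
      show "expbd (2 * r + 1) (PsiO r \<tau>2 m)" using expbd_PsiO[of \<tau>2 r m] \<tau> r by simp
      show "expbd (- l) (PhiO r \<tau>1 n)" by (rule expbd_PhiO[OF \<tau>(1)])
    qed (use r l g3 g4 nm in auto)
  qed
  from LIMSEQ_unique[OF P1[unfolded P2] this]
  show "measure M ?E = fdet N (barrier_entry M2 W h r r (tau_of t1) (tau_of t2))" unfolding \<tau>1_def \<tau>2_def .
qed

text \<open>The kernel is fixed while the level in the outer functions moves. Dominated convergence
  is applied in v and then in u, with bounds uniform over levels of modulus at most R.\<close>

lemma barrier_entry_tendsto:
  assumes W: "std_BM M W" and \<tau>: "0 < \<tau>1" "\<tau>1 < \<tau>2" and c: "continuous_on {\<tau>1..\<tau>2} (h_tilde h \<rho>)"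
    and c0: "\<And>\<tau>. \<tau> \<in> {\<tau>1..\<tau>2} \<Longrightarrow> h_tilde h \<rho> \<tau> \<le> 0" and c1: "h_tilde h \<rho> \<tau>1 = 0" "h_tilde h \<rho> \<tau>2 = 0"
    and s: "s \<longlonglongrightarrow> r" "\<And>i. \<bar>s i\<bar> \<le> R" "\<bar>r\<bar> \<le> R"
  shows "(\<lambda>i. barrier_entry M W h \<rho> (s i) \<tau>1 \<tau>2 n m) \<longlonglongrightarrow> barrier_entry M W h \<rho> r \<tau>1 \<tau>2 n m"
proof -
  have R: "R \<ge> 0" using s(3) by simp
  have S: "2 * (\<tau>2 - \<tau>1) > 0" using \<tau> by simp
  \<comment> \<open>\<open>?l\<close> exceeds \<open>?b\<close> by 1, which leaves exp (- |u|) as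
    the final dominating function.\<close>
  let ?S = "2 * (\<tau>2 - \<tau>1)" and ?b = "2 * R + 1" and ?l = "2 * R + 2"
  have l0: "0 \<le> ?l" using R by simp
  obtain C where C: "C \<ge> 0" "\<And>q u. \<bar>q\<bar> \<le> R \<Longrightarrow> \<bar>PhiF q \<tau>1 n u\<bar> \<le> C * exp (- ?l * \<bar>u\<bar>)"
    using PhiF_bound[OF R \<tau>(1) l0, where b=\<tau>1 and n=n] by blast
  obtain D where D: "D \<ge> 0" "\<And>q v. \<bar>q\<bar> \<le> R \<Longrightarrow> \<bar>PsiF q \<tau>2 m v\<bar> \<le> D * exp (?b * \<bar>v\<bar>)"
    using PsiF_bound[OF R, where b=\<tau>2 and m=m] \<tau> by (metis less_imp_le less_trans order_refl)
  have PhiO: "\<bar>PhiO q \<tau>1 n u\<bar> \<le> 2 * C * exp (- ?l * \<bar>u\<bar>)" if "\<bar>q\<bar> \<le> R" for q u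
    using C(2)[OF that, of u] C(2)[OF that, of "- u"] unfolding PhiO_def by simp
  have PsiO: "\<bar>PsiO q \<tau>2 m v\<bar> \<le> 2 * D * exp (?b * \<bar>v\<bar>)" if "\<bar>q\<bar> \<le> R" for q v
    using D(2)[OF that, of v] D(2)[OF that, of "- v"] unfolding PsiO_def by simp
  have [measurable]: "PhiO q \<tau> k \<in> borel_measurable borel" "PsiO q \<tau> k \<in> borel_measurable borel" for q \<tau> k
    unfolding PhiO_def[abs_def] PsiO_def[abs_def] by measurable
  have e: "expbd ?b (PsiO q \<tau>2 m)" if "\<bar>q\<bar> \<le> R" for q by (rule expbdI[OF _ PsiO[OF that]]) measurable
  note op = barrier_entry_op[OF W \<tau> c c0 c1]
  have inner: "(\<lambda>i. \<integral>v. T_kernel M W h \<rho> \<tau>1 \<tau>2 u v * PsiO (s i) \<tau>2 m v \<partial>lborel) \<longlonglongrightarrow> (\<integral>v. T_kernel M W h \<rho> \<tau>1 \<tau>2 u v * PsiO r \<tau>2 m v \<partial>lborel)"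
    if u: "u \<le> 0" for u
  proof (rule integral_dominated_convergence[where w="\<lambda>v. heat_kernel ?S u v * (2 * D * exp (?b * \<bar>v\<bar>))"])
    have [measurable]: "T_kernel M W h \<rho> \<tau>1 \<tau>2 u \<in> borel_measurable borel" by (rule op(3)[OF _ e[OF s(3)] u])
    show "(\<lambda>v. T_kernel M W h \<rho> \<tau>1 \<tau>2 u v * PsiO r \<tau>2 m v) \<in> borel_measurable lborel" by measurable
    show "(\<lambda>v. T_kernel M W h \<rho> \<tau>1 \<tau>2 u v * PsiO (s i) \<tau>2 m v) \<in> borel_measurable lborel" for i by measurable
    have "expbd ?b (\<lambda>v. 2 * D * exp (?b * \<bar>v\<bar>))" using D by (intro expbdI[where C="2 * D"]) auto
    then show "integrable lborel (\<lambda>v. heat_kernel ?S u v * (2 * D * exp (?b * \<bar>v\<bar>)))" using S by (rule expbd_heat_integrable)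
    show "AE v in lborel. (\<lambda>i. T_kernel M W h \<rho> \<tau>1 \<tau>2 u v * PsiO (s i) \<tau>2 m v) \<longlonglongrightarrow> T_kernel M W h \<rho> \<tau>1 \<tau>2 u v * PsiO r \<tau>2 m v"
    proof (rule AE_I2)
      fix v
      have "continuous_on UNIV (\<lambda>q. PsiO q \<tau>2 m v)" unfolding PsiO_def by (intro continuous_intros)
      then have "(\<lambda>i. PsiO (s i) \<tau>2 m v) \<longlonglongrightarrow> PsiO r \<tau>2 m v" by (rule continuous_on_tendsto_compose[OF _ s(1)]) auto
      then show "(\<lambda>i. T_kernel M W h \<rho> \<tau>1 \<tau>2 u v * PsiO (s i) \<tau>2 m v) \<longlonglongrightarrow> T_kernel M W h \<rho> \<tau>1 \<tau>2 u v * PsiO r \<tau>2 m v"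
        by (rule tendsto_mult_left)
    qed
    have "AE v in lborel. \<bar>T_kernel M W h \<rho> \<tau>1 \<tau>2 u v\<bar> \<le> heat_kernel ?S u v" by (rule op(4)[OF _ e[OF s(3)] u])
    then show "AE v in lborel. norm (T_kernel M W h \<rho> \<tau>1 \<tau>2 u v * PsiO (s i) \<tau>2 m v) \<le> heat_kernel ?S u v * (2 * D * exp (?b * \<bar>v\<bar>))" for i
    proof eventually_elim
      case (elim v)
      show ?case unfolding real_norm_def abs_mult by (rule mult_mono[OF elim PsiO[OF s(2)]]) (use \<tau> in auto)
    qed
  qed
  let ?c = "2 * D * (2 * exp (?b\<^sup>2 * ?S / 2))"
  have bd: "\<bar>\<integral>v. T_kernel M W h \<rho> \<tau>1 \<tau>2 u v * PsiO q \<tau>2 m v \<partial>lborel\<bar> \<le> ?c * exp (?b * \<bar>u\<bar>)" if u: "u \<le> 0" and q: "\<bar>q\<bar> \<le> R" for u q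
  proof -
    have "\<bar>\<integral>v. T_kernel M W h \<rho> \<tau>1 \<tau>2 u v * PsiO q \<tau>2 m v \<partial>lborel\<bar> \<le> (\<integral>v. heat_kernel ?S u v * \<bar>PsiO q \<tau>2 m v\<bar> \<partial>lborel)"
      by (rule op(2)[OF _ e[OF q] u])
    also have "\<dots> \<le> ?c * exp (?b * \<bar>u\<bar>)" by (rule expbd_heat_bound(1)[OF _ PsiO[OF q] _ S]) (use D in auto)
    finally show ?thesis .
  qed
  have m1: "(\<lambda>u. PhiO q \<tau>1 n u * (indicator {..0} u * (\<integral>v. T_kernel M W h \<rho> \<tau>1 \<tau>2 u v * PsiO q \<tau>2 m v \<partial>lborel))) \<in> borel_measurable lborel" if "\<bar>q\<bar> \<le> R" for q
  proof -
    have "(\<lambda>u. indicator {..0} u * (\<integral>v. T_kernel M W h \<rho> \<tau>1 \<tau>2 u v * PsiO q \<tau>2 m v \<partial>lborel)) \<in> borel_measurable borel"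
      by (rule expbdD[OF op(1)[OF _ e[OF that]]])
    then show ?thesis by measurable
  qed
  show ?thesis unfolding barrier_entry_def
  proof (rule integral_dominated_convergence[where w="\<lambda>u. 2 * C * ?c * exp (- 1 * \<bar>u\<bar>)"])
    have "expbd (-1) (\<lambda>u. 2 * C * ?c * exp (- 1 * \<bar>u\<bar>))" using C D by (intro expbdI[where C="2 * C * ?c"]) (auto simp: abs_mult)
    then show "integrable lborel (\<lambda>u. 2 * C * ?c * exp (- 1 * \<bar>u\<bar>))" by (rule expbd_integrable) simp
    show "AE u in lborel. (\<lambda>i. PhiO (s i) \<tau>1 n u * (indicator {..0} u * (\<integral>v. T_kernel M W h \<rho> \<tau>1 \<tau>2 u v * PsiO (s i) \<tau>2 m v \<partial>lborel)))
      \<longlonglongrightarrow> PhiO r \<tau>1 n u * (indicator {..0} u * (\<integral>v. T_kernel M W h \<rho> \<tau>1 \<tau>2 u v * PsiO r \<tau>2 m v \<partial>lborel))"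
    proof (rule AE_I2)
      fix u :: real
      have "continuous_on UNIV (\<lambda>q. PhiO q \<tau>1 n u)" unfolding PhiO_def by (intro continuous_intros) (use \<tau> in auto)
      then have a: "(\<lambda>i. PhiO (s i) \<tau>1 n u) \<longlonglongrightarrow> PhiO r \<tau>1 n u" by (rule continuous_on_tendsto_compose[OF _ s(1)]) auto
      show "(\<lambda>i. PhiO (s i) \<tau>1 n u * (indicator {..0} u * (\<integral>v. T_kernel M W h \<rho> \<tau>1 \<tau>2 u v * PsiO (s i) \<tau>2 m v \<partial>lborel)))
        \<longlonglongrightarrow> PhiO r \<tau>1 n u * (indicator {..0} u * (\<integral>v. T_kernel M W h \<rho> \<tau>1 \<tau>2 u v * PsiO r \<tau>2 m v \<partial>lborel))"
      proof (cases "u \<le> 0")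
        case True
        show ?thesis by (intro tendsto_mult a tendsto_const inner True)
      qed simp
    qed
    show "AE u in lborel. norm (PhiO (s i) \<tau>1 n u * (indicator {..0} u * (\<integral>v. T_kernel M W h \<rho> \<tau>1 \<tau>2 u v * PsiO (s i) \<tau>2 m v \<partial>lborel)))
      \<le> 2 * C * ?c * exp (- 1 * \<bar>u\<bar>)" for i
    proof (rule AE_I2)
      fix u :: real
      let ?I = "\<integral>v. T_kernel M W h \<rho> \<tau>1 \<tau>2 u v * PsiO (s i) \<tau>2 m v \<partial>lborel"
      show "norm (PhiO (s i) \<tau>1 n u * (indicator {..0} u * ?I)) \<le> 2 * C * ?c * exp (- 1 * \<bar>u\<bar>)"
      proof (cases "u \<le> 0")
        case True
        have "norm (PhiO (s i) \<tau>1 n u * (indicator {..0} u * ?I)) = \<bar>PhiO (s i) \<tau>1 n u\<bar> * \<bar>?I\<bar>" using True by (simp add: abs_mult)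
        also have "\<dots> \<le> (2 * C * exp (- ?l * \<bar>u\<bar>)) * (?c * exp (?b * \<bar>u\<bar>))"
          by (rule mult_mono[OF PhiO[OF s(2)] bd[OF True s(2)]]) (use C in auto)
        also have "\<dots> = 2 * C * ?c * (exp (- ?l * \<bar>u\<bar>) * exp (?b * \<bar>u\<bar>))" by (simp only: mult_ac)
        also have "exp (- ?l * \<bar>u\<bar>) * exp (?b * \<bar>u\<bar>) = exp (- 1 * \<bar>u\<bar>)" unfolding exp_add[symmetric] by (simp add: algebra_simps)
        finally show ?thesis .
      qed (use C D in simp)
    qed
  qed (use m1 s in auto)
qed

text \<open>On the strict event the gap between h and the path attains a positive minimum over the
  compact interval, so the event is the increasing union of the weak events for the lowered
  functions.\<close>

lemma barrier_less_prob:
  assumes N: "N \<ge> 1" and r: "r > 0" and t: "0 < t1" "t1 < t2" "t2 < 1" and h: "continuous_on {0..1} h"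
    and hr: "\<And>t. t \<in> {0..1} \<Longrightarrow> h t \<le> r" and h0: "\<And>t. t \<in> {0..1} - {t1<..<t2} \<Longrightarrow> h t = r"
    and B: "nonint_bridges M N B" and W: "std_BM M2 W"
  shows "measure M {\<omega> \<in> space M. \<forall>t\<in>{0..1}. B (N - 1) t \<omega> < h t} = fdet N (barrier_entry M2 W h r r (tau_of t1) (tau_of t2))"
proof -
  interpret prob_space M using B by (simp add: nonint_bridges_def)
  \<comment> \<open>The denominator i + 2 keeps r - \<epsilon> i positive, as
    \<open>barrier_le_prob\<close> asks of its level.\<close>
  define \<epsilon> where "\<epsilon> i = r / real (i + 2)" for i
  have \<epsilon>: "0 < \<epsilon> i" "\<epsilon> i < r" for i using r divide_strict_left_mono[of 1 "real (i + 2)" r] by (auto simp: \<epsilon>_def)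
  have \<epsilon>lim: "\<epsilon> \<longlonglongrightarrow> 0" unfolding \<epsilon>_def[abs_def] by real_asymp
  define F where "F i = {\<omega> \<in> space M. \<forall>t\<in>{0..1}. B (N - 1) t \<omega> \<le> h t - \<epsilon> i}" for i
  have hc: "continuous_on {0..1} (\<lambda>t. h t - \<epsilon> i)" for i by (intro continuous_intros h)
  have F: "F i \<in> sets M" "measure M (F i) = fdet N (barrier_entry M2 W h r (r - \<epsilon> i) (tau_of t1) (tau_of t2))" for i
  proof -
    have p: "0 < r - \<epsilon> i" using \<epsilon> by simp
    note le = barrier_le_prob[OF N p t hc _ _ B W, of i]
    show "F i \<in> sets M" unfolding F_def by (rule le(1)) (use hr h0 in auto)
    have "barrier_entry M2 W (\<lambda>t. h t - \<epsilon> i) (r - \<epsilon> i) (r - \<epsilon> i) (tau_of t1) (tau_of t2) = barrier_entry M2 W h r (r - \<epsilon> i) (tau_of t1) (tau_of t2)"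
      unfolding barrier_entry_def[abs_def] T_kernel_shift ..
    moreover have "measure M (F i) = fdet N (barrier_entry M2 W (\<lambda>t. h t - \<epsilon> i) (r - \<epsilon> i) (r - \<epsilon> i) (tau_of t1) (tau_of t2))"
      unfolding F_def by (rule le(2)) (use hr h0 in auto)
    ultimately show "measure M (F i) = fdet N (barrier_entry M2 W h r (r - \<epsilon> i) (tau_of t1) (tau_of t2))" by simp
  qed
  have "\<epsilon> j \<le> \<epsilon> i" if "i \<le> j" for i j unfolding \<epsilon>_def using that r by (intro divide_left_mono) auto
  then have inc: "incseq F" unfolding incseq_def F_def by (fastforce intro: order_trans)
  have U: "(\<Union>i. F i) = {\<omega> \<in> space M. \<forall>t\<in>{0..1}. B (N - 1) t \<omega> < h t}"
  proof (intro equalityI subsetI)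
    fix \<omega> assume "\<omega> \<in> (\<Union>i. F i)"
    then obtain i where i: "\<omega> \<in> space M" "\<forall>t\<in>{0..1}. B (N - 1) t \<omega> \<le> h t - \<epsilon> i" unfolding F_def by blast
    have "B (N - 1) t \<omega> < h t" if "t \<in> {0..1}" for t using bspec[OF i(2) that] \<epsilon>(1)[of i] by linarith
    then show "\<omega> \<in> {\<omega> \<in> space M. \<forall>t\<in>{0..1}. B (N - 1) t \<omega> < h t}" using i(1) by blast
  next
    fix \<omega> assume "\<omega> \<in> {\<omega> \<in> space M. \<forall>t\<in>{0..1}. B (N - 1) t \<omega> < h t}"
    then have w: "\<omega> \<in> space M" and lt: "\<And>t. t \<in> {0..1} \<Longrightarrow> B (N - 1) t \<omega> < h t" by blast+
    have "continuous_on {0..1} (\<lambda>t. B (N - 1) t \<omega>)" using B N w unfolding nonint_bridges_def by simp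
    then have "continuous_on {0..1} (\<lambda>t. h t - B (N - 1) t \<omega>)" by (intro continuous_intros h)
    then obtain x where x: "x \<in> {0..1}" "\<And>t. t \<in> {0..1} \<Longrightarrow> h x - B (N - 1) x \<omega> \<le> h t - B (N - 1) t \<omega>"
      using continuous_attains_inf[of "{0..1::real}" "\<lambda>t. h t - B (N - 1) t \<omega>"] by auto
    have "\<forall>\<^sub>F i in sequentially. \<epsilon> i < h x - B (N - 1) x \<omega>" using \<epsilon>lim by (rule order_tendstoD) (use lt[OF x(1)] in simp)
    from eventually_happens'[OF sequentially_bot this] obtain i where i: "\<epsilon> i < h x - B (N - 1) x \<omega>" by blast
    have "B (N - 1) t \<omega> \<le> h t - \<epsilon> i" if "t \<in> {0..1}" for t using x(2)[OF that] i by linarith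
    then have "\<omega> \<in> F i" unfolding F_def using w by blast
    then show "\<omega> \<in> (\<Union>i. F i)" by blast
  qed
  have "range F \<subseteq> sets M" using F(1) by blast
  from finite_Lim_measure_incseq[OF this inc]
  have lim1: "(\<lambda>i. fdet N (barrier_entry M2 W h r (r - \<epsilon> i) (tau_of t1) (tau_of t2))) \<longlonglongrightarrow> measure M {\<omega> \<in> space M. \<forall>t\<in>{0..1}. B (N - 1) t \<omega> < h t}"
    unfolding U F(2) .
  have \<tau>: "0 < tau_of t1" "tau_of t1 < tau_of t2" using t by (auto intro: tau_of_pos tau_of_less)
  have unit: "4 * \<tau> / (1 + 4 * \<tau>) \<in> {0..1}" if "\<tau> \<in> {tau_of t1..tau_of t2}" for \<tau>
  proof -
    have "\<tau> > 0" using that \<tau> by simp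
    then show ?thesis by (auto simp: field_simps)
  qed
  have lim2: "(\<lambda>i. fdet N (barrier_entry M2 W h r (r - \<epsilon> i) (tau_of t1) (tau_of t2))) \<longlonglongrightarrow> fdet N (barrier_entry M2 W h r r (tau_of t1) (tau_of t2))"
  proof (rule fdet_tendsto, rule barrier_entry_tendsto[OF W \<tau>, where R=r])
    have "continuous_on {tau_of t1..tau_of t2} (\<lambda>\<tau>. h (4 * \<tau> / (1 + 4 * \<tau>)))"
      by (rule continuous_on_compose2[OF h]) (use unit \<tau> in \<open>auto intro!: continuous_intros\<close>)
    then show "continuous_on {tau_of t1..tau_of t2} (h_tilde h r)" unfolding h_tilde_def[abs_def] by (intro continuous_intros) auto
    show "h_tilde h r \<tau> \<le> 0" if "\<tau> \<in> {tau_of t1..tau_of t2}" for \<tau>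
      unfolding h_tilde_def using hr[OF unit[OF that]] that \<tau> by (intro mult_nonneg_nonpos) auto
    show "h_tilde h r (tau_of t1) = 0" "h_tilde h r (tau_of t2) = 0"
      using t h0[of t1] h0[of t2] by (auto intro!: h_tilde_0 simp: inverse_tau_of)
    show "(\<lambda>i. r - \<epsilon> i) \<longlonglongrightarrow> r" using tendsto_diff[OF tendsto_const \<epsilon>lim, of r] by simp
    show "\<bar>r - \<epsilon> i\<bar> \<le> r" for i using \<epsilon>[of i] by simp
  qed (use r in simp)
  show ?thesis by (rule LIMSEQ_unique[OF lim1 lim2])
qed

text \<open>\<open>Phi\<close> and \<open>Psi\<close> are real by \<open>Phi_eq\<close> and
  \<open>Psi_eq\<close>, and the kernel vanishes for u > 0, so the complex double integral is the
  real pairing over u <= 0.\<close>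

lemma K_kernel_barrier_entry:
  assumes W: "std_BM M W" and t: "0 < t1" "t1 < t2" "t2 < 1"
  shows "K_kernel M W h r t1 t2 n m = (if n = m then 1 else 0) - of_real (barrier_entry M W h r r (tau_of t1) (tau_of t2) n m)"
proof -
  have \<tau>: "0 < tau_of t1" "tau_of t1 < tau_of t2" "0 < tau_of t2" using t by (auto intro: tau_of_pos tau_of_less)
  let ?T = "T_kernel M W h r (tau_of t1) (tau_of t2)"
  have "(\<integral>v. Phi r (tau_of t1) n u * of_real (?T u v) * Psi r (tau_of t2) m v \<partial>lborel) =
    complex_of_real (PhiO r (tau_of t1) n u * (indicator {..0} u * (\<integral>v. ?T u v * PsiO r (tau_of t2) m v \<partial>lborel)))" for u
  proof (cases "u \<le> 0")
    case True
    have "(\<integral>v. Phi r (tau_of t1) n u * of_real (?T u v) * Psi r (tau_of t2) m v \<partial>lborel) =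
      (\<integral>v. complex_of_real (PhiO r (tau_of t1) n u * (?T u v * PsiO r (tau_of t2) m v)) \<partial>lborel)"
      by (simp add: Phi_eq[OF \<tau>(1)] Psi_eq PhiO_def PsiO_def mult.assoc)
    also have "\<dots> = complex_of_real (\<integral>v. PhiO r (tau_of t1) n u * (?T u v * PsiO r (tau_of t2) m v) \<partial>lborel)"
      by (rule integral_complex_of_real)
    finally show ?thesis using True by simp
  next
    case False
    then have "?T u v = 0" for v using T_kernel_pos[OF W, of "tau_of t1" "tau_of t2" u] \<tau> by simp
    then show ?thesis using False by simp
  qed
  then show ?thesis unfolding K_kernel_def barrier_entry_def by (simp only: integral_complex_of_real)
qed

theorem theorem2p3:
  fixes N :: nat and r t1 t2 :: real and h :: "real \<Rightarrow> real"
    and M :: "'a measure" and B :: "nat \<Rightarrow> real \<Rightarrow> 'a \<Rightarrow> real"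
    and M2 :: "'b measure" and W :: "real \<Rightarrow> 'b \<Rightarrow> real"
  assumes "N \<ge> 1" and "r > 0" and "0 < t1" and "t1 < t2" and "t2 < 1"
    and "H1_01 h" and "continuous_on {0..1} h"
    and "\<forall>t\<in>{0..1}. h t \<le> r"
    and "\<forall>t\<in>{0..1} - {t1<..<t2}. h t = r"
    and "nonint_bridges M N B"
    and "std_BM M2 W"
  shows "complex_of_real (measure M {\<omega> \<in> space M. \<forall>t\<in>{0..1}. B (N - 1) t \<omega> < h t}) =
         Determinant.det (1\<^sub>m N - Matrix.mat N N (\<lambda>(n, m). K_kernel M2 W h r t1 t2 n m))"
proof -
  \<comment> \<open>Only these entries remain: the Kronecker delta in \<open>K_kernel\<close>
    cancels the identity matrix.\<close>
  let ?A = "barrier_entry M2 W h r r (tau_of t1) (tau_of t2)"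
  have "1\<^sub>m N - Matrix.mat N N (\<lambda>(n, m). K_kernel M2 W h r t1 t2 n m) = Matrix.mat N N (\<lambda>(n, m). complex_of_real (?A n m))"
    by (rule eq_matI) (auto simp: K_kernel_barrier_entry[OF assms(11,3-5)])
  then have "Determinant.det (1\<^sub>m N - Matrix.mat N N (\<lambda>(n, m). K_kernel M2 W h r t1 t2 n m)) = fdet N (\<lambda>n m. complex_of_real (?A n m))"
    unfolding fdet_def by simp
  also have "\<dots> = complex_of_real (fdet N ?A)" unfolding fdet_row by simp
  also have "fdet N ?A = measure M {\<omega> \<in> space M. \<forall>t\<in>{0..1}. B (N - 1) t \<omega> < h t}"
    using barrier_less_prob[OF assms(1-5,7) _ _ assms(10,11)] assms(8,9) by simp
  finally show ?thesis by simp
qed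

end
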